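(* There exists a constant $\beta>0$ such that the following holds. There is an algorithm that, given as input a prime power $q$, a polynomial $f\colon\mathbb{F}_q^n\to\mathbb{F}_q$ of degree $d$ (as a list of monomials), where $3\le d\le\log(n)/10$, and a point $u_0\in\mathbb{F}_q^n$, finds an affine subspace $u_0+U$ of dimension $\Omega(k_q(n,d))$ on which $f$ is constant. The algorithm runs in time $q^{\beta\cdot n^{(d-2)/(d-1)}}\cdot\mathrm{poly}(n^d)$ and uses $\mathrm{poly}(n^d,\log q)$ space.
   Context: $k_q(n,d)$ denotes the largest integer $k$ such that every polynomial on $n$ variables over $\mathbb{F}_q$ of degree at most $d$ is constant on some affine subspace of $\mathbb{F}_q^n$ of dimension $k$. Logarithms are to base 2. *)

theory Defs
  imports
    Complex_Main
    "HOL-Library.Log_Nat"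
    "HOL-Number_Theory.Prime_Powers"
    "HOL-Algebra.Algebra"
    "Jordan_Normal_Form.Missing_VectorSpace"
begin

section \<open>Algorithms\<close>

text \<open>
  The machine model is the random access machine with logarithmic cost, presented as a structured
  language. A store consists of arrays of natural numbers; an array name is a constant of the
  program, so a program uses finitely many arrays, and the first cells of arrays serve as scalar
  variables. The time of an operation is measured in the bit lengths of its operands.
\<close>

type_synonym store = "nat \<Rightarrow> nat \<Rightarrow> nat"

definition bits :: "nat \<Rightarrow> nat" where
  "bits x = max 1 (floorlog 2 x)"

datatype expr =
    Const nat
  | Cell nat expr  \<comment> \<open>array name, index\<close>
  | Add expr expr
  | Sub expr expr
  | Mul expr expr
  | Divide expr expr
  | Modulo expr expr

fun aval :: "expr \<Rightarrow> store \<Rightarrow> nat" where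
  "aval (Const k) s = k"
| "aval (Cell a e) s = s a (aval e s)"
| "aval (Add e1 e2) s = aval e1 s + aval e2 s"
| "aval (Sub e1 e2) s = aval e1 s - aval e2 s"
| "aval (Mul e1 e2) s = aval e1 s * aval e2 s"
| "aval (Divide e1 e2) s = aval e1 s div aval e2 s"
| "aval (Modulo e1 e2) s = aval e1 s mod aval e2 s"

fun acost :: "expr \<Rightarrow> store \<Rightarrow> nat" where
  "acost (Const k) s = bits k"
| "acost (Cell a e) s = acost e s + bits (aval e s) + bits (s a (aval e s))"
| "acost (Add e1 e2) s = acost e1 s + acost e2 s + bits (aval e1 s) + bits (aval e2 s)"
| "acost (Sub e1 e2) s = acost e1 s + acost e2 s + bits (aval e1 s) + bits (aval e2 s)"
| "acost (Mul e1 e2) s = acost e1 s + acost e2 s + bits (aval e1 s) * bits (aval e2 s)"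
| "acost (Divide e1 e2) s = acost e1 s + acost e2 s + bits (aval e1 s) * bits (aval e2 s)"
| "acost (Modulo e1 e2) s = acost e1 s + acost e2 s + bits (aval e1 s) * bits (aval e2 s)"

datatype prog =
    Skip
  | Assign nat expr expr  \<comment> \<open>array name, index, new content\<close>
  | Seq prog prog
  | Cond expr prog prog  \<comment> \<open>tests are of the form \<open>e \<noteq> 0\<close>\<close>
  | While expr prog

definition support :: "store \<Rightarrow> (nat \<times> nat) set" where
  "support s = {(a, i). s a i \<noteq> 0}"

text \<open>
  Number of bits needed to write down a store: index and content of each nonzero cell. Stores
  reachable from an input have finite support, see \<open>exec_finite_support\<close>. Temporaries
  inside one expression are not counted: they are at most a constant factor (depending on the
  program only) longer than the operands.
\<close>

definition store_size :: "store \<Rightarrow> nat" where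
  "store_size s = (\<Sum>(a, i)\<in>support s. bits i + bits (s a i))"

text \<open>\<open>exec c s s' t m\<close>: started in \<open>s\<close>, the program \<open>c\<close> halts in \<open>s'\<close> after time \<open>t\<close>, and
  \<open>m\<close> is the maximal size of a store occurring in this run.\<close>

inductive exec :: "prog \<Rightarrow> store \<Rightarrow> store \<Rightarrow> nat \<Rightarrow> nat \<Rightarrow> bool" where
  Skip: "exec Skip s s 1 (store_size s)"
| Assign: "s' = s(a := (s a)(aval e1 s := aval e2 s)) \<Longrightarrow>
    exec (Assign a e1 e2) s s'
      (1 + acost e1 s + acost e2 s + bits (aval e1 s) + bits (aval e2 s))
      (max (store_size s) (store_size s'))"
| Seq: "exec c1 s s1 t1 m1 \<Longrightarrow> exec c2 s1 s2 t2 m2 \<Longrightarrow>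
    exec (Seq c1 c2) s s2 (t1 + t2) (max m1 m2)"
| IfTrue: "aval e s \<noteq> 0 \<Longrightarrow> exec c1 s s' t m \<Longrightarrow>
    exec (Cond e c1 c2) s s' (1 + acost e s + t) m"
| IfFalse: "aval e s = 0 \<Longrightarrow> exec c2 s s' t m \<Longrightarrow>
    exec (Cond e c1 c2) s s' (1 + acost e s + t) m"
| WhileFalse: "aval e s = 0 \<Longrightarrow> exec (While e c) s s (1 + acost e s) (store_size s)"
| WhileTrue: "aval e s \<noteq> 0 \<Longrightarrow> exec c s s1 t1 m1 \<Longrightarrow> exec (While e c) s1 s2 t2 m2 \<Longrightarrow>
    exec (While e c) s s2 (1 + acost e s + t1 + t2) (max m1 m2)"

text \<open>The input occupies array 0; all other cells contain 0.\<close>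

definition init_store :: "nat list \<Rightarrow> store" where
  "init_store xs = (\<lambda>a i. if a = 0 \<and> i < length xs then xs ! i else 0)"

lemma finite_support_init_store: "finite (support (init_store xs))"
proof (rule finite_subset)
  show "support (init_store xs) \<subseteq> {0} \<times> {..<length xs}"
    by (auto simp: support_def init_store_def split: if_splits)
qed simp

lemma exec_finite_support: "exec c s s' t m \<Longrightarrow> finite (support s) \<Longrightarrow> finite (support s')"
proof (induction rule: exec.induct)
  case (Assign s' s a e1 e2)
  then have "support s' \<subseteq> insert (a, aval e1 s) (support s)"
    by (auto simp: support_def split: if_splits)
  with Assign show ?case
    by (meson finite.insertI finite_subset)
qed auto

section \<open>The field with \<open>q\<close> elements\<close>

text \<open>
  A field with \<open>q = p ^ e\<close> elements, its elements being written as numbers below \<open>q\<close>: the base-\<open>p\<close>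
  digits of \<open>a\<close> are the coordinates of the element \<open>a\<close> in a power basis \<open>1, \<alpha>, ..., \<alpha> ^ (e - 1)\<close>.
  This is the usual representation as residue classes modulo an irreducible monic polynomial of
  degree \<open>e\<close>, namely the minimal polynomial of \<open>\<alpha>\<close>; that polynomial is specified by the
  code \<open>r\<close> of the element \<open>\<alpha> ^ e\<close>, so that \<open>q\<close> and \<open>r\<close> determine \<open>F\<close> (up to the irrelevant
  values of its operations outside the carrier).
\<close>

definition coded_field :: "nat \<Rightarrow> nat \<Rightarrow> nat ring \<Rightarrow> bool" where
  "coded_field q r F \<longleftrightarrow> field F \<and> carrier F = {..<q} \<and>
     (\<exists>p e \<alpha>. normalization_semidom_class.prime (p :: nat) \<and> 0 < e \<and> q = p ^ e \<and>
        \<alpha> \<in> carrier F \<and> \<alpha> [^]\<^bsub>F\<^esub> (e :: nat) = r \<and>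
        (\<forall>a<q. a = (\<Oplus>\<^bsub>F\<^esub>i\<in>{..<e}. add_pow F (a div p ^ i mod p) (\<alpha> [^]\<^bsub>F\<^esub> (i :: nat)))))"

section \<open>Affine subspaces and polynomials\<close>

abbreviation affine_space :: "nat ring \<Rightarrow> nat \<Rightarrow> (nat, nat \<Rightarrow> nat) module" where
  "affine_space F n \<equiv> ring.func_space F {..<n}"

abbreviation dim_of :: "nat ring \<Rightarrow> nat \<Rightarrow> (nat \<Rightarrow> nat) set \<Rightarrow> nat" where
  "dim_of F n U \<equiv> vectorspace.dim F ((affine_space F n)\<lparr>carrier := U\<rparr>)"

text \<open>A polynomial is a list of monomials, given by a coefficient and the list of the
  exponents of the \<open>n\<close> variables.\<close>

type_synonym monomials = "(nat \<times> nat list) list"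

definition polynomial_in :: "nat ring \<Rightarrow> nat \<Rightarrow> monomials \<Rightarrow> bool" where
  "polynomial_in F n f \<longleftrightarrow>
     (\<forall>(c, es)\<in>set f. c \<in> carrier F - {\<zero>\<^bsub>F\<^esub>} \<and> length es = n) \<and> distinct (map snd f)"

definition total_degree :: "monomials \<Rightarrow> nat" where
  "total_degree f = Max (insert 0 ((\<lambda>(c, es). sum_list es) ` set f))"

definition poly_fun :: "nat ring \<Rightarrow> nat \<Rightarrow> monomials \<Rightarrow> (nat \<Rightarrow> nat) \<Rightarrow> nat" where
  "poly_fun F n f x =
     (\<Oplus>\<^bsub>F\<^esub>m\<in>set f. fst m \<otimes>\<^bsub>F\<^esub> (\<Otimes>\<^bsub>F\<^esub>i\<in>{..<n}. x i [^]\<^bsub>F\<^esub> (snd m ! i)))"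

definition const_on :: "('a \<Rightarrow> 'b) \<Rightarrow> 'a set \<Rightarrow> bool" where
  "const_on g A \<longleftrightarrow> (\<exists>c. \<forall>x\<in>A. g x = c)"

text \<open>\<open>kq F n d\<close> is \<open>k\<^sub>q(n, d)\<close> for a field \<open>F\<close> with \<open>q\<close> elements.\<close>

definition kq :: "nat ring \<Rightarrow> nat \<Rightarrow> nat \<Rightarrow> nat" where
  "kq F n d = Max {k. \<forall>f. polynomial_in F n f \<and> total_degree f \<le> d \<longrightarrow>
     (\<exists>u U. u \<in> carrier (affine_space F n) \<and> VectorSpace.subspace F U (affine_space F n) \<and>
        dim_of F n U = k \<and> const_on (poly_fun F n f) (u <+\<^bsub>affine_space F n\<^esub> U))}"

section \<open>Input and output\<close>

definition encode :: "nat \<Rightarrow> nat \<Rightarrow> nat \<Rightarrow> monomials \<Rightarrow> (nat \<Rightarrow> nat) \<Rightarrow> nat list" where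
  "encode q r n f u =
     [q, r, n] @ map u [0..<n] @ [length f] @ concat (map (\<lambda>(c, es). c # es) f)"

text \<open>A linear subspace is output as a basis: array 1 contains the number of basis vectors,
  followed by their coordinates.\<close>

definition out_vector :: "nat \<Rightarrow> store \<Rightarrow> nat \<Rightarrow> (nat \<Rightarrow> nat)" where
  "out_vector n s j = (\<lambda>i\<in>{..<n}. s 1 (Suc (j * n + i)))"

definition outputs_subspace :: "nat ring \<Rightarrow> nat \<Rightarrow> store \<Rightarrow> (nat \<Rightarrow> nat) set \<Rightarrow> bool" where
  "outputs_subspace F n s U \<longleftrightarrow>
     VectorSpace.subspace F U (affine_space F n) \<and>
     inj_on (out_vector n s) {..<s 1 0} \<and>
     vectorspace.basis F ((affine_space F n)\<lparr>carrier := U\<rparr>) (out_vector n s ` {..<s 1 0})"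

end

theory Submission
  imports Defs
begin

text \<open>
  The subspace grows by one direction per step. Let \<open>y\<^sub>1, \<dots>, y\<^sub>m\<close> be linearly independent directions such
  that \<open>f\<close> is constant on \<open>A = u\<^sub>0 + span {y\<^sub>1, \<dots>, y\<^sub>m}\<close>. The gradient of \<open>f\<close> at the points of \<open>A\<close> is a
  polynomial of degree below \<open>d\<close> in \<open>m\<close> coordinates, so all these gradients together have a common kernel of
  codimension at most \<open>(m + d - 1) choose (d - 1)\<close>. Along a direction \<open>z\<close> in that kernel the coefficient
  of \<open>t\<close> in \<open>f (x + t z)\<close>, \<open>x \<in> A\<close>, vanishes, and the coefficient of \<open>t\<^sup>j\<close> with \<open>j \<ge> 2\<close>, expanded
  in the coordinates of \<open>x\<close>, consists of \<open>(m + d - j) choose (d - j)\<close> polynomials in \<open>z\<close> that are homogeneous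
  of degree \<open>j\<close>. By the theorem of Chevalley they have a common nontrivial zero in every subspace of dimension
  exceeding the sum \<open>D\<close> of their degrees, hence a suitable \<open>z\<close> is found by testing at most
  \<open>q ^ (D + 1)\<close> candidates, and \<open>D = O(n powr ((d - 2) / (d - 1)))\<close>. Every new direction contributes a pivot
  coordinate on which all later ones vanish, which makes the directions independent.

  There is room for \<open>\<Omega>(d n powr (1 / (d - 1)))\<close> steps. Conversely, on an affine subspace of dimension \<open>k\<close>
  at most a fraction \<open>q ^ - (k choose d)\<close> of the multilinear forms of degree \<open>d\<close> is constant. If
  each of them is constant on some such subspace, counting the subspaces gives \<open>k choose d \<le> n (k + 1)\<close>, and
  therefore \<open>k = O(d n powr (1 / (d - 1)))\<close>.
\<close>

section \<open>Finite sums in a ring\<close>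

text \<open>The linear coefficients are treated apart because Chevalley's theorem would charge a
  dimension for each of them. Their number may be a constant fraction of \<open>n\<close>, so a
  search covering them would be exponential in \<open>n\<close>. Linear algebra removes them at the
  price of codimension only, and just the coefficients of degree at least 2 enter the exponent.
  Expansions are formal and gradients come from dual numbers, so small characteristic and exponents
  above \<open>q\<close> cause no trouble. To stay in polynomial space, neither points nor
  functionals are stored. Points and candidate directions are base \<open>q\<close> digits of a
  counter, and only a basis of the current kernel is kept, corrected for one functional at a time. A
  candidate is accepted by evaluating \<open>f\<close> on the whole enlarged subspace; Chevalley's
  theorem only ensures that some candidate of small code passes. With \<open>a\<close> the integer
  part of the \<open>(d - 1)\<close>-st root of \<open>n\<close>, there are
  \<open>K = d * a div 128\<close> steps; the divisor 128 makes the binomials small enough for the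
  kernel to stay large.\<close>

context ring begin

text \<open>A sum by recursion on an initial segment is what a \<open>For\<close> loop accumulates.
  Unlike \<open>finsum\<close>, it satisfies congruence without closure conditions.\<close>

primrec fsum :: "nat \<Rightarrow> (nat \<Rightarrow> 'a) \<Rightarrow> 'a" where
  "fsum 0 g = \<zero>"
| "fsum (Suc m) g = fsum m g \<oplus> g m"

lemma fsum_closed [intro, simp]: "(\<And>i. i < m \<Longrightarrow> g i \<in> carrier R) \<Longrightarrow> fsum m g \<in> carrier R"
  by (induction m) auto

lemma fsum_cong: "(\<And>i. i < m \<Longrightarrow> g i = h i) \<Longrightarrow> fsum m g = fsum m h"
  by (induction m) auto

lemma fsum_zero: "(\<And>i. i < m \<Longrightarrow> g i = \<zero>) \<Longrightarrow> fsum m g = \<zero>"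
  by (induction m) auto

lemma fsum_eq_finsum:
  "(\<And>i. i < m \<Longrightarrow> g i \<in> carrier R) \<Longrightarrow> fsum m g = (\<Oplus>i\<in>{..<m}. g i)"
proof (induction m)
  case (Suc m)
  have "(\<Oplus>i\<in>insert m {..<m}. g i) = g m \<oplus> (\<Oplus>i\<in>{..<m}. g i)"
    using Suc.prems by (intro finsum_insert) auto
  with Suc show ?case by (simp add: lessThan_Suc a_comm)
qed simp

lemma fsum_add:
  "(\<And>i. i < m \<Longrightarrow> g i \<in> carrier R) \<Longrightarrow> (\<And>i. i < m \<Longrightarrow> h i \<in> carrier R) \<Longrightarrow>
    fsum m (\<lambda>i. g i \<oplus> h i) = fsum m g \<oplus> fsum m h"
proof (induction m)
  case (Suc m)
  then have "fsum m g \<in> carrier R" "fsum m h \<in> carrier R" "g m \<in> carrier R" "h m \<in> carrier R"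
    by auto
  with Suc show ?case by (simp add: a_ac)
qed simp

lemma fsum_smult:
  "c \<in> carrier R \<Longrightarrow> (\<And>i. i < m \<Longrightarrow> g i \<in> carrier R) \<Longrightarrow>
    c \<otimes> fsum m g = fsum m (\<lambda>i. c \<otimes> g i)"
  by (induction m) (auto simp: r_distr)

lemma fsum_smult_right:
  "c \<in> carrier R \<Longrightarrow> (\<And>i. i < m \<Longrightarrow> g i \<in> carrier R) \<Longrightarrow>
    fsum m g \<otimes> c = fsum m (\<lambda>i. g i \<otimes> c)"
  by (induction m) (auto simp: l_distr)

lemma fsum_swap:
  "(\<And>i j. i < m \<Longrightarrow> j < k \<Longrightarrow> g i j \<in> carrier R) \<Longrightarrow>
    fsum m (\<lambda>i. fsum k (g i)) = fsum k (\<lambda>j. fsum m (\<lambda>i. g i j))"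
proof (induction m)
  case 0
  show ?case using fsum_zero[of k "\<lambda>j. \<zero>"] by simp
next
  case (Suc m)
  then have "fsum m (\<lambda>i. fsum k (g i)) = fsum k (\<lambda>j. fsum m (\<lambda>i. g i j))"
    by simp
  then show ?case using Suc.prems by (simp add: fsum_add)
qed

lemma fsum_single:
  assumes "i < m" "g i \<in> carrier R" "\<And>j. j < m \<Longrightarrow> j \<noteq> i \<Longrightarrow> g j = \<zero>"
  shows "fsum m g = g i"
  using assms
proof (induction m)
  case (Suc m)
  show ?case
  proof (cases "i = m")
    case True
    then have "fsum m g = \<zero>" using Suc.prems by (intro fsum_zero) auto
    with True Suc.prems show ?thesis by simp
  next
    case False
    then show ?thesis using Suc by simp
  qed
qed simp

lemma fsum_Suc_shift:
  "(\<And>i. i < Suc m \<Longrightarrow> g i \<in> carrier R) \<Longrightarrow> fsum (Suc m) g = g 0 \<oplus> fsum m (\<lambda>i. g (Suc i))"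
proof (induction m)
  case (Suc m)
  have c: "g 0 \<in> carrier R" "fsum m (\<lambda>i. g (Suc i)) \<in> carrier R" "g (Suc m) \<in> carrier R"
    using Suc.prems by auto
  have "fsum (Suc (Suc m)) g = g 0 \<oplus> fsum m (\<lambda>i. g (Suc i)) \<oplus> g (Suc m)"
    using Suc by simp
  also have "\<dots> = g 0 \<oplus> (fsum m (\<lambda>i. g (Suc i)) \<oplus> g (Suc m))"
    by (rule a_assoc) (use c in auto)
  finally show ?case by simp
qed simp

text \<open>Put additively, so that no subtraction enters; it serves
  \<open>fsum_remove\<close>.\<close>

lemma fsum_upd:
  assumes "i < m" "\<And>j. j < m \<Longrightarrow> g j \<in> carrier R" "x \<in> carrier R"
  shows "fsum m (g(i := x)) \<oplus> g i = fsum m g \<oplus> x"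
  using assms
proof (induction m)
  case (Suc m)
  have c: "g i \<in> carrier R" "g m \<in> carrier R" "fsum m g \<in> carrier R" "fsum m (g(i := x)) \<in> carrier R"
    using Suc.prems by auto
  show ?case
  proof (cases "i = m")
    case True
    then have "fsum m (g(i := x)) = fsum m g" by (intro fsum_cong) auto
    then show ?thesis using True c Suc.prems by (simp add: a_ac del: fun_upd_apply) (simp add: a_ac)
  next
    case False
    then have IH: "fsum m (g(i := x)) \<oplus> g i = fsum m g \<oplus> x"
      using Suc by (simp del: fun_upd_apply)
    have "fsum (Suc m) (g(i := x)) \<oplus> g i = (fsum m (g(i := x)) \<oplus> g i) \<oplus> g m"
      using False c by (simp add: a_ac)
    also have "\<dots> = fsum (Suc m) g \<oplus> x"
      using c Suc.prems by (simp add: IH a_ac)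
    finally show ?thesis .
  qed
qed simp

text \<open>The gap at \<open>i\<close> is filled by the last index, just as the elimination step
  fills the place of the pivot with the last kernel vector.\<close>

lemma fsum_remove:
  assumes "i < Suc m" "\<And>j. j < Suc m \<Longrightarrow> g j \<in> carrier R"
  shows "fsum (Suc m) g = fsum m (\<lambda>j. g (if j = i then m else j)) \<oplus> g i"
proof (cases "i = m")
  case True
  have "fsum m (\<lambda>j. g (if j = i then m else j)) = fsum m g"
    using True by (intro fsum_cong) auto
  with True show ?thesis by simp
next
  case False
  have "fsum m (\<lambda>j. g (if j = i then m else j)) = fsum m (g(i := g m))"
    by (intro fsum_cong) auto
  with fsum_upd[of i m g "g m"] assms False show ?thesis by simp
qed

end

section \<open>Lists of terms\<close>

text \<open>Vectors are lists here because the proof of Chevalley's theorem strips off one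
  coordinate at a time.\<close>

definition points :: "'a set \<Rightarrow> nat \<Rightarrow> 'a list set" where
  "points A v = {xs. set xs \<subseteq> A \<and> length xs = v}"

lemma points_0 [simp]: "points A 0 = {[]}"
  by (auto simp: points_def)

lemma points_Cons: "x # xs \<in> points A (Suc v) \<longleftrightarrow> x \<in> A \<and> xs \<in> points A v"
  by (auto simp: points_def)

lemma finite_points: "finite A \<Longrightarrow> finite (points A v)"
  unfolding points_def by (rule finite_lists_length_eq)

lemma card_points: "finite A \<Longrightarrow> card (points A v) = card A ^ v"
  unfolding points_def by (rule card_lists_length_eq)

lemma append_points: "xs \<in> points A v \<Longrightarrow> ys \<in> points A w \<Longrightarrow> xs @ ys \<in> points A (v + w)"
  by (auto simp: points_def)

lemma nth_points: "xs \<in> points A v \<Longrightarrow> i < v \<Longrightarrow> xs ! i \<in> A"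
  by (auto simp: points_def)

definition exps_add :: "nat list \<Rightarrow> nat list \<Rightarrow> nat list" where
  "exps_add E E' = map2 (+) E E'"

lemma length_exps_add [simp]: "length (exps_add E E') = min (length E) (length E')"
  by (simp add: exps_add_def)

lemma sum_list_exps_add: "length E = length E' \<Longrightarrow> sum_list (exps_add E E') = sum_list E + sum_list E'"
  unfolding exps_add_def by (induction E E' rule: list_induct2) auto

lemma drop_exps_add: "drop m (exps_add E E') = exps_add (drop m E) (drop m E')"
  unfolding exps_add_def by (simp add: drop_map drop_zip)

text \<open>Like terms need not be collected, so addition is concatenation and no normal form is
  maintained. The type \<open>monomials\<close> of the input is the instance at
  \<open>nat\<close>.\<close>

type_synonym 'a terms = "('a \<times> nat list) list"

context cring begin

fun mono :: "nat list \<Rightarrow> 'a list \<Rightarrow> 'a" where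
  "mono (k # ks) (x # xs) = x [^] k \<otimes> mono ks xs"
| "mono _ _ = \<one>"

lemma mono_closed [intro, simp]: "set xs \<subseteq> carrier R \<Longrightarrow> mono E xs \<in> carrier R"
  by (induction E xs rule: mono.induct) auto

lemma mono_exps_add:
  assumes "length E = length E'" "length E' = length xs" "set xs \<subseteq> carrier R"
  shows "mono (exps_add E E') xs = mono E xs \<otimes> mono E' xs"
  using assms
proof (induction E E' xs rule: list_induct3)
  case Nil
  then show ?case by (simp add: exps_add_def)
next
  case (Cons k E k' E' x xs)
  then have "x \<in> carrier R" "mono E xs \<in> carrier R" "mono E' xs \<in> carrier R"
    "mono (exps_add E E') xs = mono E xs \<otimes> mono E' xs" by auto
  then show ?case by (simp add: exps_add_def m_ac nat_pow_mult[symmetric])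
qed

lemma mono_zeros: "set xs \<subseteq> carrier R \<Longrightarrow> mono (replicate v 0) xs = \<one>"
proof (induction v arbitrary: xs)
  case (Suc v) then show ?case by (cases xs) auto
qed simp

lemma mono_append:
  assumes "length E = length xs" "set xs \<subseteq> carrier R" "set ys \<subseteq> carrier R"
  shows "mono (E @ E') (xs @ ys) = mono E xs \<otimes> mono E' ys"
  using assms by (induction E xs rule: list_induct2) (auto simp: m_ac)

lemma mono_ones: "mono E (replicate v \<one>) = \<one>"
proof (induction v arbitrary: E)
  case 0 then show ?case by (cases E) auto
next
  case (Suc v) then show ?case by (cases E) auto
qed

lemma mono_scale:
  assumes "length E = length xs" "t \<in> carrier R" "set xs \<subseteq> carrier R"
  shows "mono E (map (\<lambda>x. t \<otimes> x) xs) = t [^] sum_list E \<otimes> mono E xs"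
  using assms
proof (induction E xs rule: list_induct2)
  case (Cons k E x xs)
  then have "x \<in> carrier R" "mono E xs \<in> carrier R" by auto
  with Cons show ?case by (simp add: nat_pow_distrib nat_pow_mult[symmetric] m_ac)
qed simp

lemma mono_unit:
  assumes "i < length xs" "set xs \<subseteq> carrier R"
  shows "mono ((replicate (length xs) 0)[i := 1]) xs = xs ! i"
  using assms
proof (induction xs arbitrary: i)
  case (Cons x xs)
  then have "x \<in> carrier R" "i \<noteq> 0 \<Longrightarrow> xs ! (i - 1) \<in> carrier R"
    using nth_mem[of "i - 1" xs] by auto
  with Cons show ?case by (cases i) (auto simp: mono_zeros)
qed simp

fun term_eval :: "'a terms \<Rightarrow> 'a list \<Rightarrow> 'a" where
  "term_eval [] xs = \<zero>"
| "term_eval ((c, E) # L) xs = c \<otimes> mono E xs \<oplus> term_eval L xs"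

definition wf_terms :: "nat \<Rightarrow> nat \<Rightarrow> 'a terms \<Rightarrow> bool" where
  "wf_terms v D L \<longleftrightarrow> (\<forall>(c, E)\<in>set L. c \<in> carrier R \<and> length E = v \<and> sum_list E \<le> D)"

lemma wf_terms_simps [simp]:
  "wf_terms v D []"
  "wf_terms v D ((c, E) # L) \<longleftrightarrow> c \<in> carrier R \<and> length E = v \<and> sum_list E \<le> D \<and> wf_terms v D L"
  "wf_terms v D (L @ M) \<longleftrightarrow> wf_terms v D L \<and> wf_terms v D M"
  by (auto simp: wf_terms_def)

lemma wf_terms_filter: "wf_terms v D L \<Longrightarrow> wf_terms v D (filter Q L)"
  by (auto simp: wf_terms_def)

lemma wf_terms_mono: "wf_terms v D L \<Longrightarrow> D \<le> D' \<Longrightarrow> wf_terms v D' L"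
  by (force simp: wf_terms_def)

lemma term_eval_closed [intro, simp]:
  "wf_terms v D L \<Longrightarrow> set xs \<subseteq> carrier R \<Longrightarrow> term_eval L xs \<in> carrier R"
  by (induction L) auto

lemma term_eval_append:
  "wf_terms v D L \<Longrightarrow> wf_terms v D M \<Longrightarrow> set xs \<subseteq> carrier R \<Longrightarrow>
    term_eval (L @ M) xs = term_eval L xs \<oplus> term_eval M xs"
proof (induction L)
  case (Cons a L)
  obtain c E where a: "a = (c, E)" by (cases a)
  have "c \<in> carrier R" "term_eval L xs \<in> carrier R" "term_eval M xs \<in> carrier R" "mono E xs \<in> carrier R"
    using Cons.prems a by auto
  with Cons a show ?case by (simp add: a_ac)
qed auto

lemma term_eval_partition:
  "wf_terms v D L \<Longrightarrow> set xs \<subseteq> carrier R \<Longrightarrow>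
    term_eval L xs = term_eval (filter Q L) xs \<oplus> term_eval (filter (\<lambda>x. \<not> Q x) L) xs"
proof (induction L)
  case (Cons a L)
  obtain c E where a: "a = (c, E)" by (cases a)
  have "c \<in> carrier R" "term_eval (filter Q L) xs \<in> carrier R"
    "term_eval (filter (\<lambda>x. \<not> Q x) L) xs \<in> carrier R" "mono E xs \<in> carrier R"
    using Cons.prems a by (auto intro!: term_eval_closed[of v D] wf_terms_filter)
  with Cons a show ?case by (simp add: a_ac)
qed auto

text \<open>Strong induction on the length: the class of the first term evaluates to zero and is
  split off, which leaves the classes of all other terms intact.\<close>

lemma term_eval_zero_by_keys:
  assumes "wf_terms v D L" "set xs \<subseteq> carrier R"
    and "\<And>a. a \<in> set L \<Longrightarrow> term_eval (filter (\<lambda>b. key b = key a) L) xs = \<zero>"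
  shows "term_eval L xs = \<zero>"
  using assms
proof (induction "length L" arbitrary: L rule: less_induct)
  case less
  show ?case
  proof (cases L)
    case (Cons a L')
    let ?Q = "\<lambda>b. key b = key a"
    let ?M = "filter (\<lambda>b. \<not> ?Q b) L"
    have "term_eval ?M xs = \<zero>"
    proof (rule less.hyps)
      have "length (filter (\<lambda>b. \<not> ?Q b) L') \<le> length L'" by (rule length_filter_le)
      then show "length ?M < length L" using Cons by (simp add: less_Suc_eq_le)
      show "wf_terms v D ?M" by (rule wf_terms_filter[OF less.prems(1)])
      show "set xs \<subseteq> carrier R" by (fact less.prems)
      fix b assume b: "b \<in> set ?M"
      have "filter (\<lambda>d. key d = key b) ?M = filter (\<lambda>d. key d = key b) L"
        using b by (auto intro!: filter_cong)
      with less.prems(3)[of b] b show "term_eval (filter (\<lambda>d. key d = key b) ?M) xs = \<zero>" by simp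
    qed
    moreover have "term_eval (filter ?Q L) xs = \<zero>" using less.prems(3)[of a] Cons by simp
    ultimately show ?thesis using term_eval_partition[OF less.prems(1,2), of ?Q] by simp
  qed simp
qed

section \<open>Products of term lists, and polynomial functions of bounded degree\<close>

definition term_mult :: "'a \<times> nat list \<Rightarrow> 'a terms \<Rightarrow> 'a terms" where
  "term_mult a M = map (\<lambda>b. (fst a \<otimes> fst b, exps_add (snd a) (snd b))) M"

fun terms_mult :: "'a terms \<Rightarrow> 'a terms \<Rightarrow> 'a terms" where
  "terms_mult [] M = []"
| "terms_mult (a # L) M = term_mult a M @ terms_mult L M"

lemma wf_term_mult:
  "c \<in> carrier R \<Longrightarrow> length E = v \<Longrightarrow> sum_list E \<le> D \<Longrightarrow> wf_terms v D' M \<Longrightarrow>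
    wf_terms v (D + D') (term_mult (c, E) M)"
  by (fastforce simp: wf_terms_def term_mult_def sum_list_exps_add)

lemma wf_terms_mult: "wf_terms v D L \<Longrightarrow> wf_terms v D' M \<Longrightarrow> wf_terms v (D + D') (terms_mult L M)"
proof (induction L)
  case (Cons a L)
  then show ?case by (cases a) (auto intro: wf_term_mult)
qed simp

lemma term_eval_term_mult:
  assumes "c \<in> carrier R" "length E = v" "wf_terms v D M" "xs \<in> points (carrier R) v"
  shows "term_eval (term_mult (c, E) M) xs = (c \<otimes> mono E xs) \<otimes> term_eval M xs"
  using assms(3)
proof (induction M)
  case Nil
  then show ?case using assms by (simp add: term_mult_def points_def)
next
  case (Cons b M)
  obtain c' E' where b: "b = (c', E')" by (cases b)
  have xs: "set xs \<subseteq> carrier R" "length xs = v" using assms by (auto simp: points_def)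
  have c: "c \<in> carrier R" "mono E xs \<in> carrier R" "c' \<in> carrier R" "mono E' xs \<in> carrier R"
    "term_eval M xs \<in> carrier R" using Cons b xs assms by auto
  have "mono (exps_add E E') xs = mono E xs \<otimes> mono E' xs"
    by (rule mono_exps_add) (use Cons b xs assms in auto)
  with Cons b c show ?case by (simp add: term_mult_def r_distr m_ac)
qed

lemma term_eval_mult:
  assumes "wf_terms v D L" "wf_terms v D' M" "xs \<in> points (carrier R) v"
  shows "term_eval (terms_mult L M) xs = term_eval L xs \<otimes> term_eval M xs"
  using assms(1)
proof (induction L)
  case Nil
  then show ?case using assms by (simp add: points_def term_eval_closed[of v D'])
next
  case (Cons a L)
  obtain c E where a: "a = (c, E)" by (cases a)
  have xs: "set xs \<subseteq> carrier R" "length xs = v" using assms by (auto simp: points_def)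
  have c: "c \<in> carrier R" "mono E xs \<in> carrier R" "term_eval L xs \<in> carrier R"
    "term_eval M xs \<in> carrier R" "sum_list E \<le> D" "length E = v"
    using Cons a xs assms by auto
  have "wf_terms v (D + D') (term_mult a M)" "wf_terms v (D + D') (terms_mult L M)"
    using Cons a c assms wf_term_mult wf_terms_mult by auto
  then have "term_eval (terms_mult (a # L) M) xs
      = (c \<otimes> mono E xs) \<otimes> term_eval M xs \<oplus> term_eval (terms_mult L M) xs"
    using term_eval_append[of v "D + D'"] xs(1) term_eval_term_mult[OF c(1,6) assms(2,3)] a by simp
  also have "\<dots> = (c \<otimes> mono E xs \<oplus> term_eval L xs) \<otimes> term_eval M xs"
    using Cons a c by (simp add: l_distr)
  finally show ?case using a by simp
qed

text \<open>A property of functions rather than of formal polynomials: Chevalley's argument uses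
  only values at points and a degree bound.\<close>

definition is_poly :: "nat \<Rightarrow> nat \<Rightarrow> ('a list \<Rightarrow> 'a) \<Rightarrow> bool" where
  "is_poly v D g \<longleftrightarrow>
     (\<exists>L. wf_terms v D L \<and> (\<forall>xs\<in>points (carrier R) v. g xs = term_eval L xs))"

lemma is_poly_const: "c \<in> carrier R \<Longrightarrow> is_poly v D (\<lambda>xs. c)"
  unfolding is_poly_def
  by (intro exI[of _ "[(c, replicate v 0)]"]) (auto simp: mono_zeros points_def sum_list_replicate)

lemma is_poly_add: "is_poly v D g \<Longrightarrow> is_poly v D h \<Longrightarrow> is_poly v D (\<lambda>xs. g xs \<oplus> h xs)"
  unfolding is_poly_def
proof (elim exE conjE)
  fix L M assume "wf_terms v D L" "wf_terms v D M"
    "\<forall>xs\<in>points (carrier R) v. g xs = term_eval L xs" "\<forall>xs\<in>points (carrier R) v. h xs = term_eval M xs"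
  then show "\<exists>L. wf_terms v D L \<and> (\<forall>xs\<in>points (carrier R) v. g xs \<oplus> h xs = term_eval L xs)"
    by (intro exI[of _ "L @ M"]) (auto simp: term_eval_append points_def)
qed

lemma is_poly_mult: "is_poly v D g \<Longrightarrow> is_poly v D' h \<Longrightarrow> is_poly v (D + D') (\<lambda>xs. g xs \<otimes> h xs)"
  unfolding is_poly_def
proof (elim exE conjE)
  fix L M assume "wf_terms v D L" "wf_terms v D' M"
    "\<forall>xs\<in>points (carrier R) v. g xs = term_eval L xs" "\<forall>xs\<in>points (carrier R) v. h xs = term_eval M xs"
  then show "\<exists>L. wf_terms v (D + D') L \<and> (\<forall>xs\<in>points (carrier R) v. g xs \<otimes> h xs = term_eval L xs)"
    by (intro exI[of _ "terms_mult L M"]) (auto simp: term_eval_mult wf_terms_mult)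
qed

lemma is_poly_closed: "is_poly v D g \<Longrightarrow> xs \<in> points (carrier R) v \<Longrightarrow> g xs \<in> carrier R"
  unfolding is_poly_def by (auto simp: points_def)

lemma is_poly_pow: "is_poly v D g \<Longrightarrow> is_poly v (k * D) (\<lambda>xs. g xs [^] (k :: nat))"
proof (induction k)
  case 0
  show ?case using is_poly_const[of \<one> v 0] by simp
next
  case (Suc k)
  from is_poly_mult[OF Suc.IH[OF Suc.prems] Suc.prems] show ?case by (simp add: add.commute)
qed

end

section \<open>Chevalley's theorem\<close>

context field begin

context
  assumes fin: "finite (carrier R)"
begin

lemma pow_card_eq_one:
  assumes "x \<in> carrier R" "x \<noteq> \<zero>"
  shows "x [^] (card (carrier R) - 1) = \<one>"
proof -
  interpret M: group "Multiplicative_Group.mult_of R" by (rule field_mult_group)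
  have "x [^]\<^bsub>Multiplicative_Group.mult_of R\<^esub> order (Multiplicative_Group.mult_of R) = \<one>\<^bsub>Multiplicative_Group.mult_of R\<^esub>"
    by (rule M.pow_order_eq_1) (use assms fin in auto)
  moreover have "order (Multiplicative_Group.mult_of R) = card (carrier R) - 1"
    using fin by (simp add: order_def)
  ultimately show ?thesis by (simp add: Multiplicative_Group.nat_pow_mult_of)
qed

text \<open>For \<open>k = 0\<close> the sum is \<open>\<one>\<close> taken as often as the additive
  group has elements. Otherwise a generator \<open>a\<close> of the multiplicative group has
  \<open>a [^] k \<noteq> \<one>\<close>, while substituting \<open>a \<otimes> x\<close> for
  \<open>x\<close> multiplies the sum by \<open>a [^] k\<close>.\<close>

lemma power_sum_eq_zero:
  assumes "k < card (carrier R) - 1"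
  shows "(\<Oplus>x\<in>carrier R. x [^] (k :: nat)) = \<zero>"
proof (cases "k = 0")
  case True
  have "(\<Oplus>x\<in>carrier R. \<one>) = add_pow R (card (carrier R)) \<one>"
    using add.finprod_const[of \<one> "carrier R"] by simp
  also have "\<dots> = \<zero>"
    using add.pow_order_eq_1[of \<one>] fin by (simp add: order_def)
  finally show ?thesis using True by simp
next
  case False
  obtain a where a: "a \<in> carrier (Multiplicative_Group.mult_of R)" "carrier (Multiplicative_Group.mult_of R) = {a [^] i | i::nat. i \<in> UNIV}"
    using finite_field_mult_group_has_gen[OF fin] by auto
  have aR: "a \<in> carrier R" "a \<noteq> \<zero>" using a(1) by auto
  have "a [^] k \<noteq> \<one>"
  proof
    \<comment> \<open>Then the powers of \<open>a\<close> take at most \<open>k\<close> values, too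
      few for a generator.\<close>
    assume e: "a [^] k = \<one>"
    have mod_k: "a [^] i = a [^] (i mod k)" for i :: nat
    proof -
      have "a [^] i = a [^] (k * (i div k)) \<otimes> a [^] (i mod k)"
        using nat_pow_mult[OF aR(1), of "k * (i div k)" "i mod k"] by simp
      also have "a [^] (k * (i div k)) = (a [^] k) [^] (i div k)"
        using aR by (simp add: nat_pow_pow)
      finally show ?thesis using e aR by simp
    qed
    have "carrier (Multiplicative_Group.mult_of R) \<subseteq> (\<lambda>i. a [^] i) ` {..<k}"
    proof
      fix x assume "x \<in> carrier (Multiplicative_Group.mult_of R)"
      then have "x \<in> {a [^] i | i::nat. i \<in> UNIV}" by (simp only: a(2))
      then obtain i :: nat where i: "x = a [^] i" by blast
      have "x = a [^] (i mod k)" by (rule trans[OF i mod_k])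
      moreover have "i mod k \<in> {..<k}"
        unfolding lessThan_iff by (rule mod_less_divisor[OF False[unfolded neq0_conv]])
      ultimately show "x \<in> (\<lambda>i. a [^] i) ` {..<k}" by (rule image_eqI)
    qed
    from card_mono[OF _ this] card_image_le[of "{..<k}" "\<lambda>i. a [^] i"]
    have "card (carrier (Multiplicative_Group.mult_of R)) \<le> k" by simp
    then show False using assms fin by simp
  qed
  let ?S = "\<Oplus>x\<in>carrier R. x [^] k"
  have S: "?S \<in> carrier R" by (rule finsum_closed) auto
  have bij: "inj_on (\<lambda>x. a \<otimes> x) (carrier R)"
    using aR by (auto intro!: inj_onI simp: m_lcancel)
  have im: "(\<lambda>x. a \<otimes> x) ` carrier R = carrier R"
    using endo_inj_surj[OF fin _ bij] aR by auto
  have "?S = (\<Oplus>x\<in>(\<lambda>x. a \<otimes> x) ` carrier R. x [^] k)" by (simp add: im)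
  also have "\<dots> = (\<Oplus>x\<in>carrier R. (a \<otimes> x) [^] k)"
    by (rule finsum_reindex) (use bij aR in auto)
  also have "\<dots> = (\<Oplus>x\<in>carrier R. a [^] k \<otimes> x [^] k)"
    by (rule finsum_cong') (use aR in \<open>auto simp: nat_pow_distrib\<close>)
  also have "\<dots> = a [^] k \<otimes> ?S"
    by (rule finsum_rdistr[symmetric]) (use aR fin in auto)
  finally have "a [^] k \<otimes> ?S = \<one> \<otimes> ?S" using S by simp
  then show ?thesis
    using m_rcancel[of ?S "a [^] k" \<one>] \<open>a [^] k \<noteq> \<one>\<close> S aR by auto
qed

primrec total :: "nat \<Rightarrow> ('a list \<Rightarrow> 'a) \<Rightarrow> 'a" where
  "total 0 g = g []"
| "total (Suc v) g = (\<Oplus>x\<in>carrier R. total v (\<lambda>xs. g (x # xs)))"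

lemma total_closed:
  "(\<And>xs. xs \<in> points (carrier R) v \<Longrightarrow> g xs \<in> carrier R) \<Longrightarrow> total v g \<in> carrier R"
  by (induction v arbitrary: g) (auto intro!: finsum_closed simp: points_Cons)

lemma total_cong:
  "(\<And>xs. xs \<in> points (carrier R) v \<Longrightarrow> g xs = h xs) \<Longrightarrow>
   (\<And>xs. xs \<in> points (carrier R) v \<Longrightarrow> h xs \<in> carrier R) \<Longrightarrow> total v g = total v h"
proof (induction v arbitrary: g h)
  case (Suc v)
  have "total v (\<lambda>xs. g (x # xs)) = total v (\<lambda>xs. h (x # xs))" if "x \<in> carrier R" for x
    by (rule Suc.IH) (use Suc.prems that in \<open>auto simp: points_Cons\<close>)
  moreover have "total v (\<lambda>xs. h (x # xs)) \<in> carrier R" if "x \<in> carrier R" for x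
    by (rule total_closed) (use Suc.prems that in \<open>auto simp: points_Cons\<close>)
  ultimately show ?case by (auto intro!: finsum_cong')
qed simp

lemma total_add:
  "(\<And>xs. xs \<in> points (carrier R) v \<Longrightarrow> g xs \<in> carrier R) \<Longrightarrow>
   (\<And>xs. xs \<in> points (carrier R) v \<Longrightarrow> h xs \<in> carrier R) \<Longrightarrow>
   total v (\<lambda>xs. g xs \<oplus> h xs) = total v g \<oplus> total v h"
proof (induction v arbitrary: g h)
  case (Suc v)
  have c: "total v (\<lambda>xs. g (x # xs)) \<in> carrier R" "total v (\<lambda>xs. h (x # xs)) \<in> carrier R"
    if "x \<in> carrier R" for x
    using Suc.prems that by (auto intro!: total_closed simp: points_Cons)
  have "total (Suc v) (\<lambda>xs. g xs \<oplus> h xs)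
      = (\<Oplus>x\<in>carrier R. total v (\<lambda>xs. g (x # xs)) \<oplus> total v (\<lambda>xs. h (x # xs)))"
    unfolding total.simps
    by (rule finsum_cong') (use Suc c in \<open>auto simp: points_Cons\<close>)
  also have "\<dots> = total (Suc v) g \<oplus> total (Suc v) h"
    unfolding total.simps by (rule finsum_addf) (use c in auto)
  finally show ?case .
qed simp

lemma total_smult:
  "c \<in> carrier R \<Longrightarrow> (\<And>xs. xs \<in> points (carrier R) v \<Longrightarrow> g xs \<in> carrier R) \<Longrightarrow>
   total v (\<lambda>xs. c \<otimes> g xs) = c \<otimes> total v g"
proof (induction v arbitrary: g)
  case (Suc v)
  have c: "total v (\<lambda>xs. g (x # xs)) \<in> carrier R" if "x \<in> carrier R" for x
    using Suc.prems that by (auto intro!: total_closed simp: points_Cons)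
  have "total (Suc v) (\<lambda>xs. c \<otimes> g xs) = (\<Oplus>x\<in>carrier R. c \<otimes> total v (\<lambda>xs. g (x # xs)))"
    unfolding total.simps by (rule finsum_cong') (use Suc c in \<open>auto simp: points_Cons\<close>)
  also have "\<dots> = c \<otimes> total (Suc v) g"
    unfolding total.simps by (rule finsum_rdistr[symmetric]) (use c Suc fin in auto)
  finally show ?case .
qed simp

text \<open>Some exponent must lie below \<open>card (carrier R) - 1\<close>, and its power sum is a
  factor. The induction finds it: either the first exponent qualifies, or the remaining ones still
  satisfy the bound.\<close>

lemma total_mono:
  "length E = v \<Longrightarrow> sum_list E < v * (card (carrier R) - 1) \<Longrightarrow> total v (mono E) = \<zero>"
proof (induction v arbitrary: E)
  case (Suc v)
  then obtain k E' where E: "E = k # E'" by (cases E) auto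
  have mc: "total v (mono E') \<in> carrier R" by (rule total_closed) (auto simp: points_def)
  have "total (Suc v) (mono E) = (\<Oplus>x\<in>carrier R. x [^] k \<otimes> total v (mono E'))"
    unfolding total.simps E mono.simps
    by (rule finsum_cong') (use mc in \<open>auto intro!: total_smult simp: points_def\<close>)
  also have "\<dots> = (\<Oplus>x\<in>carrier R. x [^] k) \<otimes> total v (mono E')"
    by (rule finsum_ldistr[symmetric]) (use mc fin in auto)
  also have "\<dots> = \<zero>"
  proof (cases "k < card (carrier R) - 1")
    case True
    then show ?thesis using power_sum_eq_zero mc by simp
  next
    case False
    then have "sum_list E' < v * (card (carrier R) - 1)" using Suc.prems E by simp
    then have "total v (mono E') = \<zero>" using Suc E by auto
    moreover have "(\<Oplus>x\<in>carrier R. x [^] k) \<in> carrier R" by (rule finsum_closed) auto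
    ultimately show ?thesis by simp
  qed
  finally show ?case .
qed simp

lemma total_zero: "(\<And>xs. xs \<in> points (carrier R) v \<Longrightarrow> g xs = \<zero>) \<Longrightarrow> total v g = \<zero>"
  using total_cong[of v g "\<lambda>xs. \<zero> \<otimes> \<zero>"] total_smult[of \<zero> v "\<lambda>xs. \<zero>"]
    total_closed[of v "\<lambda>xs. \<zero>"] by simp

lemma total_term_eval:
  assumes "wf_terms v D L" "D < v * (card (carrier R) - 1)"
  shows "total v (term_eval L) = \<zero>"
  using assms(1)
proof (induction L)
  case Nil
  show ?case by (rule total_zero) simp
next
  case (Cons a L)
  obtain c E where a: "a = (c, E)" by (cases a)
  have c: "c \<in> carrier R" "length E = v" "sum_list E \<le> D" "wf_terms v D L" using Cons a by auto
  have "total v (term_eval (a # L)) = total v (\<lambda>xs. c \<otimes> mono E xs) \<oplus> total v (term_eval L)"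
    unfolding a term_eval.simps
    by (rule total_add) (use c in \<open>auto simp: points_def\<close>)
  also have "total v (\<lambda>xs. c \<otimes> mono E xs) = c \<otimes> total v (mono E)"
    by (rule total_smult) (use c in \<open>auto simp: points_def\<close>)
  also have "total v (mono E) = \<zero>" by (rule total_mono) (use c assms in auto)
  finally show ?case using Cons c by simp
qed

lemma total_indicator:
  "(\<And>xs. xs \<in> points (carrier R) v \<Longrightarrow> xs \<noteq> replicate v \<zero> \<Longrightarrow> g xs = \<zero>) \<Longrightarrow>
   g (replicate v \<zero>) = \<one> \<Longrightarrow> total v g = \<one>"
proof (induction v arbitrary: g)
  case (Suc v)
  have 1: "total v (\<lambda>xs. g (\<zero> # xs)) = \<one>"
    by (rule Suc.IH) (use Suc.prems in \<open>auto simp: points_Cons\<close>)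
  have 0: "total v (\<lambda>xs. g (x # xs)) = \<zero>" if "x \<in> carrier R - {\<zero>}" for x
    by (rule total_zero) (use Suc.prems that in \<open>auto simp: points_Cons\<close>)
  have "total (Suc v) g = (\<Oplus>x\<in>insert \<zero> (carrier R - {\<zero>}). total v (\<lambda>xs. g (x # xs)))"
    by (simp add: insert_absorb)
  also have "\<dots> = \<one> \<oplus> (\<Oplus>x\<in>carrier R - {\<zero>}. total v (\<lambda>xs. g (x # xs)))"
    using 0 1 fin by (subst finsum_insert) auto
  also have "(\<Oplus>x\<in>carrier R - {\<zero>}. total v (\<lambda>xs. g (x # xs))) = (\<Oplus>x\<in>carrier R - {\<zero>}. \<zero>)"
    by (rule finsum_cong') (use 0 in auto)
  finally show ?case by simp
qed simp

text \<open>The product of the polynomials \<open>1 - g ^ (q - 1)\<close>: it is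
  \<open>\<one>\<close> at the common zeros and \<open>\<zero>\<close> elsewhere. The sign is
  written as a constant factor, so that the closure rules of \<open>is_poly\<close> apply
  directly.\<close>

fun chev :: "(nat \<times> ('a list \<Rightarrow> 'a)) list \<Rightarrow> 'a list \<Rightarrow> 'a" where
  "chev [] xs = \<one>"
| "chev (P # Ps) xs = (\<one> \<oplus> \<ominus> \<one> \<otimes> snd P xs [^] (card (carrier R) - 1)) \<otimes> chev Ps xs"

lemma is_poly_chev:
  "(\<And>D g. (D, g) \<in> set Ps \<Longrightarrow> is_poly v D g) \<Longrightarrow>
    is_poly v (sum_list (map fst Ps) * (card (carrier R) - 1)) (chev Ps)"
proof (induction Ps)
  case Nil
  show ?case using is_poly_const[of \<one> v 0] by simp
next
  case (Cons P Ps)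
  obtain D g where P: "P = (D, g)" by (cases P)
  let ?k = "card (carrier R) - 1"
  have "is_poly v (?k * D) (\<lambda>xs. g xs [^] ?k)" using Cons.prems P by (intro is_poly_pow) auto
  then have "is_poly v (0 + ?k * D) (\<lambda>xs. \<ominus> \<one> \<otimes> g xs [^] ?k)"
    by (intro is_poly_mult is_poly_const) auto
  then have "is_poly v (?k * D) (\<lambda>xs. \<one> \<oplus> \<ominus> \<one> \<otimes> g xs [^] ?k)"
    by (intro is_poly_add is_poly_const) auto
  from is_poly_mult[OF this Cons.IH] Cons.prems P show ?case by (simp add: algebra_simps)
qed

text \<open>If the origin were the only common zero, \<open>chev Ps\<close> would be its indicator,
  with total \<open>\<one>\<close>. Yet the degree of \<open>chev Ps\<close> is below
  \<open>v\<close> times \<open>card (carrier R) - 1\<close>, which forces the total to be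
  \<open>\<zero>\<close>.\<close>

theorem chevalley:
  assumes poly: "\<And>D g. (D, g) \<in> set Ps \<Longrightarrow> is_poly v D g"
    and zero: "\<And>D g. (D, g) \<in> set Ps \<Longrightarrow> g (replicate v \<zero>) = \<zero>"
    and deg: "sum_list (map fst Ps) < v"
  shows "\<exists>xs\<in>points (carrier R) v. xs \<noteq> replicate v \<zero> \<and> (\<forall>(D, g)\<in>set Ps. g xs = \<zero>)"
proof (rule ccontr)
  assume neg: "\<not> ?thesis"
  let ?k = "card (carrier R) - 1"
  have k: "0 < ?k"
    using card_mono[OF fin, of "{\<zero>, \<one>}"] zero_not_one by auto
  obtain L where L: "wf_terms v (sum_list (map fst Ps) * ?k) L"
    "\<forall>xs\<in>points (carrier R) v. chev Ps xs = term_eval L xs"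
    using is_poly_chev[OF poly] unfolding is_poly_def by blast
  have "total v (chev Ps) = total v (term_eval L)"
    by (rule total_cong) (use L in \<open>auto simp: points_def\<close>)
  also have "\<dots> = \<zero>"
    by (rule total_term_eval[OF L(1)]) (use deg k in simp)
  finally have t0: "total v (chev Ps) = \<zero>" .
  have "total v (chev Ps) = \<one>"
  proof (rule total_indicator)
    show "chev Ps (replicate v \<zero>) = \<one>"
      using zero
    proof (induction Ps)
      case (Cons P Ps)
      have "snd P (replicate v \<zero>) = \<zero>" using Cons.prems[of "fst P" "snd P"] by simp
      moreover have "chev Ps (replicate v \<zero>) = \<one>" using Cons by auto
      ultimately show ?case using k by (simp add: nat_pow_zero)
    qed simp
  next
    fix xs assume xs: "xs \<in> points (carrier R) v" "xs \<noteq> replicate v \<zero>"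
    then obtain D g where g: "(D, g) \<in> set Ps" "g xs \<noteq> \<zero>" using neg by auto
    have "\<one> \<oplus> \<ominus> \<one> \<otimes> g xs [^] ?k = \<zero>"
      using pow_card_eq_one[of "g xs"] is_poly_closed[OF poly[OF g(1)] xs(1)] g(2)
      by (simp add: r_neg)
    with g(1) poly show "chev Ps xs = \<zero>"
    proof (induction Ps)
      case (Cons P Ps)
      have c: "chev Ps xs \<in> carrier R"
        using is_poly_closed[OF is_poly_chev[of Ps v] xs(1)] Cons.prems by auto
      have "snd P xs \<in> carrier R"
        using is_poly_closed[OF Cons.prems(2) xs(1), of "fst P" "snd P"] by simp
      with Cons c show ?case by (cases "P = (D, g)") auto
    qed simp
  qed
  with t0 show False by simp
qed

end

end

section \<open>Arithmetic in a coded field\<close>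

lemma digit_sum_less:
  fixes p :: nat
  assumes "\<And>j. j < e \<Longrightarrow> g j < p" shows "(\<Sum>j<e. g j * p ^ j) < p ^ e"
  using assms
proof (induction e)
  case (Suc e)
  have "(\<Sum>j<e. g j * p ^ j) + g e * p ^ e < p ^ e + g e * p ^ e" using Suc by simp
  also have "\<dots> = (1 + g e) * p ^ e" by simp
  also have "\<dots> \<le> p * p ^ e" using Suc.prems[of e] by (intro mult_le_mono) auto
  finally show ?case by simp
qed simp

lemma digit_of_digit_sum:
  fixes p :: nat
  assumes "\<And>j. j < e \<Longrightarrow> g j < p" "i < e"
  shows "(\<Sum>j<e. g j * p ^ j) div p ^ i mod p = g i"
  using assms
proof (induction e)
  case (Suc e)
  have p: "0 < p" using Suc.prems(1)[of 0] by simp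
  have lt: "(\<Sum>j<e. g j * p ^ j) < p ^ e" using Suc.prems by (intro digit_sum_less) auto
  show ?case
  proof (cases "i = e")
    case True
    have "((\<Sum>j<e. g j * p ^ j) + g e * p ^ e) div p ^ e = g e"
      using lt p by (subst div_mult_self1) auto
    then show ?thesis using True Suc.prems(1)[of e] by simp
  next
    case False
    then have i: "i < e" using Suc.prems by simp
    have "g e * p ^ e = (g e * p ^ (e - i)) * p ^ i"
      using i by (simp flip: power_add)
    then have "((\<Sum>j<e. g j * p ^ j) + g e * p ^ e) div p ^ i = (\<Sum>j<e. g j * p ^ j) div p ^ i + g e * p ^ (e - i)"
      using p div_mult_self1[of "p ^ i" "\<Sum>j<e. g j * p ^ j" "g e * p ^ (e - i)"]
      by (simp only: power_eq_0_iff) simp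
    moreover have "p dvd g e * p ^ (e - i)" using i by (simp add: dvd_power)
    ultimately have "((\<Sum>j<e. g j * p ^ j) + g e * p ^ e) div p ^ i mod p = (\<Sum>j<e. g j * p ^ j) div p ^ i mod p"
      by (simp add: mod_add_eq[symmetric, of _ "g e * p ^ (e - i)"] dvd_imp_mod_0)
    also have "\<dots> = g i" using Suc i by auto
    finally show ?thesis by simp
  qed
qed simp

lemma digit_expansion:
  fixes x b :: nat
  assumes "0 < b" shows "(\<Sum>j<m. (x div b ^ j mod b) * b ^ j) = x mod b ^ m"
proof (induction m)
  case (Suc m)
  have "x mod b ^ Suc m = b ^ m * (x div b ^ m mod b) + x mod b ^ m"
    using mod_mult2_eq[of x "b ^ m" b] by (simp add: mult.commute)
  with Suc show ?case by (simp add: mult.commute)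
qed simp

lemma digit_ext:
  fixes x y b :: nat
  assumes "0 < b" "x < b ^ m" "y < b ^ m"
    "\<And>j. j < m \<Longrightarrow> x div b ^ j mod b = y div b ^ j mod b"
  shows "x = y"
proof -
  have "x mod b ^ m = y mod b ^ m"
    unfolding digit_expansion[OF assms(1), symmetric] using assms(4) by simp
  with assms show ?thesis by simp
qed

locale coded = field F for F :: "nat ring" (structure) +
  fixes q r p e \<alpha> :: nat
  assumes carr: "carrier F = {..<q}"
    and prime_p: "normalization_semidom_class.prime p" and e_pos: "0 < e" and q_eq: "q = p ^ e"
    and alpha: "\<alpha> \<in> carrier F" and alpha_pow: "\<alpha> [^] e = r"
    and code: "\<And>a. a < q \<Longrightarrow> a = (\<Oplus>i\<in>{..<e}. add_pow F (a div p ^ i mod p) (\<alpha> [^] (i :: nat)))"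

lemma coded_fieldE:
  assumes "coded_field q r F"
  obtains p e \<alpha> where "coded F q r p e \<alpha>"
proof -
  from assms obtain p e \<alpha> where "field F" "carrier F = {..<q}"
    "normalization_semidom_class.prime p" "0 < e" "q = p ^ e" "\<alpha> \<in> carrier F" "\<alpha> [^]\<^bsub>F\<^esub> e = r"
    "\<forall>a<q. a = (\<Oplus>\<^bsub>F\<^esub>i\<in>{..<e}. add_pow F (a div p ^ i mod p) (\<alpha> [^]\<^bsub>F\<^esub> (i :: nat)))"
    unfolding coded_field_def by blast
  then show ?thesis
    by (intro that[of p e \<alpha>]) (auto intro!: coded.intro coded_axioms.intro)
qed

context coded begin

abbreviation pdig :: "nat \<Rightarrow> nat \<Rightarrow> nat" where
  "pdig a i \<equiv> a div p ^ i mod p"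

lemma p_gt_1: "1 < p"
  using prime_p by (rule prime_gt_1_nat)

lemma q_gt_1: "1 < q"
  unfolding q_eq by (rule one_less_power[OF p_gt_1 e_pos])

lemma p_le_q: "p \<le> q"
  unfolding q_eq by (rule self_le_power) (use p_gt_1 e_pos in auto)

lemma finite_carr: "finite (carrier F)"
  by (simp add: carr)

lemma card_carr: "card (carrier F) = q"
  by (simp add: carr)

lemma carr_iff: "x \<in> carrier F \<longleftrightarrow> x < q"
  by (simp add: carr)

lemma alpha_pow_closed [simp]: "\<alpha> [^] (i :: nat) \<in> carrier F"
  using alpha by simp

lemma code_fsum: "a < q \<Longrightarrow> a = fsum e (\<lambda>i. add_pow F (pdig a i) (\<alpha> [^] i))"
  using code[of a] by (subst fsum_eq_finsum) auto

lemma zero_code: "\<zero> = 0"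
proof -
  have "0 = fsum e (\<lambda>i. add_pow F (pdig 0 i) (\<alpha> [^] i))" using code_fsum[of 0] q_gt_1 by simp
  also have "\<dots> = \<zero>" by (rule fsum_zero) simp
  finally show ?thesis by simp
qed

text \<open>Only the digit of index 0 is nonzero, so the prime field is coded by its
  residues.\<close>

lemma small_code:
  assumes "a < p" shows "a = add_pow F a \<one>"
proof -
  have "a = fsum e (\<lambda>i. add_pow F (pdig a i) (\<alpha> [^] i))" using code_fsum[of a] p_le_q assms by simp
  also have "\<dots> = add_pow F (pdig a 0) (\<alpha> [^] (0::nat))"
  proof (rule fsum_single)
    fix j assume "j < e" "j \<noteq> 0"
    then have "p \<le> p ^ j" using p_gt_1 self_le_power[of p j] by simp
    then show "add_pow F (pdig a j) (\<alpha> [^] j) = \<zero>" using assms by simp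
  qed (use e_pos in auto)
  finally show ?thesis using assms by simp
qed

lemma one_code: "\<one> = 1"
proof -
  have "1 = add_pow F (1 :: nat) \<one>" by (rule small_code[OF p_gt_1])
  also have "\<dots> = \<one>" by simp
  finally show ?thesis by simp
qed

lemma add_pow_one_mult: "add_pow F (m * k :: nat) \<one> = add_pow F m \<one> \<otimes> add_pow F k \<one>"
proof (induction m)
  case (Suc m)
  have "add_pow F (Suc m * k) \<one> = add_pow F (m * k) \<one> \<oplus> add_pow F k \<one>"
    using add.nat_pow_mult[of \<one> "m * k" k] by (simp add: add.commute)
  with Suc show ?case by (simp add: l_distr)
qed simp

text \<open>The order of the additive group is \<open>p ^ e\<close>, so \<open>p ^ e\<close> copies
  of \<open>\<one>\<close> add up to zero; this sum is the \<open>e\<close>-th power of the sum of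
  \<open>p\<close> copies, and a field has no nilpotents.\<close>

lemma char_one: "add_pow F p \<one> = \<zero>"
proof -
  have pow: "add_pow F (p ^ i) \<one> = add_pow F p \<one> [^] i" for i :: nat
    by (induction i) (auto simp: add_pow_one_mult m_comm)
  have "add_pow F (p ^ e) \<one> = \<zero>"
    using add.pow_order_eq_1[OF one_closed] card_carr by (simp add: order_def q_eq)
  then have "add_pow F p \<one> [^] e = \<zero>" using pow by simp
  moreover have "x \<in> carrier F \<Longrightarrow> x [^] n = \<zero> \<Longrightarrow> x = \<zero>" for x and n :: nat
    by (induction n) (auto simp: integral_iff)
  ultimately show ?thesis by simp
qed

lemma char: "x \<in> carrier F \<Longrightarrow> add_pow F p x = \<zero>"
  using add_pow_ldistr[of \<one> x p] char_one by simp

lemma add_pow_mod: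
  assumes x: "x \<in> carrier F" shows "add_pow F (k mod p) x = add_pow F k x"
proof -
  have "add_pow F k x = add_pow F (p * (k div p)) x \<oplus> add_pow F (k mod p) x"
    using add.nat_pow_mult[OF x, of "p * (k div p)" "k mod p"] by simp
  also have "add_pow F (p * (k div p)) x = add_pow F (k div p) (add_pow F p x)"
    using add.nat_pow_pow[OF x] by (simp add: mult.commute)
  also have "\<dots> = \<zero>" using char[OF x] by simp
  finally show ?thesis using x by simp
qed

text \<open>The program multiplies by the code \<open>p - 1\<close> wherever a minus sign
  occurs.\<close>

lemma minus_one_code: "\<ominus> \<one> = p - 1"
proof -
  have "add_pow F (p - 1) \<one> \<oplus> \<one> = add_pow F p \<one>"
    using add.nat_pow_Suc[of "p - 1" \<one>] p_gt_1 by (simp)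
  then have "\<ominus> \<one> = add_pow F (p - 1) \<one>"
    using char_one minus_equality[of "add_pow F (p - 1) \<one>" \<one>] by (simp)
  also have "\<dots> = p - 1" using small_code[of "p - 1"] p_gt_1 by simp
  finally show ?thesis .
qed

text \<open>Digitwise \<open>a + c b\<close> for a natural number \<open>c\<close>. The quotients
  need not be cut to digits first, since their higher digits contribute multiples of
  \<open>p\<close>. The remaining field arithmetic is built on this.\<close>

definition comb :: "nat \<Rightarrow> nat \<Rightarrow> nat \<Rightarrow> nat" where
  "comb a c b = (\<Sum>j<e. ((a div p ^ j + c * (b div p ^ j)) mod p) * p ^ j)"

lemma comb_less: "comb a c b < q"
  unfolding comb_def q_eq using p_gt_1 by (intro digit_sum_less) auto

lemma pdig_comb: "j < e \<Longrightarrow> pdig (comb a c b) j = (a div p ^ j + c * (b div p ^ j)) mod p"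
  unfolding comb_def using p_gt_1 by (intro digit_of_digit_sum) auto

lemma comb_eq:
  assumes "a < q" "b < q" shows "comb a c b = a \<oplus> add_pow F c b"
proof -
  let ?A = "\<lambda>i. add_pow F (pdig a i) (\<alpha> [^] i)"
  let ?B = "\<lambda>i. add_pow F (pdig b i) (\<alpha> [^] i)"
  have mods: "(x mod p + c * (y mod p)) mod p = (x + c * y) mod p" for x y
  proof -
    have "(x mod p + c * (y mod p)) mod p = (x mod p + (c * (y mod p)) mod p) mod p"
      by (rule mod_add_right_eq[symmetric])
    also have "(c * (y mod p)) mod p = (c * y) mod p" by (rule mod_mult_right_eq)
    also have "(x mod p + (c * y) mod p) mod p = (x + c * y) mod p" by (rule mod_add_eq)
    finally show ?thesis .
  qed
  have "add_pow F (pdig (comb a c b) i) (\<alpha> [^] i) = ?A i \<oplus> add_pow F c \<one> \<otimes> ?B i" if "i < e" for i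
  proof -
    have "add_pow F (pdig (comb a c b) i) (\<alpha> [^] i)
        = add_pow F ((pdig a i + c * pdig b i) mod p) (\<alpha> [^] i)"
      unfolding pdig_comb[OF that] by (simp only: mods)
    also have "\<dots> = add_pow F (pdig a i + c * pdig b i) (\<alpha> [^] i)"
      by (rule add_pow_mod) simp
    also have "\<dots> = ?A i \<oplus> add_pow F c (?B i)"
      using add.nat_pow_mult[of "\<alpha> [^] i" "pdig a i" "c * pdig b i"]
        add.nat_pow_pow[of "\<alpha> [^] i" c "pdig b i"] by (simp add: mult.commute)
    also have "add_pow F c (?B i) = add_pow F c \<one> \<otimes> ?B i"
      using add_pow_ldistr[of \<one> "?B i" c] by simp
    finally show ?thesis .
  qed
  then have "fsum e (\<lambda>i. add_pow F (pdig (comb a c b) i) (\<alpha> [^] i))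
      = fsum e (\<lambda>i. ?A i \<oplus> add_pow F c \<one> \<otimes> ?B i)"
    by (intro fsum_cong) simp
  also have "\<dots> = fsum e ?A \<oplus> add_pow F c \<one> \<otimes> fsum e ?B"
    by (subst fsum_add) (auto simp: fsum_smult)
  finally have "comb a c b = a \<oplus> add_pow F c \<one> \<otimes> b"
    unfolding code_fsum[OF comb_less, symmetric] code_fsum[OF assms(1), symmetric]
      code_fsum[OF assms(2), symmetric] .
  moreover have "b \<in> carrier F" using assms by (simp add: carr)
  ultimately show ?thesis using add_pow_ldistr[of \<one> b c] by simp
qed

text \<open>Multiplication by \<open>\<alpha>\<close>: the lower digits move up one place, while the
  top digit becomes a coefficient of \<open>\<alpha> ^ e\<close> and multiplies \<open>r\<close>.
  The number \<open>q div p\<close> is \<open>p ^ (e - 1)\<close>.\<close>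

definition shift :: "nat \<Rightarrow> nat" where
  "shift x = comb (x mod (q div p) * p) (x div (q div p)) r"

lemma shift_less: "shift x < q"
  by (simp add: shift_def comb_less)

lemma r_less: "r < q"
  using alpha_pow alpha_pow_closed[of e] by (simp add: carr)

lemma q_div_p: "q div p = p ^ (e - 1)"
  using e_pos p_gt_1 unfolding q_eq by (cases e) auto

lemma shift_eq:
  assumes x: "x < q" shows "shift x = \<alpha> \<otimes> x"
proof -
  obtain e' where e': "e = Suc e'" using e_pos by (cases e) auto
  have qp: "q div p = p ^ e'" using q_div_p e' by simp
  define y where "y = x mod p ^ e' * p"
  define top where "top = x div p ^ e'"
  have top: "top < p" using x p_gt_1 unfolding top_def q_eq e'
    by (simp add: less_mult_imp_div_less)
  have y: "y < q" unfolding y_def q_eq e' using p_gt_1 by (simp add: mult.commute)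
  have y0: "y mod p = 0" by (simp add: y_def)
  have yS: "pdig y (Suc i) = pdig x i" if "i < e'" for i
  proof -
    have "y div p ^ Suc i = x mod p ^ e' div p ^ i"
      unfolding y_def using p_gt_1 by (simp add: div_mult2_eq)
    moreover have "x mod p ^ e' = (\<Sum>j<e'. pdig x j * p ^ j)"
      using digit_expansion[of p x e'] p_gt_1 by simp
    ultimately show ?thesis
      using digit_of_digit_sum[of e' "pdig x" p i] that p_gt_1 by simp
  qed
  have xt: "pdig x e' = top" using top by (simp add: top_def)
  have xc: "x \<in> carrier F" "r \<in> carrier F" using x r_less by (auto simp: carr)
  have "\<alpha> \<otimes> x = \<alpha> \<otimes> fsum e (\<lambda>i. add_pow F (pdig x i) (\<alpha> [^] i))"
    using code_fsum[OF x] by simp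
  also have "\<dots> = fsum e (\<lambda>i. add_pow F (pdig x i) (\<alpha> [^] Suc i))"
    by (subst fsum_smult) (auto simp: alpha add_pow_rdistr m_comm intro!: fsum_cong)
  also have "\<dots> = fsum e' (\<lambda>i. add_pow F (pdig y (Suc i)) (\<alpha> [^] Suc i)) \<oplus> add_pow F top (\<alpha> [^] e)"
    unfolding e' fsum.simps xt
    using fsum_cong[of e' "\<lambda>i. add_pow F (pdig x i) (\<alpha> [^] Suc i)"
        "\<lambda>i. add_pow F (pdig y (Suc i)) (\<alpha> [^] Suc i)"] yS by simp
  also have "fsum e' (\<lambda>i. add_pow F (pdig y (Suc i)) (\<alpha> [^] Suc i))
      = fsum e (\<lambda>i. add_pow F (pdig y i) (\<alpha> [^] i))"
    unfolding e' by (subst fsum_Suc_shift) (auto simp: y0 alpha simp del: nat_pow_Suc)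
  also have "\<dots> = y" using code_fsum[OF y] by simp
  finally have "\<alpha> \<otimes> x = y \<oplus> add_pow F top r" by (simp add: alpha_pow)
  then show ?thesis
    unfolding shift_def qp y_def[symmetric] top_def[symmetric] comb_eq[OF y r_less] by simp
qed

text \<open>Schoolbook multiplication: \<open>z + x y\<close> is accumulated digit by digit of \<open>y\<close>.\<close>

primrec mul_acc :: "nat \<Rightarrow> nat \<Rightarrow> nat \<Rightarrow> nat \<Rightarrow> nat \<times> nat" where
  "mul_acc z x y 0 = (z, x)"
| "mul_acc z x y (Suc i) =
     (comb (fst (mul_acc z x y i)) (pdig y i) (snd (mul_acc z x y i)), shift (snd (mul_acc z x y i)))"

lemma mul_acc_less: "z < q \<Longrightarrow> x < q \<Longrightarrow> fst (mul_acc z x y i) < q \<and> snd (mul_acc z x y i) < q"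
  by (cases i) (auto simp: comb_less shift_less)

lemma mul_acc_eq:
  assumes z: "z < q" and x: "x < q"
  shows "mul_acc z x y i
    = (z \<oplus> x \<otimes> fsum i (\<lambda>i. add_pow F (pdig y i) (\<alpha> [^] i)), \<alpha> [^] i \<otimes> x)"
proof (induction i)
  case 0
  then show ?case using z x by (simp add: carr) 
next
  case (Suc i)
  let ?S = "fsum i (\<lambda>i. add_pow F (pdig y i) (\<alpha> [^] i))"
  have zx: "z \<in> carrier F" "x \<in> carrier F" using z x by (simp_all add: carr_iff)
  have c: "z \<in> carrier F" "x \<in> carrier F" "\<alpha> \<in> carrier F" "\<alpha> [^] i \<in> carrier F" "?S \<in> carrier F"
    "add_pow F (pdig y i) (\<alpha> [^] i) \<in> carrier F"
    using zx alpha by auto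
  have "z \<oplus> x \<otimes> ?S \<in> carrier F" "\<alpha> [^] i \<otimes> x \<in> carrier F" using c by auto
  then have less: "z \<oplus> x \<otimes> ?S < q" "\<alpha> [^] i \<otimes> x < q" by (simp_all only: carr_iff)
  have "add_pow F (pdig y i) (\<alpha> [^] i \<otimes> x) = x \<otimes> add_pow F (pdig y i) (\<alpha> [^] i)"
    using add_pow_ldistr[OF c(4,2), of "pdig y i"] c by (simp add: m_comm)
  then have 1: "comb (z \<oplus> x \<otimes> ?S) (pdig y i) (\<alpha> [^] i \<otimes> x) = z \<oplus> x \<otimes> (?S \<oplus> add_pow F (pdig y i) (\<alpha> [^] i))"
    unfolding comb_eq[OF less] using c by (simp add: r_distr a_assoc)
  have 2: "shift (\<alpha> [^] i \<otimes> x) = \<alpha> [^] Suc i \<otimes> x"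
    unfolding shift_eq[OF less(2)] using c by (simp add: m_ac)
  show ?case
    by (simp only: mul_acc.simps Suc fst_conv snd_conv fsum.simps 1 2)
qed

lemma mul_acc:
  assumes "z < q" "x < q" "y < q" shows "fst (mul_acc z x y e) = z \<oplus> x \<otimes> y"
  unfolding mul_acc_eq[OF assms(1,2)] code_fsum[OF assms(3), symmetric] by simp

end

section \<open>Bases of kernels\<close>

context field begin

definition dot :: "nat \<Rightarrow> (nat \<Rightarrow> 'a) \<Rightarrow> (nat \<Rightarrow> 'a) \<Rightarrow> 'a" where
  "dot n g v = fsum n (\<lambda>k. g k \<otimes> v k)"

definition comb_vec :: "nat \<Rightarrow> (nat \<Rightarrow> 'a) \<Rightarrow> (nat \<Rightarrow> nat \<Rightarrow> 'a) \<Rightarrow> nat \<Rightarrow> 'a" where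
  "comb_vec N c V k = fsum N (\<lambda>j. c j \<otimes> V j k)"

definition scalars :: "nat \<Rightarrow> (nat \<Rightarrow> 'a) \<Rightarrow> bool" where
  "scalars n v \<longleftrightarrow> (\<forall>k<n. v k \<in> carrier R)"

definition indep :: "nat \<Rightarrow> (nat \<Rightarrow> nat \<Rightarrow> 'a) \<Rightarrow> nat \<Rightarrow> bool" where
  "indep n V N \<longleftrightarrow> (\<forall>c. scalars N c \<and> (\<forall>k<n. comb_vec N c V k = \<zero>) \<longrightarrow> (\<forall>j<N. c j = \<zero>))"

text \<open>The set of functionals is known only to the proof. The machine holds the vectors
  \<open>V\<close> and their number, so its space does not grow with the number of points
  visited.\<close>

definition kernel_basis :: "nat \<Rightarrow> (nat \<Rightarrow> 'a) set \<Rightarrow> (nat \<Rightarrow> nat \<Rightarrow> 'a) \<Rightarrow> nat \<Rightarrow> bool" where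
  "kernel_basis n \<G> V N \<longleftrightarrow>
     (\<forall>j<N. scalars n (V j)) \<and> (\<forall>g\<in>\<G>. scalars n g) \<and>
     (\<forall>g\<in>\<G>. \<forall>j<N. dot n g (V j) = \<zero>) \<and>
     (\<forall>v. scalars n v \<and> (\<forall>g\<in>\<G>. dot n g v = \<zero>) \<longrightarrow>
        (\<exists>c. scalars N c \<and> (\<forall>k<n. v k = comb_vec N c V k))) \<and>
     indep n V N"

lemma dot_closed [simp]: "scalars n g \<Longrightarrow> scalars n v \<Longrightarrow> dot n g v \<in> carrier R"
  by (auto simp: dot_def scalars_def)

lemma comb_vec_closed [simp]:
  "scalars N c \<Longrightarrow> (\<And>j. j < N \<Longrightarrow> scalars n (V j)) \<Longrightarrow> k < n \<Longrightarrow> comb_vec N c V k \<in> carrier R"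
  by (auto simp: comb_vec_def scalars_def)

lemma scalars_comb_vec: "scalars N c \<Longrightarrow> (\<And>j. j < N \<Longrightarrow> scalars n (V j)) \<Longrightarrow> scalars n (comb_vec N c V)"
  by (subst scalars_def) (simp add: comb_vec_closed[of N c n V])

lemma dot_cong: "(\<And>k. k < n \<Longrightarrow> v k = w k) \<Longrightarrow> dot n g v = dot n g w"
  unfolding dot_def by (intro fsum_cong) simp

lemma dot_comb_vec:
  assumes "scalars n g" "scalars N c" "\<And>j. j < N \<Longrightarrow> scalars n (V j)"
  shows "dot n g (comb_vec N c V) = fsum N (\<lambda>j. c j \<otimes> dot n g (V j))"
proof -
  have g: "g k \<in> carrier R" if "k < n" for k using assms(1) that by (simp add: scalars_def)
  have c: "c j \<in> carrier R" if "j < N" for j using assms(2) that by (simp add: scalars_def)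
  have V: "V j k \<in> carrier R" if "j < N" "k < n" for j k
    using assms(3)[OF that(1)] that by (simp add: scalars_def)
  have "dot n g (comb_vec N c V) = fsum n (\<lambda>k. fsum N (\<lambda>j. g k \<otimes> (c j \<otimes> V j k)))"
    unfolding dot_def comb_vec_def by (intro fsum_cong fsum_smult) (use g c V in auto)
  also have "\<dots> = fsum N (\<lambda>j. fsum n (\<lambda>k. g k \<otimes> (c j \<otimes> V j k)))"
    by (rule fsum_swap) (use g c V in auto)
  also have "\<dots> = fsum N (\<lambda>j. c j \<otimes> dot n g (V j))"
    unfolding dot_def
  proof (intro fsum_cong)
    fix j assume j: "j < N"
    have "c j \<otimes> fsum n (\<lambda>k. g k \<otimes> V j k) = fsum n (\<lambda>k. c j \<otimes> (g k \<otimes> V j k))"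
      by (rule fsum_smult) (use g c V j in auto)
    also have "\<dots> = fsum n (\<lambda>k. g k \<otimes> (c j \<otimes> V j k))"
      by (intro fsum_cong m_lcomm) (use g c V j in auto)
    finally show "fsum n (\<lambda>k. g k \<otimes> (c j \<otimes> V j k)) = c j \<otimes> fsum n (\<lambda>k. g k \<otimes> V j k)" ..
  qed
  finally show ?thesis .
qed

lemma kernel_basis_comb_vec:
  assumes "kernel_basis n \<G> V N" "scalars N c" "g \<in> \<G>"
  shows "dot n g (comb_vec N c V) = \<zero>"
proof -
  have "dot n g (comb_vec N c V) = fsum N (\<lambda>j. c j \<otimes> dot n g (V j))"
    by (rule dot_comb_vec) (use assms in \<open>auto simp: kernel_basis_def\<close>)
  also have "\<dots> = \<zero>"
    by (rule fsum_zero) (use assms in \<open>auto simp: kernel_basis_def scalars_def\<close>)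
  finally show ?thesis .
qed

lemma kernel_basis_unit:
  assumes "\<And>j k. j < n \<Longrightarrow> k < n \<Longrightarrow> V j k = (if j = k then \<one> else \<zero>)"
  shows "kernel_basis n {} V n"
proof -
  have cv: "comb_vec n c V k = c k" if "scalars n c" "k < n" for c k
    unfolding comb_vec_def
    by (subst fsum_single[of k]) (use that assms in \<open>auto simp: scalars_def\<close>)
  have "indep n V n" by (auto simp: indep_def cv)
  moreover have "\<exists>c. scalars n c \<and> (\<forall>k<n. v k = comb_vec n c V k)" if "scalars n v" for v
    using that cv by (intro exI[of _ v]) auto
  ultimately show ?thesis
    using assms by (auto simp: kernel_basis_def scalars_def)
qed

lemma kernel_basis_insert_trivial:
  assumes "kernel_basis n \<G> V N" "scalars n g" "\<And>j. j < N \<Longrightarrow> dot n g (V j) = \<zero>"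
  shows "kernel_basis n (insert g \<G>) V N"
  using assms unfolding kernel_basis_def by auto

text \<open>The pivot \<open>V i\<close> is replaced by the last vector, and then the multiple of the pivot that
  makes the functional vanish is subtracted from a multiple of every other vector.\<close>

lemma kernel_basis_insert_pivot:
  assumes kb: "kernel_basis n \<G> V (Suc N)" and g: "scalars n g" and i: "i < Suc N"
    and piv: "dot n g (V i) \<noteq> \<zero>"
    and W: "\<And>j k. j < N \<Longrightarrow> k < n \<Longrightarrow> W j k =
      dot n g (V i) \<otimes> V (if j = i then N else j) k \<oplus>
      (\<ominus> \<one> \<otimes> dot n g (V (if j = i then N else j))) \<otimes> V i k"
  shows "kernel_basis n (insert g \<G>) W N"
proof -
  define \<sigma> where "\<sigma> = (\<lambda>j. if j = i then N else j)"
  define l where "l = (\<lambda>j. dot n g (V j))"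
  define a where "a = l i"
  have V: "scalars n (V j)" if "j < Suc N" for j using kb that by (auto simp: kernel_basis_def)
  have Vc: "V j k \<in> carrier R" if "j < Suc N" "k < n" for j k
    using V that by (auto simp: scalars_def)
  have lc: "l j \<in> carrier R" if "j < Suc N" for j using V that g by (simp add: l_def)
  have a: "a \<in> carrier R" "a \<noteq> \<zero>" using lc i piv by (auto simp: a_def l_def)
  have ainv: "inv a \<in> carrier R" "inv a \<otimes> a = \<one>" "a \<otimes> inv a = \<one>"
    using a field_Units by auto
  have \<sigma>: "\<sigma> j < Suc N" "\<sigma> j \<noteq> i" if "j < N" for j using that i by (auto simp: \<sigma>_def)
  have W': "W j k = a \<otimes> V (\<sigma> j) k \<oplus> (\<ominus> \<one> \<otimes> l (\<sigma> j)) \<otimes> V i k" if "j < N" "k < n" for j k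
    using W that by (simp add: \<sigma>_def l_def a_def)
  have Wc: "scalars n (W j)" if "j < N" for j
    unfolding scalars_def using that W' Vc lc a \<sigma>[OF that] i by auto
  have dotW: "dot n h (W j) = a \<otimes> dot n h (V (\<sigma> j)) \<oplus> (\<ominus> \<one> \<otimes> l (\<sigma> j)) \<otimes> dot n h (V i)"
    if "j < N" "scalars n h" for j h
  proof -
    \<comment> \<open>Each \<open>W j\<close> is a combination of two vectors, which makes
      \<open>dot_comb_vec\<close> applicable with length 2.\<close>
    let ?c = "\<lambda>b. if b = 0 then a else \<ominus> \<one> \<otimes> l (\<sigma> j)"
    let ?U = "\<lambda>b. if b = 0 then V (\<sigma> j) else V i"
    have "dot n h (W j) = dot n h (comb_vec 2 ?c ?U)"
      by (rule dot_cong)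
        (use that W' Vc lc a \<sigma>[OF that(1)] i in \<open>auto simp: comb_vec_def numeral_2_eq_2\<close>)
    also have "\<dots> = fsum 2 (\<lambda>b. ?c b \<otimes> dot n h (?U b))"
      by (rule dot_comb_vec) (use that V lc a \<sigma>[OF that(1)] i in \<open>auto simp: scalars_def\<close>)
    finally show ?thesis
      using that V lc a \<sigma>[OF that(1)] i by (simp add: numeral_2_eq_2)
  qed
  have ker: "dot n h (W j) = \<zero>" if "h \<in> insert g \<G>" "j < N" for h j
  proof (cases "h = g")
    case True
    have "dot n g (W j) = a \<otimes> l (\<sigma> j) \<oplus> (\<ominus> \<one> \<otimes> l (\<sigma> j)) \<otimes> a"
      using dotW[OF that(2) g] by (simp add: l_def a_def)
    also have "(\<ominus> \<one> \<otimes> l (\<sigma> j)) \<otimes> a = \<ominus> (a \<otimes> l (\<sigma> j))"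
      using a lc[OF \<sigma>(1)[OF that(2)]] by (simp add: l_minus r_minus m_comm[of _ a])
    also have "a \<otimes> l (\<sigma> j) \<oplus> \<ominus> (a \<otimes> l (\<sigma> j)) = \<zero>"
      using a lc[OF \<sigma>(1)[OF that(2)]] by (simp add: r_neg)
    finally show ?thesis using True by simp
  next
    case False
    then have "h \<in> \<G>" using that by simp
    then have "scalars n h" "dot n h (V (\<sigma> j)) = \<zero>" "dot n h (V i) = \<zero>"
      using kb \<sigma>[OF that(2)] i by (auto simp: kernel_basis_def)
    then show ?thesis using dotW[OF that(2), of h] a lc \<sigma>[OF that(2)] by simp
  qed
  have combW: "comb_vec N c W k = fsum N (\<lambda>j. (c j \<otimes> a) \<otimes> V (\<sigma> j) k)
      \<oplus> (\<ominus> \<one> \<otimes> fsum N (\<lambda>j. c j \<otimes> l (\<sigma> j))) \<otimes> V i k" if "scalars N c" "k < n" for c k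
  proof -
    have c: "c j \<in> carrier R" if "j < N" for j using \<open>scalars N c\<close> that by (simp add: scalars_def)
    have 1: "c j \<otimes> W j k = (c j \<otimes> a) \<otimes> V (\<sigma> j) k \<oplus> (c j \<otimes> l (\<sigma> j)) \<otimes> (\<ominus> \<one> \<otimes> V i k)" if "j < N" for j
      using W'[OF that \<open>k < n\<close>] c[OF that] Vc[OF \<sigma>(1)[OF that] \<open>k < n\<close>] Vc[OF i \<open>k < n\<close>]
        lc[OF \<sigma>(1)[OF that]] a by (simp add: r_distr m_assoc l_minus r_minus)
    have "comb_vec N c W k
        = fsum N (\<lambda>j. (c j \<otimes> a) \<otimes> V (\<sigma> j) k \<oplus> (c j \<otimes> l (\<sigma> j)) \<otimes> (\<ominus> \<one> \<otimes> V i k))"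
      unfolding comb_vec_def using 1 by (intro fsum_cong) auto
    also have "\<dots> = fsum N (\<lambda>j. (c j \<otimes> a) \<otimes> V (\<sigma> j) k) \<oplus> fsum N (\<lambda>j. (c j \<otimes> l (\<sigma> j)) \<otimes> (\<ominus> \<one> \<otimes> V i k))"
      by (rule fsum_add) (use c a Vc lc \<sigma> i \<open>k < n\<close> in auto)
    also have "fsum N (\<lambda>j. (c j \<otimes> l (\<sigma> j)) \<otimes> (\<ominus> \<one> \<otimes> V i k)) = fsum N (\<lambda>j. c j \<otimes> l (\<sigma> j)) \<otimes> (\<ominus> \<one> \<otimes> V i k)"
      by (rule fsum_smult_right[symmetric]) (use c Vc lc \<sigma> i \<open>k < n\<close> in auto)
    also have "\<dots> = (\<ominus> \<one> \<otimes> fsum N (\<lambda>j. c j \<otimes> l (\<sigma> j))) \<otimes> V i k"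
      using c lc \<sigma> Vc[OF i \<open>k < n\<close>] by (simp add: l_minus r_minus)
    finally show ?thesis .
  qed
  have split: "comb_vec (Suc N) c V k = fsum N (\<lambda>j. c (\<sigma> j) \<otimes> V (\<sigma> j) k) \<oplus> c i \<otimes> V i k"
    if "scalars (Suc N) c" "k < n" for c k
    unfolding comb_vec_def
    by (subst fsum_remove[OF i]) (use that Vc in \<open>auto simp: scalars_def \<sigma>_def\<close>)
  have span: "\<exists>c. scalars N c \<and> (\<forall>k<n. v k = comb_vec N c W k)"
    if v: "scalars n v" "\<forall>h\<in>insert g \<G>. dot n h v = \<zero>" for v
  proof -
    obtain c where c: "scalars (Suc N) c" "\<forall>k<n. v k = comb_vec (Suc N) c V k"
      using kb v unfolding kernel_basis_def by blast
    have cc: "c j \<in> carrier R" if "j < Suc N" for j using c that by (simp add: scalars_def)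
    \<comment> \<open>The functional \<open>g\<close> vanishes at \<open>v\<close>, so the pivot
      coefficient is determined by the others. Dividing these by \<open>a\<close> gives coefficients
      with respect to \<open>W\<close>.\<close>
    let ?S = "fsum N (\<lambda>j. c (\<sigma> j) \<otimes> l (\<sigma> j))"
    have S: "?S \<in> carrier R" using cc lc \<sigma> by auto
    have "\<zero> = dot n g (comb_vec (Suc N) c V)" using v c dot_cong[of n v "comb_vec (Suc N) c V" g] by simp
    also have "\<dots> = fsum (Suc N) (\<lambda>j. c j \<otimes> l j)"
      unfolding l_def by (rule dot_comb_vec) (use g c V in auto)
    also have "\<dots> = ?S \<oplus> c i \<otimes> a"
      unfolding a_def by (subst fsum_remove[OF i]) (use cc lc in \<open>auto simp: \<sigma>_def\<close>)
    finally have eq0: "\<zero> = ?S \<oplus> c i \<otimes> a" .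
    have cia: "c i \<otimes> a \<in> carrier R" using a cc[OF i] by simp
    have "c i \<otimes> a \<oplus> ?S = \<zero>" unfolding eq0 by (rule a_comm[OF cia S])
    then have "\<ominus> ?S = c i \<otimes> a" by (rule minus_equality[OF _ S cia])
    then have "(\<ominus> \<one> \<otimes> ?S) \<otimes> inv a = c i \<otimes> a \<otimes> inv a" using S by (simp add: l_minus)
    also have "\<dots> = c i" using cc[OF i] a ainv by (simp add: m_assoc)
    finally have ci: "c i = (\<ominus> \<one> \<otimes> ?S) \<otimes> inv a" ..
    define c' where "c' = (\<lambda>j. c (\<sigma> j) \<otimes> inv a)"
    have c': "scalars N c'" using cc \<sigma> ainv by (auto simp: c'_def scalars_def)
    have "fsum N (\<lambda>j. c' j \<otimes> l (\<sigma> j)) = fsum N (\<lambda>j. (c (\<sigma> j) \<otimes> l (\<sigma> j)) \<otimes> inv a)"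
      unfolding c'_def by (intro fsum_cong) (use cc lc \<sigma> ainv in \<open>auto simp: m_ac\<close>)
    also have "\<dots> = ?S \<otimes> inv a"
      by (rule fsum_smult_right[symmetric]) (use cc lc \<sigma> ainv in auto)
    finally have S': "\<ominus> \<one> \<otimes> fsum N (\<lambda>j. c' j \<otimes> l (\<sigma> j)) = c i"
      using ci S ainv by (simp add: m_assoc)
    have "v k = comb_vec N c' W k" if k: "k < n" for k
    proof -
      have "fsum N (\<lambda>j. (c' j \<otimes> a) \<otimes> V (\<sigma> j) k) = fsum N (\<lambda>j. c (\<sigma> j) \<otimes> V (\<sigma> j) k)"
        unfolding c'_def by (intro fsum_cong) (use cc \<sigma> ainv a in \<open>auto simp: m_assoc\<close>)
      then show ?thesis using combW[OF c' k] split[OF c(1) k] c(2) k S' by simp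
    qed
    with c' show ?thesis by blast
  qed
  have "indep n W N"
    unfolding indep_def
  proof (intro allI impI)
    fix c j assume c: "scalars N c \<and> (\<forall>k<n. comb_vec N c W k = \<zero>)" and j: "j < N"
    have cc: "c j \<in> carrier R" if "j < N" for j using c that by (simp add: scalars_def)
    \<comment> \<open>A relation among the \<open>W j\<close>, rewritten for \<open>V\<close>. If
      \<open>i < N\<close>, the vector \<open>V N\<close> stands at place \<open>i\<close>, so its
      coefficient comes from \<open>c i\<close>.\<close>
    define c' where "c' = (\<lambda>m. if m = i then \<ominus> \<one> \<otimes> fsum N (\<lambda>j. c j \<otimes> l (\<sigma> j))
      else if m = N then c i \<otimes> a else c m \<otimes> a)"
    have c'\<sigma>: "c' (\<sigma> j) = c j \<otimes> a" if "j < N" for j using that i by (auto simp: c'_def \<sigma>_def)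
    have c'i: "c' i = \<ominus> \<one> \<otimes> fsum N (\<lambda>j. c j \<otimes> l (\<sigma> j))" by (simp add: c'_def)
    have "c' m \<in> carrier R" if m: "m < Suc N" for m
    proof (cases "m = i")
      case True then show ?thesis using cc lc \<sigma> by (auto simp: c'_def)
    next
      case False
      show ?thesis
      proof (cases "m = N")
        case True
        with False i have "i < N" by simp
        then show ?thesis using True False cc a by (simp add: c'_def)
      next
        case False
        with m show ?thesis using \<open>m \<noteq> i\<close> cc a by (simp add: c'_def)
      qed
    qed
    then have c': "scalars (Suc N) c'" by (simp add: scalars_def)
    have "comb_vec (Suc N) c' V k = \<zero>" if k: "k < n" for k
    proof -
      have "fsum N (\<lambda>j. c' (\<sigma> j) \<otimes> V (\<sigma> j) k) = fsum N (\<lambda>j. (c j \<otimes> a) \<otimes> V (\<sigma> j) k)"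
        by (intro fsum_cong) (simp add: c'\<sigma>)
      then have "comb_vec (Suc N) c' V k = comb_vec N c W k"
        unfolding split[OF c' k] combW[OF conjunct1[OF c] k] c'i by simp
      then show ?thesis using c k by simp
    qed
    then have "c' (\<sigma> j) = \<zero>"
      using kb c' \<sigma>[OF j] unfolding kernel_basis_def indep_def by blast
    then have "c j \<otimes> a = \<zero>" using c'\<sigma>[OF j] by simp
    then show "c j = \<zero>" using a cc[OF j] by (simp add: integral_iff)
  qed
  with span ker Wc g kb show ?thesis
    by (simp add: kernel_basis_def)
qed

text \<open>A dimension bound by counting: the values \<open>h k v\<close> form at most
  \<open>q ^ r\<close> tuples for a field of \<open>q\<close> elements, and two points with the same
  tuple differ by a combination of the \<open>N\<close> basis vectors. Of the \<open>h k\<close>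
  this asks only that equal values force a zero at the difference.\<close>

lemma kernel_basis_card:
  assumes fin: "finite (carrier R)" and kb: "kernel_basis n \<G> V N"
    and h: "\<And>k v. k < r \<Longrightarrow> scalars n v \<Longrightarrow> h k v \<in> carrier R"
    and h_diff: "\<And>k v w. k < r \<Longrightarrow> scalars n v \<Longrightarrow> scalars n w \<Longrightarrow> h k v = h k w \<Longrightarrow>
      h k (\<lambda>i. v i \<ominus> w i) = \<zero>"
    and h_ker: "\<And>g v. g \<in> \<G> \<Longrightarrow> scalars n v \<Longrightarrow> (\<And>k. k < r \<Longrightarrow> h k v = \<zero>) \<Longrightarrow> dot n g v = \<zero>"
  shows "n \<le> N + r"
proof -
  let ?q = "card (carrier R)"
  have q: "2 \<le> ?q" using card_mono[OF fin, of "{\<zero>, \<one>}"] zero_not_one by auto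
  let ?A = "points (carrier R) n" and ?B = "points (carrier R) r"
  let ?C = "points (carrier R) N"
  define f where "f = (\<lambda>xs. map (\<lambda>k. h k (\<lambda>i. xs ! i)) [0..<r])"
  have sc: "scalars n (\<lambda>i. xs ! i)" if "xs \<in> ?A" for xs
    using that by (auto simp: scalars_def points_def)
  have fB: "f ` ?A \<subseteq> ?B" using h sc by (auto simp: f_def points_def)
  have fiber: "card {xs \<in> ?A. f xs = b} \<le> card ?C" for b
  proof (cases "{xs \<in> ?A. f xs = b} = {}")
    case True
    show ?thesis unfolding True by simp
  next
    case False
    then obtain ys where ys: "ys \<in> ?A" "f ys = b" by auto
    have "{xs \<in> ?A. f xs = b} \<subseteq> (\<lambda>c. map (\<lambda>i. comb_vec N (\<lambda>j. c ! j) V i \<oplus> ys ! i) [0..<n]) ` ?C"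
    proof
      fix xs assume "xs \<in> {xs \<in> ?A. f xs = b}"
      then have xs: "xs \<in> ?A" "f xs = f ys" using ys by auto
      let ?v = "\<lambda>i. xs ! i \<ominus> ys ! i"
      have v: "scalars n ?v" using sc[OF xs(1)] sc[OF ys(1)] by (auto simp: scalars_def)
      have "h k (\<lambda>i. xs ! i) = h k (\<lambda>i. ys ! i)" if "k < r" for k
        using xs(2) that by (auto simp: f_def dest!: map_eq_conv[THEN iffD1])
      then have "h k ?v = \<zero>" if "k < r" for k using h_diff sc xs ys that by blast
      then have "\<forall>g\<in>\<G>. dot n g ?v = \<zero>" using h_ker v by blast
      then obtain c where c: "scalars N c" "\<forall>i<n. ?v i = comb_vec N c V i"
        using kb v unfolding kernel_basis_def by blast
      let ?cs = "map c [0..<N]"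
      have "comb_vec N (\<lambda>j. ?cs ! j) V i = comb_vec N c V i" for i
        unfolding comb_vec_def by (intro fsum_cong) simp
      moreover have "?v i \<oplus> ys ! i = xs ! i" if "i < n" for i
        using sc[OF xs(1)] sc[OF ys(1)] that by (simp add: scalars_def minus_eq a_assoc l_neg)
      ultimately have "xs = map (\<lambda>i. comb_vec N (\<lambda>j. ?cs ! j) V i \<oplus> ys ! i) [0..<n]"
        using c(2) xs(1) by (intro nth_equalityI) (auto simp: points_def)
      moreover have "?cs \<in> ?C" using c(1) by (auto simp: points_def scalars_def)
      ultimately show "xs \<in> (\<lambda>c. map (\<lambda>i. comb_vec N (\<lambda>j. c ! j) V i \<oplus> ys ! i) [0..<n]) ` ?C"
        by (rule image_eqI)
    qed
    then show ?thesis by (rule surj_card_le[OF finite_points[OF fin]])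
  qed
  have "?q ^ n = card (\<Union>b\<in>?B. {xs \<in> ?A. f xs = b})"
    using fB by (subst card_points[OF fin, symmetric], intro arg_cong[of _ _ card]) auto
  also have "\<dots> \<le> (\<Sum>b\<in>?B. card {xs \<in> ?A. f xs = b})"
    by (rule card_UN_le) (rule finite_points[OF fin])
  also have "\<dots> \<le> (\<Sum>b\<in>?B. card ?C)" by (rule sum_mono) (rule fiber)
  also have "\<dots> = ?q ^ (N + r)" by (simp add: card_points fin power_add)
  finally show ?thesis using q by (simp add: power_increasing_iff)
qed

end

section \<open>Expansion along a subspace\<close>

declare sum_list_eq_0_iff [simp del]

definition exponents :: "nat \<Rightarrow> nat \<Rightarrow> nat list set" where
  "exponents m s = {J. length J = m \<and> sum_list J \<le> s}"

lemma finite_exponents: "finite (exponents m s)"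
proof (rule finite_subset)
  show "exponents m s \<subseteq> {J. set J \<subseteq> {..s} \<and> length J = m}"
    unfolding exponents_def using member_le_sum_list by fastforce
qed (simp add: finite_lists_length_eq)

text \<open>A slack entry in front turns the inequality on the sum into an equation, and stars and
  bars counts its solutions.\<close>

lemma card_exponents: "card (exponents m s) = (m + s) choose s"
proof -
  have "bij_betw (\<lambda>J. (s - sum_list J) # J) (exponents m s) {l. length l = Suc m \<and> sum_list l = s}"
  proof (rule bij_betw_byWitness[where f' = tl])
    show "tl ` {l. length l = Suc m \<and> sum_list l = s} \<subseteq> exponents m s"
    proof clarsimp
      fix l :: "nat list" assume "length l = Suc m"
      then show "tl l \<in> exponents m (sum_list l)" by (cases l) (auto simp: exponents_def)
    qed
    show "\<forall>l\<in>{l. length l = Suc m \<and> sum_list l = s}. (s - sum_list (tl l)) # tl l = l"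
    proof clarsimp
      fix l :: "nat list" assume "length l = Suc m"
      then show "(sum_list l - sum_list (tl l)) # tl l = l" by (cases l) auto
    qed
  qed (auto simp: exponents_def)
  then have "card (exponents m s) = card {l :: nat list. length l = Suc m \<and> sum_list l = s}"
    by (rule bij_betw_same_card)
  also have "\<dots> = (s + Suc m - 1) choose s" by (rule card_length_sum_list)
  finally show ?thesis by (simp add: add.commute)
qed

section \<open>Splitting a polynomial by its degree in the new variables\<close>

context cring begin

definition part :: "nat \<Rightarrow> nat \<Rightarrow> 'a terms \<Rightarrow> 'a terms" where
  "part m k L = filter (\<lambda>a. sum_list (drop m (snd a)) = k) L"

lemma part_simps [simp]:
  "part m k [] = []"
  "part m k (a # L) = (if sum_list (drop m (snd a)) = k then a # part m k L else part m k L)"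
  "part m k (L @ M) = part m k L @ part m k M"
  by (auto simp: part_def)

lemma wf_part: "wf_terms v D L \<Longrightarrow> wf_terms v D (part m k L)"
  unfolding part_def by (rule wf_terms_filter)

lemma part_term_mult:
  assumes "length E = v" "wf_terms v D M"
  shows "part m k (term_mult (c, E) M) =
    (if sum_list (drop m E) \<le> k then term_mult (c, E) (part m (k - sum_list (drop m E)) M) else [])"
  using assms(2)
proof (induction M)
  case (Cons b M)
  obtain c' E' where b: "b = (c', E')" by (cases b)
  have "length E' = v" using Cons b by auto
  then have "sum_list (drop m (exps_add E E')) = sum_list (drop m E) + sum_list (drop m E')"
    using assms(1) by (simp add: drop_exps_add sum_list_exps_add)
  with Cons b show ?case by (auto simp: term_mult_def)
qed (simp add: term_mult_def)

text \<open>The parts of degree 0 and 1 multiply as dual numbers do; the second claim is the Leibniz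
  rule.\<close>

lemma term_eval_part_mult:
  assumes L: "wf_terms v D L" and M: "wf_terms v D' M" and xs: "xs \<in> points (carrier R) v"
  shows "term_eval (part m 0 (terms_mult L M)) xs = term_eval (part m 0 L) xs \<otimes> term_eval (part m 0 M) xs"
    and "term_eval (part m 1 (terms_mult L M)) xs = term_eval (part m 0 L) xs \<otimes> term_eval (part m 1 M) xs
      \<oplus> term_eval (part m 1 L) xs \<otimes> term_eval (part m 0 M) xs"
proof -
  have xs': "set xs \<subseteq> carrier R" using xs by (simp add: points_def)
  have Mc: "term_eval (part m k M) xs \<in> carrier R" for k
    by (rule term_eval_closed[OF wf_part[OF M] xs'])
  note eval_mult = term_eval_term_mult[OF _ _ wf_part[OF M] xs]
  have app: "term_eval (part m k (term_mult a M) @ part m k (terms_mult L M)) xs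
      = term_eval (part m k (term_mult a M)) xs \<oplus> term_eval (part m k (terms_mult L M)) xs"
    if "wf_terms v D (a # L)" for k a and L :: "'a terms"
  proof (rule term_eval_append[OF wf_part wf_part xs'])
    obtain c E where a: "a = (c, E)" by (cases a)
    show "wf_terms v (D + D') (term_mult a M)"
      unfolding a by (rule wf_term_mult[OF _ _ _ M]) (use that a in simp_all)
    show "wf_terms v (D + D') (terms_mult L M)"
      by (rule wf_terms_mult[OF _ M]) (use that a in simp)
  qed
  show "term_eval (part m 0 (terms_mult L M)) xs = term_eval (part m 0 L) xs \<otimes> term_eval (part m 0 M) xs"
    using L
  proof (induction L)
    case Nil then show ?case using Mc by simp
  next
    case (Cons a L)
    obtain c E where a: "a = (c, E)" by (cases a)
    have c: "c \<in> carrier R" "length E = v" "mono E xs \<in> carrier R" "wf_terms v D L"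
      using Cons.prems a xs' by auto
    have Lc: "term_eval (part m k L) xs \<in> carrier R" for k
      by (rule term_eval_closed[OF wf_part[OF c(4)] xs'])
    show ?case
      using app[OF Cons.prems, of 0] Cons.IH[OF c(4)] c Lc Mc unfolding a
      by (simp add: part_term_mult[OF c(2) M] eval_mult l_distr)
  qed
  show "term_eval (part m 1 (terms_mult L M)) xs = term_eval (part m 0 L) xs \<otimes> term_eval (part m 1 M) xs
      \<oplus> term_eval (part m 1 L) xs \<otimes> term_eval (part m 0 M) xs"
    using L
  proof (induction L)
    case Nil then show ?case using Mc by simp
  next
    case (Cons a L)
    obtain c E where a: "a = (c, E)" by (cases a)
    have c: "c \<in> carrier R" "length E = v" "mono E xs \<in> carrier R" "wf_terms v D L"
      using Cons.prems a xs' by auto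
    have Lc: "term_eval (part m k L) xs \<in> carrier R" for k
      by (rule term_eval_closed[OF wf_part[OF c(4)] xs'])
    have cE: "c \<otimes> mono E xs \<in> carrier R" using c by simp
    consider "sum_list (drop m E) = 0" | "sum_list (drop m E) = 1" | "sum_list (drop m E) > 1"
      by linarith
    then show ?case
    proof cases
      case 1
      then show ?thesis
        using app[OF Cons.prems, of 1] Cons.IH[OF c(4)] cE Lc Mc c unfolding a
        by (simp add: part_term_mult[OF c(2) M] eval_mult l_distr a_assoc)
    next
      case 2
      have "term_eval (part m 1 (terms_mult (a # L) M)) xs = (c \<otimes> mono E xs) \<otimes> term_eval (part m 0 M) xs \<oplus>
          (term_eval (part m 0 L) xs \<otimes> term_eval (part m 1 M) xs \<oplus>
           term_eval (part m 1 L) xs \<otimes> term_eval (part m 0 M) xs)"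
        using app[OF Cons.prems, of 1] Cons.IH[OF c(4)] 2 c unfolding a
        by (simp add: part_term_mult[OF c(2) M] eval_mult)
      also have "\<dots> = term_eval (part m 0 L) xs \<otimes> term_eval (part m 1 M) xs \<oplus>
          (c \<otimes> mono E xs \<oplus> term_eval (part m 1 L) xs) \<otimes> term_eval (part m 0 M) xs"
        using cE Lc Mc by (simp add: l_distr a_lcomm del: m_closed) (simp add: a_lcomm cE Lc Mc)
      finally show ?thesis using 2 a by simp
    next
      case 3
      then show ?thesis
        using app[OF Cons.prems, of 1] Cons.IH[OF c(4)] cE Lc Mc c unfolding a
        by (simp add: part_term_mult[OF c(2) M])
    qed
  qed
qed

text \<open>\<open>\<phi>\<close> is a polynomial of degree at most \<open>D\<close> in \<open>m + B\<close> variables, and \<open>\<phi>0\<close>, \<open>\<phi>1\<close> are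
  its parts of degree \<open>0\<close> and \<open>1\<close> in the last \<open>B\<close> variables.\<close>

definition expands :: "nat \<Rightarrow> nat \<Rightarrow> nat \<Rightarrow> ('a list \<Rightarrow> 'a list \<Rightarrow> 'a) \<Rightarrow> ('a list \<Rightarrow> 'a list \<Rightarrow> 'a) \<Rightarrow>
    ('a list \<Rightarrow> 'a list \<Rightarrow> 'a) \<Rightarrow> bool" where
  "expands m B D \<phi> \<phi>0 \<phi>1 \<longleftrightarrow> (\<exists>L. wf_terms (m + B) D L \<and>
     (\<forall>xs\<in>points (carrier R) m. \<forall>zs\<in>points (carrier R) B.
        \<phi> xs zs = term_eval L (xs @ zs) \<and> \<phi>0 xs zs = term_eval (part m 0 L) (xs @ zs) \<and>
        \<phi>1 xs zs = term_eval (part m 1 L) (xs @ zs)))"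

lemma expandsI:
  assumes "wf_terms (m + B) D L"
    "\<And>xs zs. xs \<in> points (carrier R) m \<Longrightarrow> zs \<in> points (carrier R) B \<Longrightarrow>
        \<phi> xs zs = term_eval L (xs @ zs) \<and> \<phi>0 xs zs = term_eval (part m 0 L) (xs @ zs) \<and>
        \<phi>1 xs zs = term_eval (part m 1 L) (xs @ zs)"
  shows "expands m B D \<phi> \<phi>0 \<phi>1"
  using assms unfolding expands_def by blast

lemma expandsE:
  assumes "expands m B D \<phi> \<phi>0 \<phi>1"
  obtains L where "wf_terms (m + B) D L"
    "\<And>xs zs. xs \<in> points (carrier R) m \<Longrightarrow> zs \<in> points (carrier R) B \<Longrightarrow>
        \<phi> xs zs = term_eval L (xs @ zs) \<and> \<phi>0 xs zs = term_eval (part m 0 L) (xs @ zs) \<and>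
        \<phi>1 xs zs = term_eval (part m 1 L) (xs @ zs)"
  using assms unfolding expands_def by blast

lemma expands_mono: "expands m B D \<phi> \<phi>0 \<phi>1 \<Longrightarrow> D \<le> D' \<Longrightarrow> expands m B D' \<phi> \<phi>0 \<phi>1"
  unfolding expands_def using wf_terms_mono by blast

lemma expands_const:
  assumes "c \<in> carrier R" shows "expands m B D (\<lambda>xs zs. c) (\<lambda>xs zs. c) (\<lambda>xs zs. \<zero>)"
proof (rule expandsI)
  show "wf_terms (m + B) D [(c, replicate (m + B) 0)]" using assms by (simp add: sum_list_replicate)
  fix xs zs assume "xs \<in> points (carrier R) m" "zs \<in> points (carrier R) B"
  then have "set (xs @ zs) \<subseteq> carrier R" by (simp add: points_def)
  then show "c = term_eval [(c, replicate (m + B) 0)] (xs @ zs) \<and>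
    c = term_eval (part m 0 [(c, replicate (m + B) 0)]) (xs @ zs) \<and>
    \<zero> = term_eval (part m 1 [(c, replicate (m + B) 0)]) (xs @ zs)"
    using assms by (simp add: mono_zeros sum_list_replicate)
qed

lemma sum_list_unit: "i < v \<Longrightarrow> sum_list ((replicate v 0)[i := 1]) = (1 :: nat)"
  by (induction v arbitrary: i) (auto simp: sum_list_replicate split: nat.split)

lemma expands_fixed_var:
  assumes j: "j < m" shows "expands m B 1 (\<lambda>xs zs. xs ! j) (\<lambda>xs zs. xs ! j) (\<lambda>xs zs. \<zero>)"
proof (rule expandsI)
  let ?E = "(replicate (m + B) 0)[j := 1 :: nat]"
  have s: "sum_list ?E = 1" by (rule sum_list_unit) (use j in simp)
  have d: "drop m ?E = replicate B 0" using j by simp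
  show "wf_terms (m + B) 1 [(\<one>, ?E)]" using s by simp
  fix xs zs assume x: "xs \<in> points (carrier R) m" "zs \<in> points (carrier R) B"
  then have "mono ?E (xs @ zs) = (xs @ zs) ! j"
    using mono_unit[of j "xs @ zs"] j by (simp add: points_def)
  moreover have "xs ! j \<in> carrier R" using nth_points[OF x(1) j] .
  ultimately show "xs ! j = term_eval [(\<one>, ?E)] (xs @ zs) \<and>
    xs ! j = term_eval (part m 0 [(\<one>, ?E)]) (xs @ zs) \<and> \<zero> = term_eval (part m 1 [(\<one>, ?E)]) (xs @ zs)"
    using x j d by (simp add: sum_list_replicate points_def nth_append)
qed

lemma expands_new_var:
  assumes b: "b < B" shows "expands m B 1 (\<lambda>xs zs. zs ! b) (\<lambda>xs zs. \<zero>) (\<lambda>xs zs. zs ! b)"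
proof (rule expandsI)
  let ?E = "(replicate (m + B) 0)[m + b := 1 :: nat]"
  have s: "sum_list ?E = 1" by (rule sum_list_unit) (use b in simp)
  have d: "drop m ?E = (replicate B 0)[b := 1]" by (simp add: drop_update_swap)
  have s': "sum_list (drop m ?E) = 1" unfolding d by (rule sum_list_unit[OF b])
  show "wf_terms (m + B) 1 [(\<one>, ?E)]" using s by simp
  fix xs zs assume x: "xs \<in> points (carrier R) m" "zs \<in> points (carrier R) B"
  then have "mono ?E (xs @ zs) = (xs @ zs) ! (m + b)"
    using mono_unit[of "m + b" "xs @ zs"] b by (simp add: points_def)
  moreover have "zs ! b \<in> carrier R" using nth_points[OF x(2) b] .
  ultimately show "zs ! b = term_eval [(\<one>, ?E)] (xs @ zs) \<and>
    \<zero> = term_eval (part m 0 [(\<one>, ?E)]) (xs @ zs) \<and> zs ! b = term_eval (part m 1 [(\<one>, ?E)]) (xs @ zs)"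
    using x s' by (simp add: points_def nth_append)
qed

lemma expands_add:
  assumes "expands m B D \<phi> \<phi>0 \<phi>1" "expands m B D \<psi> \<psi>0 \<psi>1"
  shows "expands m B D (\<lambda>xs zs. \<phi> xs zs \<oplus> \<psi> xs zs) (\<lambda>xs zs. \<phi>0 xs zs \<oplus> \<psi>0 xs zs)
    (\<lambda>xs zs. \<phi>1 xs zs \<oplus> \<psi>1 xs zs)"
proof -
  obtain L where L: "wf_terms (m + B) D L"
    "\<And>xs zs. xs \<in> points (carrier R) m \<Longrightarrow> zs \<in> points (carrier R) B \<Longrightarrow>
        \<phi> xs zs = term_eval L (xs @ zs) \<and> \<phi>0 xs zs = term_eval (part m 0 L) (xs @ zs) \<and>
        \<phi>1 xs zs = term_eval (part m 1 L) (xs @ zs)" by (rule expandsE[OF assms(1)]) blast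
  obtain M where M: "wf_terms (m + B) D M"
    "\<And>xs zs. xs \<in> points (carrier R) m \<Longrightarrow> zs \<in> points (carrier R) B \<Longrightarrow>
        \<psi> xs zs = term_eval M (xs @ zs) \<and> \<psi>0 xs zs = term_eval (part m 0 M) (xs @ zs) \<and>
        \<psi>1 xs zs = term_eval (part m 1 M) (xs @ zs)" by (rule expandsE[OF assms(2)]) blast
  show ?thesis
  proof (rule expandsI)
    show "wf_terms (m + B) D (L @ M)" using L M by simp
    fix xs zs assume x: "xs \<in> points (carrier R) m" "zs \<in> points (carrier R) B"
    then have "set (xs @ zs) \<subseteq> carrier R" by (simp add: points_def)
    note app = term_eval_append[OF _ _ this]
    show "\<phi> xs zs \<oplus> \<psi> xs zs = term_eval (L @ M) (xs @ zs) \<and>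
      \<phi>0 xs zs \<oplus> \<psi>0 xs zs = term_eval (part m 0 (L @ M)) (xs @ zs) \<and>
      \<phi>1 xs zs \<oplus> \<psi>1 xs zs = term_eval (part m 1 (L @ M)) (xs @ zs)"
      using L(2)[OF x] M(2)[OF x] app[OF L(1) M(1)]
        app[OF wf_part[OF L(1), of m 0] wf_part[OF M(1), of m 0]]
        app[OF wf_part[OF L(1), of m 1] wf_part[OF M(1), of m 1]] by simp
  qed
qed

lemma expands_mult:
  assumes "expands m B D \<phi> \<phi>0 \<phi>1" "expands m B D' \<psi> \<psi>0 \<psi>1"
  shows "expands m B (D + D') (\<lambda>xs zs. \<phi> xs zs \<otimes> \<psi> xs zs) (\<lambda>xs zs. \<phi>0 xs zs \<otimes> \<psi>0 xs zs)
    (\<lambda>xs zs. \<phi>0 xs zs \<otimes> \<psi>1 xs zs \<oplus> \<phi>1 xs zs \<otimes> \<psi>0 xs zs)"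
proof -
  obtain L where L: "wf_terms (m + B) D L"
    "\<And>xs zs. xs \<in> points (carrier R) m \<Longrightarrow> zs \<in> points (carrier R) B \<Longrightarrow>
        \<phi> xs zs = term_eval L (xs @ zs) \<and> \<phi>0 xs zs = term_eval (part m 0 L) (xs @ zs) \<and>
        \<phi>1 xs zs = term_eval (part m 1 L) (xs @ zs)" by (rule expandsE[OF assms(1)]) blast
  obtain M where M: "wf_terms (m + B) D' M"
    "\<And>xs zs. xs \<in> points (carrier R) m \<Longrightarrow> zs \<in> points (carrier R) B \<Longrightarrow>
        \<psi> xs zs = term_eval M (xs @ zs) \<and> \<psi>0 xs zs = term_eval (part m 0 M) (xs @ zs) \<and>
        \<psi>1 xs zs = term_eval (part m 1 M) (xs @ zs)" by (rule expandsE[OF assms(2)]) blast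
  show ?thesis
  proof (rule expandsI)
    show "wf_terms (m + B) (D + D') (terms_mult L M)" using L M by (simp add: wf_terms_mult)
    fix xs zs assume x: "xs \<in> points (carrier R) m" "zs \<in> points (carrier R) B"
    then have xz: "xs @ zs \<in> points (carrier R) (m + B)" by (rule append_points)
    show "\<phi> xs zs \<otimes> \<psi> xs zs = term_eval (terms_mult L M) (xs @ zs) \<and>
      \<phi>0 xs zs \<otimes> \<psi>0 xs zs = term_eval (part m 0 (terms_mult L M)) (xs @ zs) \<and>
      \<phi>0 xs zs \<otimes> \<psi>1 xs zs \<oplus> \<phi>1 xs zs \<otimes> \<psi>0 xs zs = term_eval (part m 1 (terms_mult L M)) (xs @ zs)"
      unfolding term_eval_mult[OF L(1) M(1) xz] term_eval_part_mult[OF L(1) M(1) xz]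
      using L(2)[OF x] M(2)[OF x] by simp
  qed
qed

lemma expands_fsum:
  "(\<And>i. i < K \<Longrightarrow> expands m B D (\<phi> i) (\<phi>0 i) (\<phi>1 i)) \<Longrightarrow>
    expands m B D (\<lambda>xs zs. fsum K (\<lambda>i. \<phi> i xs zs)) (\<lambda>xs zs. fsum K (\<lambda>i. \<phi>0 i xs zs))
      (\<lambda>xs zs. fsum K (\<lambda>i. \<phi>1 i xs zs))"
proof (induction K)
  case 0
  show ?case using expands_const[of \<zero> m B D] by simp
next
  case (Suc K)
  then show ?case by (simp add: expands_add)
qed

text \<open>Of the last variables only the total degree is recorded, not the exponents. A class is
  then homogeneous in them and gives a single polynomial for Chevalley's theorem.\<close>

definition key :: "nat \<Rightarrow> 'a \<times> nat list \<Rightarrow> nat list \<times> nat" where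
  "key m a = (take m (snd a), sum_list (drop m (snd a)))"

definition coeff_terms :: "nat \<Rightarrow> 'a terms \<Rightarrow> nat list \<times> nat \<Rightarrow> 'a terms" where
  "coeff_terms m L \<kappa> = filter (\<lambda>a. key m a = \<kappa>) L"

text \<open>The coefficient, a polynomial in the last \<open>B\<close> variables, of a monomial in the first \<open>m\<close>.\<close>

definition coeff_poly :: "nat \<Rightarrow> 'a terms \<Rightarrow> nat list \<times> nat \<Rightarrow> 'a list \<Rightarrow> 'a" where
  "coeff_poly m L \<kappa> zs = term_eval (coeff_terms m L \<kappa>) (replicate m \<one> @ zs)"

lemma wf_coeff_terms: "wf_terms v D L \<Longrightarrow> wf_terms v D (coeff_terms m L \<kappa>)"
  unfolding coeff_terms_def by (rule wf_terms_filter)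

lemma coeff_poly_closed:
  "wf_terms (m + B) D L \<Longrightarrow> zs \<in> points (carrier R) B \<Longrightarrow> coeff_poly m L \<kappa> zs \<in> carrier R"
  unfolding coeff_poly_def
  by (rule term_eval_closed[OF wf_coeff_terms]) (auto simp: points_def)

text \<open>All terms of a class share the monomial in the first \<open>m\<close> variables, and
  scaling the others by \<open>t\<close> contributes the same power of \<open>t\<close> to each;
  both factors come out of the sum.\<close>

lemma term_eval_coeff_terms:
  assumes L: "wf_terms (m + B) D L" and xs: "xs \<in> points (carrier R) m"
    and zs: "zs \<in> points (carrier R) B" and t: "t \<in> carrier R"
  shows "term_eval (coeff_terms m L \<kappa>) (xs @ map (\<lambda>z. t \<otimes> z) zs)
    = (mono (fst \<kappa>) xs \<otimes> t [^] snd \<kappa>) \<otimes> coeff_poly m L \<kappa> zs"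
  using L
proof (induction L)
  case Nil
  then show ?case using xs t by (simp add: coeff_terms_def coeff_poly_def points_def)
next
  case (Cons a L)
  obtain c E where a: "a = (c, E)" by (cases a)
  let ?J = "take m E" and ?K = "drop m E"
  have c: "c \<in> carrier R" "length E = m + B" "wf_terms (m + B) D L" using Cons.prems a by auto
  note IH = Cons.IH[OF c(3)]
  show ?case
  proof (cases "key m a = \<kappa>")
    case False
    then show ?thesis using IH by (simp add: coeff_terms_def coeff_poly_def)
  next
    case True
    have sets: "set xs \<subseteq> carrier R" "set zs \<subseteq> carrier R" "length xs = m" "length zs = B"
      using xs zs by (auto simp: points_def)
    have zt: "set (map (\<lambda>z. t \<otimes> z) zs) \<subseteq> carrier R" using sets t by auto
    have "mono (?J @ ?K) (xs @ map (\<lambda>z. t \<otimes> z) zs) = mono ?J xs \<otimes> mono ?K (map (\<lambda>z. t \<otimes> z) zs)"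
      by (rule mono_append) (use c sets zt in auto)
    also have "mono ?K (map (\<lambda>z. t \<otimes> z) zs) = t [^] sum_list ?K \<otimes> mono ?K zs"
      by (rule mono_scale) (use c sets t in auto)
    finally have 1: "mono E (xs @ map (\<lambda>z. t \<otimes> z) zs) = mono (fst \<kappa>) xs \<otimes> (t [^] snd \<kappa> \<otimes> mono ?K zs)"
      using True a by (auto simp: key_def)
    have "mono (?J @ ?K) (replicate m \<one> @ zs) = mono ?J (replicate m \<one>) \<otimes> mono ?K zs"
      by (rule mono_append) (use c sets in auto)
    then have 2: "mono E (replicate m \<one> @ zs) = mono ?K zs"
      using sets by (simp add: mono_ones)
    have cl: "mono (fst \<kappa>) xs \<in> carrier R" "t [^] snd \<kappa> \<in> carrier R" "mono ?K zs \<in> carrier R"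
      "coeff_poly m L \<kappa> zs \<in> carrier R"
      using sets t coeff_poly_closed[OF c(3) zs] by auto
    have "coeff_terms m (a # L) \<kappa> = a # coeff_terms m L \<kappa>" using True by (simp add: coeff_terms_def)
    then have "term_eval (coeff_terms m (a # L) \<kappa>) (xs @ map (\<lambda>z. t \<otimes> z) zs)
        = c \<otimes> (mono (fst \<kappa>) xs \<otimes> (t [^] snd \<kappa> \<otimes> mono ?K zs)) \<oplus>
          (mono (fst \<kappa>) xs \<otimes> t [^] snd \<kappa>) \<otimes> coeff_poly m L \<kappa> zs"
      and "coeff_poly m (a # L) \<kappa> zs = c \<otimes> mono ?K zs \<oplus> coeff_poly m L \<kappa> zs"
      by (simp_all add: a 1 2 IH coeff_poly_def)
    then show ?thesis using cl c by (simp add: r_distr m_ac)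
  qed
qed

text \<open>The preceding identity with all first variables equal to \<open>\<one>\<close>. For
  \<open>t = \<zero>\<close> it shows that classes of positive degree vanish at the origin.\<close>

lemma coeff_poly_scale:
  assumes L: "wf_terms (m + B) D L" and zs: "zs \<in> points (carrier R) B" and t: "t \<in> carrier R"
  shows "coeff_poly m L \<kappa> (map (\<lambda>z. t \<otimes> z) zs) = t [^] snd \<kappa> \<otimes> coeff_poly m L \<kappa> zs"
  using term_eval_coeff_terms[OF L _ zs t, of "replicate m \<one>" \<kappa>] coeff_poly_closed[OF L zs] t
  by (simp add: coeff_poly_def[of m L \<kappa> "map (\<lambda>z. t \<otimes> z) zs"] mono_ones points_def subset_iff)

lemma coeff_poly_is_poly:
  assumes L: "wf_terms (m + B) D L"
  shows "is_poly B (snd \<kappa>) (coeff_poly m L \<kappa>)"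
proof -
  let ?M = "map (\<lambda>a. (fst a, drop m (snd a))) (coeff_terms m L \<kappa>)"
  have "wf_terms B (snd \<kappa>) ?M"
    using L by (auto simp: wf_terms_def coeff_terms_def key_def)
  moreover have "coeff_poly m L \<kappa> zs = term_eval ?M zs" if zs: "zs \<in> points (carrier R) B" for zs
  proof -
    have "term_eval N (replicate m \<one> @ zs) = term_eval (map (\<lambda>a. (fst a, drop m (snd a))) N) zs"
      if "wf_terms (m + B) D N" for N :: "'a terms"
      using that
    proof (induction N)
      case (Cons a N)
      obtain c E where a: "a = (c, E)" by (cases a)
      have "length E = m + B" using Cons.prems a by simp
      then have "mono (take m E @ drop m E) (replicate m \<one> @ zs)
          = mono (take m E) (replicate m \<one>) \<otimes> mono (drop m E) zs"
        using zs by (intro mono_append) (auto simp: points_def)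
      then have "mono E (replicate m \<one> @ zs) = mono (drop m E) zs"
        using zs by (simp add: mono_ones points_def)
      with Cons a show ?case by simp
    qed simp
    from this[OF wf_coeff_terms[OF L]] show ?thesis by (simp add: coeff_poly_def)
  qed
  ultimately show ?thesis unfolding is_poly_def by blast
qed

lemma mono_linear:
  assumes "length E = length xs" "length xs = length ys" "set xs \<subseteq> carrier R" "set ys \<subseteq> carrier R"
    "sum_list E = 1"
  shows "mono E (map2 (\<lambda>x y. x \<ominus> y) xs ys) = mono E xs \<ominus> mono E ys"
  using assms
proof (induction E xs ys rule: list_induct3)
  case (Cons k E x xs y ys)
  have c: "x \<in> carrier R" "y \<in> carrier R" "set xs \<subseteq> carrier R" "set ys \<subseteq> carrier R" using Cons by auto
  have c': "set (map2 (\<lambda>x y. x \<ominus> y) xs ys) \<subseteq> carrier R" using c by (auto dest: set_zip_leftD set_zip_rightD)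
  show ?case
  proof (cases "k = 0")
    case True
    then show ?thesis using Cons c c' by simp
  next
    case False
    moreover have "k + sum_list E = 1" using Cons.prems by simp
    ultimately have k: "k = 1" "sum_list E = 0" by linarith+
    then have "E = replicate (length E) 0" by (simp add: replicate_eqI sum_list_eq_0_iff)
    then have "mono E zs = \<one>" if "set zs \<subseteq> carrier R" for zs using mono_zeros[OF that] by metis
    then show ?thesis using k c c' by simp
  qed
qed simp

text \<open>A class of degree 1 is linear. Compatibility with differences is the form in which
  \<open>kernel_basis_card\<close> asks for it.\<close>

lemma coeff_poly_diff:
  assumes L: "wf_terms (m + B) D L" and zs: "zs \<in> points (carrier R) B" and ws: "ws \<in> points (carrier R) B"
    and k: "snd \<kappa> = 1"
  shows "coeff_poly m L \<kappa> (map2 (\<lambda>x y. x \<ominus> y) zs ws) = coeff_poly m L \<kappa> zs \<ominus> coeff_poly m L \<kappa> ws"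
  using L
proof (induction L)
  case Nil
  then show ?case by (simp add: coeff_poly_def coeff_terms_def minus_eq)
next
  case (Cons a L)
  obtain c E where a: "a = (c, E)" by (cases a)
  have c: "c \<in> carrier R" "length E = m + B" "wf_terms (m + B) D L" using Cons.prems a by auto
  note IH = Cons.IH[OF c(3)]
  show ?case
  proof (cases "key m a = \<kappa>")
    case False
    then show ?thesis using IH by (simp add: coeff_terms_def coeff_poly_def)
  next
    case True
    have sets: "set ws \<subseteq> carrier R" "set zs \<subseteq> carrier R" "length ws = B" "length zs = B"
      using ws zs by (auto simp: points_def)
    have zws: "set (map2 (\<lambda>x y. x \<ominus> y) zs ws) \<subseteq> carrier R"
      using sets by (auto dest: set_zip_leftD set_zip_rightD)
    have m: "mono E (replicate m \<one> @ us) = mono (drop m E) us"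
      if "length us = B" "set us \<subseteq> carrier R" for us
    proof -
      have "mono (take m E @ drop m E) (replicate m \<one> @ us)
          = mono (take m E) (replicate m \<one>) \<otimes> mono (drop m E) us"
        using that c by (intro mono_append) auto
      then show ?thesis using that by (simp add: mono_ones)
    qed
    have "mono (drop m E) (map2 (\<lambda>x y. x \<ominus> y) zs ws) = mono (drop m E) zs \<ominus> mono (drop m E) ws"
      by (rule mono_linear) (use sets c True k a in \<open>auto simp: key_def\<close>)
    moreover have "coeff_poly m (a # L) \<kappa> us = c \<otimes> mono (drop m E) us \<oplus> coeff_poly m L \<kappa> us"
      if "length us = B" "set us \<subseteq> carrier R" for us
      using True m[OF that] by (simp add: coeff_terms_def coeff_poly_def a)
    moreover have "coeff_poly m L \<kappa> zs \<in> carrier R" "coeff_poly m L \<kappa> ws \<in> carrier R"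
      "mono (drop m E) zs \<in> carrier R" "mono (drop m E) ws \<in> carrier R"
      using coeff_poly_closed[OF c(3)] zs ws sets by auto
    ultimately show ?thesis
      using IH c sets zws
      by (simp add: minus_eq r_distr r_minus minus_add a_ac)
  qed
qed

text \<open>In a term of degree 1 in the new variables the old ones have degree at most
  \<open>d - 1\<close>. Hence there are as many classes as exponent vectors in
  \<open>exponents m (d - 1)\<close>, and their coefficients serve as the forms
  \<open>h\<close>.\<close>

lemma linear_part_coeffs:
  assumes "expands m B d \<phi> \<phi>0 \<phi>1"
  shows "\<exists>h. (\<forall>k<(m + (d - 1)) choose (d - 1). \<forall>zs\<in>points (carrier R) B. h k zs \<in> carrier R) \<and>
    (\<forall>k<(m + (d - 1)) choose (d - 1). \<forall>zs\<in>points (carrier R) B. \<forall>ws\<in>points (carrier R) B.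
       h k zs = h k ws \<longrightarrow> h k (map2 (\<lambda>x y. x \<ominus> y) zs ws) = \<zero>) \<and>
    (\<forall>zs\<in>points (carrier R) B. (\<forall>k<(m + (d - 1)) choose (d - 1). h k zs = \<zero>) \<longrightarrow>
       (\<forall>xs\<in>points (carrier R) m. \<phi>1 xs zs = \<zero>))"
proof -
  let ?J = "exponents m (d - 1)"
  obtain js where js: "set js = ?J" "distinct js"
    using finite_distinct_list[OF finite_exponents] by blast
  have len: "length js = (m + (d - 1)) choose (d - 1)"
    using distinct_card[OF js(2)] js(1) card_exponents by simp
  obtain L where L: "wf_terms (m + B) d L"
    "\<And>xs zs. xs \<in> points (carrier R) m \<Longrightarrow> zs \<in> points (carrier R) B \<Longrightarrow>
        \<phi>1 xs zs = term_eval (part m 1 L) (xs @ zs)"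
    by (rule expandsE[OF assms]) blast
  let ?L = "part m 1 L"
  have wf: "wf_terms (m + B) d ?L" by (rule wf_part[OF L(1)])
  define h where "h = (\<lambda>k. coeff_poly m ?L (js ! k, 1))"
  have "\<phi>1 xs zs = \<zero>" if zs: "zs \<in> points (carrier R) B" and xs: "xs \<in> points (carrier R) m"
    and h0: "\<forall>k<length js. h k zs = \<zero>" for xs zs
  proof -
    have "term_eval ?L (xs @ zs) = \<zero>"
    proof (rule term_eval_zero_by_keys[OF wf, where key = "key m"])
      show "set (xs @ zs) \<subseteq> carrier R" using xs zs by (simp add: points_def)
      fix a assume a: "a \<in> set ?L"
      then have k1: "snd (key m a) = 1" by (simp add: part_def key_def)
      have "length (snd a) = m + B" "sum_list (snd a) \<le> d" using a wf by (auto simp: wf_terms_def)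
      moreover have "sum_list (take m (snd a)) + sum_list (drop m (snd a)) = sum_list (snd a)"
        by (metis append_take_drop_id sum_list_append)
      ultimately have "fst (key m a) \<in> ?J" using k1 by (auto simp: key_def exponents_def)
      then obtain k where k: "k < length js" "js ! k = fst (key m a)"
        unfolding js(1)[symmetric] by (auto simp: in_set_conv_nth)
      have "coeff_poly m ?L (key m a) zs = \<zero>"
        using h0 k k1 unfolding h_def by (metis prod.collapse)
      moreover have "map (\<lambda>z. \<one> \<otimes> z) zs = zs" using zs by (intro map_idI) (auto simp: points_def)
      ultimately show "term_eval (filter (\<lambda>b. key m b = key m a) ?L) (xs @ zs) = \<zero>"
        using term_eval_coeff_terms[OF wf xs zs one_closed, of "key m a"] xs
        by (simp add: coeff_terms_def points_def)
    qed
    then show ?thesis using L(2)[OF xs zs] by simp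
  qed
  moreover have "h k (map2 (\<lambda>x y. x \<ominus> y) zs ws) = \<zero>"
    if "zs \<in> points (carrier R) B" "ws \<in> points (carrier R) B" "h k zs = h k ws" for k zs ws
    using coeff_poly_diff[OF wf that(1,2), of "(js ! k, 1)"] that(3) coeff_poly_closed[OF wf that(2)]
    by (simp add: h_def r_neg minus_eq)
  ultimately show ?thesis
    unfolding len[symmetric] using coeff_poly_closed[OF wf]
    by (intro exI[of _ h]) (auto simp: h_def)
qed

end

context field begin

text \<open>Chevalley's theorem is applied to the classes of degree at least 2 in the new variables.
  They are homogeneous, so their vanishing at \<open>zs\<close> extends to all its
  multiples.\<close>

lemma exists_direction:
  assumes fin: "finite (carrier R)" and exp: "expands m B d \<phi> \<phi>0 \<phi>1"
    and deg: "(\<Sum>j=2..d. j * ((m + (d - j)) choose (d - j))) < B"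
  shows "\<exists>zs\<in>points (carrier R) B. zs \<noteq> replicate B \<zero> \<and>
    (\<forall>xs\<in>points (carrier R) m. \<forall>t\<in>carrier R.
      \<phi> xs (map (\<lambda>z. t \<otimes> z) zs) = \<phi>0 xs (map (\<lambda>z. t \<otimes> z) zs) \<oplus> \<phi>1 xs (map (\<lambda>z. t \<otimes> z) zs))"
proof -
  obtain L where L: "wf_terms (m + B) d L"
    "\<And>xs zs. xs \<in> points (carrier R) m \<Longrightarrow> zs \<in> points (carrier R) B \<Longrightarrow>
        \<phi> xs zs = term_eval L (xs @ zs) \<and> \<phi>0 xs zs = term_eval (part m 0 L) (xs @ zs) \<and>
        \<phi>1 xs zs = term_eval (part m 1 L) (xs @ zs)" by (rule expandsE[OF exp]) blast
  \<comment> \<open>What remains after removing degrees 0 and 1; the nested filters match two uses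
    of \<open>term_eval_partition\<close>.\<close>
  define N where "N = filter (\<lambda>a. \<not> sum_list (drop m (snd a)) = 1) (filter (\<lambda>a. \<not> sum_list (drop m (snd a)) = 0) L)"
  have wfN: "wf_terms (m + B) d N" unfolding N_def by (intro wf_terms_filter L(1))
  have split: "term_eval L us = term_eval (part m 0 L) us \<oplus> (term_eval (part m 1 L) us \<oplus> term_eval N us)"
    if us: "set us \<subseteq> carrier R" for us
  proof -
    have "filter (\<lambda>a. sum_list (drop m (snd a)) = 1) (filter (\<lambda>a. \<not> sum_list (drop m (snd a)) = 0) L)
        = part m 1 L"
      unfolding part_def filter_filter by (rule filter_cong[OF refl]) arith
    then show ?thesis
      using term_eval_partition[OF L(1) us, of "\<lambda>a. sum_list (drop m (snd a)) = 0"]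
        term_eval_partition[OF wf_terms_filter[OF L(1)] us, of "\<lambda>a. \<not> sum_list (drop m (snd a)) = 0"
          "\<lambda>a. sum_list (drop m (snd a)) = 1"]
      by (simp add: N_def part_def)
  qed
  \<comment> \<open>All possible keys: degree \<open>j\<close> in the new variables leaves at most
    \<open>d - j\<close> for the old ones.\<close>
  define \<K> where "\<K> = (\<Union>j\<in>{2..d}. (\<lambda>J. (J, j)) ` exponents m (d - j))"
  have finK: "finite \<K>" unfolding \<K>_def by (auto intro: finite_exponents)
  obtain ks where ks: "set ks = \<K>" "distinct ks" using finite_distinct_list[OF finK] by blast
  define Ps where "Ps = map (\<lambda>\<kappa>. (snd \<kappa>, coeff_poly m N \<kappa>)) ks"
  have "sum_list (map fst Ps) = (\<Sum>\<kappa>\<in>\<K>. snd \<kappa>)"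
    using ks by (simp add: Ps_def comp_def sum_list_distinct_conv_sum_set)
  also have "\<dots> = (\<Sum>j=2..d. \<Sum>\<kappa>\<in>(\<lambda>J. (J, j)) ` exponents m (d - j). snd \<kappa>)"
    unfolding \<K>_def by (rule sum.UNION_disjoint) (auto intro: finite_exponents)
  also have "\<dots> = (\<Sum>j=2..d. j * ((m + (d - j)) choose (d - j)))"
  proof (rule sum.cong)
    fix j
    have "(\<Sum>\<kappa>\<in>(\<lambda>J. (J, j)) ` exponents m (d - j). snd \<kappa>) = (\<Sum>J\<in>exponents m (d - j). j)"
      by (subst sum.reindex) (auto simp: inj_on_def)
    then show "(\<Sum>\<kappa>\<in>(\<lambda>J. (J, j)) ` exponents m (d - j). snd \<kappa>) = j * ((m + (d - j)) choose (d - j))"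
      by (simp add: card_exponents)
  qed simp
  finally have degPs: "sum_list (map fst Ps) < B" using deg by simp
  have "\<exists>zs\<in>points (carrier R) B. zs \<noteq> replicate B \<zero> \<and> (\<forall>(D, g)\<in>set Ps. g zs = \<zero>)"
  proof (rule chevalley[OF fin _ _ degPs])
    fix D g assume "(D, g) \<in> set Ps"
    then obtain \<kappa> where \<kappa>: "\<kappa> \<in> \<K>" "D = snd \<kappa>" "g = coeff_poly m N \<kappa>"
      using ks(1) by (auto simp: Ps_def)
    show "is_poly B D g" using coeff_poly_is_poly[OF wfN] \<kappa> by simp
    have rep: "replicate B \<zero> \<in> points (carrier R) B" by (simp add: points_def subset_iff)
    \<comment> \<open>Homogeneity with the scalar \<open>\<zero>\<close> gives the zero at the
      origin that Chevalley's theorem presupposes.\<close>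
    have "map (\<lambda>z. \<zero> \<otimes> z) (replicate B \<zero>) = replicate B \<zero>" by (simp add: map_replicate)
    then have "coeff_poly m N \<kappa> (replicate B \<zero>) = \<zero> [^] snd \<kappa> \<otimes> coeff_poly m N \<kappa> (replicate B \<zero>)"
      using coeff_poly_scale[OF wfN rep zero_closed, of \<kappa>] by simp
    moreover have "0 < snd \<kappa>" using \<kappa>(1) by (auto simp: \<K>_def)
    ultimately show "g (replicate B \<zero>) = \<zero>"
      using coeff_poly_closed[OF wfN rep, of \<kappa>] \<kappa>(3) by (simp add: nat_pow_zero)
  qed
  then obtain zs where zs: "zs \<in> points (carrier R) B" "zs \<noteq> replicate B \<zero>"
    "\<And>\<kappa>. \<kappa> \<in> \<K> \<Longrightarrow> coeff_poly m N \<kappa> zs = \<zero>"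
    using ks(1) by (fastforce simp: Ps_def)
  have "\<phi> xs (map (\<lambda>z. t \<otimes> z) zs) = \<phi>0 xs (map (\<lambda>z. t \<otimes> z) zs) \<oplus> \<phi>1 xs (map (\<lambda>z. t \<otimes> z) zs)"
    if xs: "xs \<in> points (carrier R) m" and t: "t \<in> carrier R" for xs t
  proof -
    let ?z = "map (\<lambda>z. t \<otimes> z) zs"
    have z: "?z \<in> points (carrier R) B" using zs(1) t by (auto simp: points_def)
    have us: "set (xs @ ?z) \<subseteq> carrier R" using xs z by (simp add: points_def)
    have "term_eval N (xs @ ?z) = \<zero>"
    proof (rule term_eval_zero_by_keys[OF wfN us, where key = "key m"])
      fix a assume a: "a \<in> set N"
      let ?j = "sum_list (drop m (snd a))"
      have "?j \<noteq> 0" "?j \<noteq> 1" using a by (simp_all add: N_def)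
      then have j: "2 \<le> ?j" by linarith
      have "length (snd a) = m + B" "sum_list (snd a) \<le> d" using a wfN by (auto simp: wf_terms_def)
      moreover have "sum_list (take m (snd a)) + ?j = sum_list (snd a)"
        by (metis append_take_drop_id sum_list_append)
      ultimately have "take m (snd a) \<in> exponents m (d - ?j)" "?j \<in> {2..d}"
        using j by (auto simp: exponents_def)
      then have "key m a \<in> \<K>" unfolding \<K>_def key_def by blast
      then show "term_eval (filter (\<lambda>b. key m b = key m a) N) (xs @ ?z) = \<zero>"
        using term_eval_coeff_terms[OF wfN xs zs(1) t, of "key m a"] zs(3) xs t
        by (simp add: coeff_terms_def points_def)
    qed
    then show ?thesis
      using L(2)[OF xs z] split[OF us] term_eval_closed[OF wf_part[OF L(1)] us] by simp
  qed
  with zs show ?thesis by blast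
qed

end

section \<open>Values and directional derivatives\<close>

context cring begin

text \<open>Multiplication of a dual number by \<open>x i + \<epsilon> w i\<close>. Powers are
  iterated steps, as in the loops of the program.\<close>

definition dual_step :: "(nat \<Rightarrow> 'a) \<Rightarrow> (nat \<Rightarrow> 'a) \<Rightarrow> nat \<Rightarrow> 'a \<times> 'a \<Rightarrow> 'a \<times> 'a" where
  "dual_step x w i vd = (fst vd \<otimes> x i, snd vd \<otimes> x i \<oplus> fst vd \<otimes> w i)"

lemma fst_dual_step: "fst (dual_step x w i v) = fst v \<otimes> x i"
  and snd_dual_step: "snd (dual_step x w i v) = snd v \<otimes> x i \<oplus> fst v \<otimes> w i"
  by (simp_all add: dual_step_def)

text \<open>Evaluation at \<open>x + \<epsilon> w\<close> with \<open>\<epsilon>\<^sup>2 = 0\<close>.\<close>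

primrec dual_mono :: "(nat \<Rightarrow> 'a) \<Rightarrow> (nat \<Rightarrow> 'a) \<Rightarrow> 'a \<times> nat list \<Rightarrow> nat \<Rightarrow> 'a \<times> 'a" where
  "dual_mono x w a 0 = (fst a, \<zero>)"
| "dual_mono x w a (Suc k) = (dual_step x w k ^^ (snd a ! k)) (dual_mono x w a k)"

definition dual_poly :: "(nat \<Rightarrow> 'a) \<Rightarrow> (nat \<Rightarrow> 'a) \<Rightarrow> nat \<Rightarrow> 'a terms \<Rightarrow> nat \<Rightarrow> 'a \<times> 'a" where
  "dual_poly x w n f t =
     (fsum t (\<lambda>i. fst (dual_mono x w (f ! i) n)), fsum t (\<lambda>i. snd (dual_mono x w (f ! i) n)))"

lemma dual_pow_closed:
  assumes "x i \<in> carrier R" "w i \<in> carrier R" "fst v \<in> carrier R" "snd v \<in> carrier R"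
  shows "fst ((dual_step x w i ^^ k) v) \<in> carrier R" "snd ((dual_step x w i ^^ k) v) \<in> carrier R"
  by (induction k) (auto simp: dual_step_def assms)

lemma dual_mono_closed:
  assumes "\<And>i. i < k \<Longrightarrow> x i \<in> carrier R" "\<And>i. i < k \<Longrightarrow> w i \<in> carrier R" "fst a \<in> carrier R"
  shows "fst (dual_mono x w a k) \<in> carrier R" "snd (dual_mono x w a k) \<in> carrier R"
  using assms by (induction k) (auto intro!: dual_pow_closed)

lemma fst_dual_pow: "fst v = fst v' \<Longrightarrow> fst ((dual_step x w i ^^ k) v) = fst ((dual_step x w' i ^^ k) v')"
  by (induction k) (auto simp: dual_step_def)

lemma fst_dual_mono: "fst (dual_mono x w a k) = fst (dual_mono x w' a k)"
  by (induction k) (auto intro: fst_dual_pow)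

lemma fst_dual_mono_eq:
  assumes "\<And>i. i < k \<Longrightarrow> x i \<in> carrier R" "fst a \<in> carrier R"
  shows "fst (dual_mono x w a k) = fst a \<otimes> (\<Otimes>i\<in>{..<k}. x i [^] (snd a ! i))"
  using assms
proof (induction k)
  case (Suc k)
  let ?P = "\<Otimes>i\<in>{..<k}. x i [^] (snd a ! i)"
  have c: "?P \<in> carrier R" "x k \<in> carrier R" using Suc.prems by (auto intro!: finprod_closed)
  have pow: "fst ((dual_step x w k ^^ j) v) = fst v \<otimes> x k [^] j" if "fst v \<in> carrier R" for j v
    by (induction j) (use that c in \<open>auto simp: dual_step_def m_assoc\<close>)
  have "(\<Otimes>i\<in>insert k {..<k}. x i [^] (snd a ! i)) = x k [^] (snd a ! k) \<otimes> ?P"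
    using Suc.prems by (intro finprod_insert) auto
  then have "(\<Otimes>i\<in>{..<Suc k}. x i [^] (snd a ! i)) = ?P \<otimes> x k [^] (snd a ! k)"
    using c by (simp add: lessThan_Suc m_comm)
  with Suc c show ?case by (simp add: pow m_assoc)
qed simp

text \<open>At a point whose parts of degree 0 and 1 are \<open>x\<close> and \<open>w\<close>, the
  monomial has as its own such parts the two components of the dual number. Both sides obey the same
  Leibniz rule, factor by factor.\<close>

lemma expands_dual_mono:
  assumes "\<And>i. i < k \<Longrightarrow> expands m B 1 (\<lambda>xs zs. y xs zs i) (\<lambda>xs zs. x xs zs i) (\<lambda>xs zs. w xs zs i)"
    and "fst a \<in> carrier R" "k \<le> length (snd a)"
  shows "expands m B (sum_list (take k (snd a))) (\<lambda>xs zs. fst (dual_mono (y xs zs) (w xs zs) a k))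
    (\<lambda>xs zs. fst (dual_mono (x xs zs) (w xs zs) a k)) (\<lambda>xs zs. snd (dual_mono (x xs zs) (w xs zs) a k))"
  using assms
proof (induction k)
  case 0
  then show ?case using expands_const[of "fst a" m B 0] by simp
next
  case (Suc k)
  have base: "expands m B (sum_list (take k (snd a))) (\<lambda>xs zs. fst (dual_mono (y xs zs) (w xs zs) a k))
    (\<lambda>xs zs. fst (dual_mono (x xs zs) (w xs zs) a k)) (\<lambda>xs zs. snd (dual_mono (x xs zs) (w xs zs) a k))"
    using Suc by simp
  have e2: "expands m B 1 (\<lambda>xs zs. y xs zs k) (\<lambda>xs zs. x xs zs k) (\<lambda>xs zs. w xs zs k)"
    using Suc.prems(1)[of k] by simp
  have "expands m B (sum_list (take k (snd a)) + j)
    (\<lambda>xs zs. fst ((dual_step (y xs zs) (w xs zs) k ^^ j) (dual_mono (y xs zs) (w xs zs) a k)))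
    (\<lambda>xs zs. fst ((dual_step (x xs zs) (w xs zs) k ^^ j) (dual_mono (x xs zs) (w xs zs) a k)))
    (\<lambda>xs zs. snd ((dual_step (x xs zs) (w xs zs) k ^^ j) (dual_mono (x xs zs) (w xs zs) a k)))" for j
  proof (induction j)
    case 0
    then show ?case using base by simp
  next
    case (Suc j)
    note e1 = Suc
    let ?v = "\<lambda>xs zs. (dual_step (x xs zs) (w xs zs) k ^^ j) (dual_mono (x xs zs) (w xs zs) a k)"
    obtain L where L: "wf_terms (m + B) (sum_list (take k (snd a)) + j) L"
      "\<And>xs zs. xs \<in> points (carrier R) m \<Longrightarrow> zs \<in> points (carrier R) B \<Longrightarrow>
          fst (?v xs zs) = term_eval (part m 0 L) (xs @ zs) \<and> snd (?v xs zs) = term_eval (part m 1 L) (xs @ zs)"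
      by (rule expandsE[OF e1]) blast
    obtain M where M: "wf_terms (m + B) 1 M"
      "\<And>xs zs. xs \<in> points (carrier R) m \<Longrightarrow> zs \<in> points (carrier R) B \<Longrightarrow>
          x xs zs k = term_eval (part m 0 M) (xs @ zs) \<and> w xs zs k = term_eval (part m 1 M) (xs @ zs)"
      by (rule expandsE[OF e2]) blast
    \<comment> \<open>\<open>expands_mult\<close> and \<open>dual_step\<close> list the two Leibniz
      summands in opposite order, and they commute only at points of the carrier.\<close>
    have comm: "snd (?v xs zs) \<otimes> x xs zs k \<oplus> fst (?v xs zs) \<otimes> w xs zs k
        = fst (?v xs zs) \<otimes> w xs zs k \<oplus> snd (?v xs zs) \<otimes> x xs zs k"
      if "xs \<in> points (carrier R) m" "zs \<in> points (carrier R) B" for xs zs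
    proof -
      have "set (xs @ zs) \<subseteq> carrier R" using that by (simp add: points_def)
      then show ?thesis
        using L(2)[OF that] M(2)[OF that] term_eval_closed[OF wf_part[OF L(1)]] term_eval_closed[OF wf_part[OF M(1)]]
        by (simp add: a_comm)
    qed
    obtain N where N: "wf_terms (m + B) (sum_list (take k (snd a)) + j + 1) N"
      "\<And>xs zs. xs \<in> points (carrier R) m \<Longrightarrow> zs \<in> points (carrier R) B \<Longrightarrow>
        fst ((dual_step (y xs zs) (w xs zs) k ^^ j) (dual_mono (y xs zs) (w xs zs) a k)) \<otimes> y xs zs k = term_eval N (xs @ zs) \<and>
        fst (?v xs zs) \<otimes> x xs zs k = term_eval (part m 0 N) (xs @ zs) \<and>
        fst (?v xs zs) \<otimes> w xs zs k \<oplus> snd (?v xs zs) \<otimes> x xs zs k = term_eval (part m 1 N) (xs @ zs)"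
      by (rule expandsE[OF expands_mult[OF e1 e2]]) blast
    show ?case
      by (rule expandsI[of _ _ _ N]) (use N comm in \<open>auto simp: fst_dual_step snd_dual_step\<close>)
  qed
  from this[of "snd a ! k"] show ?case
    using Suc.prems by (simp add: take_Suc_conv_app_nth)
qed

lemma expands_dual_poly:
  assumes "\<And>i. i < n \<Longrightarrow> expands m B 1 (\<lambda>xs zs. y xs zs i) (\<lambda>xs zs. x xs zs i) (\<lambda>xs zs. w xs zs i)"
    and "wf_terms n d f"
  shows "expands m B d (\<lambda>xs zs. fst (dual_poly (y xs zs) (w xs zs) n f (length f)))
    (\<lambda>xs zs. fst (dual_poly (x xs zs) (w xs zs) n f (length f)))
    (\<lambda>xs zs. snd (dual_poly (x xs zs) (w xs zs) n f (length f)))"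
proof -
  have a: "fst a \<in> carrier R" "length (snd a) = n" "sum_list (snd a) \<le> d" if "a \<in> set f" for a
    using assms(2) that by (auto simp: wf_terms_def)
  show ?thesis
    unfolding dual_poly_def fst_conv snd_conv
  proof (rule expands_fsum)
    fix i assume "i < length f"
    then have "f ! i \<in> set f" by simp
    from a[OF this] show "expands m B d (\<lambda>xs zs. fst (dual_mono (y xs zs) (w xs zs) (f ! i) n))
      (\<lambda>xs zs. fst (dual_mono (x xs zs) (w xs zs) (f ! i) n)) (\<lambda>xs zs. snd (dual_mono (x xs zs) (w xs zs) (f ! i) n))"
      using expands_mono[OF expands_dual_mono[of n m B y x w "f ! i"]] assms(1) by simp
  qed
qed

abbreviation unit_vec :: "nat \<Rightarrow> nat \<Rightarrow> 'a" where
  "unit_vec c i \<equiv> (if i = c then \<one> else \<zero>)"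

text \<open>Linearity of the derivative in the direction: it allows the partial derivatives to be
  computed one by one and recombined.\<close>

lemma snd_dual_mono:
  assumes x: "\<And>i. i < n \<Longrightarrow> x i \<in> carrier R" and w: "\<And>i. i < n \<Longrightarrow> w i \<in> carrier R"
    and a: "fst a \<in> carrier R" and k: "k \<le> n"
  shows "snd (dual_mono x w a k) = fsum n (\<lambda>c. snd (dual_mono x (unit_vec c) a k) \<otimes> w c)"
  using k
proof (induction k)
  case 0
  show ?case by (simp, rule fsum_zero[symmetric]) (use w in auto)
next
  case (Suc k)
  have "snd ((dual_step x w k ^^ j) (dual_mono x w a k))
      = fsum n (\<lambda>c. snd ((dual_step x (unit_vec c) k ^^ j) (dual_mono x (unit_vec c) a k)) \<otimes> w c)" for j
  proof (induction j)
    case 0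
    then show ?case using Suc by simp
  next
    case (Suc j)
    let ?s = "\<lambda>c. snd ((dual_step x (unit_vec c) k ^^ j) (dual_mono x (unit_vec c) a k))"
    let ?v = "fst ((dual_step x w k ^^ j) (dual_mono x w a k))"
    have k: "k < n" using \<open>Suc k \<le> n\<close> by simp
    have v: "fst ((dual_step x (unit_vec c) k ^^ j) (dual_mono x (unit_vec c) a k)) = ?v" for c
      by (rule fst_dual_pow) (rule fst_dual_mono)
    have vc: "?v \<in> carrier R" using x w a k by (intro dual_pow_closed dual_mono_closed) auto
    have sc: "?s c \<in> carrier R" for c
      using x w a k by (intro dual_pow_closed dual_mono_closed) auto
    have distr: "(a \<otimes> b \<oplus> e) \<otimes> u = (a \<otimes> u) \<otimes> b \<oplus> e \<otimes> u"
      if "a \<in> carrier R" "b \<in> carrier R" "e \<in> carrier R" "u \<in> carrier R" for a b e u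
      using that by (simp add: l_distr) (simp add: m_ac)
    have "fsum n (\<lambda>c. (?s c \<otimes> x k \<oplus> ?v \<otimes> unit_vec c k) \<otimes> w c)
        = fsum n (\<lambda>c. (?s c \<otimes> w c) \<otimes> x k \<oplus> (?v \<otimes> unit_vec c k) \<otimes> w c)"
      by (intro fsum_cong distr) (use sc x w vc k in auto)
    also have "\<dots> = fsum n (\<lambda>c. (?s c \<otimes> w c) \<otimes> x k) \<oplus> fsum n (\<lambda>c. (?v \<otimes> unit_vec c k) \<otimes> w c)"
      by (rule fsum_add) (use sc x w vc k in auto)
    also have "fsum n (\<lambda>c. (?s c \<otimes> w c) \<otimes> x k) = fsum n (\<lambda>c. ?s c \<otimes> w c) \<otimes> x k"
      by (rule fsum_smult_right[symmetric]) (use sc x w k in auto)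
    also have "fsum n (\<lambda>c. (?v \<otimes> unit_vec c k) \<otimes> w c) = (?v \<otimes> unit_vec k k) \<otimes> w k"
      by (rule fsum_single) (use vc w k in auto)
    finally show ?case
      using Suc v vc by (simp add: fst_dual_step snd_dual_step)
  qed
  then show ?case by simp
qed

lemma wf_terms_nth:
  assumes "wf_terms v d f" "i < length f" shows "fst (f ! i) \<in> carrier R"
  using bspec[OF assms(1)[unfolded wf_terms_def] nth_mem[OF assms(2)]]
  by (simp add: case_prod_unfold)

lemma snd_dual_poly:
  assumes x: "\<And>i. i < n \<Longrightarrow> x i \<in> carrier R" and w: "\<And>i. i < n \<Longrightarrow> w i \<in> carrier R"
    and f: "wf_terms n d f" and t: "t \<le> length f"
  shows "snd (dual_poly x w n f t) = fsum n (\<lambda>c. snd (dual_poly x (unit_vec c) n f t) \<otimes> w c)"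
proof -
  have a: "fst (f ! i) \<in> carrier R" if "i < t" for i
    using wf_terms_nth[OF f] t that by simp
  have s: "snd (dual_mono x (unit_vec c) (f ! i) n) \<in> carrier R" if "i < t" for i c
    using x a[OF that] by (intro dual_mono_closed) auto
  have "snd (dual_poly x w n f t) = fsum t (\<lambda>i. fsum n (\<lambda>c. snd (dual_mono x (unit_vec c) (f ! i) n) \<otimes> w c))"
    unfolding dual_poly_def snd_conv
    by (intro fsum_cong snd_dual_mono) (use x w a in auto)
  also have "\<dots> = fsum n (\<lambda>c. fsum t (\<lambda>i. snd (dual_mono x (unit_vec c) (f ! i) n) \<otimes> w c))"
    by (rule fsum_swap) (use s w in auto)
  also have "\<dots> = fsum n (\<lambda>c. snd (dual_poly x (unit_vec c) n f t) \<otimes> w c)"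
    unfolding dual_poly_def snd_conv
    by (intro fsum_cong fsum_smult_right[symmetric]) (use s w in auto)
  finally show ?thesis .
qed

lemma dual_poly_closed:
  assumes "\<And>i. i < n \<Longrightarrow> x i \<in> carrier R" "\<And>i. i < n \<Longrightarrow> w i \<in> carrier R" "wf_terms n d f" "t \<le> length f"
  shows "fst (dual_poly x w n f t) \<in> carrier R" "snd (dual_poly x w n f t) \<in> carrier R"
proof -
  have a: "fst (f ! i) \<in> carrier R" if "i < t" for i
    using wf_terms_nth[OF assms(3)] assms(4) that by simp
  show "fst (dual_poly x w n f t) \<in> carrier R" "snd (dual_poly x w n f t) \<in> carrier R"
    unfolding dual_poly_def using assms a by (auto intro!: fsum_closed dual_mono_closed)
qed

end

section \<open>Affine subspaces over a coded field\<close>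

context coded begin

lemma vectorspace_affine: "vectorspace F (affine_space F n)"
  by (intro vectorspace.intro func_space_is_module field_axioms)

lemma abelian_group_affine: "abelian_group (affine_space F n)"
  by (rule module.axioms(2)[OF func_space_is_module])

lemma carrier_affine: "carrier (affine_space F n) = {..<n} \<rightarrow>\<^sub>E carrier F"
  by (simp add: func_space_def)

lemma add_affine: "x \<oplus>\<^bsub>affine_space F n\<^esub> y = (\<lambda>i\<in>{..<n}. x i \<oplus> y i)"
  by (simp add: func_space_def)

lemma smult_affine: "c \<odot>\<^bsub>affine_space F n\<^esub> x = (\<lambda>i\<in>{..<n}. c \<otimes> x i)"
  by (simp add: func_space_def)

lemma zero_affine: "\<zero>\<^bsub>affine_space F n\<^esub> = (\<lambda>i\<in>{..<n}. \<zero>)"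
  by (simp add: func_space_def)

lemma coset_affine: "u <+\<^bsub>affine_space F n\<^esub> U = (\<lambda>v. \<lambda>i\<in>{..<n}. u i \<oplus> v i) ` U"
  by (auto simp: a_l_coset_def l_coset_def func_space_def)

lemma finite_affine: "finite (carrier (affine_space F n))"
  unfolding carrier_affine by (intro finite_PiE) (auto simp: finite_carr)

lemma card_affine: "card (carrier (affine_space F n)) = q ^ n"
  unfolding carrier_affine by (simp add: card_PiE card_carr)

lemma lincomb_affine:
  assumes "finite A" "A \<subseteq> carrier (affine_space F n)" "a \<in> A \<rightarrow> carrier F" "i < n"
  shows "module.lincomb (affine_space F n) a A i = (\<Oplus>v\<in>A. a v \<otimes> v i)"
proof -
  interpret V: vectorspace F "affine_space F n" by (rule vectorspace_affine)
  show ?thesis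
    using assms(1-3)
  proof (induction A rule: finite_induct)
    case empty
    then show ?case using assms(4) by (simp add: V.lincomb_def zero_affine)
  next
    case (insert v A)
    have vi: "w i \<in> carrier F" if "w \<in> insert v A" for w
      using insert.prems(1) that assms(4) by (auto simp: carrier_affine PiE_iff)
    have "V.lincomb a (insert v A) = a v \<odot>\<^bsub>affine_space F n\<^esub> v \<oplus>\<^bsub>affine_space F n\<^esub> V.lincomb a A"
    proof -
      have "A \<union> {v} = insert v A" by simp
      moreover have "V.lincomb a (A \<union> {v}) = a v \<odot>\<^bsub>affine_space F n\<^esub> v \<oplus>\<^bsub>affine_space F n\<^esub> V.lincomb a A"
        by (rule V.lincomb_insert) (use insert in auto)
      ultimately show ?thesis by simp
    qed
    then have "V.lincomb a (insert v A) i = a v \<otimes> v i \<oplus> (\<Oplus>w\<in>A. a w \<otimes> w i)"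
      using insert assms(4) by (simp add: add_affine smult_affine)
    also have "\<dots> = (\<Oplus>w\<in>insert v A. a w \<otimes> w i)"
      by (rule finsum_insert[symmetric]) (use insert vi in auto)
    finally show ?case .
  qed
qed

lemma span_of_indep:
  assumes B: "finite B" "B \<subseteq> carrier (affine_space F n)"
    and li: "\<not> module.lin_dep F (affine_space F n) B"
  shows "VectorSpace.subspace F (module.span F (affine_space F n) B) (affine_space F n)"
    and "vectorspace.basis F ((affine_space F n)\<lparr>carrier := module.span F (affine_space F n) B\<rparr>) B"
    and "dim_of F n (module.span F (affine_space F n) B) = card B"
proof -
  interpret V: vectorspace F "affine_space F n" by (rule vectorspace_affine)
  show sub: "VectorSpace.subspace F (V.span B) (affine_space F n)"
    by (rule V.span_is_subspace[OF B(2)])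
  then have subm: "submodule F (V.span B) (affine_space F n)" by (rule V.is_module)
  have BU: "B \<subseteq> V.span B" by (rule V.in_own_span[OF B(2)])
  interpret W: vectorspace F "(affine_space F n)\<lparr>carrier := V.span B\<rparr>"
    by (rule V.subspace_is_vs[OF sub])
  show basis: "W.basis B"
    unfolding W.basis_def using V.span_li_not_depend[OF BU subm] li BU by simp
  show "W.dim = card B" by (rule W.dim_basis[OF B(1) basis])
qed

lemma subspace_basis:
  assumes U: "VectorSpace.subspace F U (affine_space F n)"
  obtains B where "finite B" "B \<subseteq> carrier (affine_space F n)" "card B = dim_of F n U"
    "\<not> module.lin_dep F (affine_space F n) B" "module.span F (affine_space F n) B = U"
proof -
  interpret V: vectorspace F "affine_space F n" by (rule vectorspace_affine)
  have subm: "submodule F U (affine_space F n)" by (rule V.is_module[OF U])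
  have UV: "U \<subseteq> carrier (affine_space F n)"
    by (rule LinearCombinations.submodule.subset[OF subm])
  interpret W: vectorspace F "(affine_space F n)\<lparr>carrier := U\<rparr>"
    by (rule V.subspace_is_vs[OF U])
  have finU: "finite U" by (rule finite_subset[OF UV finite_affine])
  have "W.fin_dim"
    unfolding W.fin_dim_def
  proof (intro exI conjI)
    show "finite U" by (fact finU)
    show "U \<subseteq> carrier ((affine_space F n)\<lparr>carrier := U\<rparr>)" by simp
    show "W.gen_set U"
      using W.in_own_span[of U] W.span_is_subset2[of U] by auto
  qed
  then obtain B where B: "finite B" "W.basis B" using W.finite_basis_exists by blast
  have BU: "B \<subseteq> U" using B(2) by (simp add: W.basis_def)
  show ?thesis
  proof (rule that)
    show "finite B" by (fact B)
    show "B \<subseteq> carrier (affine_space F n)" using BU UV by simp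
    show "card B = W.dim" by (rule W.dim_basis[OF B, symmetric])
    show "\<not> V.lin_dep B" "V.span B = U"
      using B(2) V.span_li_not_depend[OF BU subm] by (auto simp: W.basis_def)
  qed
qed

lemma card_span_ge:
  assumes B: "finite B" "B \<subseteq> carrier (affine_space F n)"
    and li: "\<not> module.lin_dep F (affine_space F n) B"
  shows "q ^ card B \<le> card (module.span F (affine_space F n) B)"
proof -
  interpret V: vectorspace F "affine_space F n" by (rule vectorspace_affine)
  have sp: "V.span B = {V.lincomb a B | a. a \<in> B \<rightarrow> carrier F}" by (rule V.finite_span[OF B])
  have "inj_on (\<lambda>a. V.lincomb a B) (B \<rightarrow>\<^sub>E carrier F)"
  proof (rule inj_onI)
    fix a b assume a: "a \<in> B \<rightarrow>\<^sub>E carrier F" and b: "b \<in> B \<rightarrow>\<^sub>E carrier F"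
      and eq: "V.lincomb a B = V.lincomb b B"
    have ab: "a \<in> B \<rightarrow> carrier F" "b \<in> B \<rightarrow> carrier F" using a b by auto
    have cl: "(\<lambda>v. a v \<ominus> b v) \<in> B \<rightarrow> carrier F" using ab by auto
    have bB: "V.lincomb b B \<in> carrier (affine_space F n)" by (rule V.lincomb_closed[OF B(2) ab(2)])
    have "V.lincomb (\<lambda>v. a v \<ominus> b v) B = V.lincomb b B \<ominus>\<^bsub>affine_space F n\<^esub> V.lincomb b B"
      using V.lincomb_diff[OF B ab] unfolding eq .
    also have "\<dots> = \<zero>\<^bsub>affine_space F n\<^esub>"
      unfolding a_minus_def by (rule abelian_group.r_neg[OF abelian_group_affine bB])
    finally have lc0: "V.lincomb (\<lambda>v. a v \<ominus> b v) B = \<zero>\<^bsub>affine_space F n\<^esub>" .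
    have "a v \<ominus> b v = \<zero>" if v: "v \<in> B" for v
    proof (rule ccontr)
      assume "a v \<ominus> b v \<noteq> \<zero>"
      from V.lin_dep_crit[OF B(1) subset_refl cl v this lc0] li show False by contradiction
    qed
    then have "a v = b v" if "v \<in> B" for v
      using ab that r_right_minus_eq[of "a v" "b v"] by auto
    then show "a = b" using a b by (intro PiE_ext) auto
  qed
  moreover have "(\<lambda>a. V.lincomb a B) ` (B \<rightarrow>\<^sub>E carrier F) \<subseteq> V.span B"
    unfolding sp by auto
  moreover have "finite (V.span B)"
    by (rule finite_subset[OF _ finite_affine]) (rule V.span_is_subset2[OF B(2)])
  ultimately have "card (B \<rightarrow>\<^sub>E carrier F) \<le> card (V.span B)"
    by (rule card_inj_on_le)
  then show ?thesis using B(1) by (simp add: card_PiE card_carr)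
qed

text \<open>Closure in coordinates, so that the induction in \<open>free_coordinates\<close> can
  pass to the vectors vanishing at one coordinate without rebuilding a module.\<close>

definition vec_closed :: "nat \<Rightarrow> (nat \<Rightarrow> nat) set \<Rightarrow> bool" where
  "vec_closed n U \<longleftrightarrow> U \<subseteq> {..<n} \<rightarrow>\<^sub>E carrier F \<and> U \<noteq> {} \<and>
     (\<forall>u\<in>U. \<forall>v\<in>U. (\<lambda>i\<in>{..<n}. u i \<oplus> v i) \<in> U) \<and>
     (\<forall>c\<in>carrier F. \<forall>u\<in>U. (\<lambda>i\<in>{..<n}. c \<otimes> u i) \<in> U)"

lemma vec_closed_subspace:
  assumes U: "VectorSpace.subspace F U (affine_space F n)"
  shows "vec_closed n U"
proof -
  interpret V: vectorspace F "affine_space F n" by (rule vectorspace_affine)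
  have subm: "submodule F U (affine_space F n)" by (rule V.is_module[OF U])
  have "U \<subseteq> {..<n} \<rightarrow>\<^sub>E carrier F"
    using LinearCombinations.submodule.subset[OF subm] unfolding carrier_affine .
  moreover have "\<zero>\<^bsub>affine_space F n\<^esub> \<in> U" by (rule LinearCombinations.submodule.zero_closed[OF subm])
  then have "U \<noteq> {}" by blast
  moreover have "(\<lambda>i\<in>{..<n}. u i \<oplus> v i) \<in> U" if "u \<in> U" "v \<in> U" for u v
    using LinearCombinations.submodule.m_closed[OF subm that] unfolding add_affine .
  moreover have "(\<lambda>i\<in>{..<n}. c \<otimes> u i) \<in> U" if "c \<in> carrier F" "u \<in> U" for c u
    using LinearCombinations.submodule.smult_closed[OF subm that] unfolding smult_affine .
  ultimately show ?thesis unfolding vec_closed_def by blast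
qed

text \<open>Induction on \<open>k\<close>. A set of this size has a vector \<open>v\<close> that is
  nonzero at some \<open>i\<close>. The fibres over the values at \<open>i\<close> inject into the
  set of vectors vanishing at \<open>i\<close>, which therefore has size at least
  \<open>q ^ k\<close> and provides the other coordinates.\<close>

lemma free_coordinates:
  assumes "vec_closed n U" "q ^ k \<le> card U"
  shows "\<exists>P\<subseteq>{..<n}. card P = k \<and> (\<forall>\<tau>\<in>P \<rightarrow> carrier F. \<exists>u\<in>U. \<forall>i\<in>P. u i = \<tau> i)"
  using assms
proof (induction k arbitrary: U)
  case 0
  then show ?case unfolding vec_closed_def by (intro exI[of _ "{}"]) auto
next
  case (Suc k)
  note U = Suc.prems(1)[unfolded vec_closed_def]
  have Uc: "u i \<in> carrier F" if "u \<in> U" "i < n" for u i using U that by blast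
  have add: "(\<lambda>i\<in>{..<n}. u i \<oplus> v i) \<in> U" if "u \<in> U" "v \<in> U" for u v using U that by blast
  have smult: "(\<lambda>i\<in>{..<n}. c \<otimes> u i) \<in> U" if "c \<in> carrier F" "u \<in> U" for c u using U that by blast
  have finU: "finite U"
    using U finite_affine[of n] finite_subset unfolding carrier_affine by blast
  have "\<exists>v\<in>U. \<exists>i<n. v i \<noteq> \<zero>"
  proof (rule ccontr)
    assume "\<not> ?thesis"
    then have "U \<subseteq> {\<lambda>i\<in>{..<n}. \<zero>}" using U by (fastforce simp: PiE_iff extensional_def)
    then have "card U \<le> 1" using card_mono[of "{\<lambda>i\<in>{..<n}. \<zero>}" U] by simp
    moreover have "q \<le> q ^ Suc k" by (rule self_le_power) (use q_gt_1 in auto)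
    ultimately show False using Suc.prems(2) q_gt_1 by linarith
  qed
  then obtain v i where v: "v \<in> U" "i < n" "v i \<noteq> \<zero>" by blast
  let ?U = "{u \<in> U. u i = \<zero>}"
  have U': "vec_closed n ?U"
    unfolding vec_closed_def
  proof (intro conjI ballI)
    show "?U \<subseteq> {..<n} \<rightarrow>\<^sub>E carrier F" using U by blast
    have "(\<lambda>i\<in>{..<n}. \<zero> \<otimes> v i) \<in> ?U" using smult[OF zero_closed v(1)] v Uc by simp
    then show "?U \<noteq> {}" by blast
  qed (use add smult v in auto)
  have fiber: "card {u \<in> U. u i = a} \<le> card ?U" for a
  proof (cases "{u \<in> U. u i = a} = {}")
    case True
    show ?thesis unfolding True by simp
  next
    case False
    then obtain w where w: "w \<in> U" "w i = a" by blast
    let ?f = "\<lambda>u. \<lambda>j\<in>{..<n}. u j \<oplus> (\<lambda>j\<in>{..<n}. \<ominus> \<one> \<otimes> w j) j"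
    have mw: "(\<lambda>j\<in>{..<n}. \<ominus> \<one> \<otimes> w j) \<in> U" by (rule smult) (use w in auto)
    have "inj_on ?f {u \<in> U. u i = a}"
    proof (rule inj_onI)
      fix x y assume x: "x \<in> {u \<in> U. u i = a}" and y: "y \<in> {u \<in> U. u i = a}" and eq: "?f x = ?f y"
      show "x = y"
      proof (rule PiE_ext[of _ "{..<n}" "\<lambda>_. carrier F"])
        show "x \<in> {..<n} \<rightarrow>\<^sub>E carrier F" "y \<in> {..<n} \<rightarrow>\<^sub>E carrier F" using U x y by blast+
        fix j assume j: "j \<in> {..<n}"
        have "x j \<oplus> \<ominus> \<one> \<otimes> w j = y j \<oplus> \<ominus> \<one> \<otimes> w j" using fun_cong[OF eq, of j] j by simp
        then show "x j = y j" using Uc x y w(1) j by (simp add: add.r_cancel)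
      qed
    qed
    moreover have "?f ` {u \<in> U. u i = a} \<subseteq> ?U"
    proof
      fix z assume "z \<in> ?f ` {u \<in> U. u i = a}"
      then obtain x where x: "x \<in> U" "x i = a" "z = ?f x" by blast
      have "z \<in> U" unfolding x(3) by (rule add[OF x(1) mw])
      moreover have "z i = \<zero>" using x w Uc[OF w(1) v(2)] v(2) by (simp add: l_minus r_neg)
      ultimately show "z \<in> ?U" by simp
    qed
    moreover have "finite ?U" using finU by simp
    ultimately show ?thesis by (rule card_inj_on_le)
  qed
  have "U = (\<Union>a\<in>carrier F. {u \<in> U. u i = a})" using Uc v(2) by auto
  then have "card U \<le> (\<Sum>a\<in>carrier F. card {u \<in> U. u i = a})"
    using card_UN_le[OF finite_carr, of "\<lambda>a. {u \<in> U. u i = a}"] by simp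
  also have "\<dots> \<le> (\<Sum>a\<in>carrier F. card ?U)" by (rule sum_mono) (rule fiber)
  finally have "card U \<le> q * card ?U" by (simp add: card_carr)
  from order.trans[OF Suc.prems(2) this] have "q * q ^ k \<le> q * card ?U" by (simp only: power_Suc)
  then have "0 < q \<longrightarrow> q ^ k \<le> card ?U" by (simp only: mult_le_cancel1)
  then have "q ^ k \<le> card ?U" using q_gt_1 by simp
  from Suc.IH[OF U' this] obtain P where P: "P \<subseteq> {..<n}" "card P = k"
    "\<forall>\<tau>\<in>P \<rightarrow> carrier F. \<exists>u\<in>?U. \<forall>i\<in>P. u i = \<tau> i" by blast
  have iP: "i \<notin> P"
  proof
    assume "i \<in> P"
    moreover obtain u where "u \<in> ?U" "\<forall>i\<in>P. u i = \<one>" using P(3) by fastforce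
    ultimately show False by simp
  qed
  show ?case
  proof (intro exI[of _ "insert i P"] conjI ballI)
    show "insert i P \<subseteq> {..<n}" using P v by simp
    show "card (insert i P) = Suc k" using P iP finite_subset[OF P(1)] by simp
    fix \<tau> assume \<tau>: "\<tau> \<in> insert i P \<rightarrow> carrier F"
    \<comment> \<open>A multiple of \<open>v\<close> takes the right value at \<open>i\<close>; a
      vector vanishing at \<open>i\<close> then corrects the coordinates in
      \<open>P\<close>.\<close>
    let ?c = "\<tau> i \<otimes> inv (v i)"
    have vi: "v i \<in> Units F" using v Uc field_Units by auto
    have c: "?c \<in> carrier F" "?c \<otimes> v i = \<tau> i" using \<tau> vi Uc[OF v(1,2)] by (auto simp: m_assoc)
    let ?w = "\<lambda>j\<in>{..<n}. ?c \<otimes> v j"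
    have w: "?w \<in> U" by (rule smult[OF c(1) v(1)])
    have "(\<lambda>j. \<tau> j \<ominus> ?w j) \<in> P \<rightarrow> carrier F"
    proof (rule Pi_I)
      fix j assume j: "j \<in> P"
      then have "j < n" using P(1) by blast
      from Uc[OF w this] j \<tau> show "\<tau> j \<ominus> ?w j \<in> carrier F" by (intro minus_closed) auto
    qed
    from bspec[OF P(3) this] obtain u where u: "u \<in> ?U" "\<forall>j\<in>P. u j = \<tau> j \<ominus> ?w j" by blast
    show "\<exists>u\<in>U. \<forall>j\<in>insert i P. u j = \<tau> j"
    proof (rule bexI)
      show "(\<lambda>j\<in>{..<n}. u j \<oplus> ?w j) \<in> U" using add u w by blast
      show "\<forall>j\<in>insert i P. (\<lambda>j\<in>{..<n}. u j \<oplus> ?w j) j = \<tau> j"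
      proof
        fix j assume j: "j \<in> insert i P"
        then have jn: "j < n" using P(1) v(2) by auto
        have cl: "\<tau> j \<in> carrier F" "?w j \<in> carrier F" using \<tau> j Uc[OF w jn] by auto
        show "(\<lambda>j\<in>{..<n}. u j \<oplus> ?w j) j = \<tau> j"
        proof (cases "j = i")
          case True
          then show ?thesis using u(1) c v(2) \<tau> by simp
        next
          case False
          then have "u j = \<tau> j \<ominus> ?w j" using j u(2) by blast
          then have "u j \<oplus> ?w j = \<tau> j" using cl by (simp only: minus_eq) (simp add: a_assoc l_neg del: restrict_apply)
          then show ?thesis using jn by simp
        qed
      qed
    qed
  qed
qed

section \<open>The upper bound for \<open>k\<^sub>q\<close>\<close>

definition ml_fun :: "nat set set \<Rightarrow> (nat set \<Rightarrow> nat) \<Rightarrow> (nat \<Rightarrow> nat) \<Rightarrow> nat" where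
  "ml_fun \<S> c x = (\<Oplus>S\<in>\<S>. c S \<otimes> (\<Otimes>i\<in>S. x i))"

lemma multilinear_polynomial:
  assumes \<S>: "\<S> \<subseteq> {S. S \<subseteq> {..<n} \<and> card S = d}" and c: "c \<in> \<S> \<rightarrow> carrier F"
  obtains f where "polynomial_in F n f" "total_degree f \<le> d"
    "\<And>x. (\<And>i. i < n \<Longrightarrow> x i \<in> carrier F) \<Longrightarrow> poly_fun F n f x = ml_fun \<S> c x"
proof -
  have fin\<S>: "finite \<S>" by (rule finite_subset[OF \<S>]) simp
  \<comment> \<open>Zero coefficients are dropped, since \<open>polynomial_in\<close> forbids
    them.\<close>
  let ?T = "{S \<in> \<S>. c S \<noteq> \<zero>}"
  obtain Sl where Sl: "set Sl = ?T" "distinct Sl"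
    using finite_distinct_list[of ?T] fin\<S> by auto
  define ex where "ex = (\<lambda>S. map (\<lambda>i. if i \<in> S then 1 else 0 :: nat) [0..<n])"
  define f where "f = map (\<lambda>S. (c S, ex S)) Sl"
  have Sn: "S \<subseteq> {..<n}" "card S = d" if "S \<in> \<S>" for S using \<S> that by auto
  have inj: "inj_on ex \<S>"
  proof (rule inj_onI)
    fix S T assume S: "S \<in> \<S>" "T \<in> \<S>" and eq: "ex S = ex T"
    have "i \<in> S \<longleftrightarrow> i \<in> T" if "i < n" for i
      using arg_cong[OF eq, of "\<lambda>l. l ! i"] that by (auto simp: ex_def split: if_splits)
    then show "S = T" using Sn(1)[OF S(1)] Sn(1)[OF S(2)] by auto
  qed
  have p: "polynomial_in F n f"
    unfolding polynomial_in_def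
  proof
    show "\<forall>(c', es)\<in>set f. c' \<in> carrier F - {\<zero>} \<and> length es = n"
      using Sl c by (auto simp: f_def ex_def)
    show "distinct (map snd f)"
      using Sl inj by (auto simp: f_def distinct_map comp_def intro: inj_on_subset)
  qed
  have deg: "sum_list (ex S) = d" if "S \<in> \<S>" for S
  proof -
    have "sum_list (ex S) = (\<Sum>i<n. if i \<in> S then 1 else 0)"
      by (simp add: ex_def sum_list_sum_nth atLeast0LessThan)
    also have "\<dots> = card ({..<n} \<inter> S)" by (simp add: sum.If_cases)
    finally show ?thesis using Sn[OF that] by (simp add: Int_absorb1)
  qed
  have td: "total_degree f \<le> d"
    unfolding total_degree_def
  proof (rule Max.boundedI)
    show "finite (insert 0 ((\<lambda>(c, es). sum_list es) ` set f))" by simp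
  qed (use deg Sl in \<open>auto simp: f_def\<close>)
  have "poly_fun F n f x = ml_fun \<S> c x" if x: "\<And>i. i < n \<Longrightarrow> x i \<in> carrier F" for x
  proof -
    have prodc: "(\<Otimes>i\<in>S. x i) \<in> carrier F" if "S \<in> \<S>" for S
      using Sn[OF that] x by (intro finprod_closed) auto
    have cS: "c S \<in> carrier F" if "S \<in> \<S>" for S using c that by auto
    have prod: "(\<Otimes>i\<in>{..<n}. x i [^] (ex S ! i)) = (\<Otimes>i\<in>S. x i)" if "S \<in> \<S>" for S
      by (rule finprod_mono_neutral_cong_right) (use Sn[OF that] x in \<open>auto simp: ex_def\<close>)
    have "poly_fun F n f x = (\<Oplus>m\<in>(\<lambda>S. (c S, ex S)) ` ?T. fst m \<otimes> (\<Otimes>i\<in>{..<n}. x i [^] (snd m ! i)))"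
      unfolding poly_fun_def f_def using Sl by simp
    also have "\<dots> = (\<Oplus>S\<in>?T. c S \<otimes> (\<Otimes>i\<in>{..<n}. x i [^] (ex S ! i)))"
    proof (subst finsum_reindex)
      show "inj_on (\<lambda>S. (c S, ex S)) ?T" using inj by (auto simp: inj_on_def)
    qed (use cS prod prodc in auto)
    also have "\<dots> = (\<Oplus>S\<in>?T. c S \<otimes> (\<Otimes>i\<in>S. x i))"
      by (rule finsum_cong') (use cS prod prodc in auto)
    also have "\<dots> = (\<Oplus>S\<in>\<S>. c S \<otimes> (\<Otimes>i\<in>S. x i))"
      by (rule add.finprod_mono_neutral_cong_left) (use fin\<S> cS prodc in auto)
    finally show ?thesis by (simp add: ml_fun_def)
  qed
  with p td show ?thesis by (rule that)
qed

text \<open>Since the coordinates in \<open>P\<close> are free on \<open>A\<close>, two coefficient systems that agree outside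
  the subsets of \<open>P\<close> and are constant on \<open>A\<close> coincide: compare the values at a point vanishing on
  \<open>P\<close> and at the indicator of \<open>S \<subseteq> P\<close>.\<close>

lemma ml_fun_unique:
  assumes \<S>: "\<S> = {S. S \<subseteq> {..<n} \<and> card S = d}" and d: "0 < d" and P: "P \<subseteq> {..<n}"
    and A: "A \<subseteq> {..<n} \<rightarrow>\<^sub>E carrier F" "\<And>\<tau>. \<tau> \<in> P \<rightarrow> carrier F \<Longrightarrow> \<exists>x\<in>A. \<forall>i\<in>P. x i = \<tau> i"
    and c: "c \<in> \<S> \<rightarrow>\<^sub>E carrier F" "const_on (ml_fun \<S> c) A"
    and c': "c' \<in> \<S> \<rightarrow>\<^sub>E carrier F" "const_on (ml_fun \<S> c') A"
    and agree: "\<And>S. S \<in> \<S> \<Longrightarrow> \<not> S \<subseteq> P \<Longrightarrow> c S = c' S"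
  shows "c = c'"
proof -
  have fin\<S>: "finite \<S>" unfolding \<S> by simp
  have finP: "finite P" by (rule finite_subset[OF P]) simp
  let ?Q = "{S \<in> \<S>. \<not> S \<subseteq> P}" and ?M = "{S \<in> \<S>. S \<subseteq> P}"
  have prodc: "(\<Otimes>i\<in>S. x i) \<in> carrier F" if "S \<in> \<S>" "x \<in> A" for S x
    using A(1) that unfolding \<S> by (intro finprod_closed) (auto simp: PiE_iff subset_iff)
  have split: "ml_fun \<S> b x = ml_fun ?Q b x \<oplus> ml_fun ?M b x" if "b \<in> \<S> \<rightarrow> carrier F" "x \<in> A" for b x
  proof -
    have "\<S> = ?Q \<union> ?M" by auto
    then have "ml_fun \<S> b x = (\<Oplus>S\<in>?Q \<union> ?M. b S \<otimes> (\<Otimes>i\<in>S. x i))" by (simp add: ml_fun_def)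
    also have "\<dots> = ml_fun ?Q b x \<oplus> ml_fun ?M b x"
      unfolding ml_fun_def
      by (rule finsum_Un_disjoint) (use fin\<S> that prodc in auto)
    finally show ?thesis .
  qed
  have prod0: "(\<Otimes>i\<in>S. x i) = \<zero>" if S: "S \<in> \<S>" "i \<in> S" "x i = \<zero>" and x: "x \<in> A" for S x i
  proof -
    have finS: "finite S" using S(1) unfolding \<S> by (auto intro: finite_subset)
    have cl: "x j \<in> carrier F" if "j \<in> S" for j
      using A(1) x S(1) that unfolding \<S> by (auto simp: PiE_iff subset_iff)
    have "(\<Otimes>i\<in>insert i (S - {i}). x i) = x i \<otimes> (\<Otimes>i\<in>S - {i}. x i)"
      by (rule finprod_insert) (use finS cl S(2) in auto)
    moreover have "(\<Otimes>i\<in>S - {i}. x i) \<in> carrier F" using cl by (intro finprod_closed) auto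
    ultimately show ?thesis using S by (simp add: insert_absorb)
  qed
  obtain x0 where x0: "x0 \<in> A" "\<forall>i\<in>P. x0 i = \<zero>" using A(2)[of "\<lambda>_. \<zero>"] by auto
  have M0: "ml_fun ?M b x0 = \<zero>" if "b \<in> \<S> \<rightarrow> carrier F" for b
    unfolding ml_fun_def
  proof (rule add.finprod_one_eqI)
    fix S assume S: "S \<in> ?M"
    then obtain i where i: "i \<in> S" using d by (fastforce simp: \<S>)
    then show "b S \<otimes> (\<Otimes>i\<in>S. x0 i) = \<zero>"
      using prod0[of S i x0] S x0 that by (auto simp: Pi_iff)
  qed
  have eq: "c S = c' S" if S: "S \<in> \<S>" "S \<subseteq> P" for S
  proof -
    obtain x1 where x1: "x1 \<in> A" "\<forall>i\<in>P. x1 i = (if i \<in> S then \<one> else \<zero>)"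
      using A(2)[of "\<lambda>i. if i \<in> S then \<one> else \<zero>"] by auto
    have M1: "ml_fun ?M b x1 = b S" if b: "b \<in> \<S> \<rightarrow> carrier F" for b
    proof -
      have one: "(\<Otimes>i\<in>S. x1 i) = \<one>" by (rule finprod_one_eqI) (use x1 S in auto)
      have zero: "(\<Otimes>i\<in>T. x1 i) = \<zero>" if T: "T \<in> ?M - {S}" for T
      proof -
        \<comment> \<open>Two different sets of equal size: \<open>T\<close> has an element outside
          \<open>S\<close>, which lies in \<open>P\<close>, and \<open>x1\<close> vanishes
          there.\<close>
        have "\<not> T \<subseteq> S"
          using T S(1) card_subset_eq[of S T] unfolding \<S> by (auto dest: finite_subset)
        then obtain i where "i \<in> T" "i \<notin> S" by blast
        then show ?thesis using prod0[of T i x1] T x1 by auto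
      qed
      have "ml_fun ?M b x1 = (\<Oplus>T\<in>{S}. b T \<otimes> (\<Otimes>i\<in>T. x1 i))"
        unfolding ml_fun_def
      proof (rule add.finprod_mono_neutral_cong_right)
        show "finite ?M" "{S} \<subseteq> ?M" using fin\<S> S by auto
        fix T assume "T \<in> ?M - {S}"
        with zero[OF this] b show "b T \<otimes> (\<Otimes>i\<in>T. x1 i) = \<zero>" by (auto simp: Pi_iff)
      qed (use b prodc x1 in auto)
      also have "\<dots> = b S" using one b S by (simp add: Pi_iff)
      finally show ?thesis .
    qed
    \<comment> \<open>The coefficient at \<open>S\<close> is a difference of sums over sets not
      contained in \<open>P\<close>, where the two systems agree.\<close>
    have val: "b S = ml_fun ?Q b x0 \<oplus> \<ominus> ml_fun ?Q b x1"
      if b: "b \<in> \<S> \<rightarrow> carrier F" "const_on (ml_fun \<S> b) A" for b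
    proof -
      have Qc: "ml_fun ?Q b x0 \<in> carrier F" "ml_fun ?Q b x1 \<in> carrier F"
        unfolding ml_fun_def using b(1) prodc x0(1) x1(1) by (auto intro!: finsum_closed)
      have bS: "b S \<in> carrier F" using b(1) S by auto
      have "ml_fun \<S> b x0 = ml_fun \<S> b x1" using b(2) x0(1) x1(1) by (auto simp: const_on_def)
      then have "ml_fun ?Q b x0 = ml_fun ?Q b x1 \<oplus> b S"
        using split[OF b(1) x0(1)] split[OF b(1) x1(1)] M0[OF b(1)] M1[OF b(1)] Qc by simp
      then show ?thesis using Qc bS by (simp add: a_ac r_neg r_neg2)
    qed
    have "ml_fun ?Q c x = ml_fun ?Q c' x" if "x \<in> A" for x
      unfolding ml_fun_def by (rule finsum_cong') (use agree c' prodc that in auto)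
    moreover have "c \<in> \<S> \<rightarrow> carrier F" "c' \<in> \<S> \<rightarrow> carrier F" using c(1) c'(1) by (simp_all add: PiE_def)
    ultimately show ?thesis using val[of c] val[of c'] c(2) c'(2) x0(1) x1(1) by simp
  qed
  show ?thesis
    by (rule PiE_ext[OF c(1) c'(1)]) (use eq agree in blast)
qed

lemma binomial_le_pow': "(n choose k) \<le> n ^ k"
  by (cases "k \<le> n") (auto simp: binomial_le_pow binomial_eq_0)

text \<open>The subspaces are counted by pairs of a point and a set of \<open>k\<close> vectors, at
  most \<open>q ^ (n * (k + 1))\<close> of them. This count must reach the reciprocal
  \<open>q ^ (k choose d)\<close> of the largest fraction of forms that one subspace can
  serve.\<close>

lemma constant_dim_bound:
  assumes d: "0 < d"
    and const: "\<And>f. polynomial_in F n f \<Longrightarrow> total_degree f \<le> d \<Longrightarrow>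
     (\<exists>u U. u \<in> carrier (affine_space F n) \<and> VectorSpace.subspace F U (affine_space F n) \<and>
        dim_of F n U = k \<and> const_on (poly_fun F n f) (u <+\<^bsub>affine_space F n\<^esub> U))"
  shows "k choose d \<le> n * (k + 1)"
proof -
  interpret V: vectorspace F "affine_space F n" by (rule vectorspace_affine)
  let ?V = "carrier (affine_space F n)"
  define \<S> where "\<S> = {S. S \<subseteq> {..<n} \<and> card S = d}"
  have fin\<S>: "finite \<S>" by (simp add: \<S>_def)
  define C where "C = \<S> \<rightarrow>\<^sub>E carrier F"
  define I where "I = ?V \<times> {B. B \<subseteq> ?V \<and> card B = k}"
  have finI: "finite I" unfolding I_def using finite_affine by auto
  define G where "G = (\<lambda>(u, B). {c \<in> C. const_on (ml_fun \<S> c) (u <+\<^bsub>affine_space F n\<^esub> V.span B)})"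
  have finC: "finite C" unfolding C_def using fin\<S> finite_carr by (intro finite_PiE) auto
  have cardC: "card C = q ^ card \<S>" unfolding C_def using fin\<S> by (simp add: card_PiE card_carr)
  have cover: "\<exists>i\<in>I. c \<in> G i \<and> \<not> V.lin_dep (snd i)" if c: "c \<in> C" for c
  proof -
    obtain f where f: "polynomial_in F n f" "total_degree f \<le> d"
      "\<And>x. (\<And>i. i < n \<Longrightarrow> x i \<in> carrier F) \<Longrightarrow> poly_fun F n f x = ml_fun \<S> c x"
      by (rule multilinear_polynomial[of \<S> n d c]) (use c in \<open>auto simp: \<S>_def C_def\<close>)
    obtain u U where u: "u \<in> ?V" "VectorSpace.subspace F U (affine_space F n)" "dim_of F n U = k"
      "const_on (poly_fun F n f) (u <+\<^bsub>affine_space F n\<^esub> U)" using const[OF f(1,2)] by blast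
    obtain B where B: "finite B" "B \<subseteq> ?V" "card B = dim_of F n U" "\<not> V.lin_dep B" "V.span B = U"
      by (rule subspace_basis[OF u(2)])
    have xc: "x i \<in> carrier F" if "x \<in> u <+\<^bsub>affine_space F n\<^esub> U" "i < n" for x i
      using that u(1) V.span_is_subset2[OF B(2)] B(5)
      by (auto simp: coset_affine carrier_affine PiE_iff subset_iff)
    obtain a where a: "\<And>x. x \<in> u <+\<^bsub>affine_space F n\<^esub> U \<Longrightarrow> poly_fun F n f x = a"
      using u(4) unfolding const_on_def by blast
    have "const_on (ml_fun \<S> c) (u <+\<^bsub>affine_space F n\<^esub> U)"
      unfolding const_on_def
    proof (intro exI[of _ a] ballI)
      fix x assume "x \<in> u <+\<^bsub>affine_space F n\<^esub> U"
      from a[OF this] f(3)[of x, OF xc[OF this]] show "ml_fun \<S> c x = a" by simp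
    qed
    then show ?thesis using u B c by (intro bexI[of _ "(u, B)"]) (auto simp: G_def I_def)
  qed
  let ?r = "card \<S> - (k choose d)"
  have small: "card (G i) * q ^ (k choose d) \<le> q ^ card \<S>" if i: "i \<in> I" and li: "\<not> V.lin_dep (snd i)" for i
  proof -
    obtain u B where [simp]: "i = (u, B)" by (cases i)
    have u: "u \<in> ?V" and B: "B \<subseteq> ?V" "card B = k" using i by (auto simp: I_def)
    have finB: "finite B" by (rule finite_subset[OF B(1) finite_affine])
    have sub: "vec_closed n (V.span B)" by (rule vec_closed_subspace[OF V.span_is_subspace[OF B(1)]])
    have "q ^ k \<le> card (V.span B)" using card_span_ge[OF finB B(1)] li B(2) by simp
    from free_coordinates[OF sub this] obtain P where P: "P \<subseteq> {..<n}" "card P = k"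
      "\<forall>\<tau>\<in>P \<rightarrow> carrier F. \<exists>u\<in>V.span B. \<forall>i\<in>P. u i = \<tau> i" by blast
    have finP: "finite P" by (rule finite_subset[OF P(1)]) simp
    let ?A = "u <+\<^bsub>affine_space F n\<^esub> V.span B"
    let ?M = "{S \<in> \<S>. S \<subseteq> P}" and ?Q = "{S \<in> \<S>. \<not> S \<subseteq> P}"
    have uc: "u j \<in> carrier F" if "j < n" for j using u that by (auto simp: carrier_affine)
    have A: "?A \<subseteq> {..<n} \<rightarrow>\<^sub>E carrier F"
      using sub uc by (auto simp: coset_affine vec_closed_def PiE_iff subset_iff)
    have free: "\<exists>x\<in>?A. \<forall>i\<in>P. x i = \<tau> i" if \<tau>: "\<tau> \<in> P \<rightarrow> carrier F" for \<tau>
    proof -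
      have "(\<lambda>i. \<tau> i \<ominus> u i) \<in> P \<rightarrow> carrier F" using \<tau> uc P(1) by auto
      from bspec[OF P(3) this]
      obtain v where v: "v \<in> V.span B" "\<forall>i\<in>P. v i = \<tau> i \<ominus> u i" by blast
      show ?thesis
      proof (rule bexI)
        show "(\<lambda>i\<in>{..<n}. u i \<oplus> v i) \<in> ?A" using v(1) by (auto simp: coset_affine)
        show "\<forall>i\<in>P. (\<lambda>i\<in>{..<n}. u i \<oplus> v i) i = \<tau> i"
        proof
          fix j assume j: "j \<in> P"
          then have "j < n" "\<tau> j \<in> carrier F" using P(1) \<tau> by auto
          then show "(\<lambda>i\<in>{..<n}. u i \<oplus> v i) j = \<tau> j"
            using v(2) j uc[of j] by (simp add: minus_eq a_ac r_neg r_neg2)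
        qed
      qed
    qed
    \<comment> \<open>By \<open>ml_fun_unique\<close> the coefficients at subsets of
      \<open>P\<close> are determined by the rest, so these \<open>k choose d\<close> coefficients
      carry no freedom.\<close>
    have "inj_on (\<lambda>c. restrict c ?Q) (G i)"
    proof (rule inj_onI)
      fix c c' assume c: "c \<in> G i" "c' \<in> G i" and eq: "restrict c ?Q = restrict c' ?Q"
      show "c = c'"
      proof (rule ml_fun_unique[OF \<S>_def d P(1) A free])
        fix S assume "S \<in> \<S>" "\<not> S \<subseteq> P"
        then show "c S = c' S" using fun_cong[OF eq, of S] by simp
      qed (use c in \<open>auto simp: G_def C_def\<close>)
    qed
    then have "card (G i) = card ((\<lambda>c. restrict c ?Q) ` G i)" by (simp add: card_image)
    also have "\<dots> \<le> card (?Q \<rightarrow>\<^sub>E carrier F)"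
    proof (rule card_mono)
      show "finite (?Q \<rightarrow>\<^sub>E carrier F)" using fin\<S> finite_carr by (intro finite_PiE) auto
      show "(\<lambda>c. restrict c ?Q) ` G i \<subseteq> ?Q \<rightarrow>\<^sub>E carrier F"
      proof
        fix b assume "b \<in> (\<lambda>c. restrict c ?Q) ` G i"
        then obtain c where c: "b = restrict c ?Q" "c \<in> \<S> \<rightarrow>\<^sub>E carrier F" by (auto simp: G_def C_def)
        show "b \<in> ?Q \<rightarrow>\<^sub>E carrier F"
          unfolding c(1) restrict_PiE_iff using PiE_mem[OF c(2)] by blast
      qed
    qed
    also have "\<dots> = q ^ card ?Q" using fin\<S> by (simp add: card_PiE card_carr)
    finally have "card (G i) \<le> q ^ card ?Q" .
    moreover have "card ?M = k choose d"
    proof -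
      have "?M = {S. S \<subseteq> P \<and> card S = d}" using P(1) by (auto simp: \<S>_def)
      then show ?thesis using n_subsets[OF finP, of d] P(2) by simp
    qed
    moreover have "card \<S> = card ?Q + card ?M"
    proof -
      have "card (?Q \<union> ?M) = card ?Q + card ?M"
        by (rule card_Un_disjoint) (use fin\<S> in auto)
      moreover have "?Q \<union> ?M = \<S>" by auto
      ultimately show ?thesis by simp
    qed
    ultimately show ?thesis by (simp add: power_add)
  qed
  have "card C \<le> card (\<Union>i\<in>{i \<in> I. \<not> V.lin_dep (snd i)}. G i)"
    by (rule card_mono) (use finI finC cover in \<open>auto simp: G_def\<close>)
  also have "\<dots> \<le> (\<Sum>i\<in>{i \<in> I. \<not> V.lin_dep (snd i)}. card (G i))"
    by (rule card_UN_le) (use finI in auto)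
  finally have "q ^ card \<S> * q ^ (k choose d)
      \<le> (\<Sum>i\<in>{i \<in> I. \<not> V.lin_dep (snd i)}. card (G i) * q ^ (k choose d))"
    unfolding cardC by (simp add: sum_distrib_right[symmetric])
  also have "\<dots> \<le> (\<Sum>i\<in>{i \<in> I. \<not> V.lin_dep (snd i)}. q ^ card \<S>)"
    by (rule sum_mono) (use small in auto)
  also have "\<dots> \<le> card I * q ^ card \<S>"
    using card_mono[OF finI, of "{i \<in> I. \<not> V.lin_dep (snd i)}"] by auto
  finally have "q ^ (k choose d) \<le> card I" using q_gt_1 by simp
  also have "card I = q ^ n * (q ^ n choose k)"
    unfolding I_def by (simp add: card_cartesian_product card_affine n_subsets[OF finite_affine])
  also have "\<dots> \<le> q ^ n * (q ^ n) ^ k" by (intro mult_le_mono2 binomial_le_pow')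
  also have "\<dots> = q ^ (n * (k + 1))" by (simp add: power_add power_mult)
  finally show ?thesis using q_gt_1 by (simp add: power_increasing_iff)
qed

text \<open>The maximum in \<open>kq\<close> is attained: its set contains 0, as every function is
  constant on a point, and testing it on the empty polynomial bounds its members by
  \<open>n\<close>.\<close>

lemma kq_choose:
  assumes d: "0 < d" shows "kq F n d choose d \<le> n * (kq F n d + 1)"
proof -
  interpret V: vectorspace F "affine_space F n" by (rule vectorspace_affine)
  let ?K = "{k. \<forall>f. polynomial_in F n f \<and> total_degree f \<le> d \<longrightarrow>
     (\<exists>u U. u \<in> carrier (affine_space F n) \<and> VectorSpace.subspace F U (affine_space F n) \<and>
        dim_of F n U = k \<and> const_on (poly_fun F n f) (u <+\<^bsub>affine_space F n\<^esub> U))}"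
  have "?K \<subseteq> {..n}"
  proof
    fix k assume "k \<in> ?K"
    moreover have "polynomial_in F n []" "total_degree [] \<le> d"
      by (simp_all add: polynomial_in_def total_degree_def)
    ultimately obtain U where U: "VectorSpace.subspace F U (affine_space F n)" "dim_of F n U = k"
      by blast
    obtain B where B: "finite B" "B \<subseteq> carrier (affine_space F n)" "card B = dim_of F n U"
      "\<not> V.lin_dep B" "V.span B = U"
      by (rule subspace_basis[OF U(1)])
    have "q ^ k \<le> card (V.span B)" using card_span_ge[OF B(1,2,4)] B(3) U(2) by simp
    also have "\<dots> \<le> q ^ n"
      unfolding card_affine[symmetric] by (rule card_mono[OF finite_affine V.span_is_subset2[OF B(2)]])
    finally show "k \<in> {..n}" using q_gt_1 by (simp add: power_increasing_iff)
  qed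
  then have fin: "finite ?K" by (rule finite_subset) simp
  have "0 \<in> ?K"
  proof (intro CollectI allI impI)
    fix f :: monomials
    let ?u = "\<lambda>i\<in>{..<n}. \<zero>"
    have "\<not> V.lin_dep {}" by (auto simp: V.lin_dep_def)
    note sp = span_of_indep[of "{}" n, OF _ _ this]
    have u: "?u \<in> carrier (affine_space F n)" by (simp add: carrier_affine)
    have "V.span {} \<subseteq> {\<zero>\<^bsub>affine_space F n\<^esub>}" by (auto simp: V.span_def V.lincomb_def)
    then have "const_on (poly_fun F n f) (?u <+\<^bsub>affine_space F n\<^esub> V.span {})"
      by (auto simp: const_on_def coset_affine)
    with u sp show "\<exists>u U. u \<in> carrier (affine_space F n) \<and> VectorSpace.subspace F U (affine_space F n) \<and>
        dim_of F n U = 0 \<and> const_on (poly_fun F n f) (u <+\<^bsub>affine_space F n\<^esub> U)"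
      by (intro exI[of _ ?u] exI[of _ "V.span {}"]) auto
  qed
  then have "kq F n d \<in> ?K" unfolding kq_def using Max_in[OF fin] by blast
  then show ?thesis by (intro constant_dim_bound[OF d]) blast
qed

end

section \<open>Existence of the next basis vector\<close>

context cring begin

lemma dual_mono_cong:
  "(\<And>i. i < k \<Longrightarrow> x i = y i) \<Longrightarrow> (\<And>i. i < k \<Longrightarrow> w i = v i) \<Longrightarrow> dual_mono x w a k = dual_mono y v a k"
proof (induction k)
  case (Suc k)
  then have "dual_step x w k = dual_step y v k" by (intro ext) (simp add: dual_step_def)
  with Suc show ?case by simp
qed simp

lemma dual_poly_cong:
  assumes "\<And>i. i < n \<Longrightarrow> x i = y i" "\<And>i. i < n \<Longrightarrow> w i = v i"
  shows "dual_poly x w n f t = dual_poly y v n f t"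
proof -
  have "dual_mono x w a n = dual_mono y v a n" for a
    by (rule dual_mono_cong) (use assms in auto)
  then show ?thesis by (simp add: dual_poly_def)
qed

lemma fst_dual_poly: "fst (dual_poly x w n f t) = fst (dual_poly x v n f t)"
  unfolding dual_poly_def fst_conv by (intro fsum_cong fst_dual_mono)

definition poly_value :: "nat \<Rightarrow> 'a terms \<Rightarrow> (nat \<Rightarrow> 'a) \<Rightarrow> 'a" where
  "poly_value n f x = fst (dual_poly x (\<lambda>_. \<zero>) n f (length f))"

text \<open>Formal partial derivatives read off from dual numbers; they are meaningful in every
  characteristic.\<close>

definition gradient :: "nat \<Rightarrow> 'a terms \<Rightarrow> (nat \<Rightarrow> 'a) \<Rightarrow> nat \<Rightarrow> 'a" where
  "gradient n f x c = snd (dual_poly x (unit_vec c) n f (length f))"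

lemma poly_value_cong: "(\<And>i. i < n \<Longrightarrow> x i = y i) \<Longrightarrow> poly_value n f x = poly_value n f y"
  unfolding poly_value_def by (rule arg_cong[of _ _ fst], rule dual_poly_cong) auto

lemma gradient_cong: "(\<And>i. i < n \<Longrightarrow> x i = y i) \<Longrightarrow> gradient n f x c = gradient n f y c"
  unfolding gradient_def by (rule arg_cong[of _ _ snd], rule dual_poly_cong) auto

definition affine_pt :: "(nat \<Rightarrow> 'a) \<Rightarrow> (nat \<Rightarrow> nat \<Rightarrow> 'a) \<Rightarrow> nat \<Rightarrow> (nat \<Rightarrow> 'a) \<Rightarrow> nat \<Rightarrow> 'a" where
  "affine_pt u Y m c i = u i \<oplus> fsum m (\<lambda>j. c j \<otimes> Y j i)"

lemma affine_pt_cong: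
  assumes "\<And>j. j < m \<Longrightarrow> c j = c' j" shows "affine_pt u Y m c = affine_pt u Y m c'"
proof
  fix i
  have "fsum m (\<lambda>j. c j \<otimes> Y j i) = fsum m (\<lambda>j. c' j \<otimes> Y j i)"
    by (rule fsum_cong) (simp add: assms)
  then show "affine_pt u Y m c i = affine_pt u Y m c' i" by (simp add: affine_pt_def)
qed

lemma affine_pt_cong':
  assumes "\<And>j. j < m \<Longrightarrow> Y j i = Y' j i" shows "affine_pt u Y m c i = affine_pt u Y' m c i"
proof -
  have "fsum m (\<lambda>j. c j \<otimes> Y j i) = fsum m (\<lambda>j. c j \<otimes> Y' j i)"
    by (rule fsum_cong) (simp add: assms)
  then show ?thesis by (simp add: affine_pt_def)
qed

end

context field begin

lemma affine_pt_closed: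
  assumes "u i \<in> carrier R" "scalars m c" "\<And>j. j < m \<Longrightarrow> scalars n (Y j)" "i < n"
  shows "affine_pt u Y m c i \<in> carrier R"
  unfolding affine_pt_def using assms by (auto simp: scalars_def intro!: fsum_closed)

lemma gradient_closed:
  assumes "scalars n x" "wf_terms n d f" shows "scalars n (gradient n f x)"
  unfolding scalars_def gradient_def
  by (intro allI impI dual_poly_closed(2)[OF _ _ assms(2)]) (use assms(1) in \<open>auto simp: scalars_def\<close>)

lemma dot_gradient:
  assumes x: "scalars n x" and w: "scalars n w" and f: "wf_terms n d f"
  shows "dot n (gradient n f x) w = snd (dual_poly x w n f (length f))"
  unfolding dot_def gradient_def
  by (rule snd_dual_poly[OF _ _ f order.refl, symmetric]) (use x w in \<open>auto simp: scalars_def\<close>)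

text \<open>The added zeros stay in the statement because they cancel only at points of the carrier;
  \<open>expands_value\<close> removes them there.\<close>

lemma expands_affine_pt:
  assumes u: "scalars n u" and Y: "\<And>j. j < m \<Longrightarrow> scalars n (Y j)" and V: "\<And>j. j < B \<Longrightarrow> scalars n (V j)"
    and i: "i < n"
  shows "expands m B 1 (\<lambda>xs zs. affine_pt u Y m ((!) xs) i \<oplus> comb_vec B ((!) zs) V i)
    (\<lambda>xs zs. affine_pt u Y m ((!) xs) i \<oplus> \<zero>) (\<lambda>xs zs. \<zero> \<oplus> comb_vec B ((!) zs) V i)"
proof -
  have c: "u i \<in> carrier R" "j < m \<Longrightarrow> Y j i \<in> carrier R" "j < B \<Longrightarrow> V j i \<in> carrier R" for j
    using u Y V i by (auto simp: scalars_def)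
  have zz: "fsum K (\<lambda>j. \<zero>) = \<zero>" for K by (rule fsum_zero) simp
  have 1: "expands m B 1 (\<lambda>xs zs. xs ! j \<otimes> Y j i) (\<lambda>xs zs. xs ! j \<otimes> Y j i) (\<lambda>xs zs. \<zero>)" if "j < m" for j
  proof -
    have e: "expands m B (1 + 0) (\<lambda>xs zs. xs ! j \<otimes> Y j i) (\<lambda>xs zs. xs ! j \<otimes> Y j i)
        (\<lambda>xs zs. xs ! j \<otimes> \<zero> \<oplus> \<zero> \<otimes> Y j i)"
      by (intro expands_mult expands_fixed_var expands_const c that)
    obtain L where L: "wf_terms (m + B) (1 + 0) L" "\<And>xs zs. xs \<in> points (carrier R) m \<Longrightarrow> zs \<in> points (carrier R) B \<Longrightarrow>
        xs ! j \<otimes> Y j i = term_eval L (xs @ zs) \<and> xs ! j \<otimes> Y j i = term_eval (part m 0 L) (xs @ zs) \<and>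
        xs ! j \<otimes> \<zero> \<oplus> \<zero> \<otimes> Y j i = term_eval (part m 1 L) (xs @ zs)"
      by (rule expandsE[OF e]) blast
    show ?thesis
    proof (rule expandsI)
      show "wf_terms (m + B) 1 L" using L(1) by simp
      fix xs zs assume x: "xs \<in> points (carrier R) m" "zs \<in> points (carrier R) B"
      have e0: "xs ! j \<otimes> \<zero> \<oplus> \<zero> \<otimes> Y j i = \<zero>" using nth_points[OF x(1) that] c(2)[OF that] by simp
      show "xs ! j \<otimes> Y j i = term_eval L (xs @ zs) \<and> xs ! j \<otimes> Y j i = term_eval (part m 0 L) (xs @ zs) \<and>
        \<zero> = term_eval (part m 1 L) (xs @ zs)" using L(2)[OF x] unfolding e0 .
    qed
  qed
  have 2: "expands m B 1 (\<lambda>xs zs. zs ! j \<otimes> V j i) (\<lambda>xs zs. \<zero>) (\<lambda>xs zs. zs ! j \<otimes> V j i)" if "j < B" for j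
  proof -
    have e: "expands m B (1 + 0) (\<lambda>xs zs. zs ! j \<otimes> V j i) (\<lambda>xs zs. \<zero> \<otimes> V j i)
        (\<lambda>xs zs. \<zero> \<otimes> \<zero> \<oplus> zs ! j \<otimes> V j i)"
      by (intro expands_mult expands_new_var expands_const c that)
    obtain L where L: "wf_terms (m + B) (1 + 0) L" "\<And>xs zs. xs \<in> points (carrier R) m \<Longrightarrow> zs \<in> points (carrier R) B \<Longrightarrow>
        zs ! j \<otimes> V j i = term_eval L (xs @ zs) \<and> \<zero> \<otimes> V j i = term_eval (part m 0 L) (xs @ zs) \<and>
        \<zero> \<otimes> \<zero> \<oplus> zs ! j \<otimes> V j i = term_eval (part m 1 L) (xs @ zs)"
      by (rule expandsE[OF e]) blast
    show ?thesis
    proof (rule expandsI)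
      show "wf_terms (m + B) 1 L" using L(1) by simp
      fix xs zs assume x: "xs \<in> points (carrier R) m" "zs \<in> points (carrier R) B"
      have e0: "\<zero> \<otimes> \<zero> \<oplus> zs ! j \<otimes> V j i = zs ! j \<otimes> V j i" "\<zero> \<otimes> V j i = \<zero>"
        using nth_points[OF x(2) that] c(3)[OF that] by simp_all
      show "zs ! j \<otimes> V j i = term_eval L (xs @ zs) \<and> \<zero> = term_eval (part m 0 L) (xs @ zs) \<and>
        zs ! j \<otimes> V j i = term_eval (part m 1 L) (xs @ zs)" using L(2)[OF x] unfolding e0 .
    qed
  qed
  have a: "expands m B 1 (\<lambda>xs zs. fsum m (\<lambda>j. xs ! j \<otimes> Y j i)) (\<lambda>xs zs. fsum m (\<lambda>j. xs ! j \<otimes> Y j i)) (\<lambda>xs zs. \<zero>)"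
    using expands_fsum[of m m B 1 "\<lambda>j xs zs. xs ! j \<otimes> Y j i" "\<lambda>j xs zs. xs ! j \<otimes> Y j i" "\<lambda>j xs zs. \<zero>", OF 1] zz by simp
  have b: "expands m B 1 (\<lambda>xs zs. fsum B (\<lambda>j. zs ! j \<otimes> V j i)) (\<lambda>xs zs. \<zero>) (\<lambda>xs zs. fsum B (\<lambda>j. zs ! j \<otimes> V j i))"
    using expands_fsum[of B m B 1 "\<lambda>j xs zs. zs ! j \<otimes> V j i" "\<lambda>j xs zs. \<zero>" "\<lambda>j xs zs. zs ! j \<otimes> V j i", OF 2] zz by simp
  have "expands m B 1 (\<lambda>xs zs. (u i \<oplus> fsum m (\<lambda>j. xs ! j \<otimes> Y j i)) \<oplus> fsum B (\<lambda>j. zs ! j \<otimes> V j i))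
    (\<lambda>xs zs. (u i \<oplus> fsum m (\<lambda>j. xs ! j \<otimes> Y j i)) \<oplus> \<zero>) (\<lambda>xs zs. (\<zero> \<oplus> \<zero>) \<oplus> fsum B (\<lambda>j. zs ! j \<otimes> V j i))"
    by (intro expands_add expands_const a b c)
  then show ?thesis by (simp add: affine_pt_def comb_vec_def)
qed

lemma points_scalars: "xs \<in> points (carrier R) m \<Longrightarrow> scalars m ((!) xs)"
  by (auto simp: scalars_def points_def)

lemma scalars_points: "scalars m c \<Longrightarrow> map c [0..<m] \<in> points (carrier R) m"
  by (auto simp: scalars_def points_def)

text \<open>The link between the formal expansion and the quantities that the machine evaluates,
  namely values and gradients at points of the affine subspace.\<close>

lemma expands_value:
  assumes u: "scalars n u" and Y: "\<And>j. j < m \<Longrightarrow> scalars n (Y j)" and V: "\<And>j. j < B \<Longrightarrow> scalars n (V j)"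
    and f: "wf_terms n d f"
  shows "expands m B d (\<lambda>xs zs. poly_value n f (\<lambda>i. affine_pt u Y m ((!) xs) i \<oplus> comb_vec B ((!) zs) V i))
    (\<lambda>xs zs. poly_value n f (affine_pt u Y m ((!) xs)))
    (\<lambda>xs zs. dot n (gradient n f (affine_pt u Y m ((!) xs))) (comb_vec B ((!) zs) V))"
proof -
  let ?y = "\<lambda>xs zs i. affine_pt u Y m ((!) xs) i \<oplus> comb_vec B ((!) zs) V i"
  let ?x = "\<lambda>xs (zs :: 'a list) i. affine_pt u Y m ((!) xs) i \<oplus> \<zero>"
  let ?w = "\<lambda>(xs :: 'a list) zs i. \<zero> \<oplus> comb_vec B ((!) zs) V i"
  have "expands m B d (\<lambda>xs zs. fst (dual_poly (?y xs zs) (?w xs zs) n f (length f)))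
    (\<lambda>xs zs. fst (dual_poly (?x xs zs) (?w xs zs) n f (length f)))
    (\<lambda>xs zs. snd (dual_poly (?x xs zs) (?w xs zs) n f (length f)))"
    by (rule expands_dual_poly[OF expands_affine_pt[OF u Y V] f])
  then obtain L where L: "wf_terms (m + B) d L"
    "\<And>xs zs. xs \<in> points (carrier R) m \<Longrightarrow> zs \<in> points (carrier R) B \<Longrightarrow>
      fst (dual_poly (?y xs zs) (?w xs zs) n f (length f)) = term_eval L (xs @ zs) \<and>
      fst (dual_poly (?x xs zs) (?w xs zs) n f (length f)) = term_eval (part m 0 L) (xs @ zs) \<and>
      snd (dual_poly (?x xs zs) (?w xs zs) n f (length f)) = term_eval (part m 1 L) (xs @ zs)"
    by (rule expandsE) blast
  show ?thesis
  proof (rule expandsI[OF L(1)])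
    fix xs zs assume x: "xs \<in> points (carrier R) m" "zs \<in> points (carrier R) B"
    have pt: "scalars n (affine_pt u Y m ((!) xs))"
      unfolding scalars_def
      by (intro allI impI affine_pt_closed[of u _ m "(!) xs" n Y]) (use u Y points_scalars[OF x(1)] in \<open>auto simp: scalars_def\<close>)
    have cv: "scalars n (comb_vec B ((!) zs) V)"
      by (rule scalars_comb_vec[OF points_scalars[OF x(2)] V])
    have "poly_value n f (?y xs zs) = fst (dual_poly (?y xs zs) (?w xs zs) n f (length f))"
      unfolding poly_value_def by (rule fst_dual_poly)
    moreover have "poly_value n f (affine_pt u Y m ((!) xs)) = fst (dual_poly (?x xs zs) (?w xs zs) n f (length f))"
    proof -
      have "poly_value n f (affine_pt u Y m ((!) xs)) = poly_value n f (?x xs zs)"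
        by (rule poly_value_cong) (use pt in \<open>auto simp: scalars_def\<close>)
      also have "\<dots> = fst (dual_poly (?x xs zs) (?w xs zs) n f (length f))"
        unfolding poly_value_def by (rule fst_dual_poly)
      finally show ?thesis .
    qed
    moreover have "dot n (gradient n f (affine_pt u Y m ((!) xs))) (comb_vec B ((!) zs) V)
        = snd (dual_poly (?x xs zs) (?w xs zs) n f (length f))"
    proof -
      have "dual_poly (?x xs zs) (?w xs zs) n f (length f) = dual_poly (affine_pt u Y m ((!) xs)) (comb_vec B ((!) zs) V) n f (length f)"
        by (rule dual_poly_cong) (use pt cv in \<open>auto simp: scalars_def\<close>)
      then show ?thesis using dot_gradient[OF pt cv f] by simp
    qed
    ultimately show "poly_value n f (?y xs zs) = term_eval L (xs @ zs) \<and>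
      poly_value n f (affine_pt u Y m ((!) xs)) = term_eval (part m 0 L) (xs @ zs) \<and>
      dot n (gradient n f (affine_pt u Y m ((!) xs))) (comb_vec B ((!) zs) V) = term_eval (part m 1 L) (xs @ zs)"
      using L(2)[OF x] by simp
  qed
qed

text \<open>Staying in the kernel removes the part of degree 1, and \<open>exists_direction\<close>
  removes all higher parts; only the value at the old point is left.\<close>

lemma next_direction:
  assumes fin: "finite (carrier R)" and u: "scalars n u" and Y: "\<And>j. j < m \<Longrightarrow> scalars n (Y j)"
    and V: "\<And>j. j < B \<Longrightarrow> scalars n (V j)" and f: "wf_terms n d f"
    and grad: "\<And>c j. scalars m c \<Longrightarrow> j < B \<Longrightarrow> dot n (gradient n f (affine_pt u Y m c)) (V j) = \<zero>"
    and deg: "(\<Sum>j=2..d. j * ((m + (d - j)) choose (d - j))) < B"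
  shows "\<exists>z. scalars B z \<and> (\<exists>j<B. z j \<noteq> \<zero>) \<and> (\<forall>c t. scalars m c \<longrightarrow> t \<in> carrier R \<longrightarrow>
    poly_value n f (\<lambda>i. affine_pt u Y m c i \<oplus> t \<otimes> comb_vec B z V i) = poly_value n f (affine_pt u Y m c))"
proof -
  have ex: "expands m B d (\<lambda>xs zs. poly_value n f (\<lambda>i. affine_pt u Y m ((!) xs) i \<oplus> comb_vec B ((!) zs) V i))
    (\<lambda>xs zs. poly_value n f (affine_pt u Y m ((!) xs)))
    (\<lambda>xs zs. dot n (gradient n f (affine_pt u Y m ((!) xs))) (comb_vec B ((!) zs) V))"
    by (rule expands_value[OF u _ _ f]) (use Y V in auto)
  obtain zs where zs: "zs \<in> points (carrier R) B" "zs \<noteq> replicate B \<zero>"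
    "\<And>xs t. xs \<in> points (carrier R) m \<Longrightarrow> t \<in> carrier R \<Longrightarrow>
      poly_value n f (\<lambda>i. affine_pt u Y m ((!) xs) i \<oplus> comb_vec B ((!) (map (\<lambda>z. t \<otimes> z) zs)) V i)
      = poly_value n f (affine_pt u Y m ((!) xs)) \<oplus>
        dot n (gradient n f (affine_pt u Y m ((!) xs))) (comb_vec B ((!) (map (\<lambda>z. t \<otimes> z) zs)) V)"
    using exists_direction[OF fin ex deg] by blast
  have len: "length zs = B" using zs(1) by (simp add: points_def)
  show ?thesis
  proof (intro exI[of _ "(!) zs"] conjI allI impI)
    show "scalars B ((!) zs)" by (rule points_scalars[OF zs(1)])
    show "\<exists>j<B. zs ! j \<noteq> \<zero>"
    proof (rule ccontr)
      assume "\<not> ?thesis"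
      then have "zs = replicate B \<zero>" using len by (intro nth_equalityI) auto
      with zs(2) show False by simp
    qed
    fix c t assume c: "scalars m c" and t: "t \<in> carrier R"
    let ?xs = "map c [0..<m]" and ?tz = "map (\<lambda>z. t \<otimes> z) zs"
    have xs: "?xs \<in> points (carrier R) m" by (rule scalars_points[OF c])
    have pc: "affine_pt u Y m ((!) ?xs) = affine_pt u Y m c" by (rule affine_pt_cong) simp
    have tz: "?tz \<in> points (carrier R) B" using zs(1) t by (auto simp: points_def)
    have zc: "zs ! j \<in> carrier R" if "j < B" for j using nth_points[OF zs(1) that] .
    have cv: "comb_vec B ((!) ?tz) V i = t \<otimes> comb_vec B ((!) zs) V i" if "i < n" for i
    proof -
      have Vi: "V j i \<in> carrier R" if "j < B" for j using V[OF that] \<open>i < n\<close> by (simp add: scalars_def)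
      have "t \<otimes> comb_vec B ((!) zs) V i = fsum B (\<lambda>j. t \<otimes> (zs ! j \<otimes> V j i))"
        unfolding comb_vec_def by (rule fsum_smult) (use t zc Vi in auto)
      also have "\<dots> = comb_vec B ((!) ?tz) V i"
        unfolding comb_vec_def by (intro fsum_cong) (use t zc Vi len in \<open>simp add: m_assoc\<close>)
      finally show ?thesis by simp
    qed
    have pt: "scalars n (affine_pt u Y m c)"
      unfolding scalars_def
      by (intro allI impI affine_pt_closed[of u _ m c n Y]) (use u Y c in \<open>auto simp: scalars_def\<close>)
    have vc: "poly_value n f (affine_pt u Y m c) \<in> carrier R"
      unfolding poly_value_def by (rule dual_poly_closed(1)[OF _ _ f]) (use pt in \<open>auto simp: scalars_def\<close>)
    have "dot n (gradient n f (affine_pt u Y m c)) (comb_vec B ((!) ?tz) V)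
        = fsum B (\<lambda>j. ?tz ! j \<otimes> dot n (gradient n f (affine_pt u Y m c)) (V j))"
      by (rule dot_comb_vec[OF gradient_closed[OF pt f] points_scalars[OF tz] V])
    also have "\<dots> = \<zero>"
      by (rule fsum_zero) (use grad[OF c] points_scalars[OF tz] in \<open>auto simp: scalars_def\<close>)
    finally have d0: "dot n (gradient n f (affine_pt u Y m c)) (comb_vec B ((!) ?tz) V) = \<zero>" .
    have "poly_value n f (\<lambda>i. affine_pt u Y m c i \<oplus> t \<otimes> comb_vec B ((!) zs) V i)
        = poly_value n f (\<lambda>i. affine_pt u Y m c i \<oplus> comb_vec B ((!) ?tz) V i)"
      by (rule poly_value_cong) (simp add: cv)
    also have "\<dots> = poly_value n f (affine_pt u Y m c)"
      using zs(3)[OF xs t] d0 vc unfolding pc by simp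
    finally show "poly_value n f (\<lambda>i. affine_pt u Y m c i \<oplus> t \<otimes> comb_vec B ((!) zs) V i) = poly_value n f (affine_pt u Y m c)" .
  qed
qed

text \<open>Few of the functionals are independent: they all vanish where the coefficients of the
  linear part of the expansion and the pivot coordinates do.\<close>

lemma kernel_dim_bound:
  assumes fin: "finite (carrier R)" and u: "scalars n u" and Y: "\<And>j. j < m \<Longrightarrow> scalars n (Y j)"
    and f: "wf_terms n d f" and kb: "kernel_basis n \<G> V N" and piv: "\<And>j. j < k \<Longrightarrow> piv j < n"
    and \<G>: "\<And>g. g \<in> \<G> \<Longrightarrow>
      (\<exists>c. scalars m c \<and> (\<forall>i<n. g i = gradient n f (affine_pt u Y m c) i)) \<or>
      (\<exists>j<k. \<forall>i<n. g i = unit_vec (piv j) i)"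
  shows "n \<le> N + (((m + (d - 1)) choose (d - 1)) + k)"
proof -
  \<comment> \<open>With the unit vectors as new directions, the expansion covers every vector of
    the space.\<close>
  let ?E = "\<lambda>j. unit_vec j"
  let ?M = "(m + (d - 1)) choose (d - 1)"
  have E: "scalars n (?E j)" for j by (simp add: scalars_def)
  have cvE: "comb_vec n c ?E i = c i" if "scalars n c" "i < n" for c i
    unfolding comb_vec_def
    by (subst fsum_single[of i]) (use that in \<open>auto simp: scalars_def\<close>)
  have ex: "expands m n d (\<lambda>xs zs. poly_value n f (\<lambda>i. affine_pt u Y m ((!) xs) i \<oplus> comb_vec n ((!) zs) ?E i))
    (\<lambda>xs zs. poly_value n f (affine_pt u Y m ((!) xs)))
    (\<lambda>xs zs. dot n (gradient n f (affine_pt u Y m ((!) xs))) (comb_vec n ((!) zs) ?E))"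
    by (rule expands_value[OF u _ _ f]) (use Y E in auto)
  obtain h where h: "(\<forall>k<?M. \<forall>zs\<in>points (carrier R) n. h k zs \<in> carrier R) \<and>
    (\<forall>k<?M. \<forall>zs\<in>points (carrier R) n. \<forall>ws\<in>points (carrier R) n.
       h k zs = h k ws \<longrightarrow> h k (map2 (\<lambda>x y. x \<ominus> y) zs ws) = \<zero>) \<and>
    (\<forall>zs\<in>points (carrier R) n. (\<forall>k<?M. h k zs = \<zero>) \<longrightarrow> (\<forall>xs\<in>points (carrier R) m.
       dot n (gradient n f (affine_pt u Y m ((!) xs))) (comb_vec n ((!) zs) ?E) = \<zero>))"
    using linear_part_coeffs[OF ex] by (rule exE)
  note h1 = conjunct1[OF h, rule_format] and h2 = conjunct1[OF conjunct2[OF h], rule_format]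
    and h3 = conjunct2[OF conjunct2[OF h]]
  let ?l = "\<lambda>v. map v [0..<n]"
  define H where "H = (\<lambda>j v. if j < ?M then h j (?l v) else v (piv (j - ?M)))"
  show ?thesis
  proof (rule kernel_basis_card[OF fin kb, where h = H])
    fix j v assume j: "j < ?M + k" and v: "scalars n v"
    show "H j v \<in> carrier R"
      using j h1[of j, OF _ scalars_points[OF v]] v piv[of "j - ?M"] by (auto simp: H_def scalars_def)
  next
    fix j v w assume j: "j < ?M + k" and v: "scalars n v" and w: "scalars n w" and eq: "H j v = H j w"
    show "H j (\<lambda>i. v i \<ominus> w i) = \<zero>"
    proof (cases "j < ?M")
      case True
      have "?l (\<lambda>i. v i \<ominus> w i) = map2 (\<lambda>x y. x \<ominus> y) (?l v) (?l w)"
        by (rule nth_equalityI) auto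
      then show ?thesis
        using h2[OF True scalars_points[OF v] scalars_points[OF w]] eq True by (simp add: H_def)
    next
      case False
      then have "w (piv (j - ?M)) \<in> carrier R" using w piv[of "j - ?M"] j by (auto simp: scalars_def)
      then show ?thesis using eq False by (simp add: H_def minus_eq r_neg)
    qed
  next
    fix g v assume g: "g \<in> \<G>" and v: "scalars n v" and H0: "\<And>j. j < ?M + k \<Longrightarrow> H j v = \<zero>"
    show "dot n g v = \<zero>"
    proof (cases "\<exists>c. scalars m c \<and> (\<forall>i<n. g i = gradient n f (affine_pt u Y m c) i)")
      case True
      then obtain c where c: "scalars m c" "\<forall>i<n. g i = gradient n f (affine_pt u Y m c) i" by blast
      have h0: "\<forall>k<?M. h k (?l v) = \<zero>"
      proof (intro allI impI)
        fix k' assume "k' < ?M"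
        then show "h k' (?l v) = \<zero>" using H0[of k'] by (simp add: H_def)
      qed
      have pc: "affine_pt u Y m ((!) (map c [0..<m])) = affine_pt u Y m c" by (rule affine_pt_cong) simp
      have "dot n g v = dot n (gradient n f (affine_pt u Y m c)) (comb_vec n ((!) (?l v)) ?E)"
        unfolding dot_def
        by (intro fsum_cong) (use c(2) cvE[OF points_scalars[OF scalars_points[OF v]]] in simp)
      also have "\<dots> = \<zero>"
        using bspec[OF mp[OF bspec[OF h3 scalars_points[OF v]] h0] scalars_points[OF c(1)]] unfolding pc .
      finally show ?thesis .
    next
      case False
      then obtain j where j: "j < k" "\<forall>i<n. g i = unit_vec (piv j) i" using \<G>[OF g] by blast
      have "dot n g v = g (piv j) \<otimes> v (piv j)"
        unfolding dot_def
        by (rule fsum_single[OF piv[OF j(1)]]) (use j piv[OF j(1)] v in \<open>auto simp: scalars_def\<close>)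
      also have "\<dots> = v (piv j)" using j piv[OF j(1)] v by (auto simp: scalars_def)
      also have "\<dots> = H (?M + j) v" by (simp add: H_def)
      also have "\<dots> = \<zero>" by (rule H0) (use j in simp)
      finally show ?thesis .
    qed
  qed
qed

text \<open>Strong induction on \<open>j\<close>: in the pivot coordinate of \<open>j\<close> all
  later vectors vanish, and the earlier coefficients are already zero, so only the
  \<open>j\<close>-th term of the relation survives.\<close>

lemma triangular_indep:
  assumes Y: "\<And>j. j < m \<Longrightarrow> scalars n (Y j)" and piv: "\<And>j. j < m \<Longrightarrow> piv j < n"
    and nz: "\<And>j. j < m \<Longrightarrow> Y j (piv j) \<noteq> \<zero>"
    and tri: "\<And>i j. i < j \<Longrightarrow> j < m \<Longrightarrow> Y j (piv i) = \<zero>"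
  shows "indep n Y m"
  unfolding indep_def
proof (intro allI impI)
  fix c j assume c: "scalars m c \<and> (\<forall>k<n. comb_vec m c Y k = \<zero>)" and "j < m"
  from \<open>j < m\<close> show "c j = \<zero>"
  proof (induction j rule: less_induct)
    case (less j)
    have cc: "c i \<in> carrier R" if "i < m" for i using c that by (simp add: scalars_def)
    have Yc: "Y i (piv j) \<in> carrier R" if "i < m" for i using Y[OF that] piv[OF less.prems] by (simp add: scalars_def)
    have "comb_vec m c Y (piv j) = c j \<otimes> Y j (piv j)"
      unfolding comb_vec_def
    proof (rule fsum_single[OF less.prems])
      fix i assume i: "i < m" "i \<noteq> j"
      show "c i \<otimes> Y i (piv j) = \<zero>"
      proof (cases "i < j")
        case True
        then show ?thesis using less.IH[OF True i(1)] Yc[OF i(1)] by simp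
      next
        case False
        then show ?thesis using tri[of j i] i cc[OF i(1)] by simp
      qed
    qed (use cc Yc less.prems in auto)
    then have "c j \<otimes> Y j (piv j) = \<zero>" using c piv[OF less.prems] by simp
    then show ?case using nz[OF less.prems] cc[OF less.prems] Yc[OF less.prems] by (simp add: integral_iff)
  qed
qed

end

context coded begin

text \<open>\<open>poly_fun\<close> sums over a set, evaluation over a list. They agree because the
  exponent lists, and hence the terms, are distinct.\<close>

lemma poly_fun_eq_value:
  assumes f: "polynomial_in F n f" and x: "\<And>i. i < n \<Longrightarrow> x i \<in> carrier F"
  shows "poly_fun F n f x = poly_value n f x"
proof -
  have a: "fst (f ! t) \<in> carrier F" if "t < length f" for t
    using f nth_mem[OF that] by (auto simp: polynomial_in_def case_prod_unfold)
  let ?g = "\<lambda>m. fst m \<otimes> (\<Otimes>i\<in>{..<n}. x i [^] (snd m ! i))"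
  have gc: "?g (f ! t) \<in> carrier F" if "t < length f" for t
    using a[OF that] x by (intro m_closed finprod_closed) auto
  have dist: "distinct f" using f unfolding polynomial_in_def by (auto simp: distinct_map)
  have "poly_value n f x = fsum (length f) (\<lambda>t. fst (dual_mono x (\<lambda>_. \<zero>) (f ! t) n))"
    by (simp add: poly_value_def dual_poly_def)
  also have "\<dots> = fsum (length f) (\<lambda>t. ?g (f ! t))"
    by (intro fsum_cong fst_dual_mono_eq x a)
  also have "\<dots> = (\<Oplus>t\<in>{..<length f}. ?g (f ! t))"
    by (rule fsum_eq_finsum) (rule gc)
  also have "\<dots> = (\<Oplus>m\<in>(!) f ` {..<length f}. ?g m)"
  proof (rule finsum_reindex[symmetric])
    show "inj_on ((!) f) {..<length f}" using dist by (auto simp: inj_on_def nth_eq_iff_index_eq)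
    show "?g \<in> (!) f ` {..<length f} \<rightarrow> carrier F" using gc by auto
  qed
  also have "(!) f ` {..<length f} = set f" by (auto simp: set_conv_nth)
  finally show ?thesis by (simp add: poly_fun_def)
qed

lemma exists_digits:
  assumes "\<And>j. j < m \<Longrightarrow> c j < q"
  shows "\<exists>x<q ^ m. \<forall>j<m. x div q ^ j mod q = c j"
  using digit_sum_less[of m c q] digit_of_digit_sum[of m c q] assms by blast

text \<open>Passage from numbered families to sets of vectors. Injectivity comes first, since a
  repeated vector would be lost in the image.\<close>

lemma basis_of_indep:
  assumes Y: "\<And>j. j < m \<Longrightarrow> scalars n (Y j)" and ind: "indep n Y m"
  defines "B \<equiv> (\<lambda>j. \<lambda>i\<in>{..<n}. Y j i) ` {..<m}"
  shows "inj_on (\<lambda>j. \<lambda>i\<in>{..<n}. Y j i) {..<m}"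
    and "B \<subseteq> carrier (affine_space F n)"
    and "\<not> module.lin_dep F (affine_space F n) B"
    and "\<And>v. v \<in> module.span F (affine_space F n) B \<Longrightarrow>
      \<exists>c. scalars m c \<and> (\<forall>i<n. v i = comb_vec m c Y i)"
proof -
  interpret V: vectorspace F "affine_space F n" by (rule vectorspace_affine)
  let ?y = "\<lambda>j. \<lambda>i\<in>{..<n}. Y j i"
  have Yc: "Y j i \<in> carrier F" if "j < m" "i < n" for j i using Y[OF that(1)] that(2) by (simp add: scalars_def)
  show inj: "inj_on ?y {..<m}"
  proof (rule inj_onI, rule ccontr)
    fix a b assume ab: "a \<in> {..<m}" "b \<in> {..<m}" "?y a = ?y b" "a \<noteq> b"
    \<comment> \<open>Two equal vectors would satisfy the relation with coefficients
      \<open>\<one>\<close> and \<open>\<ominus> \<one>\<close>.\<close>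
    define c where "c = (\<lambda>j. if j = a then \<one> else if j = b then \<ominus> \<one> else \<zero>)"
    have c: "scalars m c" by (simp add: c_def scalars_def)
    have "comb_vec m c Y k = \<zero>" if k: "k < n" for k
    proof -
      have eq: "Y a k = Y b k" using fun_cong[OF ab(3), of k] k by simp
      let ?g = "\<lambda>j. if j = a then Y a k else \<zero>" and ?h = "\<lambda>j. if j = b then \<ominus> Y a k else \<zero>"
      have "comb_vec m c Y k = fsum m (\<lambda>j. ?g j \<oplus> ?h j)"
        unfolding comb_vec_def
        by (intro fsum_cong) (use ab(1,2,4) eq Yc k in \<open>auto simp: c_def l_minus\<close>)
      also have "\<dots> = fsum m ?g \<oplus> fsum m ?h"
        by (rule fsum_add) (use ab(1,2) Yc k in auto)
      also have "fsum m ?g = Y a k" using fsum_single[of a m ?g] ab(1) Yc k by simp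
      also have "fsum m ?h = \<ominus> Y a k" using fsum_single[of b m ?h] ab(1,2) Yc k by simp
      finally show ?thesis using ab(1) Yc k by (simp add: r_neg)
    qed
    with ind c have "c a = \<zero>" using ab(1) unfolding indep_def by blast
    then show False by (simp add: c_def)
  qed
  show BV: "B \<subseteq> carrier (affine_space F n)"
    using Yc unfolding B_def carrier_affine by (auto intro!: restrict_PiE_iff[THEN iffD2] simp del: restrict_PiE_iff)
  have finB: "finite B" by (simp add: B_def)
  have lc: "V.lincomb a B i = comb_vec m (\<lambda>j. a (?y j)) Y i" if a: "a \<in> B \<rightarrow> carrier F" and i: "i < n" for a i
  proof -
    have ac: "a (?y j) \<in> carrier F" if "j < m" for j using a that by (auto simp: B_def)
    have "V.lincomb a B i = (\<Oplus>v\<in>B. a v \<otimes> v i)" by (rule lincomb_affine[OF finB BV a i])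
    also have "\<dots> = (\<Oplus>j\<in>{..<m}. a (?y j) \<otimes> ?y j i)"
      unfolding B_def by (rule finsum_reindex[OF _ inj]) (use ac Yc i in auto)
    also have "\<dots> = fsum m (\<lambda>j. a (?y j) \<otimes> ?y j i)"
      by (rule fsum_eq_finsum[symmetric]) (use ac Yc i in auto)
    also have "\<dots> = comb_vec m (\<lambda>j. a (?y j)) Y i"
      unfolding comb_vec_def by (intro fsum_cong) (use i in simp)
    finally show ?thesis .
  qed
  show "\<not> V.lin_dep B"
  proof (rule V.finite_lin_indpt2[OF finB BV])
    fix a assume a: "a \<in> B \<rightarrow> carrier F" and z: "V.lincomb a B = \<zero>\<^bsub>affine_space F n\<^esub>"
    have "comb_vec m (\<lambda>j. a (?y j)) Y i = \<zero>" if "i < n" for i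
      using lc[OF a that] z that by (simp add: zero_affine)
    moreover have "scalars m (\<lambda>j. a (?y j))" using a by (auto simp: scalars_def B_def)
    ultimately have "\<forall>j<m. a (?y j) = \<zero>" using ind unfolding indep_def by blast
    then show "\<forall>v\<in>B. a v = \<zero>" by (auto simp: B_def)
  qed
  fix v assume "v \<in> V.span B"
  then obtain a where a: "a \<in> B \<rightarrow> carrier F" "v = V.lincomb a B"
    unfolding V.finite_span[OF finB BV] by blast
  have "scalars m (\<lambda>j. a (?y j))" using a(1) by (auto simp: scalars_def B_def)
  then show "\<exists>c. scalars m c \<and> (\<forall>i<n. v i = comb_vec m c Y i)"
    using lc[OF a(1)] a(2) by blast
qed

end

section \<open>Bounded runs of programs\<close>

lemma bits_pos: "0 < bits x"
  by (simp add: bits_def)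

lemma bits_le_iff: "0 < k \<Longrightarrow> bits x \<le> k \<longleftrightarrow> x < 2 ^ k"
  by (auto simp: bits_def floorlog_le_iff)

lemma less_two_power_bits: "x < 2 ^ bits x"
  using bits_le_iff[of "bits x" x] bits_pos[of x] by simp

lemma bits_mono: "x \<le> y \<Longrightarrow> bits x \<le> bits y"
  using bits_le_iff[of "bits y" x] bits_pos[of y] less_two_power_bits[of y] by simp

lemma bits_add: "bits (x + y) \<le> bits x + bits y"
proof -
  have "x + 1 \<le> 2 ^ bits x" "y + 1 \<le> 2 ^ bits y"
    using less_two_power_bits[of x] less_two_power_bits[of y] by auto
  then have "(x + 1) * (y + 1) \<le> 2 ^ (bits x + bits y)"
    unfolding power_add by (intro mult_mono) auto
  then show ?thesis
    using bits_le_iff[of "bits x + bits y" "x + y"] bits_pos[of x] by (simp add: algebra_simps)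
qed

lemma bits_mult: "bits (x * y) \<le> bits x + bits y"
proof -
  have "x * y < 2 ^ bits x * 2 ^ bits y"
    using less_two_power_bits[of x] less_two_power_bits[of y] by (intro mult_strict_mono') auto
  then show ?thesis
    using bits_le_iff[of "bits x + bits y" "x * y"] bits_pos[of x] by (simp add: power_add)
qed

lemma bits_le_Suc: "bits x \<le> x + 1"
  using bits_le_iff[of "x + 1" x] less_exp[of x] by simp

text \<open>Chosen so that a value has at most \<open>expr_size e\<close> times as many bits as
  \<open>R\<close>, the bound for the cells; this is why constants count with their bit
  length.\<close>

fun expr_size :: "expr \<Rightarrow> nat" where
  "expr_size (Const k) = bits k"
| "expr_size (Cell a e) = Suc (expr_size e)"
| "expr_size (Add e1 e2) = Suc (expr_size e1 + expr_size e2)"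
| "expr_size (Sub e1 e2) = Suc (expr_size e1 + expr_size e2)"
| "expr_size (Mul e1 e2) = Suc (expr_size e1 + expr_size e2)"
| "expr_size (Divide e1 e2) = Suc (expr_size e1 + expr_size e2)"
| "expr_size (Modulo e1 e2) = Suc (expr_size e1 + expr_size e2)"

fun reads :: "expr \<Rightarrow> nat set" where
  "reads (Const k) = {}"
| "reads (Cell a e) = insert a (reads e)"
| "reads (Add e1 e2) = reads e1 \<union> reads e2"
| "reads (Sub e1 e2) = reads e1 \<union> reads e2"
| "reads (Mul e1 e2) = reads e1 \<union> reads e2"
| "reads (Divide e1 e2) = reads e1 \<union> reads e2"
| "reads (Modulo e1 e2) = reads e1 \<union> reads e2"

fun writes :: "prog \<Rightarrow> nat set" where
  "writes Skip = {}"
| "writes (Assign a e1 e2) = {a}"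
| "writes (Seq c1 c2) = writes c1 \<union> writes c2"
| "writes (Cond e c1 c2) = writes c1 \<union> writes c2"
| "writes (While e c) = writes c"

definition frame :: "nat set \<Rightarrow> store \<Rightarrow> store \<Rightarrow> bool" where
  "frame A s s' \<longleftrightarrow> (\<forall>a. a \<notin> A \<longrightarrow> s' a = s a)"

lemma frameD: "frame A s s' \<Longrightarrow> a \<notin> A \<Longrightarrow> s' a = s a"
  by (simp add: frame_def)

lemma exec_frame: "exec c s s' t m \<Longrightarrow> frame (writes c) s s'"
  by (induction rule: exec.induct) (auto simp: frame_def)

lemma aval_frame: "frame A s s' \<Longrightarrow> reads e \<inter> A = {} \<Longrightarrow> aval e s' = aval e s"
  by (induction e) (auto simp: frame_def Int_Un_distrib2)

text \<open>\<open>NA\<close> bounds the array names and \<open>IX\<close> the indices, while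
  \<open>R\<close> bounds both the cell contents and the iterations of each loop execution.\<close>

locale machine =
  fixes NA IX R :: nat
  assumes IX_pos: "0 < IX" and R_pos: "0 < R"
begin

definition ok :: "store \<Rightarrow> bool" where
  "ok s \<longleftrightarrow> (\<forall>a i. s a i \<noteq> 0 \<longrightarrow> a < NA \<and> i < IX \<and> s a i \<le> R)"

definition max_size :: nat where
  "max_size = NA * IX * (bits IX + bits R)"

lemma ok_le: "ok s \<Longrightarrow> s a i \<le> R"
  unfolding ok_def by (metis le0)

lemma ok_store_size:
  assumes "ok s" shows "store_size s \<le> max_size"
proof -
  have sub: "support s \<subseteq> {..<NA} \<times> {..<IX}"
    using assms by (auto simp: support_def ok_def)
  have "store_size s \<le> (\<Sum>(a, i)\<in>support s. bits IX + bits R)"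
    unfolding store_size_def
  proof (rule sum_mono)
    fix x assume x: "x \<in> support s"
    obtain a i where [simp]: "x = (a, i)" by (cases x)
    have "i \<le> IX" "s a i \<le> R"
      using x assms by (auto simp: support_def ok_def less_imp_le)
    then show "(case x of (a, i) \<Rightarrow> bits i + bits (s a i)) \<le> (case x of (a, i) \<Rightarrow> bits IX + bits R)"
      by (simp add: add_mono bits_mono)
  qed
  also have "\<dots> = card (support s) * (bits IX + bits R)"
    by (simp add: case_prod_unfold)
  also have "\<dots> \<le> card ({..<NA} \<times> {..<IX}) * (bits IX + bits R)"
    by (intro mult_right_mono card_mono sub) auto
  finally show ?thesis
    by (simp add: max_size_def card_cartesian_product)
qed

lemma bits_aval: "ok s \<Longrightarrow> bits (aval e s) \<le> expr_size e * bits R"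
proof (induction e)
  case (Const k)
  then show ?case using bits_pos[of R] by simp
next
  case (Cell a e)
  then show ?case
    using bits_mono[OF ok_le[OF Cell(2), of a "aval e s"]] by simp
next
  case (Add e1 e2)
  then show ?case using bits_add[of "aval e1 s" "aval e2 s"] by (simp add: algebra_simps)
next
  case (Sub e1 e2)
  then show ?case using bits_mono[of "aval e1 s - aval e2 s" "aval e1 s"]
    by (simp add: algebra_simps)
next
  case (Mul e1 e2)
  then show ?case using bits_mult[of "aval e1 s" "aval e2 s"] by (simp add: algebra_simps)
next
  case (Divide e1 e2)
  then show ?case using bits_mono[of "aval e1 s div aval e2 s" "aval e1 s"]
    by (simp add: algebra_simps)
next
  case (Modulo e1 e2)
  then show ?case using bits_mono[of "aval e1 s mod aval e2 s" "aval e1 s"]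
    by (simp add: algebra_simps)
qed

text \<open>The squares reflect the quadratic cost of multiplication; the factor 3 leaves room in
  the induction for the lengths of the operands.\<close>

definition expr_bound :: "expr \<Rightarrow> nat" where
  "expr_bound e = 3 * (expr_size e)\<^sup>2 * (bits R)\<^sup>2"

lemma acost_le:
  assumes "ok s" shows "acost e s \<le> expr_bound e"
proof -
  define W where "W = bits R"
  have W: "1 \<le> W" using bits_pos[of R] by (simp add: W_def)
  then have WW: "W \<le> W\<^sup>2" by (simp add: power2_eq_square)
  have b: "bits (aval e s) \<le> expr_size e * W" for e
    using bits_aval[OF assms] by (simp add: W_def)
  have b2: "bits (aval e s) \<le> expr_size e * W\<^sup>2" for e
    using order.trans[OF b mult_le_mono2[OF WW]] .
  have bb: "bits (aval e1 s) * bits (aval e2 s) \<le> expr_size e1 * expr_size e2 * W\<^sup>2" for e1 e2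
    using mult_mono[OF b[of e1] b[of e2]] by (simp add: power2_eq_square algebra_simps)
  have "acost e s \<le> 3 * (expr_size e)\<^sup>2 * W\<^sup>2"
  proof (induction e)
    case (Const k)
    have "bits k \<le> (bits k)\<^sup>2 * W\<^sup>2"
      using bits_pos[of k] W by (simp add: power2_eq_square)
    then show ?case by simp
  next
    case (Cell a e)
    have "bits (s a (aval e s)) \<le> W" unfolding W_def by (rule bits_mono[OF ok_le[OF assms]])
    with Cell WW b2[of e] have "acost (Cell a e) s \<le> 3 * (expr_size e)\<^sup>2 * W\<^sup>2 + expr_size e * W\<^sup>2 + W\<^sup>2"
      by simp
    also have "\<dots> \<le> 3 * (Suc (expr_size e))\<^sup>2 * W\<^sup>2"
      by (simp add: power2_eq_square algebra_simps)
    finally show ?case by simp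
  next
    case (Add e1 e2)
    then show ?case using b2[of e1] b2[of e2]
      by (simp add: power2_eq_square algebra_simps)
  next
    case (Sub e1 e2)
    then show ?case using b2[of e1] b2[of e2]
      by (simp add: power2_eq_square algebra_simps)
  next
    case (Mul e1 e2)
    then show ?case using bb[of e1 e2]
      by (simp add: power2_eq_square algebra_simps)
  next
    case (Divide e1 e2)
    then show ?case using bb[of e1 e2]
      by (simp add: power2_eq_square algebra_simps)
  next
    case (Modulo e1 e2)
    then show ?case using bb[of e1 e2]
      by (simp add: power2_eq_square algebra_simps)
  qed
  then show ?thesis by (simp add: expr_bound_def W_def)
qed

text \<open>Time of a run in which every loop is iterated at most \<open>R\<close> times.\<close>

fun time_bound :: "prog \<Rightarrow> nat" where
  "time_bound Skip = 1"
| "time_bound (Assign a e1 e2) =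
     1 + expr_bound e1 + expr_bound e2 + expr_size e1 * bits R + expr_size e2 * bits R"
| "time_bound (Seq c1 c2) = time_bound c1 + time_bound c2"
| "time_bound (Cond e c1 c2) = 1 + expr_bound e + time_bound c1 + time_bound c2"
| "time_bound (While e c) = (R + 1) * (1 + expr_bound e + time_bound c)"

text \<open>Total correctness with the time and space bounds built in, so that every Hoare rule also
  accounts for the resources.\<close>

definition wp :: "prog \<Rightarrow> (store \<Rightarrow> bool) \<Rightarrow> store \<Rightarrow> bool" where
  "wp c Q s \<longleftrightarrow> (\<exists>s' t m. exec c s s' t m \<and> t \<le> time_bound c \<and> m \<le> max_size \<and> ok s' \<and> Q s')"

lemma wp_skip: "ok s \<Longrightarrow> Q s \<Longrightarrow> wp Skip Q s"
  unfolding wp_def using exec.Skip ok_store_size by fastforce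

lemma wp_assign:
  assumes "ok s" "a < NA" "aval e1 s < IX" "aval e2 s \<le> R"
    and "\<And>s'. ok s' \<Longrightarrow> s' = s(a := (s a)(aval e1 s := aval e2 s)) \<Longrightarrow> Q s'"
  shows "wp (Assign a e1 e2) Q s"
proof -
  define s' where "s' = s(a := (s a)(aval e1 s := aval e2 s))"
  have "ok s'" using assms(1-4) by (auto simp: ok_def s'_def)
  moreover have "1 + acost e1 s + acost e2 s + bits (aval e1 s) + bits (aval e2 s)
      \<le> time_bound (Assign a e1 e2)"
    using acost_le[OF assms(1)] bits_aval[OF assms(1)] by (simp add: add_mono)
  moreover have "max (store_size s) (store_size s') \<le> max_size"
    using ok_store_size[OF assms(1)] ok_store_size[OF \<open>ok s'\<close>] by simp
  moreover have "Q s'" using assms(5) \<open>ok s'\<close> by (simp add: s'_def)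
  ultimately show ?thesis unfolding wp_def using exec.Assign[OF s'_def] by blast
qed

lemma wp_seq:
  assumes "wp c1 P s"
    and "\<And>s'. ok s' \<Longrightarrow> frame (writes c1) s s' \<Longrightarrow> P s' \<Longrightarrow> wp c2 Q s'"
  shows "wp (Seq c1 c2) Q s"
proof -
  obtain s1 t1 m1 where 1: "exec c1 s s1 t1 m1" "t1 \<le> time_bound c1" "m1 \<le> max_size" "ok s1" "P s1"
    using assms(1) unfolding wp_def by blast
  obtain s2 t2 m2 where 2: "exec c2 s1 s2 t2 m2" "t2 \<le> time_bound c2" "m2 \<le> max_size" "ok s2" "Q s2"
    using assms(2)[OF 1(4) exec_frame[OF 1(1)] 1(5)] unfolding wp_def by blast
  show ?thesis
    unfolding wp_def using exec.Seq[OF 1(1) 2(1)] 1 2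
    by (intro exI[of _ s2] exI[of _ "t1 + t2"] exI[of _ "max m1 m2"]) auto
qed

lemma wp_cond:
  assumes "ok s" "aval e s \<noteq> 0 \<Longrightarrow> wp c1 Q s" "aval e s = 0 \<Longrightarrow> wp c2 Q s"
  shows "wp (Cond e c1 c2) Q s"
proof (cases "aval e s = 0")
  case True
  then obtain s' t m where "exec c2 s s' t m" "t \<le> time_bound c2" "m \<le> max_size" "ok s'" "Q s'"
    using assms unfolding wp_def by blast
  then show ?thesis unfolding wp_def
    using exec.IfFalse[OF True, of c2 s' t m c1] acost_le[OF assms(1), of e]
    by (intro exI[of _ s'] exI[of _ "1 + acost e s + t"] exI[of _ m]) auto
next
  case False
  then obtain s' t m where "exec c1 s s' t m" "t \<le> time_bound c1" "m \<le> max_size" "ok s'" "Q s'"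
    using assms unfolding wp_def by blast
  then show ?thesis unfolding wp_def
    using exec.IfTrue[OF False, of c1 s' t m c2] acost_le[OF assms(1), of e]
    by (intro exI[of _ s'] exI[of _ "1 + acost e s + t"] exI[of _ m]) auto
qed

text \<open>The invariant counts the iterations. Proving \<open>j < R\<close> whenever the test
  succeeds yields termination and the time bound at once.\<close>

lemma wp_while:
  assumes "ok s" and init: "I 0 s"
    and step: "\<And>j s'. ok s' \<Longrightarrow> frame (writes c) s s' \<Longrightarrow> I j s' \<Longrightarrow> aval e s' \<noteq> 0 \<Longrightarrow>
      j < R \<and> wp c (I (Suc j)) s'"
    and fin: "\<And>j s'. ok s' \<Longrightarrow> frame (writes c) s s' \<Longrightarrow> I j s' \<Longrightarrow> aval e s' = 0 \<Longrightarrow> Q s'"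
  shows "wp (While e c) Q s"
proof -
  define T where "T = 1 + expr_bound e + time_bound c"
  \<comment> \<open>Generalised to a start after \<open>j\<close> iterations, when at most
    \<open>R - j + 1\<close> tests remain to be paid for.\<close>
  have "\<exists>s2 t m. exec (While e c) s' s2 t m \<and> t \<le> (R - j + 1) * T \<and> m \<le> max_size \<and> ok s2 \<and> Q s2"
    if "ok s'" "frame (writes c) s s'" "I j s'" "j \<le> R" for j s'
    using that
  proof (induction "R - j" arbitrary: j s' rule: less_induct)
    case less
    show ?case
    proof (cases "aval e s' = 0")
      case True
      have "1 + acost e s' \<le> (R - j + 1) * T"
        using acost_le[OF less.prems(1), of e] unfolding T_def by (simp add: algebra_simps)
      then show ?thesis
        using exec.WhileFalse[OF True, of c] fin[OF less.prems(1,2,3) True]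
          ok_store_size[OF less.prems(1)] less.prems(1)
        by (intro exI[of _ s'] exI[of _ "1 + acost e s'"] exI[of _ "store_size s'"] conjI) auto
    next
      case False
      from step[OF less.prems(1,2,3) False] have j: "j < R" and "wp c (I (Suc j)) s'" by auto
      then obtain s1 t1 m1 where 1: "exec c s' s1 t1 m1" "t1 \<le> time_bound c" "m1 \<le> max_size"
        "ok s1" "I (Suc j) s1"
        unfolding wp_def by blast
      have fr: "frame (writes c) s s1"
        using less.prems(2) exec_frame[OF 1(1)] by (auto simp: frame_def)
      have "R - Suc j < R - j" using j by simp
      from less.hyps[OF this 1(4) fr 1(5)] j
      obtain s2 t2 m2 where 2: "exec (While e c) s1 s2 t2 m2" "t2 \<le> (R - Suc j + 1) * T"
        "m2 \<le> max_size" "ok s2" "Q s2"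
        by auto
      have "1 + acost e s' + t1 + t2 \<le> T + (R - Suc j + 1) * T"
        using acost_le[OF less.prems(1), of e] 1(2) 2(2) unfolding T_def by linarith
      also have "\<dots> = (R - j + 1) * T"
        using j by (simp add: Suc_diff_Suc flip: mult_Suc)
      finally show ?thesis
        using exec.WhileTrue[OF False 1(1) 2(1)] 1 2
        by (intro exI[of _ s2] exI[of _ "1 + acost e s' + t1 + t2"] exI[of _ "max m1 m2"]) auto
    qed
  qed
  from this[OF assms(1) _ init] show ?thesis
    unfolding wp_def T_def by (simp add: frame_def)
qed

end

abbreviation Var :: "nat \<Rightarrow> expr" where
  "Var a \<equiv> Cell a (Const 0)"

abbreviation Set :: "nat \<Rightarrow> expr \<Rightarrow> prog" where
  "Set a e \<equiv> Assign a (Const 0) e"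

text \<open>The bound is evaluated anew at every test, so the rule for it requires that neither body
  nor counter writes an array read by \<open>b\<close>.\<close>

definition For :: "nat \<Rightarrow> expr \<Rightarrow> prog \<Rightarrow> prog" where
  "For v b c = Seq (Set v (Const 0))
     (While (Sub b (Var v)) (Seq c (Set v (Add (Var v) (Const 1)))))"

lemma writes_For [simp]: "writes (For v b c) = insert v (writes c)"
  by (auto simp: For_def)

context machine begin

text \<open>The premise \<open>indep\<close> makes the invariant insensitive to the counter, which
  is reset and incremented outside the body.\<close>

lemma wp_for:
  assumes ok: "ok s" and v: "v < NA" "v \<notin> writes c"
    and b: "aval b s = B" "B \<le> R" "reads b \<inter> insert v (writes c) = {}"
    and indep: "\<And>i s f. I i (s(v := f)) = I i s"
    and init: "I 0 s"
    and step: "\<And>i s'. ok s' \<Longrightarrow> frame (insert v (writes c)) s s' \<Longrightarrow> i < B \<Longrightarrow> s' v 0 = i \<Longrightarrow>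
      I i s' \<Longrightarrow> wp c (I (Suc i)) s'"
    and fin: "\<And>s'. ok s' \<Longrightarrow> frame (insert v (writes c)) s s' \<Longrightarrow> I B s' \<Longrightarrow> Q s'"
  shows "wp (For v b c) Q s"
  unfolding For_def
proof (rule wp_seq[where P = "\<lambda>s'. s' = s(v := (s v)(0 := 0))"])
  show "wp (Set v (Const 0)) (\<lambda>s'. s' = s(v := (s v)(0 := 0))) s"
    by (rule wp_assign) (use ok v IX_pos in auto)
next
  fix s0 assume s0: "ok s0" "s0 = s(v := (s v)(0 := 0))"
  let ?body = "Seq c (Set v (Add (Var v) (Const 1)))"
  let ?J = "\<lambda>i s'. I i s' \<and> s' v 0 = i \<and> i \<le> B"
  have frs: "frame (insert v (writes c)) s s'" if "frame (writes ?body) s0 s'" for s'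
    using that s0(2) by (auto simp: frame_def)
  have bb: "aval b s' = B" if "frame (writes ?body) s0 s'" for s'
    using aval_frame[OF frs[OF that] b(3)] b(1) by simp
  show "wp (While (Sub b (Var v)) ?body) Q s0"
  proof (rule wp_while[where I = ?J])
    show "ok s0" by (fact s0)
    show "?J 0 s0" using init s0 indep by simp
  next
    fix j s' assume s': "ok s'" "frame (writes ?body) s0 s'" "?J j s'" "aval (Sub b (Var v)) s' \<noteq> 0"
    then have j: "j < B" using bb by auto
    have "wp ?body (?J (Suc j)) s'"
    proof (rule wp_seq[where P = "I (Suc j)"])
      show "wp c (I (Suc j)) s'"
        by (rule step) (use s' frs j in auto)
    next
      fix s2 assume s2: "ok s2" "frame (writes c) s' s2" "I (Suc j) s2"
      have "s2 v 0 = j" using s2(2) v(2) s'(3) by (simp add: frame_def)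
      then show "wp (Set v (Add (Var v) (Const 1))) (?J (Suc j)) s2"
        using j b(2) IX_pos s2 v indep
        by (intro wp_assign) auto
    qed
    then show "j < R \<and> wp ?body (?J (Suc j)) s'" using j b(2) by simp
  next
    fix j s' assume s': "ok s'" "frame (writes ?body) s0 s'" "?J j s'" "aval (Sub b (Var v)) s' = 0"
    then have "j = B" using bb by auto
    then show "Q s'" using s' frs fin by blast
  qed
qed

end

section \<open>Running time as a power of the value bound, with constants of the program\<close>

fun prog_size :: "prog \<Rightarrow> nat" where
  "prog_size Skip = 1"
| "prog_size (Assign a e1 e2) =
     1 + 3 * (expr_size e1)\<^sup>2 + 3 * (expr_size e2)\<^sup>2 + expr_size e1 + expr_size e2"
| "prog_size (Seq c1 c2) = prog_size c1 + prog_size c2"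
| "prog_size (Cond e c1 c2) = 1 + 3 * (expr_size e)\<^sup>2 + prog_size c1 + prog_size c2"
| "prog_size (While e c) = 1 + 3 * (expr_size e)\<^sup>2 + prog_size c"

text \<open>Straight-line code has depth 1 instead of 0, which pays for the cost of its
  expressions.\<close>

fun loop_depth :: "prog \<Rightarrow> nat" where
  "loop_depth Skip = 1"
| "loop_depth (Assign a e1 e2) = 1"
| "loop_depth (Seq c1 c2) = max (loop_depth c1) (loop_depth c2)"
| "loop_depth (Cond e c1 c2) = max (loop_depth c1) (loop_depth c2)"
| "loop_depth (While e c) = Suc (loop_depth c)"

text \<open>A loop multiplies the time by \<open>R + 1\<close>, and an expression costs at most a
  constant times the square of \<open>bits R\<close>. Both are absorbed by one factor
  \<open>(R + 1) ^ 3\<close> per level of nesting.\<close>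

lemma (in machine) time_bound_le: "time_bound c \<le> prog_size c * ((R + 1) ^ 3) ^ loop_depth c"
proof -
  define W where "W = bits R"
  define Y where "Y = (R + 1) ^ 3"
  have W: "1 \<le> W" using bits_pos[of R] by (simp add: W_def)
  have WR: "W \<le> R + 1" unfolding W_def by (rule bits_le_Suc)
  have "(R + 1) * W\<^sup>2 \<le> (R + 1) * (R + 1)\<^sup>2"
    by (intro mult_le_mono power_mono WR) auto
  also have "\<dots> = Y" by (simp add: Y_def power3_eq_cube power2_eq_square)
  finally have Y: "(R + 1) * W\<^sup>2 \<le> Y" .
  have WY: "W\<^sup>2 \<le> Y" using Y by (simp add: algebra_simps)
  have WW: "W \<le> W\<^sup>2" using W by (simp add: power2_eq_square)
  have WY1: "W \<le> Y" using WW WY by simp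
  have Y1: "1 \<le> Y" using WY1 W by simp
  have pm: "k * Y ^ i \<le> k * Y ^ max i j" "k * Y ^ j \<le> k * Y ^ max i j" for k i j :: nat
    by (auto intro!: mult_le_mono power_increasing Y1)
  have eb: "expr_bound e \<le> 3 * (expr_size e)\<^sup>2 * Y ^ i" if "1 \<le> i" for e i
  proof -
    have "Y ^ 1 \<le> Y ^ i" using that Y1 by (intro power_increasing) auto
    then show ?thesis using WY unfolding expr_bound_def W_def[symmetric]
      by (intro mult_le_mono) auto
  qed
  have ld: "1 \<le> loop_depth c" for c by (induction c) auto
  have Yp: "1 \<le> Y ^ i" for i using Y1 by simp
  have "time_bound c \<le> prog_size c * Y ^ loop_depth c"
  proof (induction c)
    case Skip
    then show ?case using Y1 by simp
  next
    case (Assign a e1 e2)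
    have "1 + expr_bound e1 + expr_bound e2 + expr_size e1 * W + expr_size e2 * W
      \<le> Y + 3 * (expr_size e1)\<^sup>2 * Y ^ 1 + 3 * (expr_size e2)\<^sup>2 * Y ^ 1 + expr_size e1 * Y + expr_size e2 * Y"
      by (intro add_mono mult_le_mono order.refl eb Y1 WY1)
    then show ?case
      by (simp add: W_def algebra_simps)
  next
    case (Seq c1 c2)
    show ?case
      using order.trans[OF Seq(1) pm(1)[of _ _ "loop_depth c2"]]
        order.trans[OF Seq(2) pm(2)[of _ _ "loop_depth c1"]]
      by (simp add: algebra_simps)
  next
    case (Cond e c1 c2)
    define i where "i = max (loop_depth c1) (loop_depth c2)"
    have "1 \<le> i" using ld[of c1] by (simp add: i_def)
    from eb[OF this, of e] Yp[of i] order.trans[OF Cond(1) pm(1)[of _ _ "loop_depth c2"]]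
        order.trans[OF Cond(2) pm(2)[of _ _ "loop_depth c1"]]
    show ?case by (simp add: algebra_simps i_def[symmetric])
  next
    case (While e c)
    have "(R + 1) * 1 \<le> (R + 1) * W\<^sup>2" using W by (intro mult_le_mono) auto
    then have RY: "R + 1 \<le> Y" using Y by simp
    have "time_bound (While e c) \<le> Y * (1 + expr_bound e + time_bound c)"
      unfolding time_bound.simps by (intro mult_le_mono RY) auto
    also have "\<dots> \<le> Y * (Y ^ loop_depth c + 3 * (expr_size e)\<^sup>2 * Y ^ loop_depth c
        + prog_size c * Y ^ loop_depth c)"
      by (intro mult_le_mono add_mono Yp eb ld While) auto
    finally show ?case by (simp add: algebra_simps)
  qed
  then show ?thesis by (simp add: Y_def)
qed

section \<open>Choice of the parameters\<close>

text \<open>A weak form of Stirling's bound, with 3 in place of the base of the natural logarithm: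
  consecutive quotients are controlled by \<open>(1 + 1 / s) ^ s \<le> 3\<close>.\<close>

lemma power_self_le_fact: "real s ^ s \<le> 3 ^ s * fact s"
proof (induction s)
  case (Suc s)
  have "(1 + 1 / real s) ^ s \<le> 3" if "0 < s"
  proof -
    have "(1 + 1 / real s) ^ s \<le> exp 1" by (rule exp_ge_one_plus_x_over_n_power_n) (use that in auto)
    then show ?thesis using exp_le by linarith
  qed
  then have "real (Suc s) ^ s \<le> 3 * real s ^ s"
  proof (cases "s = 0")
    case False
    then have "real (Suc s) = real s * (1 + 1 / real s)" by (simp add: field_simps)
    then have "real (Suc s) ^ s = real s ^ s * (1 + 1 / real s) ^ s" by (simp add: power_mult_distrib)
    also have "\<dots> \<le> real s ^ s * 3"
      by (rule mult_left_mono) (use \<open>0 < s \<Longrightarrow> _\<close> False in auto)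
    finally show ?thesis by simp
  qed simp
  then have "real (Suc s) * real (Suc s) ^ s \<le> real (Suc s) * (3 * (3 ^ s * fact s))"
    using Suc by (intro mult_left_mono) auto
  then show ?case by (simp add: algebra_simps)
qed simp

text \<open>The binomial is at most \<open>(m + s) ^ s / fact s\<close>, and the preceding bound
  turns this into \<open>(3 * (m + s) / s) ^ s\<close>.\<close>

lemma binomial_le_scaled_power:
  assumes "3 * real (m + s) \<le> \<theta> * real s"
  shows "real ((m + s) choose s) \<le> \<theta> ^ s"
proof (cases "s = 0")
  case False
  have "real ((m + s) choose s) * real s ^ s \<le> real ((m + s) choose s) * (3 ^ s * fact s)"
    by (intro mult_left_mono power_self_le_fact) simp
  also have "\<dots> = 3 ^ s * real (((m + s) choose s) * fact s)" by simp
  also have "\<dots> \<le> 3 ^ s * real ((m + s) ^ s)"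
    by (intro mult_left_mono of_nat_mono binomial_fact_pow) simp
  also have "\<dots> = (3 * real (m + s)) ^ s" by (simp only: power_mult_distrib of_nat_power)
  also have "\<dots> \<le> (\<theta> * real s) ^ s" by (intro power_mono assms) simp
  finally have "real ((m + s) choose s) * real s ^ s \<le> \<theta> ^ s * real s ^ s" by (simp add: power_mult_distrib)
  then show ?thesis using False by simp
qed simp

text \<open>For \<open>s = d - 2\<close> it absorbs the factor \<open>d ^ 2\<close> of the degree
  sum; this is why the binomial in \<open>room\<close> is bounded with the base
  \<open>a / 12\<close>.\<close>

lemma square_le_power_12: "(s + 2)\<^sup>2 \<le> 12 ^ s" if "1 \<le> s" for s :: nat
  using that
proof (induction s rule: dec_induct)
  case (step s)
  have "(Suc s + 2)\<^sup>2 \<le> 12 * (s + 2)\<^sup>2" by (simp add: power2_eq_square algebra_simps)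
  also have "\<dots> \<le> 12 * 12 ^ s" using step by simp
  finally show ?case by simp
qed (simp add: power2_eq_square)

text \<open>\<open>a\<close> is the integer part of the \<open>(d - 1)\<close>-st root of
  \<open>n\<close>. The divisor 128 together with \<open>a \<ge> 1024\<close> gives
  \<open>m + d \<le> 9 / 1024 * d * a\<close> for \<open>m < K\<close>, on which \<open>room\<close>
  rests.\<close>

locale parameters =
  fixes n d a K :: nat
  assumes d: "3 \<le> d" and n: "2 ^ (10 * d) \<le> n"
    and a_le: "a ^ (d - 1) \<le> n" and a_gt: "n < (a + 1) ^ (d - 1)" and K_eq: "K = d * a div 128"
begin

text \<open>The factor 10 in the hypothesis on \<open>n\<close> appears here as
  \<open>2 ^ 10\<close>.\<close>

lemma a_ge: "1024 \<le> a"
proof (rule ccontr)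
  assume "\<not> 1024 \<le> a"
  then have "(a + 1) ^ (d - 1) \<le> 1024 ^ (d - 1)" by (intro power_mono) auto
  also have "\<dots> = 2 ^ (10 * (d - 1))" by (simp add: power_mult)
  also have "\<dots> \<le> 2 ^ (10 * d)" by (intro power_increasing) auto
  finally show False using n a_gt by simp
qed

lemma n_ge: "2 ^ 30 \<le> n"
proof -
  have "(2 :: nat) ^ 30 \<le> 2 ^ (10 * d)" using d by (intro power_increasing) auto
  then show ?thesis using n by simp
qed

lemma d_le_power: assumes "d \<le> 10 * k" shows "d \<le> a ^ k"
proof -
  have "d \<le> 2 ^ d" using less_exp[of d] by simp
  also have "\<dots> \<le> 2 ^ (10 * k)" using assms by (intro power_increasing) auto
  also have "\<dots> = 1024 ^ k" by (simp add: power_mult)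
  also have "\<dots> \<le> a ^ k" using a_ge by (intro power_mono) auto
  finally show ?thesis .
qed

lemma pow_step: "a ^ (d - 2) * a = a ^ (d - 1)"
  using d by (simp add: power_Suc2[symmetric] Suc_diff_Suc numeral_2_eq_2 del: power_Suc power_Suc2)

lemma pow_le: "1024 * a ^ (d - 2) \<le> n"
proof -
  have "1024 * a ^ (d - 2) \<le> a * a ^ (d - 2)" using a_ge by (intro mult_right_mono) auto
  also have "\<dots> \<le> n" using pow_step a_le by (simp add: mult.commute)
  finally show ?thesis .
qed

lemma d_a_le: "d * a \<le> n"
proof -
  have "d \<le> a ^ (d - 2)" using d by (intro d_le_power) auto
  then have "d * a \<le> a ^ (d - 2) * a" by (rule mult_right_mono) simp
  then show ?thesis using pow_step a_le by simp
qed

text \<open>Enumerating the points of a subspace of dimension \<open>K\<close> is thereby no longer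
  than the allowed search.\<close>

lemma K_le_pow: "K \<le> a ^ (d - 2)"
proof (cases "d = 3")
  case False
  then have "d \<le> a ^ (d - 3)" using d by (intro d_le_power) auto
  then have "d * a \<le> a ^ (d - 3) * a" by (rule mult_right_mono) simp
  also have "\<dots> = a ^ (d - 2)"
    using d False by (simp add: power_Suc2[symmetric] Suc_diff_Suc numeral_2_eq_2 numeral_3_eq_3 del: power_Suc power_Suc2)
  finally show ?thesis unfolding K_eq using div_le_dividend[of "d * a" 128] by linarith
qed (simp add: K_eq)

lemma K_less: "K < n"
proof -
  have "K < d * a" unfolding K_eq using d a_ge by (intro div_less_dividend) auto
  then show ?thesis using d_a_le by simp
qed

text \<open>The first bound limits the length of the search; the second leaves the kernel a
  dimension exceeding the degree sum. All binomials of the sum are at most the one for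
  \<open>j = 2\<close>, which is at most \<open>(a / 12) ^ (d - 2)\<close>.\<close>

lemma room:
  assumes m: "m < K"
  shows "(\<Sum>j=2..d. j * ((m + (d - j)) choose (d - j))) \<le> a ^ (d - 2)"
    and "Suc (\<Sum>j=2..d. j * ((m + (d - j)) choose (d - j))) + (((m + (d - 1)) choose (d - 1)) + m) \<le> n"
proof -
  define S where "S = (\<Sum>j=2..d. j * ((m + (d - j)) choose (d - j)))"
  have "128 * m \<le> d * a" using m unfolding K_eq by linarith
  then have m': "128 * real m \<le> real d * real a" by (metis of_nat_le_iff of_nat_mult of_nat_numeral)
  have "real d * 1024 \<le> real d * real a" using a_ge by (intro mult_left_mono) auto
  then have md: "real m + real d \<le> 9 / 1024 * (real d * real a)" using m' by linarith
  \<comment> \<open>The product \<open>3 * 9 / 1024 * 3 / 2\<close> is just below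
    \<open>1 / 25\<close>.\<close>
  have "real ((m + (d - 1)) choose (d - 1)) \<le> (real a / 25) ^ (d - 1)"
  proof (rule binomial_le_scaled_power)
    have "real d \<le> 3 / 2 * real (d - 1)" using d by linarith
    then have "real d * real a \<le> 3 / 2 * real (d - 1) * real a" by (rule mult_right_mono) simp
    moreover have "0 \<le> real (d - 1) * real a" by simp
    ultimately show "3 * real (m + (d - 1)) \<le> real a / 25 * real (d - 1)" using md by (simp add: algebra_simps)
  qed
  also have "\<dots> = real (a ^ (d - 1)) / 25 ^ (d - 1)" by (simp add: power_divide)
  also have "\<dots> \<le> real n / 25 ^ 2"
    using d a_le power_increasing[of 2 "d - 1" "25 :: real"] by (intro frac_le) (auto simp flip: of_nat_power)
  finally have mon: "625 * real ((m + (d - 1)) choose (d - 1)) \<le> real n" by simp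
  \<comment> \<open>Here \<open>3 * 9 / 1024 * 3\<close> is below \<open>1 / 12\<close>.\<close>
  have B: "real ((m + (d - 2)) choose (d - 2)) \<le> (real a / 12) ^ (d - 2)"
  proof (rule binomial_le_scaled_power)
    have "real d \<le> 3 * real (d - 2)" using d by linarith
    then have "real d * real a \<le> 3 * real (d - 2) * real a" by (rule mult_right_mono) simp
    moreover have "0 \<le> real (d - 2) * real a" by simp
    ultimately show "3 * real (m + (d - 2)) \<le> real a / 12 * real (d - 2)" using md by (simp add: algebra_simps)
  qed
  have "S \<le> (\<Sum>j=2..d. d * ((m + (d - 2)) choose (d - 2)))"
    unfolding S_def
  proof (intro sum_mono mult_le_mono)
    fix j assume j: "j \<in> {2..d}"
    then show "j \<le> d" by simp
    have "(m + (d - j)) choose m \<le> (m + (d - 2)) choose m" using j by (intro binomial_right_mono) auto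
    then show "(m + (d - j)) choose (d - j) \<le> (m + (d - 2)) choose (d - 2)"
      using binomial_symmetric[of m "m + (d - j)"] binomial_symmetric[of m "m + (d - 2)"] by simp
  qed
  also have "\<dots> \<le> d * (d * ((m + (d - 2)) choose (d - 2)))" using d by simp
  finally have "S \<le> d\<^sup>2 * ((m + (d - 2)) choose (d - 2))" by (simp add: power2_eq_square)
  then have "real S \<le> real (d\<^sup>2) * real ((m + (d - 2)) choose (d - 2))" by (metis of_nat_le_iff of_nat_mult)
  also have "\<dots> \<le> 12 ^ (d - 2) * (real a / 12) ^ (d - 2)"
  proof (intro mult_mono B)
    have "d - 2 + 2 = d" using d by simp
    then have "d\<^sup>2 \<le> 12 ^ (d - 2)" using square_le_power_12[of "d - 2"] d by simp
    then show "real (d\<^sup>2) \<le> 12 ^ (d - 2)" by (metis of_nat_le_iff of_nat_numeral of_nat_power)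
  qed auto
  also have "\<dots> = real (a ^ (d - 2))" by (simp add: power_divide)
  finally have S: "S \<le> a ^ (d - 2)" by simp
  then show "(\<Sum>j=2..d. j * ((m + (d - j)) choose (d - j))) \<le> a ^ (d - 2)" by (simp add: S_def)
  have "1024 * S \<le> n" using S pow_le by linarith
  moreover have "625 * ((m + (d - 1)) choose (d - 1)) \<le> n"
    using mon by (metis of_nat_le_iff of_nat_mult of_nat_numeral)
  moreover have "128 * m \<le> n" using \<open>128 * m \<le> d * a\<close> d_a_le by linarith
  ultimately have "Suc S + (((m + (d - 1)) choose (d - 1)) + m) \<le> n" using n_ge by simp
  then show "Suc (\<Sum>j=2..d. j * ((m + (d - j)) choose (d - j))) + (((m + (d - 1)) choose (d - 1)) + m) \<le> n"
    by (simp add: S_def)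
qed

text \<open>If \<open>k \<ge> 4 * d * (a + 1)\<close>, then \<open>k choose d\<close> is at least
  \<open>(k / d) * 4 ^ (d - 1) * (a + 1) ^ (d - 1)\<close>, and
  \<open>4 ^ (d - 1) \<ge> 2 * d\<close> makes this exceed \<open>n * (k + 1)\<close>. Hence
  \<open>k < 8 * d * a\<close>. Since \<open>d * a \<ge> 3072\<close>, rounding in \<open>K\<close>
  costs at most a factor 2, and \<open>2048 = 8 * 2 * 128\<close>.\<close>

lemma dim_le_K:
  assumes "k choose d \<le> n * (k + 1)" shows "k \<le> 2048 * K"
proof -
  have "k < 4 * d * (a + 1)"
  proof (rule ccontr)
    assume "\<not> ?thesis"
    then have k: "4 * d * (a + 1) \<le> k" by simp
    then have "real (4 * d * (a + 1)) \<le> real k" by (rule of_nat_mono)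
    then have kd: "real (4 * (a + 1)) \<le> real k / real d" using d by (simp add: field_simps)
    have dk: "d \<le> k"
    proof -
      have "d * 1 \<le> d * (4 * (a + 1))" by (intro mult_le_mono2) simp
      then show ?thesis using k by simp
    qed
    have "2 * d \<le> 4 ^ (d - 1)"
      using d
    proof (induction d rule: dec_induct)
      case (step d)
      have "2 * Suc d \<le> 4 * (2 * d)" using step by simp
      also have "\<dots> \<le> 4 * 4 ^ (d - 1)" using step by (intro mult_le_mono2)
      also have "\<dots> = 4 ^ (Suc d - 1)" using step by (simp add: power_Suc[symmetric] del: power_Suc)
      finally show ?case .
    qed simp
    then have "2 * real d \<le> 4 ^ (d - 1)" by (metis of_nat_le_iff of_nat_mult of_nat_numeral of_nat_power)
    then have "2 * real k \<le> real k / real d * 4 ^ (d - 1)"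
      using d mult_left_mono[of "2 * real d" "4 ^ (d - 1)" "real k / real d"] by simp
    then have "2 * real k * real ((a + 1) ^ (d - 1)) \<le> real k / real d * 4 ^ (d - 1) * real ((a + 1) ^ (d - 1))"
      by (rule mult_right_mono) simp
    also have "\<dots> = real k / real d * real (4 * (a + 1)) ^ (d - 1)"
      by (simp only: of_nat_mult of_nat_power of_nat_numeral power_mult_distrib mult.assoc)
    also have "\<dots> \<le> real k / real d * (real k / real d) ^ (d - 1)"
      by (intro mult_left_mono power_mono kd) auto
    also have "\<dots> = (real k / real d) ^ d" using d by (simp add: power_Suc[symmetric] del: power_Suc)
    also have "\<dots> \<le> real (k choose d)" by (rule binomial_ge_n_over_k_pow_k[OF dk])
    also have "\<dots> \<le> real (n * (k + 1))" using assms by (rule of_nat_mono)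
    finally have "2 * k * (a + 1) ^ (d - 1) \<le> n * (k + 1)"
      by (metis of_nat_le_iff of_nat_mult of_nat_numeral)
    moreover have "2 * k * (n + 1) \<le> 2 * k * (a + 1) ^ (d - 1)" using a_gt by (intro mult_le_mono2) simp
    moreover have "n * (k + 1) < 2 * k * (n + 1)"
    proof -
      have "n \<le> n * k" using dk d by simp
      moreover have "n * (k + 1) = n * k + n" "2 * k * (n + 1) = 2 * (n * k) + 2 * k"
        by (simp_all add: algebra_simps)
      moreover have "0 < k" using dk d by simp
      ultimately show ?thesis by linarith
    qed
    ultimately show False by linarith
  qed
  also have "\<dots> \<le> 8 * (d * a)" using a_ge by (simp add: algebra_simps)
  finally have "k < 8 * (d * a)" .
  moreover have "3 * 1024 \<le> d * a" using d a_ge by (rule mult_le_mono)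
  ultimately show ?thesis unfolding K_eq by linarith
qed

text \<open>The exponent of the time bound originates here: \<open>a ^ (d - 2)\<close> is the power
  \<open>(d - 2) / (d - 1)\<close> of \<open>a ^ (d - 1) \<le> n\<close>.\<close>

lemma pow_le_powr: "real (a ^ (d - 2)) \<le> real n powr ((real d - 2) / (real d - 1))"
proof -
  have ap: "0 < real a" using a_ge by simp
  have "real (a ^ (d - 2)) = real a powr (real (d - 1) * ((real d - 2) / (real d - 1)))"
    using ap d by (simp add: powr_realpow[symmetric] of_nat_diff)
  also have "\<dots> = (real a powr real (d - 1)) powr ((real d - 2) / (real d - 1))" by (simp add: powr_powr)
  also have "\<dots> = real (a ^ (d - 1)) powr ((real d - 2) / (real d - 1))"
    using ap by (simp add: powr_realpow)
  also have "\<dots> \<le> real n powr ((real d - 2) / (real d - 1))"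
    using a_le d by (intro powr_mono2) (auto simp flip: of_nat_power)
  finally show ?thesis .
qed

lemma n_le_pow: "k \<le> 4 * d \<Longrightarrow> n ^ k \<le> n ^ (4 * d)"
  using n_ge by (intro power_increasing) auto

text \<open>One bound for all indices and for the trial powers of the root. At most
  \<open>(n + d) ^ d \<le> n ^ (2 * d)\<close> monomials occur, and a further
  \<open>n ^ 2 \<le> n ^ (2 * d)\<close> covers their lengths and the lower terms.\<close>

lemma index_bounds:
  assumes len: "l \<le> (n + d) choose d"
  shows "5 + n + l * (n + 1) \<le> n ^ (4 * d)" "n * n + n + 1 < n ^ (4 * d)" "(a + 1) ^ (d - 1) \<le> n ^ (4 * d)"
    "n \<le> n ^ (4 * d)"
proof -
  have n1: "1 \<le> n" "5 \<le> n" using n_ge by simp_all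
  have dn: "d \<le> n" "2 ^ d \<le> n"
  proof -
    have "2 ^ d \<le> (2 :: nat) ^ (10 * d)" by (intro power_increasing) auto
    then show "2 ^ d \<le> n" using n by (rule order.trans)
    then show "d \<le> n" using less_exp[of d] by linarith
  qed
  have n2: "n * n \<le> n ^ (2 * d)" using n1 d power_increasing[of 2 "2 * d" n] by (simp add: power2_eq_square)
  have "l \<le> (n + d) ^ d" by (rule order.trans[OF len binomial_le_pow]) simp
  also have "\<dots> \<le> (n * n) ^ d"
  proof (rule power_mono)
    have "n + d \<le> 2 * n" using dn by simp
    also have "\<dots> \<le> n * n" using n1 by (intro mult_right_mono) auto
    finally show "n + d \<le> n * n" .
  qed simp
  also have "\<dots> = n ^ (2 * d)" by (simp add: power_mult power2_eq_square)
  finally have l: "l * (n + 1) \<le> n ^ (2 * d) * (n + 1)" by (rule mult_right_mono) simp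
  have p1: "1 \<le> n ^ (2 * d)" using n1 by simp
  define Q where "Q = n ^ (2 * d)"
  have Q: "1 \<le> Q" "l * (n + 1) \<le> Q * n + Q" using p1 l by (simp_all add: Q_def)
  have "1 * 5 \<le> Q * n" "1 * n \<le> Q * n" "Q * 1 \<le> Q * n"
    using Q(1) n1 by (intro mult_le_mono; simp)+
  then have "5 + n + l * (n + 1) \<le> 5 * (Q * n)" using Q(2) by linarith
  also have "\<dots> \<le> n * (Q * n)" using n1 by (intro mult_right_mono) auto
  also have "\<dots> = n ^ (2 * d) * (n * n)" by (simp add: Q_def)
  also have "\<dots> \<le> n ^ (2 * d) * n ^ (2 * d)" using n2 by (rule mult_le_mono2)
  finally show "5 + n + l * (n + 1) \<le> n ^ (4 * d)" by (simp add: power_add[symmetric])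
  have "n * n + n + 1 < n * n * n"
  proof -
    have "1 * n \<le> n * n" "5 * (n * n) \<le> n * (n * n)" "1 * 1 \<le> n * n"
      using n1 by (intro mult_right_mono mult_le_mono; simp)+
    moreover have "n * n * n = n * (n * n)" by (simp only: mult.assoc)
    ultimately show ?thesis by linarith
  qed
  also have "\<dots> \<le> n ^ (4 * d)" using n_le_pow[of 3] d by (simp add: power3_eq_cube)
  finally show "n * n + n + 1 < n ^ (4 * d)" .
  have "(a + 1) ^ (d - 1) \<le> (2 * a) ^ (d - 1)" using a_ge by (intro power_mono) auto
  also have "\<dots> = 2 ^ (d - 1) * a ^ (d - 1)" by (simp add: power_mult_distrib)
  also have "\<dots> \<le> n * n"
  proof (rule mult_le_mono[OF _ a_le])
    have "(2 :: nat) ^ (d - 1) \<le> 2 ^ d" by (intro power_increasing) auto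
    then show "2 ^ (d - 1) \<le> n" using dn(2) by (rule order.trans)
  qed
  also have "\<dots> \<le> n ^ (4 * d)" using n_le_pow[of 2] d by (simp add: power2_eq_square)
  finally show "(a + 1) ^ (d - 1) \<le> n ^ (4 * d)" .
  show "n \<le> n ^ (4 * d)" using n_le_pow[of 1] d by simp
qed

text \<open>By \<open>R + 1 \<le> R ^ 2\<close> the time is at most \<open>P * R ^ (6 * L)\<close>;
  with \<open>R\<close> inserted, the exponents \<open>12 * L\<close> of \<open>q\<close> and
  \<open>24 * L\<close> of \<open>n ^ d\<close> appear. The increments 840 and 5 come from the space
  bound, which shares these constants.\<close>

lemma time_estimate:
  assumes q: "2 \<le> q" and R: "R = q ^ (2 * a ^ (d - 2)) * n ^ (4 * d)" and t: "t \<le> P * ((R + 1) ^ 3) ^ L"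
  shows "real t \<le> real q powr ((12 * real L + 1) * real n powr ((real d - 2) / (real d - 1)))
    * (real (P + 840) * real (n ^ d) ^ (24 * L + 5))"
proof -
  define A where "A = a ^ (d - 2)"
  define N where "N = n ^ d"
  have N1: "1 \<le> N" using n_ge unfolding N_def by (simp add: Suc_leI)
  have RN: "R = q ^ (2 * A) * N ^ 4" by (simp add: R A_def N_def power_mult[symmetric] mult.commute)
  have N2: "2 \<le> N"
  proof -
    have "n ^ 1 \<le> n ^ d" using n_ge d by (intro power_increasing) auto
    then show ?thesis using n_ge by (simp add: N_def)
  qed
  have "2 \<le> R"
  proof -
    have "1 * N ^ 1 \<le> q ^ (2 * A) * N ^ 4" using q N1 by (intro mult_le_mono power_increasing) auto
    then show ?thesis using N2 by (simp add: RN)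
  qed
  then have R2: "R + 1 \<le> 2 * R" "2 * R \<le> R * R" by (simp_all add: mult_right_mono)
  have "R + 1 \<le> R ^ 2" unfolding power2_eq_square using R2 by (rule order.trans)
  then have "((R + 1) ^ 3) ^ L \<le> ((R ^ 2) ^ 3) ^ L" by (intro power_mono) auto
  also have "\<dots> = q ^ (12 * L * A) * N ^ (24 * L)"
    by (simp add: RN power_mult_distrib power_mult[symmetric] mult_ac)
  finally have "t \<le> P * (q ^ (12 * L * A) * N ^ (24 * L))" using t by (meson mult_le_mono2 order.trans)
  then have "real t \<le> real (P * (q ^ (12 * L * A) * N ^ (24 * L)))" by (rule of_nat_mono)
  also have "\<dots> = real q ^ (12 * L * A) * (real P * real N ^ (24 * L))" by simp
  also have "\<dots> \<le> real q powr ((12 * real L + 1) * real n powr ((real d - 2) / (real d - 1)))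
      * (real (P + 840) * real N ^ (24 * L + 5))"
  proof (intro mult_mono)
    have "real (12 * L * A) \<le> (12 * real L + 1) * real n powr ((real d - 2) / (real d - 1))"
      using mult_mono[of "12 * real L" "12 * real L + 1" "real A", OF _ pow_le_powr[folded A_def]] by simp
    then have "real q powr real (12 * L * A) \<le> real q powr ((12 * real L + 1) * real n powr ((real d - 2) / (real d - 1)))"
      using q by (intro powr_mono) auto
    moreover have "real q powr real (12 * L * A) = real q ^ (12 * L * A)"
      by (rule powr_realpow) (use q in simp)
    ultimately show "real q ^ (12 * L * A) \<le> real q powr ((12 * real L + 1) * real n powr ((real d - 2) / (real d - 1)))"
      by (simp only:)
    show "real N ^ (24 * L) \<le> real N ^ (24 * L + 5)" using N1 by (intro power_increasing) auto
  qed auto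
  finally show ?thesis by (simp add: N_def)
qed

text \<open>The bit length of \<open>R\<close> is at most 7 times \<open>n ^ d * log 2 q\<close>.
  With 60 arrays of \<open>n ^ (4 * d)\<close> cells and two such lengths per cell, the factor is
  \<open>60 * 2 * 7 = 840\<close> and the power 5.\<close>

lemma space_estimate:
  assumes q: "2 \<le> q" and R: "R = q ^ (2 * a ^ (d - 2)) * n ^ (4 * d)"
    and m: "m \<le> 60 * n ^ (4 * d) * (bits (n ^ (4 * d)) + bits R)"
  shows "real m \<le> real (P + 840) * (real (n ^ d) * log 2 (real q)) ^ (24 * L + 5)"
proof -
  define A where "A = a ^ (d - 2)"
  define N where "N = n ^ d"
  define l where "l = log 2 (real q)"
  have N1: "1 \<le> N" using n_ge unfolding N_def by (simp add: Suc_leI)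
  have RN: "R = q ^ (2 * A) * N ^ 4" by (simp add: R A_def N_def power_mult[symmetric] mult.commute)
  have IX: "n ^ (4 * d) = N ^ 4" by (simp add: N_def power_mult[symmetric] mult.commute)
  have l1: "1 \<le> l" unfolding l_def using q by (subst le_log_iff) auto
  have R1: "0 < R" using q N1 by (simp add: RN)
  have "log 2 (real R) = 2 * real A * l + 4 * log 2 (real N)"
    using q N1 by (simp add: RN log_mult log_nat_power l_def)
  also have "log 2 (real N) \<le> real N"
  proof -
    have "real N \<le> 2 ^ N" using less_exp[of N] by (metis less_imp_le of_nat_le_iff of_nat_numeral of_nat_power)
    then show ?thesis using N1 by (subst log_le_iff) (auto simp: powr_realpow)
  qed
  also have "real A \<le> real N"
  proof -
    have "A \<le> n" using pow_le by (simp add: A_def)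
    also have "n \<le> N" using n_ge d power_increasing[of 1 d n] by (simp add: N_def)
    finally show ?thesis by simp
  qed
  finally have "log 2 (real R) \<le> 2 * real N * l + 4 * real N" using l1 by simp
  moreover have "real N \<le> real N * l" "1 \<le> real N * l"
    using l1 N1 mult_mono[of 1 "real N" 1 l] by simp_all
  moreover have "real (bits R) \<le> log 2 (real R) + 1"
  proof -
    have "0 \<le> log 2 (real R)" using R1 by simp
    then show ?thesis using R1 by (auto simp: bits_def floorlog_def max_def)
  qed
  ultimately have bR: "real (bits R) \<le> 7 * (real N * l)" by (simp add: algebra_simps)
  have "bits (n ^ (4 * d)) \<le> bits R" unfolding IX by (rule bits_mono) (use q in \<open>simp add: RN\<close>)
  then have "m \<le> 60 * N ^ 4 * (2 * bits R)" using m unfolding IX by (rule_tac order.trans) (auto intro: mult_le_mono2)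
  then have "real m \<le> real (60 * N ^ 4 * (2 * bits R))" by (rule of_nat_mono)
  also have "\<dots> = 60 * real N ^ 4 * (2 * real (bits R))" by simp
  also have "\<dots> \<le> 60 * real N ^ 4 * (2 * (7 * (real N * l)))" by (intro mult_left_mono bR) auto
  also have "\<dots> \<le> 60 * (real N * l) ^ 4 * (2 * (7 * (real N * l)))"
    using \<open>real N \<le> real N * l\<close> l1 by (intro mult_right_mono mult_left_mono power_mono) auto
  also have "\<dots> = 840 * (real N * l) ^ 5" by (simp add: power_numeral_reduce)
  also have "\<dots> \<le> real (P + 840) * (real N * l) ^ (24 * L + 5)"
    using \<open>1 \<le> real N * l\<close> by (intro mult_mono power_increasing) auto
  finally show ?thesis by (simp add: N_def l_def)
qed

end

section \<open>Field arithmetic on the machine\<close>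

context machine begin

text \<open>Fixing the final store lets straight-line code be chained through named intermediate
  stores instead of postconditions.\<close>

definition run :: "prog \<Rightarrow> store \<Rightarrow> store \<Rightarrow> bool" where
  "run c s s' \<longleftrightarrow> (\<exists>t m. exec c s s' t m \<and> t \<le> time_bound c \<and> m \<le> max_size) \<and> ok s'"

lemma wp_iff_run: "wp c Q s \<longleftrightarrow> (\<exists>s'. run c s s' \<and> Q s')"
  by (auto simp: wp_def run_def)

lemma wpI: "run c s s' \<Longrightarrow> Q s' \<Longrightarrow> wp c Q s"
  by (auto simp: wp_iff_run)

lemma wpE:
  assumes "wp c Q s" obtains s' where "run c s s'" "Q s'"
  using assms by (auto simp: wp_iff_run)

lemma run_ok: "run c s s' \<Longrightarrow> ok s'"
  by (simp add: run_def)

lemma run_frame: "run c s s' \<Longrightarrow> frame (writes c) s s'"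
  unfolding run_def using exec_frame by blast

lemma run_seq:
  assumes "run c1 s s1" "run c2 s1 s2" shows "run (Seq c1 c2) s s2"
proof -
  have "wp c1 (\<lambda>s'. s' = s1) s" "wp c2 (\<lambda>s'. s' = s2) s1" using assms by (auto intro: wpI)
  then have "wp (Seq c1 c2) (\<lambda>s'. s' = s2) s" by (auto intro: wp_seq)
  then show ?thesis by (auto simp: wp_iff_run)
qed

lemma run_assign:
  assumes "ok s" "a < NA" "aval e1 s < IX" "aval e2 s \<le> R"
  shows "run (Assign a e1 e2) s (s(a := (s a)(aval e1 s := aval e2 s)))"
proof -
  have "wp (Assign a e1 e2) (\<lambda>s'. s' = s(a := (s a)(aval e1 s := aval e2 s))) s"
    by (rule wp_assign[OF assms]) simp
  then show ?thesis by (auto simp: wp_iff_run)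
qed

lemma run_set:
  assumes "ok s" "a < NA" "aval e s = v" "v \<le> R"
  shows "run (Set a e) s (s(a := (s a)(0 := v)))"
  using run_assign[of s a "Const 0" e] assms IX_pos by simp

lemma run_skip: "ok s \<Longrightarrow> run Skip s s"
  using wp_skip[of s "\<lambda>s'. s' = s"] by (auto simp: wp_iff_run)

lemma run_cond_true: "ok s \<Longrightarrow> aval e s \<noteq> 0 \<Longrightarrow> run c1 s s' \<Longrightarrow> run (Cond e c1 c2) s s'"
  using wp_cond[of s e c1 "\<lambda>s2. s2 = s'" c2] by (auto simp: wp_iff_run)

lemma run_cond_false: "ok s \<Longrightarrow> aval e s = 0 \<Longrightarrow> run c2 s s' \<Longrightarrow> run (Cond e c1 c2) s s'"
  using wp_cond[of s e c1 "\<lambda>s2. s2 = s'" c2] by (auto simp: wp_iff_run)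

end

text \<open>Arrays: \<open>0\<close> input, \<open>1\<close> output, \<open>2\<close> the characteristic, \<open>10\<close>--\<open>15\<close> registers of the
  field arithmetic.\<close>

abbreviation "eQ \<equiv> Cell 0 (Const 0)"
abbreviation "eR \<equiv> Cell 0 (Const 1)"
abbreviation "eN \<equiv> Cell 0 (Const 2)"
abbreviation "eP \<equiv> Var 2"

text \<open>The program for \<open>comb\<close>: array 15 runs through the powers of
  \<open>p\<close>, and array 14 collects the digits. Reaching \<open>q\<close> ends the loop, so
  \<open>e\<close> is never computed.\<close>

definition Lin :: "expr \<Rightarrow> expr \<Rightarrow> expr \<Rightarrow> prog" where
  "Lin a c b = Seq (Set 14 (Const 0)) (Seq (Set 15 (Const 1))
     (While (Sub eQ (Var 15)) (Seq
        (Set 14 (Add (Var 14) (Mul (Modulo (Add (Divide a (Var 15)) (Mul c (Divide b (Var 15)))) eP) (Var 15))))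
        (Set 15 (Mul (Var 15) eP)))))"

text \<open>The program for \<open>mul_acc\<close>. The second \<open>Lin\<close> is
  \<open>shift\<close>, and array 13 holds the power of \<open>p\<close> that selects the next digit
  of array 11.\<close>

definition Fma :: prog where
  "Fma = Seq (Set 13 (Const 1)) (While (Sub eQ (Var 13)) (Seq
     (Lin (Var 12) (Modulo (Divide (Var 11) (Var 13)) eP) (Var 10)) (Seq
     (Set 12 (Var 14)) (Seq
     (Lin (Mul (Modulo (Var 10) (Divide eQ eP)) eP) (Divide (Var 10) (Divide eQ eP)) eR) (Seq
     (Set 10 (Var 14))
     (Set 13 (Mul (Var 13) eP)))))))"

text \<open>All field arithmetic of the later programs has this form: a sum is the case of a factor
  1, and a sign is a factor \<open>p - 1\<close>.\<close>

definition Acc :: "nat \<Rightarrow> expr \<Rightarrow> expr \<Rightarrow> expr \<Rightarrow> prog" where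
  "Acc a i x y = Seq (Set 12 (Cell a i)) (Seq (Set 10 x) (Seq (Set 11 y) (Seq Fma (Assign a i (Var 12)))))"

lemma writes_Lin [simp]: "writes (Lin a c b) = {14, 15}"
  by (auto simp: Lin_def)

lemma writes_Fma [simp]: "writes Fma = {10, 12, 13, 14, 15}"
  by (auto simp: Fma_def)

lemma writes_Acc [simp]: "writes (Acc a i x y) = {a, 10, 11, 12, 13, 14, 15}"
  by (auto simp: Acc_def)

abbreviation "registers \<equiv> {10, 11, 12, 13, 14, 15 :: nat}"

lemma nth_concat_blocks:
  assumes "\<And>xs. xs \<in> set xss \<Longrightarrow> length xs = k" "t < length xss" "i < k"
  shows "concat xss ! (t * k + i) = xss ! t ! i" and "t * k + i < length (concat xss)"
proof -
  have "concat xss ! (t * k + i) = xss ! t ! i \<and> t * k + i < length (concat xss)"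
    using assms
  proof (induction xss arbitrary: t)
    case (Cons xs xss)
    then have "length xs = k" by simp
    with Cons show ?case
      by (cases t) (auto simp: nth_append)
  qed simp
  then show "concat xss ! (t * k + i) = xss ! t ! i" and "t * k + i < length (concat xss)" by auto
qed

locale algorithm = coded F q r p e \<alpha> + machine 60 IX R
  for F :: "nat ring" (structure) and q r p e \<alpha> IX R :: nat +
  fixes n :: nat and f :: monomials and u0 :: "nat \<Rightarrow> nat"
  assumes f_poly: "polynomial_in F n f"
    and u0_closed: "\<And>i. i < n \<Longrightarrow> u0 i \<in> carrier F"
    and IX_input: "5 + n + length f * (n + 1) \<le> IX"
    and IX_square: "n * n + n + 1 < IX"
    and IX_le_R: "IX \<le> R" and q_le_R: "q \<le> R"
begin

definition input :: "nat \<Rightarrow> nat" where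
  "input = init_store (encode q r n f u0) 0"

definition env :: "store \<Rightarrow> bool" where
  "env s \<longleftrightarrow> s 0 = input \<and> s 2 0 = p"

lemma env_frame: "env s \<Longrightarrow> frame A s s' \<Longrightarrow> 0 \<notin> A \<Longrightarrow> 2 \<notin> A \<Longrightarrow> env s'"
  by (simp add: env_def frame_def)

lemma input_simps:
  "input 0 = q" "input (Suc 0) = r" "input 2 = n" "i < n \<Longrightarrow> input (3 + i) = u0 i"
  "input (3 + n) = length f"
  by (auto simp: input_def init_store_def encode_def nth_append nth_Cons numeral_2_eq_2 numeral_3_eq_3)

lemma input_monomials:
  assumes t: "t < length f"
  shows "input (4 + n + t * (n + 1)) = fst (f ! t)"
    and "i < n \<Longrightarrow> input (5 + n + t * (n + 1) + i) = snd (f ! t) ! i"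
proof -
  let ?xss = "map (\<lambda>(c, es). c # es) f"
  have len: "length xs = n + 1" if "xs \<in> set ?xss" for xs
    using that f_poly by (auto simp: polynomial_in_def)
  have enc: "encode q r n f u0 = ([q, r, n] @ map u0 [0..<n] @ [length f]) @ concat ?xss"
    by (simp add: encode_def)
  have "input (4 + n + (t * (n + 1) + j)) = ?xss ! t ! j" if "j < n + 1" for j
  proof -
    have "concat ?xss ! (t * (n + 1) + j) = ?xss ! t ! j" "t * (n + 1) + j < length (concat ?xss)"
      using nth_concat_blocks[of ?xss "n + 1" t j] len t that by auto
    moreover have "input (4 + n + k) = concat ?xss ! k" if "k < length (concat ?xss)" for k
      unfolding input_def init_store_def enc using that by (simp add: nth_append)
    ultimately show ?thesis by simp
  qed
  from this[of 0] this[of "Suc i"] t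
  show "input (4 + n + t * (n + 1)) = fst (f ! t)"
    and "i < n \<Longrightarrow> input (5 + n + t * (n + 1) + i) = snd (f ! t) ! i"
    by (auto simp: case_prod_unfold add.assoc)
qed

lemma Lin:
  assumes ok: "ok s" and env: "env s"
    and reads: "reads a \<inter> {14, 15} = {}" "reads c \<inter> {14, 15} = {}" "reads b \<inter> {14, 15} = {}"
  obtains s' where "run (Lin a c b) s s'" "s' 14 0 = comb (aval a s) (aval c s) (aval b s)"
proof -
  let ?x = "aval a s" and ?c = "aval c s" and ?y = "aval b s"
  define g where "g = (\<lambda>j. (?x div p ^ j + ?c * (?y div p ^ j)) mod p)"
  have comb_g: "comb ?x ?c ?y = (\<Sum>j<e. g j * p ^ j)" by (simp only: comb_def g_def)
  have p0: "0 < p" using p_gt_1 by simp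
  have part: "(\<Sum>j<i. g j * p ^ j) < p ^ i" for i by (rule digit_sum_less) (use p0 in \<open>simp add: g_def\<close>)
  have pe: "p ^ i \<le> q" if "i \<le> e" for i unfolding q_eq using p0 that by (intro power_increasing) auto
  define s1 where "s1 = s(14 := (s 14)(0 := 0))"
  define s2 where "s2 = s1(15 := (s1 15)(0 := 1))"
  have r1: "run (Set 14 (Const 0)) s s1" unfolding s1_def by (rule run_set[OF ok]) auto
  have r2: "run (Set 15 (Const 1)) s1 s2"
    unfolding s2_def by (rule run_set[OF run_ok[OF r1]]) (use R_pos in auto)
  have fr2: "frame {14, 15} s s2" by (auto simp: frame_def s1_def s2_def)
  let ?body = "Seq (Set 14 (Add (Var 14) (Mul (Modulo (Add (Divide a (Var 15)) (Mul c (Divide b (Var 15)))) eP) (Var 15))))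
        (Set 15 (Mul (Var 15) eP))"
  have "wp (While (Sub eQ (Var 15)) ?body) (\<lambda>s'. s' 14 0 = comb ?x ?c ?y) s2"
  proof (rule wp_while[where I = "\<lambda>j s'. j \<le> e \<and> s' 15 0 = p ^ j \<and> s' 14 0 = (\<Sum>i<j. g i * p ^ i)"])
    show "ok s2" by (rule run_ok[OF r2])
    show "0 \<le> e \<and> s2 15 0 = p ^ 0 \<and> s2 14 0 = (\<Sum>i<0. g i * p ^ i)" by (simp add: s2_def s1_def)
  next
    fix j s' assume ok': "ok s'" and fr: "frame (writes ?body) s2 s'"
      and I: "j \<le> e \<and> s' 15 0 = p ^ j \<and> s' 14 0 = (\<Sum>i<j. g i * p ^ i)"
      and test: "aval (Sub eQ (Var 15)) s' \<noteq> 0"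
    have fr': "frame {14, 15} s s'" using fr fr2 by (auto simp: frame_def)
    have env': "env s'" by (rule env_frame[OF env fr']) auto
    have avs: "aval a s' = ?x" "aval c s' = ?c" "aval b s' = ?y"
      using aval_frame[OF fr'] reads by auto
    have "p ^ j < q" using test I env' by (simp add: env_def input_simps)
    then have "p ^ j < p ^ e" by (simp only: q_eq)
    then have j: "j < e" by (rule power_less_imp_less_exp[OF p_gt_1])
    \<comment> \<open>The iterations are counted against \<open>R\<close> through
      \<open>e < p ^ e = q \<le> R\<close>.\<close>
    have "e < p ^ e" using power_gt_expt[of p e] p_gt_1 by simp
    then have "j < R" using j q_le_R q_eq by linarith
    define t1 where "t1 = s'(14 := (s' 14)(0 := \<Sum>i<Suc j. g i * p ^ i))"
    define t2 where "t2 = t1(15 := (t1 15)(0 := p ^ Suc j))"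
    have "run (Set 14 (Add (Var 14) (Mul (Modulo (Add (Divide a (Var 15)) (Mul c (Divide b (Var 15)))) eP) (Var 15)))) s' t1"
      unfolding t1_def
    proof (rule run_set[OF ok'])
      show "(\<Sum>i<Suc j. g i * p ^ i) \<le> R" 
        by (rule order.trans[OF less_imp_le[OF part] order.trans[OF pe q_le_R]]) (use j in simp)
      show "aval (Add (Var 14) (Mul (Modulo (Add (Divide a (Var 15)) (Mul c (Divide b (Var 15)))) eP) (Var 15))) s'
          = (\<Sum>i<Suc j. g i * p ^ i)"
        using I env' avs by (simp add: env_def g_def[THEN fun_cong, of j])
    qed simp
    moreover from run_ok[OF this] have "run (Set 15 (Mul (Var 15) eP)) t1 t2"
      unfolding t2_def
    proof (rule run_set)
      show "p ^ Suc j \<le> R" by (rule order.trans[OF pe q_le_R]) (use j in simp)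
      have "t1 15 0 = p ^ j" "t1 2 0 = p" using I env' by (auto simp: t1_def env_def)
      then show "aval (Mul (Var 15) eP) t1 = p ^ Suc j" by (simp only: aval.simps power_Suc2)
    qed simp
    ultimately have rb: "run ?body s' t2" by (rule run_seq)
    have post: "Suc j \<le> e \<and> t2 15 0 = p ^ Suc j \<and> t2 14 0 = (\<Sum>i<Suc j. g i * p ^ i)"
      using j by (simp add: t2_def t1_def)
    show "j < R \<and> wp ?body (\<lambda>s'. Suc j \<le> e \<and> s' 15 0 = p ^ Suc j \<and> s' 14 0 = (\<Sum>i<Suc j. g i * p ^ i)) s'"
      unfolding wp_iff_run by (rule conjI, rule \<open>j < R\<close>, rule exI[where x = t2], rule conjI, rule rb, rule post)
  next
    fix j s' assume ok': "ok s'" and fr: "frame (writes ?body) s2 s'"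
      and I: "j \<le> e \<and> s' 15 0 = p ^ j \<and> s' 14 0 = (\<Sum>i<j. g i * p ^ i)"
      and test: "aval (Sub eQ (Var 15)) s' = 0"
    have fr': "frame {14, 15} s s'" using fr fr2 by (auto simp: frame_def)
    have env': "env s'" by (rule env_frame[OF env fr']) auto
    have "q \<le> p ^ j" using test I env' by (simp add: env_def input_simps)
    then have "p ^ e \<le> p ^ j" by (simp only: q_eq)
    then have "e \<le> j" by (rule power_le_imp_le_exp[OF p_gt_1])
    then have "j = e" using I by simp
    then show "s' 14 0 = comb ?x ?c ?y" using I by (simp only: comb_g)
  qed
  then obtain s' where "run (While (Sub eQ (Var 15)) ?body) s2 s'" "s' 14 0 = comb ?x ?c ?y"
    by (rule wpE)
  then show ?thesis
    using that run_seq[OF r1 run_seq[OF r2]] unfolding Lin_def by blast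
qed

lemma Fma:
  assumes ok: "ok s" and env: "env s" and x: "s 10 0 < q" and y: "s 11 0 < q" and z: "s 12 0 < q"
  obtains s' where "run Fma s s'" "s' 12 0 = s 12 0 \<oplus> s 10 0 \<otimes> s 11 0"
proof -
  let ?m = "mul_acc (s 12 0) (s 10 0) (s 11 0)"
  have p0: "0 < p" using p_gt_1 by simp
  have pe: "p ^ i \<le> q" if "i \<le> e" for i unfolding q_eq using p0 that by (intro power_increasing) auto
  have mless: "fst (?m i) < q" "snd (?m i) < q" for i using mul_acc_less[OF z x] by auto
  define s1 where "s1 = s(13 := (s 13)(0 := 1))"
  have r1: "run (Set 13 (Const 1)) s s1"
    unfolding s1_def by (rule run_set[OF ok]) (use R_pos in auto)
  have fr1: "frame {13} s s1" by (auto simp: frame_def s1_def)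
  let ?l1 = "Lin (Var 12) (Modulo (Divide (Var 11) (Var 13)) eP) (Var 10)"
  let ?l2 = "Lin (Mul (Modulo (Var 10) (Divide eQ eP)) eP) (Divide (Var 10) (Divide eQ eP)) eR"
  let ?body = "Seq ?l1 (Seq (Set 12 (Var 14)) (Seq ?l2 (Seq (Set 10 (Var 14)) (Set 13 (Mul (Var 13) eP)))))"
  let ?I = "\<lambda>j s'. j \<le> e \<and> s' 13 0 = p ^ j \<and> s' 12 0 = fst (?m j) \<and> s' 10 0 = snd (?m j)"
  have "wp (While (Sub eQ (Var 13)) ?body) (\<lambda>s'. s' 12 0 = fst (?m e)) s1"
  proof (rule wp_while[where I = ?I])
    show "ok s1" by (rule run_ok[OF r1])
    show "?I 0 s1" by (simp add: s1_def)
  next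
    fix j s' assume ok': "ok s'" and fr: "frame (writes ?body) s1 s'" and I: "?I j s'"
      and test: "aval (Sub eQ (Var 13)) s' \<noteq> 0"
    have fr': "frame {10, 12, 13, 14, 15} s s'" using fr fr1 by (auto simp: frame_def)
    have env': "env s'" by (rule env_frame[OF env fr']) auto
    have y': "s' 11 0 = s 11 0" using frameD[OF fr', of 11] by simp
    have "p ^ j < q" using test I env' by (simp add: env_def input_simps)
    then have "p ^ j < p ^ e" by (simp only: q_eq)
    then have j: "j < e" by (rule power_less_imp_less_exp[OF p_gt_1])
    have "e < p ^ e" using power_gt_expt[of p e] p_gt_1 by simp
    then have "j < R" using j q_le_R q_eq by linarith
    obtain t1 where t1: "run ?l1 s' t1"
      "t1 14 0 = comb (s' 12 0) ((s' 11 0 div s' 13 0) mod p) (s' 10 0)"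
      by (rule Lin[OF ok' env', of "Var 12" "Modulo (Divide (Var 11) (Var 13)) eP" "Var 10"])
        (use env' in \<open>auto simp: env_def\<close>)
    have f1: "t1 12 = s' 12" "t1 10 = s' 10" "t1 13 = s' 13" "t1 0 = s' 0" "t1 2 = s' 2"
      using run_frame[OF t1(1)] by (auto simp: frame_def)
    have v1: "t1 14 0 = fst (?m (Suc j))" using t1(2) I y' by simp
    define t2 where "t2 = t1(12 := (t1 12)(0 := fst (?m (Suc j))))"
    have r2: "run (Set 12 (Var 14)) t1 t2"
      unfolding t2_def
    proof (rule run_set[OF run_ok[OF t1(1)]])
      show "fst (?m (Suc j)) \<le> R" using mless(1)[of "Suc j"] q_le_R by linarith
    qed (use v1 in auto)
    have env2: "env t2" using env' f1 by (simp add: env_def t2_def)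
    obtain t3 where t3: "run ?l2 t2 t3" "t3 14 0 = comb (s' 10 0 mod (q div p) * p) (s' 10 0 div (q div p)) r"
      by (rule Lin[OF run_ok[OF r2] env2, of "Mul (Modulo (Var 10) (Divide eQ eP)) eP" "Divide (Var 10) (Divide eQ eP)" eR])
        (use env2 f1 in \<open>auto simp: env_def t2_def input_simps\<close>)
    have f3: "t3 12 = t2 12" "t3 13 = t2 13" "t3 2 = t2 2"
      using run_frame[OF t3(1)] by (auto simp: frame_def)
    have v3: "t3 14 0 = snd (?m (Suc j))" using t3(2) I by (simp add: shift_def)
    define t4 where "t4 = t3(10 := (t3 10)(0 := snd (?m (Suc j))))"
    have r4: "run (Set 10 (Var 14)) t3 t4"
      unfolding t4_def
    proof (rule run_set[OF run_ok[OF t3(1)]])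
      show "snd (?m (Suc j)) \<le> R" using mless(2)[of "Suc j"] q_le_R by linarith
    qed (use v3 in auto)
    define t5 where "t5 = t4(13 := (t4 13)(0 := p ^ Suc j))"
    have r5: "run (Set 13 (Mul (Var 13) eP)) t4 t5"
      unfolding t5_def
    proof (rule run_set[OF run_ok[OF r4]])
      show "p ^ Suc j \<le> R" by (rule order.trans[OF pe q_le_R]) (use j in simp)
      have "t4 13 0 = p ^ j" "t4 2 0 = p" using I env' f1 f3 by (auto simp: t4_def t2_def env_def)
      then show "aval (Mul (Var 13) eP) t4 = p ^ Suc j" by (simp only: aval.simps power_Suc2)
    qed simp
    have rb: "run ?body s' t5" by (intro run_seq[OF t1(1)] run_seq[OF r2] run_seq[OF t3(1)] run_seq[OF r4] r5)
    have post: "?I (Suc j) t5"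
      using j f3 by (simp add: t5_def t4_def t2_def del: mul_acc.simps)
    show "j < R \<and> wp ?body (?I (Suc j)) s'"
      unfolding wp_iff_run by (rule conjI, rule \<open>j < R\<close>, rule exI[where x = t5], rule conjI, rule rb, rule post)
  next
    fix j s' assume ok': "ok s'" and fr: "frame (writes ?body) s1 s'" and I: "?I j s'"
      and test: "aval (Sub eQ (Var 13)) s' = 0"
    have fr': "frame {10, 12, 13, 14, 15} s s'" using fr fr1 by (auto simp: frame_def)
    have env': "env s'" by (rule env_frame[OF env fr']) auto
    have "q \<le> p ^ j" using test I env' by (simp add: env_def input_simps)
    then have "p ^ e \<le> p ^ j" by (simp only: q_eq)
    then have "e \<le> j" by (rule power_le_imp_le_exp[OF p_gt_1])
    then have "j = e" using I by simp
    then show "s' 12 0 = fst (?m e)" using I by simp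
  qed
  then obtain s' where "run (While (Sub eQ (Var 13)) ?body) s1 s'" "s' 12 0 = fst (?m e)"
    by (rule wpE)
  then show ?thesis
    using that run_seq[OF r1] mul_acc[OF z x y] unfolding Fma_def by metis
qed

lemma Acc:
  assumes ok: "ok s" and env: "env s" and a: "a < 60" "a \<notin> registers" "a \<noteq> 0" "a \<noteq> 2"
    and i: "aval i s = k" "k < IX" "reads i \<inter> registers = {}"
    and x: "aval x s = vx" "vx < q" "reads x \<inter> registers = {}"
    and y: "aval y s = vy" "vy < q" "reads y \<inter> registers = {}"
    and z: "s a k < q"
  obtains s' where "run (Acc a i x y) s s'" "s' a = (s a)(k := s a k \<oplus> vx \<otimes> vy)" "env s'"
proof -
  have qR: "v \<le> R" if "v < q" for v using that q_le_R by linarith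
  define s1 where "s1 = s(12 := (s 12)(0 := s a k))"
  have r1: "run (Set 12 (Cell a i)) s s1"
    unfolding s1_def by (rule run_set[OF ok]) (use i qR[OF z] in auto)
  have fr1: "frame registers s s1" by (auto simp: frame_def s1_def)
  define s2 where "s2 = s1(10 := (s1 10)(0 := vx))"
  have r2: "run (Set 10 x) s1 s2"
    unfolding s2_def by (rule run_set[OF run_ok[OF r1]]) (use aval_frame[OF fr1 x(3)] x qR[OF x(2)] in auto)
  have fr2: "frame registers s s2" using fr1 by (auto simp: frame_def s2_def)
  define s3 where "s3 = s2(11 := (s2 11)(0 := vy))"
  have r3: "run (Set 11 y) s2 s3"
    unfolding s3_def by (rule run_set[OF run_ok[OF r2]]) (use aval_frame[OF fr2 y(3)] y qR[OF y(2)] in auto)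
  have fr3: "frame registers s s3" using fr2 by (auto simp: frame_def s3_def)
  have v3: "s3 10 0 = vx" "s3 11 0 = vy" "s3 12 0 = s a k" by (auto simp: s1_def s2_def s3_def)
  have env3: "env s3" by (rule env_frame[OF env fr3]) auto
  obtain s4 where s4: "run Fma s3 s4" "s4 12 0 = s a k \<oplus> vx \<otimes> vy"
    by (rule Fma[OF run_ok[OF r3] env3]) (use v3 x y z in auto)
  have fr4: "frame registers s s4" using fr3 run_frame[OF s4(1)] by (auto simp: frame_def)
  have "s a k \<oplus> vx \<otimes> vy \<in> carrier F" using x(2) y(2) z by (simp add: carr_iff[symmetric])
  then have lt: "s a k \<oplus> vx \<otimes> vy < q" by (simp only: carr_iff)
  have ik: "aval i s4 = k" using aval_frame[OF fr4 i(3)] i(1) by simp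
  have r5: "run (Assign a i (Var 12)) s4 (s4(a := (s4 a)(k := s a k \<oplus> vx \<otimes> vy)))"
    using run_assign[OF run_ok[OF s4(1)] a(1), of i "Var 12"] ik i(2) s4(2) qR[OF lt] by simp
  show ?thesis
  proof (rule that)
    show "run (Acc a i x y) s (s4(a := (s4 a)(k := s a k \<oplus> vx \<otimes> vy)))"
      unfolding Acc_def by (intro run_seq[OF r1] run_seq[OF r2] run_seq[OF r3] run_seq[OF s4(1)] r5)
    show "(s4(a := (s4 a)(k := s a k \<oplus> vx \<otimes> vy))) a = (s a)(k := s a k \<oplus> vx \<otimes> vy)"
      using frameD[OF fr4 a(2)] by simp
    show "env (s4(a := (s4 a)(k := s a k \<oplus> vx \<otimes> vy)))"
      using env frameD[OF fr4, of 0] frameD[OF fr4, of 2] a by (simp add: env_def)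
  qed
qed

end

context machine begin

lemma run_for:
  assumes "ok s" "v < NA" "v \<notin> writes c" "aval b s = B" "B \<le> R" "reads b \<inter> insert v (writes c) = {}"
    and "\<And>i s f. I i (s(v := f)) = I i s"
    and "I 0 s"
    and "\<And>i s'. ok s' \<Longrightarrow> frame (insert v (writes c)) s s' \<Longrightarrow> i < B \<Longrightarrow> s' v 0 = i \<Longrightarrow>
      I i s' \<Longrightarrow> \<exists>s2. run c s' s2 \<and> I (Suc i) s2"
  shows "\<exists>s'. run (For v b c) s s' \<and> I B s'"
  unfolding wp_iff_run[symmetric]
  by (rule wp_for[where I = I and B = B]) (use assms in \<open>simp_all add: wp_iff_run\<close>)

lemma run_while:
  assumes "ok s" "I 0 s"
    and "\<And>j s'. ok s' \<Longrightarrow> frame (writes c) s s' \<Longrightarrow> I j s' \<Longrightarrow> aval e s' \<noteq> 0 \<Longrightarrow>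
      j < R \<and> (\<exists>s2. run c s' s2 \<and> I (Suc j) s2)"
  shows "\<exists>s' j. run (While e c) s s' \<and> I j s' \<and> aval e s' = 0"
proof -
  have "wp (While e c) (\<lambda>s'. \<exists>j. I j s' \<and> aval e s' = 0) s"
    by (rule wp_while[where I = I]) (use assms in \<open>auto simp: wp_iff_run\<close>)
  then show ?thesis by (auto simp: wp_iff_run)
qed

end

section \<open>Subroutines\<close>

text \<open>Arrays: \<open>20\<close> a point, \<open>21\<close> and \<open>22\<close> value and derivative, \<open>23\<close>--\<open>25\<close> and \<open>30\<close>--\<open>36\<close>
  scratch, \<open>40\<close> a functional, \<open>41\<close> the vectors of the kernel basis, \<open>42\<close> their number,
  \<open>43\<close> values of the functional, \<open>44\<close> the pivot, \<open>45\<close>--\<open>47\<close> scratch.\<close>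

definition Lc :: "expr \<Rightarrow> expr \<Rightarrow> nat \<Rightarrow> expr \<Rightarrow> expr \<Rightarrow> prog" where
  "Lc init cnt src off code = Seq (Set 34 code) (Seq (For 31 eN (Assign 20 (Var 31) init))
     (For 35 cnt (Seq (Set 36 (Modulo (Var 34) eQ)) (Seq (Set 34 (Divide (Var 34) eQ))
       (For 31 eN (Acc 20 (Var 31) (Var 36) (Cell src (Add off (Add (Mul (Var 35) eN) (Var 31))))))))))"

text \<open>This is \<open>1 - |i - c|\<close> in truncated subtraction, the indicator of equality
  of arrays 31 and 33. It relies on the codes 0 and 1 of zero and one.\<close>

abbreviation "eUnit \<equiv> Sub (Const 1) (Add (Sub (Var 31) (Var 33)) (Sub (Var 33) (Var 31)))"
abbreviation "eLen \<equiv> Cell 0 (Add (Const 3) eN)"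
abbreviation "eCoef \<equiv> Cell 0 (Add (Add (Const 4) eN) (Mul (Var 30) (Add eN (Const 1))))"
abbreviation "eExp \<equiv> Cell 0 (Add (Add (Add (Const 5) eN) (Mul (Var 30) (Add eN (Const 1)))) (Var 31))"

text \<open>The derivative in array 24 is renewed first, since it depends on the old value in array
  23.\<close>

definition Dual_step :: prog where
  "Dual_step = Seq (Set 25 (Const 0)) (Seq (Acc 25 (Const 0) (Var 24) (Cell 20 (Var 31)))
     (Seq (Acc 25 (Const 0) (Var 23) eUnit) (Seq (Set 24 (Var 25)) (Seq (Set 25 (Const 0))
     (Seq (Acc 25 (Const 0) (Var 23) (Cell 20 (Var 31))) (Set 23 (Var 25)))))))"

text \<open>The direction is the unit vector with the index in array 33, so one run gives the value
  together with one partial derivative.\<close>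

definition Eval :: prog where
  "Eval = Seq (Set 21 (Const 0)) (Seq (Set 22 (Const 0)) (For 30 eLen
     (Seq (Set 23 eCoef) (Seq (Set 24 (Const 0)) (Seq (For 31 eN (For 32 eExp Dual_step))
     (Seq (Acc 21 (Const 0) (Var 23) (Const 1)) (Acc 22 (Const 0) (Var 24) (Const 1))))))))"

abbreviation "eVec j i \<equiv> Add (Mul j eN) i"

text \<open>One elimination step on the kernel basis. In truncated arithmetic the test of the search
  loop is a conjunction: the index is in range and the functional vanishes there. After lowering the
  count, the last vector and its functional value move into the place of the pivot, which is saved
  in array 44.\<close>

definition Reduce :: prog where
  "Reduce = Seq (For 35 (Var 42) (Seq (Assign 43 (Var 35) (Const 0))
       (For 31 eN (Acc 43 (Var 35) (Cell 40 (Var 31)) (Cell 41 (eVec (Var 35) (Var 31)))))))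
     (Seq (Set 46 (Const 0)) (Seq
     (While (Mul (Sub (Var 42) (Var 46)) (Sub (Const 1) (Cell 43 (Var 46)))) (Set 46 (Add (Var 46) (Const 1))))
     (Cond (Sub (Var 42) (Var 46))
       (Seq (Set 45 (Cell 43 (Var 46))) (Seq (Set 42 (Sub (Var 42) (Const 1)))
       (Seq (For 31 eN (Seq (Assign 44 (Var 31) (Cell 41 (eVec (Var 46) (Var 31))))
          (Assign 41 (eVec (Var 46) (Var 31)) (Cell 41 (eVec (Var 42) (Var 31))))))
       (Seq (Assign 43 (Var 46) (Cell 43 (Var 42)))
       (For 35 (Var 42) (Seq (Set 47 (Const 0)) (Seq
          (Acc 47 (Const 0) (Sub eP (Const 1)) (Cell 43 (Var 35)))
          (For 31 eN (Seq (Set 25 (Const 0)) (Seq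
             (Acc 25 (Const 0) (Var 45) (Cell 41 (eVec (Var 35) (Var 31)))) (Seq
             (Acc 25 (Const 0) (Var 47) (Cell 44 (Var 31)))
             (Assign 41 (eVec (Var 35) (Var 31)) (Var 25)))))))))))))
       Skip)))"

lemma writes_Lc [simp]: "writes (Lc init cnt src off code) = registers \<union> {20, 31, 34, 35, 36}"
  by (auto simp: Lc_def)

lemma writes_Dual_step [simp]: "writes Dual_step = registers \<union> {23, 24, 25}"
  by (auto simp: Dual_step_def)

lemma writes_Eval [simp]: "writes Eval = registers \<union> {21, 22, 23, 24, 25, 30, 31, 32}"
  by (auto simp: Eval_def)

lemma writes_Reduce [simp]: "writes Reduce = registers \<union> {25, 31, 35, 41, 42, 43, 44, 45, 46, 47}"
  by (auto simp: Reduce_def)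

context algorithm begin

abbreviation qdig :: "nat \<Rightarrow> nat \<Rightarrow> nat" where
  "qdig z j \<equiv> z div q ^ j mod q"

lemma qdig_less: "qdig z j < q"
  using q_gt_1 by simp

lemma n_less_IX: "n < IX"
  using IX_square by simp

lemma n_le_R: "n \<le> R"
  using n_less_IX IX_le_R by simp

lemma env_simps:
  assumes "env s" shows "s 0 0 = q" "s 0 (Suc 0) = r" "s 0 2 = n" "s 2 0 = p" "s 0 (3 + n) = length f"
    and "i < n \<Longrightarrow> s 0 (3 + i) = u0 i"
  using assms input_simps by (auto simp: env_def)

lemma env_upd: "a \<noteq> 0 \<Longrightarrow> a \<noteq> 2 \<Longrightarrow> env (s(a := g)) = env s"
  by (simp add: env_def)

lemma field_less: "x < q \<Longrightarrow> y < q \<Longrightarrow> x \<oplus> y < q" "x < q \<Longrightarrow> y < q \<Longrightarrow> x \<otimes> y < q"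
  using a_closed m_closed by (simp_all only: carr_iff[symmetric])

lemma zero_add: "x < q \<Longrightarrow> 0 \<oplus> x = x"
  using l_zero[of x] by (simp only: carr_iff zero_code)

lemma less_R: "x < q \<Longrightarrow> x \<le> R"
  using q_le_R by simp

lemma vec_index: "j < n \<Longrightarrow> i < n \<Longrightarrow> j * n + i < n * n"
proof -
  assume "j < n" "i < n"
  then have "j * n + i < Suc j * n" by simp
  also have "\<dots> \<le> n * n" using \<open>j < n\<close> by (intro mult_le_mono) auto
  finally show ?thesis .
qed

lemma vec_index_inj: "i < n \<Longrightarrow> i' < n \<Longrightarrow> j * n + i = j' * n + i' \<longleftrightarrow> j = j' \<and> i = i'"
proof
  assume i: "i < n" "i' < n" and eq: "j * n + i = j' * n + i'"
  have "(j * n + i) div n = j" "(j' * n + i') div n = j'" using i by simp_all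
  with eq have "j = j'" by simp
  with eq show "j = j' \<and> i = i'" by simp
qed simp

lemma Lc:
  assumes ok: "ok s" and env: "env s" and z: "aval code s = z" "z \<le> R"
    and init: "\<And>s' i. env s' \<Longrightarrow> s' 31 0 = i \<Longrightarrow> i < n \<Longrightarrow> aval init s' = v0 i"
    and v0: "\<And>i. i < n \<Longrightarrow> v0 i < q"
    and cnt: "aval cnt s = N" "N \<le> R" "reads cnt \<inter> writes (Lc init cnt src off code) = {}"
    and src: "src \<notin> writes (Lc init cnt src off code)"
    and off: "aval off s = a" "reads off \<inter> writes (Lc init cnt src off code) = {}"
    and vals: "\<And>j i. j < N \<Longrightarrow> i < n \<Longrightarrow> s src (a + (j * n + i)) < q"
  obtains s' where "run (Lc init cnt src off code) s s'" "env s'"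
    "\<And>i. i < n \<Longrightarrow> s' 20 i = v0 i \<oplus> fsum N (\<lambda>j. qdig z j \<otimes> s src (a + (j * n + i)))"
proof -
  let ?W = "registers \<union> {20, 31, 34, 35, 36}"
  define val where "val = (\<lambda>j i. v0 i \<oplus> fsum j (\<lambda>j. qdig z j \<otimes> s src (a + (j * n + i))))"
  have fc: "fsum j (\<lambda>j. qdig z j \<otimes> s src (a + (j * n + i))) \<in> carrier F" if "j \<le> N" "i < n" for j i
    by (rule fsum_closed, rule m_closed) (use that vals qdig_less in \<open>auto simp: carr_iff\<close>)
  have val_less: "val j i < q" if "j \<le> N" "i < n" for j i
    using fc[OF that] v0[OF that(2)] unfolding val_def by (intro field_less) (simp_all add: carr_iff)
  have val_Suc: "val j i \<oplus> qdig z j \<otimes> s src (a + (j * n + i)) = val (Suc j) i" if "j < N" "i < n" for j i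
    unfolding val_def fsum.simps
    by (rule a_assoc) (use fc[of j i] that vals v0 qdig_less in \<open>auto simp: carr_iff intro!: field_less\<close>)
  have val_0: "val 0 i = v0 i" if "i < n" for i
    using v0[OF that] by (simp add: val_def carr_iff)
  define s1 where "s1 = s(34 := (s 34)(0 := z))"
  have r1: "run (Set 34 code) s s1" unfolding s1_def by (rule run_set[OF ok]) (use z in auto)
  have env1: "env s1" using env by (simp add: s1_def env_upd)
  have "\<exists>s2. run (For 31 eN (Assign 20 (Var 31) init)) s1 s2 \<and> (\<forall>i<n. s2 20 i = v0 i)"
  proof (rule run_for[where I = "\<lambda>i s'. \<forall>k<i. s' 20 k = v0 k" and B = n])
    show "ok s1" by (rule run_ok[OF r1])
    show "aval eN s1 = n" using env_simps[OF env1] by simp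
    show "n \<le> R" by (rule n_le_R)
  next
    fix i s' assume s': "ok s'" "frame (insert 31 (writes (Assign 20 (Var 31) init))) s1 s'" "i < n"
      "s' 31 0 = i" "\<forall>k<i. s' 20 k = v0 k"
    have env': "env s'" by (rule env_frame[OF env1 s'(2)]) auto
    let ?t = "s'(20 := (s' 20)(i := v0 i))"
    have "run (Assign 20 (Var 31) init) s' ?t"
      using run_assign[OF s'(1), of 20 "Var 31" init] init[OF env' s'(4,3)] s'(3,4) n_less_IX less_R[OF v0[OF s'(3)]]
      by simp
    moreover have "\<forall>k<Suc i. ?t 20 k = v0 k" using s'(5) by (auto simp: less_Suc_eq)
    ultimately show "\<exists>s2. run (Assign 20 (Var 31) init) s' s2 \<and> (\<forall>k<Suc i. s2 20 k = v0 k)" by blast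
  qed auto
  then obtain s2 where r2: "run (For 31 eN (Assign 20 (Var 31) init)) s1 s2"
    and p2: "\<forall>i<n. s2 20 i = v0 i" by blast
  have fr2: "frame ?W s s2" using run_frame[OF r2] by (auto simp: frame_def s1_def)
  have env2: "env s2" by (rule env_frame[OF env fr2]) auto
  have t2: "s2 34 0 = z" using run_frame[OF r2] by (simp add: frame_def s1_def)
  let ?src = "Cell src (Add off (Add (Mul (Var 35) eN) (Var 31)))"
  let ?acc = "Acc 20 (Var 31) (Var 36) ?src"
  let ?body = "Seq (Set 36 (Modulo (Var 34) eQ)) (Seq (Set 34 (Divide (Var 34) eQ)) (For 31 eN ?acc))"
  have wb: "insert 35 (writes ?body) = ?W" by auto
  let ?I = "\<lambda>j s'. s' 34 0 = z div q ^ j \<and> (\<forall>i<n. s' 20 i = val j i)"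
  have "\<exists>s3. run (For 35 cnt ?body) s2 s3 \<and> ?I N s3"
  proof (rule run_for[where I = ?I and B = N])
    show "ok s2" by (rule run_ok[OF r2])
    show "aval cnt s2 = N" using aval_frame[OF fr2] cnt by simp
    show "N \<le> R" by (rule cnt)
    show "reads cnt \<inter> insert 35 (writes ?body) = {}" unfolding wb using cnt(3) by simp
    show "?I 0 s2" using t2 p2 val_0 by simp
  next
    fix j s' assume s': "ok s'" "frame (insert 35 (writes ?body)) s2 s'" "j < N" "s' 35 0 = j" "?I j s'"
    have fr': "frame ?W s s'" using s'(2) fr2 unfolding wb by (auto simp: frame_def)
    have env': "env s'" by (rule env_frame[OF env fr']) auto
    define t1 where "t1 = s'(36 := (s' 36)(0 := qdig z j))"
    have q1: "run (Set 36 (Modulo (Var 34) eQ)) s' t1"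
      unfolding t1_def
      by (rule run_set[OF s'(1)]) (use s'(5) env_simps[OF env'] less_R[OF qdig_less] in auto)
    define t2 where "t2 = t1(34 := (t1 34)(0 := z div q ^ Suc j))"
    have zle: "z div q ^ Suc j \<le> R" using z(2) by (meson div_le_dividend order.trans)
    have zS: "z div q ^ j div q = z div q ^ Suc j" by (simp only: power_Suc2 div_mult2_eq)
    have q2: "run (Set 34 (Divide (Var 34) eQ)) t1 t2"
      unfolding t2_def
      by (rule run_set[OF run_ok[OF q1]])
        (use s'(5) env_simps(1)[OF env'] zle zS in \<open>simp_all add: t1_def del: power_Suc\<close>)
    have frt: "frame ?W s t2" using fr' by (auto simp: frame_def t2_def t1_def)
    have envt: "env t2" by (rule env_frame[OF env frt]) auto
    have t35: "t2 35 0 = j" "t2 36 0 = qdig z j" "t2 34 0 = z div q ^ Suc j" "\<forall>i<n. t2 20 i = val j i"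
      using s'(4,5) by (auto simp: t2_def t1_def)
    let ?K = "\<lambda>i s'. s' 34 0 = z div q ^ Suc j \<and> s' 35 0 = j \<and> s' 36 0 = qdig z j \<and>
      (\<forall>k<n. s' 20 k = (if k < i then val (Suc j) k else val j k))"
    have "\<exists>s3. run (For 31 eN ?acc) t2 s3 \<and> ?K n s3"
    proof (rule run_for[where I = ?K and B = n])
      show "ok t2" by (rule run_ok[OF q2])
      show "aval eN t2 = n" using env_simps[OF envt] by simp
      show "n \<le> R" by (rule n_le_R)
      show "?K 0 t2" using t35 by auto
    next
      fix i s'' assume s'': "ok s''" "frame (insert 31 (writes ?acc)) t2 s''" "i < n" "s'' 31 0 = i" "?K i s''"
      have fr'': "frame ?W s s''" using s''(2) frt by (auto simp: frame_def)
      have env'': "env s''" by (rule env_frame[OF env fr'']) auto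
      have "src \<notin> ?W" using src by simp
      then have src'': "s'' src = s src" by (rule frameD[OF fr''])
      have off'': "aval off s'' = a" using aval_frame[OF fr''] off by simp
      have v: "s src (a + (j * n + i)) < q" using vals s'(3) s''(3) by simp
      obtain s3 where s3: "run ?acc s'' s3"
        "s3 20 = (s'' 20)(i := s'' 20 i \<oplus> qdig z j \<otimes> s src (a + (j * n + i)))" "env s3"
      proof (rule Acc[OF s''(1) env''])
        show "aval (Var 31) s'' = i" using s''(4) by simp
        show "aval (Var 36) s'' = qdig z j" using s''(5) by simp
        show "aval ?src s'' = s src (a + (j * n + i))"
          using s''(4,5) env_simps[OF env''] off'' src'' by simp
        show "i < IX" using s''(3) n_less_IX by simp
        show "qdig z j < q" by (rule qdig_less)
        show "s src (a + (j * n + i)) < q" by (rule v)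
        show "s'' 20 i < q" using s''(3,5) val_less s'(3) by simp
        show "reads ?src \<inter> registers = {}" using src off(2) by auto
      qed auto
      have "s3 34 = s'' 34" "s3 35 = s'' 35" "s3 36 = s'' 36"
        using run_frame[OF s3(1)] by (auto simp: frame_def)
      then have "?K (Suc i) s3"
        using s''(3,5) s3(2) val_Suc[OF s'(3) s''(3)] by (auto simp: less_Suc_eq)
      with s3(1) show "\<exists>s2. run ?acc s'' s2 \<and> ?K (Suc i) s2" by blast
    qed auto
    then obtain s3 where s3: "run (For 31 eN ?acc) t2 s3" "?K n s3" by blast
    have "run ?body s' s3" by (rule run_seq[OF q1 run_seq[OF q2 s3(1)]])
    moreover have "?I (Suc j) s3" using s3(2) by simp
    ultimately show "\<exists>s2. run ?body s' s2 \<and> ?I (Suc j) s2" by blast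
  qed auto
  then obtain s3 where s3: "run (For 35 cnt ?body) s2 s3" "?I N s3" by blast
  have r: "run (Lc init cnt src off code) s s3"
    unfolding Lc_def by (rule run_seq[OF r1 run_seq[OF r2 s3(1)]])
  have "env s3" by (rule env_frame[OF env run_frame[OF r]]) auto
  with r s3(2) show ?thesis by (intro that[of s3]) (auto simp: val_def)
qed

lemma Dual_step:
  assumes ok: "ok s" and env: "env s" and i: "s 31 0 = i"
    and v: "s 23 0 < q" "s 24 0 < q" "s 20 i < q"
  obtains s' where "run Dual_step s s'" "env s'"
    "(s' 23 0, s' 24 0) = dual_step (s 20) (unit_vec (s 33 0)) i (s 23 0, s 24 0)"
proof -
  let ?w = "unit_vec (s 33 0) i"
  have w: "?w < q" using q_gt_1 by (simp add: zero_code one_code)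
  have eUnit: "aval eUnit s' = ?w" if "s' 31 0 = i" "s' 33 = s 33" for s'
    using that by (simp add: zero_code one_code)
  note [simp] = frame_def
  define s1 where "s1 = s(25 := (s 25)(0 := 0))"
  have r1: "run (Set 25 (Const 0)) s s1" unfolding s1_def by (rule run_set[OF ok]) auto
  have env1: "env s1" using env by (simp add: s1_def env_upd)
  obtain s2 where r2: "run (Acc 25 (Const 0) (Var 24) (Cell 20 (Var 31))) s1 s2"
    and p2: "s2 25 = (s1 25)(0 := s1 25 0 \<oplus> s 24 0 \<otimes> s 20 i)" and env2: "env s2"
    by (rule Acc[OF run_ok[OF r1] env1, of 25 "Const 0" 0 "Var 24" "s 24 0" "Cell 20 (Var 31)" "s 20 i"])
      (use i v IX_pos q_gt_1 in \<open>auto simp: s1_def\<close>)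
  have f2: "s2 23 = s 23" "s2 24 = s 24" "s2 20 = s 20" "s2 31 = s 31" "s2 33 = s 33"
    using run_frame[OF r2] by (auto simp: s1_def)
  have v2: "s2 25 0 = s 24 0 \<otimes> s 20 i" using p2 zero_add[OF field_less(2)[OF v(2,3)]] by (simp add: s1_def)
  obtain s3 where r3: "run (Acc 25 (Const 0) (Var 23) eUnit) s2 s3"
    and p3: "s3 25 = (s2 25)(0 := s2 25 0 \<oplus> s 23 0 \<otimes> ?w)" and env3: "env s3"
  proof (rule Acc[OF run_ok[OF r2] env2, of 25 "Const 0" 0 "Var 23" "s 23 0" eUnit ?w])
    show "aval eUnit s2 = ?w" by (rule eUnit) (use f2 i in auto)
    show "?w < q" by (rule w)
    show "s2 25 0 < q" unfolding v2 by (rule field_less(2)[OF v(2,3)])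
  qed (use f2 v IX_pos in auto)
  have f3: "s3 23 = s 23" "s3 24 = s 24" "s3 20 = s 20" "s3 31 = s 31" "s3 33 = s 33"
    using run_frame[OF r3] f2 by auto
  define d where "d = s 24 0 \<otimes> s 20 i \<oplus> s 23 0 \<otimes> ?w"
  have d: "d < q" unfolding d_def by (intro field_less v w)
  have v3: "s3 25 0 = d" using p3 v2 by (simp add: d_def)
  define s4 where "s4 = s3(24 := (s3 24)(0 := d))"
  have r4: "run (Set 24 (Var 25)) s3 s4"
    unfolding s4_def by (rule run_set[OF run_ok[OF r3]]) (use v3 less_R[OF d] in auto)
  define s5 where "s5 = s4(25 := (s4 25)(0 := 0))"
  have r5: "run (Set 25 (Const 0)) s4 s5" unfolding s5_def by (rule run_set[OF run_ok[OF r4]]) auto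
  have env5: "env s5" using env3 by (simp add: s5_def s4_def env_upd)
  obtain s6 where r6: "run (Acc 25 (Const 0) (Var 23) (Cell 20 (Var 31))) s5 s6"
    and p6: "s6 25 = (s5 25)(0 := s5 25 0 \<oplus> s 23 0 \<otimes> s 20 i)" and env6: "env s6"
    by (rule Acc[OF run_ok[OF r5] env5, of 25 "Const 0" 0 "Var 23" "s 23 0" "Cell 20 (Var 31)" "s 20 i"])
      (use i v f3 IX_pos q_gt_1 in \<open>auto simp: s5_def s4_def\<close>)
  have v6: "s6 25 0 = s 23 0 \<otimes> s 20 i" using p6 zero_add[OF field_less(2)[OF v(1,3)]] by (simp add: s5_def)
  have f6: "s6 24 0 = d" using run_frame[OF r6] by (simp add: s5_def s4_def)
  define s7 where "s7 = s6(23 := (s6 23)(0 := s 23 0 \<otimes> s 20 i))"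
  have r7: "run (Set 23 (Var 25)) s6 s7"
    unfolding s7_def by (rule run_set[OF run_ok[OF r6]]) (use v6 less_R[OF field_less(2)[OF v(1,3)]] in auto)
  have "run Dual_step s s7"
    unfolding Dual_step_def
    by (intro run_seq[OF r1] run_seq[OF r2] run_seq[OF r3] run_seq[OF r4] run_seq[OF r5] run_seq[OF r6] r7)
  moreover have "env s7" using env6 by (simp add: s7_def env_upd)
  moreover have "(s7 23 0, s7 24 0) = dual_step (s 20) (unit_vec (s 33 0)) i (s 23 0, s 24 0)"
    using f6 by (simp add: s7_def dual_step_def d_def)
  ultimately show ?thesis by (rule that)
qed

lemma coeff_closed: "t < length f \<Longrightarrow> fst (f ! t) \<in> carrier F"
  using f_poly nth_mem[of t f] by (auto simp: polynomial_in_def case_prod_unfold)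

lemma Eval:
  assumes ok: "ok s" and env: "env s" and x: "\<And>i. i < n \<Longrightarrow> s 20 i < q"
  obtains s' where "run Eval s s'" "env s'"
    "(s' 21 0, s' 22 0) = dual_poly (s 20) (unit_vec (s 33 0)) n f (length f)"
proof -
  let ?W = "registers \<union> {21, 22, 23, 24, 25, 30, 31, 32}"
  let ?w = "unit_vec (s 33 0)"
  let ?dm = "\<lambda>t i. dual_mono (s 20) ?w (f ! t) i"
  have xc: "s 20 i \<in> carrier F" if "i < n" for i using x[OF that] by (simp add: carr_iff)
  have wc: "?w i \<in> carrier F" for i by simp
  have dmc: "fst (?dm t i) < q" "snd (?dm t i) < q" if "t < length f" "i \<le> n" for t i
    using dual_mono_closed[of i "s 20" ?w "f ! t"] xc coeff_closed that by (auto simp: carr_iff[symmetric])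
  have dpc: "fst ((dual_step (s 20) ?w i ^^ j) (?dm t i)) < q" "snd ((dual_step (s 20) ?w i ^^ j) (?dm t i)) < q"
    if "t < length f" "i < n" for t i j
    using dual_pow_closed[of "s 20" i ?w "?dm t i" j] dmc[of t i] xc[OF that(2)] wc that
    by (simp_all add: carr_iff[symmetric])
  let ?dp = "\<lambda>t. dual_poly (s 20) ?w n f t"
  have dpoly: "fst (?dp t) < q" "snd (?dp t) < q" if "t \<le> length f" for t
    using that dmc unfolding dual_poly_def
    by (auto simp: carr_iff[symmetric] intro!: fsum_closed)
  have lenR: "length f \<le> R"
  proof -
    have "length f * 1 \<le> length f * (n + 1)" by (intro mult_le_mono) auto
    then show ?thesis using IX_input IX_le_R by linarith
  qed
  define s1 where "s1 = s(21 := (s 21)(0 := 0))"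
  have r1: "run (Set 21 (Const 0)) s s1" unfolding s1_def by (rule run_set[OF ok]) auto
  define s2 where "s2 = s1(22 := (s1 22)(0 := 0))"
  have r2: "run (Set 22 (Const 0)) s1 s2" unfolding s2_def by (rule run_set[OF run_ok[OF r1]]) auto
  have fr2: "frame ?W s s2" by (auto simp: frame_def s2_def s1_def)
  have env2: "env s2" by (rule env_frame[OF env fr2]) auto
  let ?fj = "For 32 eExp Dual_step" and ?fi = "For 31 eN (For 32 eExp Dual_step)"
  let ?b5 = "Acc 22 (Const 0) (Var 24) (Const 1)" and ?b4 = "Acc 21 (Const 0) (Var 23) (Const 1)"
  let ?body = "Seq (Set 23 eCoef) (Seq (Set 24 (Const 0)) (Seq ?fi (Seq ?b4 ?b5)))"
  have wb: "insert 30 (writes ?body) = ?W" by auto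
  let ?I = "\<lambda>t s'. s' 21 0 = fst (?dp t) \<and> s' 22 0 = snd (?dp t)"
  have "\<exists>s3. run (For 30 eLen ?body) s2 s3 \<and> ?I (length f) s3"
  proof (rule run_for[where I = ?I and B = "length f"])
    show "ok s2" by (rule run_ok[OF r2])
    show "aval eLen s2 = length f" using env_simps[OF env2] by simp
    show "length f \<le> R" by (rule lenR)
    show "?I 0 s2" by (simp add: s2_def s1_def dual_poly_def zero_code)
  next
    fix t s' assume s': "ok s'" "frame (insert 30 (writes ?body)) s2 s'" "t < length f" "s' 30 0 = t" "?I t s'"
    have fr': "frame ?W s s'" using s'(2) fr2 unfolding wb by (auto simp: frame_def)
    have env': "env s'" by (rule env_frame[OF env fr']) auto
    define t1 where "t1 = s'(23 := (s' 23)(0 := fst (f ! t)))"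
    have q1: "run (Set 23 eCoef) s' t1"
      unfolding t1_def
    proof (rule run_set[OF s'(1)])
      have "aval eCoef s' = s' 0 (4 + n + t * (n + 1))" using env_simps[OF env'] s'(4) by simp
      then show "aval eCoef s' = fst (f ! t)" using env' input_monomials(1)[OF s'(3)] by (simp add: env_def)
      show "fst (f ! t) \<le> R" using coeff_closed[OF s'(3)] less_R by (simp add: carr_iff)
    qed simp
    define t2 where "t2 = t1(24 := (t1 24)(0 := 0))"
    have q2: "run (Set 24 (Const 0)) t1 t2" unfolding t2_def by (rule run_set[OF run_ok[OF q1]]) auto
    have frt: "frame ?W s t2" using fr' by (auto simp: frame_def t2_def t1_def)
    have envt: "env t2" by (rule env_frame[OF env frt]) auto
    let ?K = "\<lambda>i s''. (s'' 23 0, s'' 24 0) = ?dm t i \<and> s'' 30 0 = t \<and> ?I t s''"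
    have "\<exists>s3. run ?fi t2 s3 \<and> ?K n s3"
    proof (rule run_for[where I = ?K and B = n])
      show "ok t2" by (rule run_ok[OF q2])
      show "aval eN t2 = n" using env_simps[OF envt] by simp
      show "n \<le> R" by (rule n_le_R)
      show "?K 0 t2" using s'(4,5) by (simp add: t2_def t1_def zero_code)
    next
      fix i s'' assume s'': "ok s''" "frame (insert 31 (writes ?fj)) t2 s''" "i < n" "s'' 31 0 = i" "?K i s''"
      have fr'': "frame ?W s s''" using s''(2) frt by (auto simp: frame_def)
      have env'': "env s''" by (rule env_frame[OF env fr'']) auto
      let ?M = "\<lambda>j s3. (s3 23 0, s3 24 0) = (dual_step (s 20) ?w i ^^ j) (?dm t i) \<and> s3 31 0 = i \<and> s3 30 0 = t \<and> ?I t s3"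
      have ex: "aval eExp s'' = snd (f ! t) ! i"
      proof -
        have "aval eExp s'' = s'' 0 (5 + n + t * (n + 1) + i)" using env_simps[OF env''] s''(4,5) by simp
        then show ?thesis using env'' input_monomials(2)[OF s'(3) s''(3)] by (simp add: env_def)
      qed
      have "\<exists>s3. run ?fj s'' s3 \<and> ?M (snd (f ! t) ! i) s3"
      proof (rule run_for[where I = ?M and B = "snd (f ! t) ! i"])
        show "ok s''" by (rule s'')
        show "aval eExp s'' = snd (f ! t) ! i" by (rule ex)
        \<comment> \<open>An exponent is the content of a cell, which bounds the innermost loop by
          \<open>R\<close>.\<close>
        have "aval eExp s'' \<le> R" using ok_le[OF s''(1)] by simp
        then show "snd (f ! t) ! i \<le> R" unfolding ex .
        show "?M 0 s''" using s''(4,5) by simp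
      next
        fix j s3 assume s3: "ok s3" "frame (insert 32 (writes Dual_step)) s'' s3" "j < snd (f ! t) ! i" "s3 32 0 = j" "?M j s3"
        have fr3: "frame ?W s s3" using s3(2) fr'' by (auto simp: frame_def)
        have env3: "env s3" by (rule env_frame[OF env fr3]) auto
        have x3: "s3 20 = s 20" "s3 33 = s 33" using fr3 by (auto simp: frame_def)
        have M: "s3 23 0 = fst ((dual_step (s 20) ?w i ^^ j) (?dm t i))" "s3 24 0 = snd ((dual_step (s 20) ?w i ^^ j) (?dm t i))"
          using s3(5) by (simp_all add: prod_eq_iff)
        obtain s4 where s4: "run Dual_step s3 s4" "env s4"
          "(s4 23 0, s4 24 0) = dual_step (s3 20) (unit_vec (s3 33 0)) i (s3 23 0, s3 24 0)"
        proof (rule Dual_step[OF s3(1) env3])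
          show "s3 31 0 = i" using s3(5) by simp
          show "s3 23 0 < q" "s3 24 0 < q" unfolding M by (rule dpc[OF s'(3) s''(3)])+
          show "s3 20 i < q" unfolding x3 by (rule x[OF s''(3)])
        qed
        have f4: "s4 31 = s3 31" "s4 30 = s3 30" "s4 21 = s3 21" "s4 22 = s3 22"
          using run_frame[OF s4(1)] by (auto simp: frame_def)
        have "(s4 23 0, s4 24 0) = (dual_step (s 20) ?w i ^^ Suc j) (?dm t i)"
          using s4(3) s3(5) unfolding x3 by simp
        then have "?M (Suc j) s4" using s3(5) f4 by simp
        with s4(1) show "\<exists>s2. run Dual_step s3 s2 \<and> ?M (Suc j) s2" by blast
      qed auto
      then obtain s3 where s3: "run ?fj s'' s3" "?M (snd (f ! t) ! i) s3" by blast
      then have "?K (Suc i) s3" by simp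
      with s3(1) show "\<exists>s2. run ?fj s'' s2 \<and> ?K (Suc i) s2" by blast
    qed auto
    then obtain t3 where t3: "run ?fi t2 t3" "?K n t3" by blast
    have env3: "env t3" by (rule env_frame[OF envt run_frame[OF t3(1)]]) auto
    have K: "t3 23 0 = fst (?dm t n)" "t3 24 0 = snd (?dm t n)" "t3 21 0 = fst (?dp t)" "t3 22 0 = snd (?dp t)"
      using t3(2) by (auto simp: prod_eq_iff)
    obtain t4 where t4: "run ?b4 t3 t4" "t4 21 = (t3 21)(0 := t3 21 0 \<oplus> fst (?dm t n) \<otimes> 1)" "env t4"
      by (rule Acc[OF run_ok[OF t3(1)] env3, of 21 "Const 0" 0 "Var 23" "fst (?dm t n)" "Const 1" 1])
        (use K dmc[OF s'(3)] dpoly[of t] s'(3) IX_pos q_gt_1 in auto)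
    have f4: "t4 24 = t3 24" "t4 22 = t3 22" using run_frame[OF t4(1)] by (auto simp: frame_def)
    obtain t5 where t5: "run ?b5 t4 t5" "t5 22 = (t4 22)(0 := t4 22 0 \<oplus> snd (?dm t n) \<otimes> 1)" "env t5"
      by (rule Acc[OF run_ok[OF t4(1)] t4(3), of 22 "Const 0" 0 "Var 24" "snd (?dm t n)" "Const 1" 1])
        (use K f4 dmc[OF s'(3)] dpoly[of t] s'(3) IX_pos q_gt_1 in auto)
    have f5: "t5 21 = t4 21" using run_frame[OF t5(1)] by (auto simp: frame_def)
    have one: "y \<otimes> 1 = y" if "y < q" for y using r_one[of y] that by (simp only: carr_iff one_code)
    have "?I (Suc t) t5"
      using t5(2) t4(2) f4 f5 K one dmc[OF s'(3)] by (simp add: dual_poly_def)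
    moreover have "run ?body s' t5"
      by (intro run_seq[OF q1] run_seq[OF q2] run_seq[OF t3(1)] run_seq[OF t4(1)] t5(1))
    ultimately show "\<exists>s2. run ?body s' s2 \<and> ?I (Suc t) s2" by blast
  qed auto
  then obtain s3 where s3: "run (For 30 eLen ?body) s2 s3" "?I (length f) s3" by blast
  have r: "run Eval s s3" unfolding Eval_def by (rule run_seq[OF r1 run_seq[OF r2 s3(1)]])
  have "env s3" by (rule env_frame[OF env run_frame[OF r]]) auto
  with r s3(2) show ?thesis by (intro that[of s3]) (auto simp: prod_eq_iff)
qed

end

section \<open>Correctness of the elimination step\<close>

context algorithm begin

abbreviation vecs :: "store \<Rightarrow> nat \<Rightarrow> nat \<Rightarrow> nat" where
  "vecs s j i \<equiv> s 41 (j * n + i)"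

lemma scalars_less: "scalars n v \<longleftrightarrow> (\<forall>i<n. v i < q)"
  by (simp add: scalars_def carr_iff)

lemma fsum_less: "(\<And>i. i < m \<Longrightarrow> g i < q) \<Longrightarrow> fsum m g < q"
  using fsum_closed[of m g] by (simp only: carr_iff)

lemma Reduce_functional:
  assumes ok: "ok s" and env: "env s" and N: "s 42 0 \<le> n"
    and V: "\<And>j. j < s 42 0 \<Longrightarrow> scalars n (vecs s j)" and g: "scalars n (s 40)"
  shows "\<exists>s'. run (For 35 (Var 42) (Seq (Assign 43 (Var 35) (Const 0))
       (For 31 eN (Acc 43 (Var 35) (Cell 40 (Var 31)) (Cell 41 (eVec (Var 35) (Var 31))))))) s s' \<and>
    (\<forall>j<s 42 0. s' 43 j = dot n (s 40) (vecs s j))"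
proof -
  let ?acc = "Acc 43 (Var 35) (Cell 40 (Var 31)) (Cell 41 (eVec (Var 35) (Var 31)))"
  let ?body = "Seq (Assign 43 (Var 35) (Const 0)) (For 31 eN ?acc)"
  define l where "l = (\<lambda>j. dot n (s 40) (vecs s j))"
  have glt: "s 40 i < q" if "i < n" for i using g that by (simp add: scalars_less)
  have Vlt: "vecs s j i < q" if "j < s 42 0" "i < n" for j i using V[OF that(1)] that(2) by (simp add: scalars_less)
  have part: "fsum i (\<lambda>k. s 40 k \<otimes> vecs s j k) < q" if "i \<le> n" "j < s 42 0" for i j
    by (rule fsum_less, rule field_less) (use that glt Vlt in auto)
  let ?I = "\<lambda>j s'. \<forall>j'<j. s' 43 j' = l j'"
  have "\<exists>s'. run (For 35 (Var 42) ?body) s s' \<and> ?I (s 42 0) s'"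
  proof (rule run_for[where I = ?I and B = "s 42 0"])
    show "ok s" by (fact ok)
    show "s 42 0 \<le> R" by (rule ok_le[OF ok])
  next
    fix j s' assume s': "ok s'" "frame (insert 35 (writes ?body)) s s'" "j < s 42 0" "s' 35 0 = j" "?I j s'"
    have env': "env s'" by (rule env_frame[OF env s'(2)]) auto
    have jIX: "j < IX" using s'(3) N n_less_IX by simp
    define t1 where "t1 = s'(43 := (s' 43)(j := 0))"
    have q1: "run (Assign 43 (Var 35) (Const 0)) s' t1"
      unfolding t1_def using run_assign[OF s'(1), of 43 "Var 35" "Const 0"] s'(4) jIX by simp
    have frt: "frame (registers \<union> {31, 35, 43}) s t1" using s'(2) by (auto simp: frame_def t1_def)
    have envt: "env t1" by (rule env_frame[OF env frt]) auto
    let ?K = "\<lambda>i s''. s'' 35 0 = j \<and> s'' 43 j = fsum i (\<lambda>k. s 40 k \<otimes> vecs s j k) \<and> ?I j s''"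
    have "\<exists>s3. run (For 31 eN ?acc) t1 s3 \<and> ?K n s3"
    proof (rule run_for[where I = ?K and B = n])
      show "ok t1" by (rule run_ok[OF q1])
      show "aval eN t1 = n" using env_simps[OF envt] by simp
      show "n \<le> R" by (rule n_le_R)
      show "?K 0 t1" using s'(4,5) by (simp add: t1_def zero_code)
    next
      fix i s'' assume s'': "ok s''" "frame (insert 31 (writes ?acc)) t1 s''" "i < n" "s'' 31 0 = i" "?K i s''"
      have fr'': "frame (registers \<union> {31, 35, 43}) s s''" using s''(2) frt by (auto simp: frame_def)
      have env'': "env s''" by (rule env_frame[OF env fr'']) auto
      have same: "s'' 40 = s 40" "s'' 41 = s 41" using fr'' by (auto simp: frame_def)
      obtain s3 where s3: "run ?acc s'' s3" "s3 43 = (s'' 43)(j := s'' 43 j \<oplus> s 40 i \<otimes> vecs s j i)" "env s3"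
        by (rule Acc[OF s''(1) env'', of 43 "Var 35" j "Cell 40 (Var 31)" "s 40 i" "Cell 41 (eVec (Var 35) (Var 31))" "vecs s j i"])
          (use s''(3,4,5) s'(3) same jIX glt Vlt part[of i j] env_simps[OF env''] in auto)
      have "s3 35 = s'' 35" using run_frame[OF s3(1)] by (auto simp: frame_def)
      then have "?K (Suc i) s3" using s3(2) s''(5) by simp
      with s3(1) show "\<exists>s2. run ?acc s'' s2 \<and> ?K (Suc i) s2" by blast
    qed auto
    then obtain s3 where s3: "run (For 31 eN ?acc) t1 s3" "?K n s3" by blast
    have "run ?body s' s3" by (rule run_seq[OF q1 s3(1)])
    moreover have "?I (Suc j) s3" using s3(2) by (auto simp: less_Suc_eq l_def dot_def)
    ultimately show "\<exists>s2. run ?body s' s2 \<and> ?I (Suc j) s2" by blast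
  qed auto
  then show ?thesis by (simp add: l_def)
qed

text \<open>The count has already been lowered, so \<open>N\<close> is the index of the last old
  vector. The case \<open>i = N\<close> is included; the move is then the identity.\<close>

lemma Reduce_pivot_row:
  assumes ok: "ok s" and env: "env s" and i: "s 46 0 = i" "i \<le> N" and N: "s 42 0 = N" "N < n"
  shows "\<exists>s'. run (For 31 eN (Seq (Assign 44 (Var 31) (Cell 41 (eVec (Var 46) (Var 31))))
          (Assign 41 (eVec (Var 46) (Var 31)) (Cell 41 (eVec (Var 42) (Var 31)))))) s s' \<and>
    (\<forall>k<n. s' 44 k = vecs s i k) \<and>
    (\<forall>j\<le>N. \<forall>k<n. vecs s' j k = (if j = i then vecs s N k else vecs s j k))"
proof -
  let ?body = "Seq (Assign 44 (Var 31) (Cell 41 (eVec (Var 46) (Var 31))))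
          (Assign 41 (eVec (Var 46) (Var 31)) (Cell 41 (eVec (Var 42) (Var 31))))"
  let ?I = "\<lambda>k s'. (\<forall>k'<k. s' 44 k' = vecs s i k') \<and>
    (\<forall>j\<le>N. \<forall>k'<n. vecs s' j k' = (if j = i \<and> k' < k then vecs s N k' else vecs s j k'))"
  have "\<exists>s'. run (For 31 eN ?body) s s' \<and> ?I n s'"
  proof (rule run_for[where I = ?I and B = n])
    show "ok s" by (fact ok)
    show "aval eN s = n" using env_simps[OF env] by simp
    show "n \<le> R" by (rule n_le_R)
  next
    fix k s' assume s': "ok s'" "frame (insert 31 (writes ?body)) s s'" "k < n" "s' 31 0 = k" "?I k s'"
    have env': "env s'" by (rule env_frame[OF env s'(2)]) auto
    have same: "s' 46 0 = i" "s' 42 0 = N" using s'(2) i N by (auto simp: frame_def)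
    have ix: "j * n + k < IX" if "j \<le> N" for j
      using vec_index[of j k] that N(2) s'(3) IX_square by linarith
    have vi: "vecs s' i k = vecs s i k" using s'(3,5) i(2) by simp
    have vN: "vecs s' N k = vecs s N k" using s'(3,5) by simp
    define t1 where "t1 = s'(44 := (s' 44)(k := vecs s i k))"
    have q1: "run (Assign 44 (Var 31) (Cell 41 (eVec (Var 46) (Var 31)))) s' t1"
      unfolding t1_def
      using run_assign[OF s'(1), of 44 "Var 31" "Cell 41 (eVec (Var 46) (Var 31))"] s'(3,4) n_less_IX same
        ok_le[OF s'(1), of 41 "i * n + k"] env_simps(3)[OF env'] vi by simp
    define t2 where "t2 = t1(41 := (t1 41)(i * n + k := vecs s N k))"
    have q2: "run (Assign 41 (eVec (Var 46) (Var 31)) (Cell 41 (eVec (Var 42) (Var 31)))) t1 t2"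
      unfolding t2_def
      using run_assign[OF run_ok[OF q1], of 41 "eVec (Var 46) (Var 31)" "Cell 41 (eVec (Var 42) (Var 31))"]
        s'(3,4) ix[OF i(2)] same ok_le[OF s'(1), of 41 "N * n + k"] env_simps(3)[OF env'] vN
      by (simp add: t1_def)
    have "vecs t2 j k' = (if j = i \<and> k' < Suc k then vecs s N k' else vecs s j k')" if "j \<le> N" "k' < n" for j k'
    proof (cases "j = i \<and> k' = k")
      case True
      then show ?thesis by (simp add: t2_def)
    next
      case False
      then have "j * n + k' \<noteq> i * n + k" using vec_index_inj[OF that(2) s'(3)] by blast
      then have "vecs t2 j k' = vecs s' j k'" by (simp add: t2_def t1_def)
      then show ?thesis using s'(5) that False by (auto simp: less_Suc_eq)
    qed
    moreover have "\<forall>k'<Suc k. t2 44 k' = vecs s i k'" using s'(5) by (auto simp: t2_def t1_def less_Suc_eq)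
    ultimately have "?I (Suc k) t2" by blast
    moreover have "run ?body s' t2" by (rule run_seq[OF q1 q2])
    ultimately show "\<exists>s2. run ?body s' s2 \<and> ?I (Suc k) s2" by blast
  qed auto
  then show ?thesis by (auto cong: if_cong)
qed

lemma Reduce_eliminate:
  assumes ok: "ok s" and env: "env s" and N: "s 42 0 = N" "N < n" and a: "s 45 0 < q"
    and V: "\<And>j k. j < N \<Longrightarrow> k < n \<Longrightarrow> vecs s j k < q" and l: "\<And>j. j < N \<Longrightarrow> s 43 j < q"
    and t: "\<And>k. k < n \<Longrightarrow> s 44 k < q"
  shows "\<exists>s'. run (For 35 (Var 42) (Seq (Set 47 (Const 0)) (Seq
          (Acc 47 (Const 0) (Sub eP (Const 1)) (Cell 43 (Var 35)))
          (For 31 eN (Seq (Set 25 (Const 0)) (Seq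
             (Acc 25 (Const 0) (Var 45) (Cell 41 (eVec (Var 35) (Var 31)))) (Seq
             (Acc 25 (Const 0) (Var 47) (Cell 44 (Var 31)))
             (Assign 41 (eVec (Var 35) (Var 31)) (Var 25))))))))) s s' \<and>
    (\<forall>j<N. \<forall>k<n. vecs s' j k = s 45 0 \<otimes> vecs s j k \<oplus> (\<ominus> \<one> \<otimes> s 43 j) \<otimes> s 44 k)"
proof -
  let ?a1 = "Acc 25 (Const 0) (Var 45) (Cell 41 (eVec (Var 35) (Var 31)))"
  let ?a2 = "Acc 25 (Const 0) (Var 47) (Cell 44 (Var 31))"
  let ?inn = "Seq (Set 25 (Const 0)) (Seq ?a1 (Seq ?a2 (Assign 41 (eVec (Var 35) (Var 31)) (Var 25))))"
  let ?nl = "Acc 47 (Const 0) (Sub eP (Const 1)) (Cell 43 (Var 35))"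
  let ?body = "Seq (Set 47 (Const 0)) (Seq ?nl (For 31 eN ?inn))"
  let ?W = "registers \<union> {25, 31, 35, 41, 47}"
  have wb: "insert 35 (writes ?body) = ?W" by auto
  define W where "W = (\<lambda>j k. s 45 0 \<otimes> vecs s j k \<oplus> (\<ominus> \<one> \<otimes> s 43 j) \<otimes> s 44 k)"
  have m1: "\<ominus> \<one> < q" using minus_one_code p_le_q p_gt_1 by simp
  have Wlt: "W j k < q" if "j < N" "k < n" for j k
    unfolding W_def by (intro field_less m1 a V l t that)
  let ?I = "\<lambda>j s'. \<forall>j'<N. \<forall>k<n. vecs s' j' k = (if j' < j then W j' k else vecs s j' k)"
  have "\<exists>s'. run (For 35 (Var 42) ?body) s s' \<and> ?I N s'"
  proof (rule run_for[where I = ?I and B = N])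
    show "ok s" by (fact ok)
    show "N \<le> R" using ok_le[OF ok, of 42 0] N by simp
    show "aval (Var 42) s = N" using N by simp
  next
    fix j s' assume s': "ok s'" "frame (insert 35 (writes ?body)) s s'" "j < N" "s' 35 0 = j" "?I j s'"
    have fr': "frame ?W s s'" using s'(2) unfolding wb .
    have env': "env s'" by (rule env_frame[OF env fr']) auto
    have same: "s' 43 = s 43" "s' 44 = s 44" "s' 45 = s 45" using fr' by (auto simp: frame_def)
    define t1 where "t1 = s'(47 := (s' 47)(0 := 0))"
    have q1: "run (Set 47 (Const 0)) s' t1" unfolding t1_def by (rule run_set[OF s'(1)]) auto
    have env1: "env t1" using env' by (simp add: t1_def env_upd)
    have p1: "p - 1 < q" using p_le_q p_gt_1 by simp
    obtain t2 where t2: "run ?nl t1 t2" "t2 47 = (t1 47)(0 := t1 47 0 \<oplus> (p - 1) \<otimes> s 43 j)" "env t2"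
      by (rule Acc[OF run_ok[OF q1] env1, of 47 "Const 0" 0 "Sub eP (Const 1)" "p - 1" "Cell 43 (Var 35)" "s 43 j"])
        (use s'(3,4) same IX_pos q_gt_1 l p1 env_simps(4)[OF env'] in \<open>auto simp: t1_def\<close>)
    have v2: "t2 47 0 = \<ominus> \<one> \<otimes> s 43 j"
      using t2(2) zero_add[OF field_less(2)[OF p1 l[OF s'(3)]]] by (simp add: t1_def minus_one_code)
    have frt: "frame ?W s t2" using fr' run_frame[OF t2(1)] by (auto simp: frame_def t1_def)
    have f2: "t2 35 0 = j" "t2 41 = s' 41" using run_frame[OF t2(1)] s'(4) by (auto simp: frame_def t1_def)
    let ?K = "\<lambda>k s''. s'' 35 0 = j \<and> s'' 47 0 = \<ominus> \<one> \<otimes> s 43 j \<and>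
      (\<forall>j'<N. \<forall>k'<n. vecs s'' j' k' = (if j' < j \<or> (j' = j \<and> k' < k) then W j' k' else vecs s j' k'))"
    have "\<exists>s3. run (For 31 eN ?inn) t2 s3 \<and> ?K n s3"
    proof (rule run_for[where I = ?K and B = n])
      show "ok t2" by (rule run_ok[OF t2(1)])
      show "aval eN t2 = n" using env_simps[OF t2(3)] by simp
      show "n \<le> R" by (rule n_le_R)
      show "?K 0 t2" using s'(5) f2 v2 by simp
    next
      fix k s'' assume s'': "ok s''" "frame (insert 31 (writes ?inn)) t2 s''" "k < n" "s'' 31 0 = k" "?K k s''"
      have fr'': "frame ?W s s''" using s''(2) frt by (auto simp: frame_def)
      have env'': "env s''" by (rule env_frame[OF env fr'']) auto
      have same': "s'' 44 = s 44" "s'' 45 = s 45" using fr'' by (auto simp: frame_def)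
      have vjk: "vecs s'' j k = vecs s j k" using s''(3,5) s'(3) by simp
      define x1 where "x1 = s''(25 := (s'' 25)(0 := 0))"
      have r1: "run (Set 25 (Const 0)) s'' x1" unfolding x1_def by (rule run_set[OF s''(1)]) auto
      have envx1: "env x1" using env'' by (simp add: x1_def env_upd)
      obtain x2 where x2: "run ?a1 x1 x2" "x2 25 = (x1 25)(0 := x1 25 0 \<oplus> s 45 0 \<otimes> vecs s j k)" "env x2"
        by (rule Acc[OF run_ok[OF r1] envx1, of 25 "Const 0" 0 "Var 45" "s 45 0" "Cell 41 (eVec (Var 35) (Var 31))" "vecs s j k"])
          (use s''(4,5) same' IX_pos q_gt_1 a V[OF s'(3) s''(3)] vjk env_simps(3)[OF env''] in \<open>auto simp: x1_def\<close>)
      have w2: "x2 25 0 = s 45 0 \<otimes> vecs s j k"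
        using x2(2) zero_add[OF field_less(2)[OF a V[OF s'(3) s''(3)]]] by (simp add: x1_def)
      have g2: "x2 47 = s'' 47" "x2 44 = s'' 44" "x2 31 = s'' 31" "x2 35 = s'' 35" "x2 41 = s'' 41"
        using run_frame[OF x2(1)] by (auto simp: frame_def x1_def)
      obtain x3 where x3: "run ?a2 x2 x3" "x3 25 = (x2 25)(0 := x2 25 0 \<oplus> (\<ominus> \<one> \<otimes> s 43 j) \<otimes> s 44 k)" "env x3"
        by (rule Acc[OF run_ok[OF x2(1)] x2(3), of 25 "Const 0" 0 "Var 47" "\<ominus> \<one> \<otimes> s 43 j" "Cell 44 (Var 31)" "s 44 k"])
          (use s''(4,5) same' g2 IX_pos t[OF s''(3)] field_less(2)[OF m1 l[OF s'(3)]] w2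
            field_less(2)[OF a V[OF s'(3) s''(3)]] in auto)
      have w3: "x3 25 0 = W j k" using x3(2) w2 by (simp add: W_def)
      have g3: "x3 47 = s'' 47" "x3 31 = s'' 31" "x3 35 = s'' 35" "x3 41 = s'' 41"
        using run_frame[OF x3(1)] g2 by (auto simp: frame_def)
      have ix: "j * n + k < IX"
        using vec_index[of j k] s'(3) N(2) s''(3) IX_square by linarith
      define x4 where "x4 = x3(41 := (x3 41)(j * n + k := W j k))"
      have r4: "run (Assign 41 (eVec (Var 35) (Var 31)) (Var 25)) x3 x4"
        unfolding x4_def
        using run_assign[OF run_ok[OF x3(1)], of 41 "eVec (Var 35) (Var 31)" "Var 25"] s''(4,5) g3 ix
          env_simps(3)[OF x3(3)] w3 less_R[OF Wlt[OF s'(3) s''(3)]] by simp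
      have "vecs x4 j' k' = (if j' < j \<or> (j' = j \<and> k' < Suc k) then W j' k' else vecs s j' k')"
        if "j' < N" "k' < n" for j' k'
      proof (cases "j' = j \<and> k' = k")
        case True
        then show ?thesis by (simp add: x4_def)
      next
        case False
        then have "j' * n + k' \<noteq> j * n + k" using vec_index_inj[OF that(2) s''(3)] by blast
        then have "vecs x4 j' k' = vecs s'' j' k'" using g3 by (simp add: x4_def)
        then show ?thesis using s''(5) that False by (auto simp: less_Suc_eq)
      qed
      then have "?K (Suc k) x4" using s''(5) g3 by (simp add: x4_def)
      moreover have "run ?inn s'' x4" by (intro run_seq[OF r1] run_seq[OF x2(1)] run_seq[OF x3(1)] r4)
      ultimately show "\<exists>s2. run ?inn s'' s2 \<and> ?K (Suc k) s2" by blast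
    qed auto
    then obtain s3 where s3: "run (For 31 eN ?inn) t2 s3" "?K n s3" by blast
    have "run ?body s' s3" by (rule run_seq[OF q1 run_seq[OF t2(1) s3(1)]])
    moreover have "?I (Suc j) s3" using s3(2) by (auto simp: less_Suc_eq)
    ultimately show "\<exists>s2. run ?body s' s2 \<and> ?I (Suc j) s2" by blast
  qed auto
  then show ?thesis by (simp add: W_def)
qed

lemma Reduce:
  assumes ok: "ok s" and env: "env s" and N: "s 42 0 \<le> n"
    and kb: "kernel_basis n \<G> (vecs s) (s 42 0)" and g: "scalars n (s 40)"
  obtains s' where "run Reduce s s'" "env s'" "kernel_basis n (insert (s 40) \<G>) (vecs s') (s' 42 0)"
    "s' 42 0 \<le> s 42 0"
proof -
  let ?N = "s 42 0"
  define l where "l = (\<lambda>j. dot n (s 40) (vecs s j))"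
  have V: "scalars n (vecs s j)" if "j < ?N" for j using kb that by (auto simp: kernel_basis_def)
  have Vlt: "vecs s j k < q" if "j < ?N" "k < n" for j k using V[OF that(1)] that(2) by (simp add: scalars_less)
  have lq: "l j < q" if "j < ?N" for j
    unfolding l_def using dot_closed[OF g V[OF that]] by (simp only: carr_iff)
  let ?c1 = "For 35 (Var 42) (Seq (Assign 43 (Var 35) (Const 0))
       (For 31 eN (Acc 43 (Var 35) (Cell 40 (Var 31)) (Cell 41 (eVec (Var 35) (Var 31))))))"
  obtain s1 where r1: "run ?c1 s s1" and p1: "\<forall>j<?N. s1 43 j = l j"
    using Reduce_functional[OF ok env N V g] unfolding l_def by blast
  have f1: "s1 41 = s 41" "s1 42 = s 42" "s1 40 = s 40" "s1 0 = s 0" "s1 2 = s 2"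
    using run_frame[OF r1] by (auto simp: frame_def)
  define s2 where "s2 = s1(46 := (s1 46)(0 := 0))"
  have r2: "run (Set 46 (Const 0)) s1 s2" unfolding s2_def by (rule run_set[OF run_ok[OF r1]]) auto
  let ?e = "Mul (Sub (Var 42) (Var 46)) (Sub (Const 1) (Cell 43 (Var 46)))"
  let ?b = "Set 46 (Add (Var 46) (Const 1))"
  let ?I = "\<lambda>j s'. s' 46 0 = j \<and> j \<le> ?N \<and> (\<forall>j'<j. l j' = 0)"
  have "\<exists>s' j. run (While ?e ?b) s2 s' \<and> ?I j s' \<and> aval ?e s' = 0"
  proof (rule run_while[where I = ?I])
    show "ok s2" by (rule run_ok[OF r2])
    show "?I 0 s2" by (simp add: s2_def)
  next
    fix j s' assume s': "ok s'" "frame (writes ?b) s2 s'" "?I j s'" "aval ?e s' \<noteq> 0"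
    have same: "s' 42 = s 42" "s' 43 = s1 43" using s'(2) f1 by (auto simp: frame_def s2_def)
    have j: "j < ?N" "s1 43 j = 0" using s'(3,4) same by auto
    have jR: "j < R" using j(1) N n_less_IX IX_le_R by simp
    have "run ?b s' (s'(46 := (s' 46)(0 := Suc j)))"
      by (rule run_set[OF s'(1)]) (use s'(3) jR in auto)
    moreover have "?I (Suc j) (s'(46 := (s' 46)(0 := Suc j)))"
      using s'(3) j p1 by (auto simp: less_Suc_eq)
    ultimately show "j < R \<and> (\<exists>s2. run ?b s' s2 \<and> ?I (Suc j) s2)" using jR by blast
  qed
  then obtain s3 i where r3: "run (While ?e ?b) s2 s3" and i: "?I i s3" and test: "aval ?e s3 = 0" by blast
  have f3: "s3 41 = s 41" "s3 42 = s 42" "s3 40 = s 40" "s3 43 = s1 43" "s3 0 = s 0" "s3 2 = s 2"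
    using run_frame[OF r3] f1 by (auto simp: frame_def s2_def)
  have env3: "env s3" using env f3 by (simp add: env_def)
  \<comment> \<open>The test fails either at the end of the list or at a vector on which the
    functional is nonzero.\<close>
  have l_piv: "i = ?N \<or> l i \<noteq> 0"
  proof (cases "i = ?N")
    case False
    then have "s3 43 i = l i" "i < ?N" using i p1 f3 by auto
    with test i f3 show ?thesis by auto
  qed simp
  let ?swap = "For 31 eN (Seq (Assign 44 (Var 31) (Cell 41 (eVec (Var 46) (Var 31))))
          (Assign 41 (eVec (Var 46) (Var 31)) (Cell 41 (eVec (Var 42) (Var 31)))))"
  let ?elim = "For 35 (Var 42) (Seq (Set 47 (Const 0)) (Seq
          (Acc 47 (Const 0) (Sub eP (Const 1)) (Cell 43 (Var 35)))
          (For 31 eN (Seq (Set 25 (Const 0)) (Seq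
             (Acc 25 (Const 0) (Var 45) (Cell 41 (eVec (Var 35) (Var 31)))) (Seq
             (Acc 25 (Const 0) (Var 47) (Cell 44 (Var 31)))
             (Assign 41 (eVec (Var 35) (Var 31)) (Var 25))))))))"
  let ?thn = "Seq (Set 45 (Cell 43 (Var 46))) (Seq (Set 42 (Sub (Var 42) (Const 1)))
       (Seq ?swap (Seq (Assign 43 (Var 46) (Cell 43 (Var 42))) ?elim)))"
  let ?cond = "Cond (Sub (Var 42) (Var 46)) ?thn Skip"
  have Reduce_eq: "Reduce = Seq ?c1 (Seq (Set 46 (Const 0)) (Seq (While ?e ?b) ?cond))"
    by (simp add: Reduce_def)
  show ?thesis
  proof (cases "i = ?N")
    case True
    have r4: "run ?cond s3 s3"
      by (rule run_cond_false[OF run_ok[OF r3]]) (use True i f3 run_skip[OF run_ok[OF r3]] in auto)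
    have r: "run Reduce s s3"
      unfolding Reduce_eq by (intro run_seq[OF r1] run_seq[OF r2] run_seq[OF r3] r4)
    have "kernel_basis n (insert (s 40) \<G>) (vecs s3) (s3 42 0)"
      unfolding f3
      by (rule kernel_basis_insert_trivial[OF kb g]) (use i True in \<open>auto simp: l_def zero_code\<close>)
    then show ?thesis by (intro that[OF r env3]) (use f3 in auto)
  next
    case False
    then have iN: "i < ?N" using i by simp
    then obtain N' where N': "?N = Suc N'" by (cases ?N) auto
    have lt: "i \<le> N'" "N' < n" using iN N' N by auto
    define s4 where "s4 = s3(45 := (s3 45)(0 := l i))"
    have r4: "run (Set 45 (Cell 43 (Var 46))) s3 s4"
      unfolding s4_def by (rule run_set[OF run_ok[OF r3]]) (use i p1 iN f3 less_R[OF lq[OF iN]] in auto)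
    define s5 where "s5 = s4(42 := (s4 42)(0 := N'))"
    have r5: "run (Set 42 (Sub (Var 42) (Const 1))) s4 s5"
      unfolding s5_def by (rule run_set[OF run_ok[OF r4]]) (use N' lt n_le_R f3 in \<open>auto simp: s4_def\<close>)
    have fr5: "s5 0 = s3 0" "s5 2 = s3 2" "s5 46 = s3 46" "s5 41 = s3 41" "s5 43 = s3 43" "s5 45 0 = l i" "s5 42 0 = N'"
      unfolding s5_def s4_def by simp_all
    have env5: "env s5" using env3 unfolding env_def fr5 .
    have v5: "s5 46 0 = i" "s5 42 0 = N'" "s5 41 = s 41" using i fr5 f3 by simp_all
    obtain s6 where r6: "run ?swap s5 s6" and p6: "\<forall>k<n. s6 44 k = vecs s i k"
      "\<forall>j\<le>N'. \<forall>k<n. vecs s6 j k = (if j = i then vecs s N' k else vecs s j k)"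
      by (rule exE[OF Reduce_pivot_row[OF run_ok[OF r5] env5 v5(1) lt(1) v5(2) lt(2), unfolded v5(3)]]) blast
    have f6: "s6 46 0 = i" "s6 42 0 = N'" "s6 43 = s1 43" "s6 45 0 = l i" "s6 0 = s5 0" "s6 2 = s5 2"
      using run_frame[OF r6] v5 fr5 f3 by (simp_all add: frame_def)
    have env6: "env s6" using env5 f6 by (simp add: env_def)
    define s7 where "s7 = s6(43 := (s6 43)(i := l N'))"
    have r7: "run (Assign 43 (Var 46) (Cell 43 (Var 42))) s6 s7"
      unfolding s7_def
      using run_assign[OF run_ok[OF r6], of 43 "Var 46" "Cell 43 (Var 42)"] f6 lt n_less_IX p1 N'
        less_R[OF lq[of N']] by simp
    have "s7 0 = s6 0" "s7 2 = s6 2" unfolding s7_def by simp_all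
    then have env7: "env s7" using env6 by (simp only: env_def)
    let ?\<sigma> = "\<lambda>j. if j = i then N' else j"
    have v7: "vecs s7 j k = vecs s (?\<sigma> j) k" if "j < N'" "k < n" for j k
      using p6(2) that by (auto simp: s7_def)
    have l7: "s7 43 j = l (?\<sigma> j)" if "j < N'" for j
      using p1 f6 that N' by (auto simp: s7_def)
    have \<sigma>N: "?\<sigma> j < ?N" if "j < N'" for j using that N' by auto
    have "\<exists>s'. run ?elim s7 s' \<and>
      (\<forall>j<N'. \<forall>k<n. vecs s' j k = s7 45 0 \<otimes> vecs s7 j k \<oplus> (\<ominus> \<one> \<otimes> s7 43 j) \<otimes> s7 44 k)"
    proof (rule Reduce_eliminate[OF run_ok[OF r7] env7 _ lt(2)])
      show "s7 42 0 = N'" using f6 by (simp add: s7_def)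
      show "s7 45 0 < q" using f6 lq[OF iN] by (simp add: s7_def)
      show "vecs s7 j k < q" if "j < N'" "k < n" for j k using v7[OF that] Vlt[OF \<sigma>N[OF that(1)] that(2)] by simp
      show "s7 43 j < q" if "j < N'" for j using l7[OF that] lq[OF \<sigma>N[OF that]] by simp
      show "s7 44 k < q" if "k < n" for k using p6(1) Vlt[OF iN that] that by (simp add: s7_def)
    qed
    then obtain s8 where r8: "run ?elim s7 s8"
      and p8: "\<And>j k. j < N' \<Longrightarrow> k < n \<Longrightarrow> vecs s8 j k = s7 45 0 \<otimes> vecs s7 j k \<oplus> (\<ominus> \<one> \<otimes> s7 43 j) \<otimes> s7 44 k"
      by blast
    have W: "vecs s8 j k = dot n (s 40) (vecs s i) \<otimes> vecs s (?\<sigma> j) k \<oplus>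
        (\<ominus> \<one> \<otimes> dot n (s 40) (vecs s (?\<sigma> j))) \<otimes> vecs s i k" if "j < N'" "k < n" for j k
      using p8[OF that] v7[OF that] l7[OF that(1)] p6(1) that f6 by (simp add: s7_def l_def)
    have f8: "s8 42 0 = N'" using run_frame[OF r8] f6 by (auto simp: frame_def s7_def)
    have "kernel_basis n (insert (s 40) \<G>) (vecs s8) N'"
    proof (rule kernel_basis_insert_pivot[OF kb[unfolded N'] g])
      show "i < Suc N'" using lt by simp
      show "dot n (s 40) (vecs s i) \<noteq> \<zero>" using l_piv False by (simp add: l_def zero_code)
    qed (rule W)
    moreover have "run Reduce s s8"
      unfolding Reduce_eq
      by (intro run_seq[OF r1] run_seq[OF r2] run_seq[OF r3] run_cond_true[OF run_ok[OF r3]]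
          run_seq[OF r4] run_seq[OF r5] run_seq[OF r6] run_seq[OF r7] r8) (use iN i f3 in auto)
    moreover have "env s8" by (rule env_frame[OF env7 run_frame[OF r8]]) auto
    ultimately show ?thesis using f8 N' by (intro that[of s8]) auto
  qed
qed

end

section \<open>The main loop\<close>

text \<open>Splits off exactly three facts and keeps a conjunctive invariant in one piece.\<close>

lemma ex_conj3E:
  assumes "\<exists>x y. A x y \<and> B x y \<and> C x y"
    and "\<And>x y. A x y \<Longrightarrow> B x y \<Longrightarrow> C x y \<Longrightarrow> T"
  shows T
  using assms by blast

text \<open>Arrays: \<open>9\<close> the target dimension, \<open>48\<close> the power \<open>q ^ m\<close> where \<open>m\<close> is the number of output
  vectors, \<open>49\<close> the value at \<open>u0\<close>, \<open>50\<close>--\<open>52\<close> loop variables and the flag of the search.\<close>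

definition Point :: "expr \<Rightarrow> expr \<Rightarrow> prog" where
  "Point cnt code = Lc (Cell 0 (Add (Const 3) (Var 31))) cnt 1 (Const 1) code"

definition Gradient :: prog where
  "Gradient = For 33 eN (Seq Eval (Assign 40 (Var 33) (Var 22)))"

text \<open>The kernel basis is carried over from step to step: earlier points also lie in the
  larger subspace, so the functionals imposed earlier remain legitimate.\<close>

definition Gradient_phase :: prog where
  "Gradient_phase = For 50 (Var 48) (Seq (Point (Var 1) (Var 50)) (Seq Gradient Reduce))"

text \<open>The sum of the two truncated differences is the distance of the value from the value at
  \<open>u0\<close>; a single deviation clears the flag in array 51.\<close>

definition Test :: prog where
  "Test = Seq (Set 51 (Const 1)) (For 50 (Mul (Var 48) eQ)
     (Seq (Point (Add (Var 1) (Const 1)) (Var 50)) (Seq Eval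
       (Cond (Add (Sub (Var 21) (Var 49)) (Sub (Var 49) (Var 21))) (Set 51 (Const 0)) Skip))))"

text \<open>The candidate is written directly into the next place of the output, but the count grows
  only at the end of \<open>Step\<close>.\<close>

definition Candidate :: prog where
  "Candidate = Seq (Lc (Const 0) (Var 42) 41 (Const 0) (Var 52))
     (For 31 eN (Assign 1 (Add (Const 1) (eVec (Var 1) (Var 31))) (Cell 20 (Var 31))))"

text \<open>The codes start at 1, as code 0 is the zero vector. The loop carries no bound of its
  own; it ends because some candidate is known to pass.\<close>

definition Search_phase :: prog where
  "Search_phase = Seq (Set 51 (Const 0)) (Seq (Set 52 (Const 0)) (While (Sub (Const 1) (Var 51))
     (Seq (Set 52 (Add (Var 52) (Const 1))) (Seq Candidate Test))))"

definition Pivot_phase :: prog where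
  "Pivot_phase = Seq (Set 33 (Const 0)) (Seq
     (While (Sub (Const 1) (Cell 1 (Add (Const 1) (eVec (Var 1) (Var 33))))) (Set 33 (Add (Var 33) (Const 1))))
     (Seq (For 31 eN (Assign 40 (Var 31) eUnit)) Reduce))"

definition Step :: prog where
  "Step = Seq Gradient_phase (Seq Search_phase (Seq Pivot_phase
     (Seq (Set 48 (Mul (Var 48) eQ)) (Set 1 (Add (Var 1) (Const 1))))))"

definition Main_loop :: prog where
  "Main_loop = While (Sub (Var 9) (Var 1)) Step"

lemma writes_Point [simp]: "writes (Point cnt code) = registers \<union> {20, 31, 34, 35, 36}"
  by (auto simp: Point_def)

lemma writes_Gradient [simp]: "writes Gradient = registers \<union> {21, 22, 23, 24, 25, 30, 31, 32, 33, 40}"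
  by (auto simp: Gradient_def)

lemma writes_Gradient_phase [simp]: "writes Gradient_phase = registers \<union>
    {20, 21, 22, 23, 24, 25, 30, 31, 32, 33, 34, 35, 36, 40, 41, 42, 43, 44, 45, 46, 47, 50}"
  by (auto simp: Gradient_phase_def)

lemma writes_Test [simp]: "writes Test = registers \<union> {20, 21, 22, 23, 24, 25, 30, 31, 32, 34, 35, 36, 50, 51}"
  by (auto simp: Test_def)

lemma writes_Candidate [simp]: "writes Candidate = registers \<union> {1, 20, 31, 34, 35, 36}"
  by (auto simp: Candidate_def)

lemma writes_Search_phase [simp]: "writes Search_phase = registers \<union>
    {1, 20, 21, 22, 23, 24, 25, 30, 31, 32, 34, 35, 36, 50, 51, 52}"
  by (auto simp: Search_phase_def)

lemma writes_Pivot_phase [simp]: "writes Pivot_phase = registers \<union>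
    {25, 31, 33, 35, 40, 41, 42, 43, 44, 45, 46, 47}"
  by (auto simp: Pivot_phase_def)

lemma writes_Step [simp]: "writes Step = registers \<union>
    {1, 20, 21, 22, 23, 24, 25, 30, 31, 32, 33, 34, 35, 36, 40, 41, 42, 43, 44, 45, 46, 47, 48, 50, 51, 52}"
  by (auto simp: Step_def)

section \<open>Correctness of one step of the main loop\<close>

locale search = algorithm F q r p e \<alpha> IX R n f u0
  for F :: "nat ring" (structure) and q r p e \<alpha> IX R n :: nat and f u0 +
  fixes d K :: nat
  assumes wf_f: "wf_terms n d f" and K_less: "K < n"
    and room: "\<And>m. m < K \<Longrightarrow>
      Suc (\<Sum>j=2..d. j * ((m + (d - j)) choose (d - j))) + (((m + (d - 1)) choose (d - 1)) + m) \<le> n"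
    and R_K: "q ^ K \<le> R"
    and R_B: "\<And>m. m < K \<Longrightarrow> q ^ Suc (\<Sum>j=2..d. j * ((m + (d - j)) choose (d - j))) \<le> R"
begin

abbreviation outs :: "store \<Rightarrow> nat \<Rightarrow> nat \<Rightarrow> nat" where
  "outs s j i \<equiv> s 1 (Suc (j * n + i))"

abbreviation val :: "(nat \<Rightarrow> nat) \<Rightarrow> nat" where
  "val x \<equiv> poly_value n f x"

lemma u0_scalars: "scalars n u0"
  using u0_closed by (simp add: scalars_def)

lemma qdig_scalars: "scalars m (qdig x)"
  using qdig_less by (simp add: scalars_def carr_iff)

lemma affine_pt_qdig_closed:
  assumes "\<And>j. j < m \<Longrightarrow> scalars n (Y j)" "i < n"
  shows "affine_pt u0 Y m (qdig z) i \<in> carrier F"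
proof (rule affine_pt_closed[where n = n])
  show "u0 i \<in> carrier F" using u0_closed assms(2) .
  show "scalars m (qdig z)" by (rule qdig_scalars)
qed (use assms in auto)

lemma comb_vec_qdig_closed:
  assumes "\<And>j. j < m \<Longrightarrow> scalars n (Y j)"
  shows "scalars n (comb_vec m (qdig z) Y)"
  by (rule scalars_comb_vec) (use assms qdig_scalars in auto)

lemma Point:
  assumes ok: "ok s" and env: "env s" and z: "aval code s = z" "z \<le> R"
    and cnt: "aval cnt s = N" "N \<le> n" "reads cnt \<subseteq> {1}"
    and Y: "\<And>j. j < N \<Longrightarrow> scalars n (outs s j)"
  obtains s' where "run (Point cnt code) s s'" "env s'"
    "\<And>i. i < n \<Longrightarrow> s' 20 i = affine_pt u0 (outs s) N (qdig z) i" "\<And>i. i < n \<Longrightarrow> s' 20 i < q"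
proof -
  obtain s' where s': "run (Point cnt code) s s'" "env s'"
    "\<And>i. i < n \<Longrightarrow> s' 20 i = u0 i \<oplus> fsum N (\<lambda>j. qdig z j \<otimes> s 1 (1 + (j * n + i)))"
    unfolding Point_def
  proof (rule Lc[OF ok env z])
    show "aval (Cell 0 (Add (Const 3) (Var 31))) s' = u0 i" if "env s'" "s' 31 0 = i" "i < n" for s' i
      using env_simps(6)[OF that(1,3)] that(2) by simp
    show "u0 i < q" if "i < n" for i using u0_closed[OF that] by (simp add: carr_iff)
    show "aval cnt s = N" by (rule cnt)
    show "N \<le> R" using cnt(2) n_le_R by simp
    show "reads cnt \<inter> writes (Lc (Cell 0 (Add (Const 3) (Var 31))) cnt 1 (Const 1) code) = {}"
      using cnt(3) by auto
    show "s 1 (1 + (j * n + i)) < q" if "j < N" "i < n" for j i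
      using Y[OF that(1)] that(2) by (simp add: scalars_less)
  qed auto
  have pt: "s' 20 i = affine_pt u0 (outs s) N (qdig z) i" if "i < n" for i
    using s'(3)[OF that] by (simp add: affine_pt_def)
  have "affine_pt u0 (outs s) N (qdig z) i \<in> carrier F" if "i < n" for i
    by (rule affine_pt_qdig_closed) (use Y that in auto)
  then have "s' 20 i < q" if "i < n" for i using pt that by (simp add: carr_iff)
  with s'(1,2) pt show ?thesis by (rule that)
qed

lemma Gradient:
  assumes ok: "ok s" and env: "env s" and x: "\<And>i. i < n \<Longrightarrow> s 20 i < q"
  obtains s' where "run Gradient s s'" "env s'" "\<And>i. i < n \<Longrightarrow> s' 40 i = gradient n f (s 20) i"
proof -
  let ?body = "Seq Eval (Assign 40 (Var 33) (Var 22))"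
  let ?I = "\<lambda>c s'. \<forall>i<c. s' 40 i = gradient n f (s 20) i"
  have xs: "scalars n (s 20)" using x by (simp add: scalars_less)
  have glt: "gradient n f (s 20) i < q" if "i < n" for i
    using gradient_closed[OF xs wf_f] that by (simp add: scalars_less)
  have "\<exists>s'. run (For 33 eN ?body) s s' \<and> ?I n s'"
  proof (rule run_for[where I = ?I and B = n])
    show "ok s" by (fact ok)
    show "aval eN s = n" using env_simps[OF env] by simp
    show "n \<le> R" by (rule n_le_R)
  next
    fix c s' assume s': "ok s'" "frame (insert 33 (writes ?body)) s s'" "c < n" "s' 33 0 = c" "?I c s'"
    have env': "env s'" by (rule env_frame[OF env s'(2)]) auto
    have same: "s' 20 = s 20" using s'(2) by (auto simp: frame_def)
    obtain t1 where t1: "run Eval s' t1" "env t1"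
      "(t1 21 0, t1 22 0) = dual_poly (s' 20) (unit_vec (s' 33 0)) n f (length f)"
      by (rule Eval[OF s'(1) env']) (use x same in auto)
    have "snd (t1 21 0, t1 22 0) = gradient n f (s 20) c"
      unfolding t1(3) same s'(4) gradient_def ..
    then have g: "t1 22 0 = gradient n f (s 20) c" by simp
    have f1: "t1 33 = s' 33" "t1 40 = s' 40" using run_frame[OF t1(1)] by (auto simp: frame_def)
    define t2 where "t2 = t1(40 := (t1 40)(c := gradient n f (s 20) c))"
    have "run (Assign 40 (Var 33) (Var 22)) t1 t2"
      unfolding t2_def using run_assign[OF run_ok[OF t1(1)], of 40 "Var 33" "Var 22"] f1 s'(3,4) g
        n_less_IX less_R[OF glt[OF s'(3)]] by simp
    then have "run ?body s' t2" by (rule run_seq[OF t1(1)])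
    moreover have "?I (Suc c) t2" using s'(5) f1 by (auto simp: t2_def less_Suc_eq)
    ultimately show "\<exists>s2. run ?body s' s2 \<and> ?I (Suc c) s2" by blast
  qed auto
  then obtain s' where s': "run Gradient s s'" "?I n s'" unfolding Gradient_def by blast
  have "env s'" by (rule env_frame[OF env run_frame[OF s'(1)]]) auto
  with s' show ?thesis by (intro that[of s']) auto
qed

text \<open>An upper bound on the constraints imposed so far: \<open>kernel_dim_bound\<close>
  applies only if nothing besides gradients on the subspace and pivot coordinates has been
  imposed.\<close>

definition known :: "store \<Rightarrow> nat \<Rightarrow> (nat \<Rightarrow> nat) \<Rightarrow> (nat \<Rightarrow> nat) set \<Rightarrow> bool" where
  "known s m piv \<G> \<longleftrightarrow> (\<forall>g\<in>\<G>.
     (\<exists>c. scalars m c \<and> (\<forall>i<n. g i = gradient n f (affine_pt u0 (outs s) m c) i)) \<or>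
     (\<exists>j<m. \<forall>i<n. g i = unit_vec (piv j) i))"

lemma Gradient_phase:
  assumes ok: "ok s" and env: "env s" and m: "s 1 0 = m" "m < n" and qm: "s 48 0 = q ^ m"
    and Y: "\<And>j. j < m \<Longrightarrow> scalars n (outs s j)" and N: "s 42 0 \<le> n"
    and kb: "kernel_basis n \<G> (vecs s) (s 42 0)" and kn: "known s m piv \<G>"
  obtains s' \<G>' where "run Gradient_phase s s'" "env s'" "s' 42 0 \<le> n" "\<G> \<subseteq> \<G>'"
    "kernel_basis n \<G>' (vecs s') (s' 42 0)" "known s m piv \<G>'"
    "\<And>c. scalars m c \<Longrightarrow> \<exists>g\<in>\<G>'. \<forall>i<n. g i = gradient n f (affine_pt u0 (outs s) m c) i"
proof -
  let ?body = "Seq (Point (Var 1) (Var 50)) (Seq Gradient Reduce)"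
  let ?W = "writes Gradient_phase"
  have wb: "insert 50 (writes ?body) = ?W" by (auto simp: Gradient_phase_def)
  let ?I = "\<lambda>x s'. s' 42 0 \<le> n \<and> (\<exists>\<G>'. \<G> \<subseteq> \<G>' \<and> kernel_basis n \<G>' (vecs s') (s' 42 0) \<and> known s m piv \<G>' \<and>
     (\<forall>x'<x. \<exists>g\<in>\<G>'. \<forall>i<n. g i = gradient n f (affine_pt u0 (outs s) m (qdig x')) i))"
  have "\<exists>s'. run (For 50 (Var 48) ?body) s s' \<and> ?I (q ^ m) s'"
  proof (rule run_for[where I = ?I and B = "q ^ m"])
    show "ok s" by (fact ok)
    show "aval (Var 48) s = q ^ m" using qm by simp
    show "q ^ m \<le> R" using ok_le[OF ok, of 48 0] qm by simp
    show "?I 0 s" using N kb kn by auto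
  next
    fix x s' assume s': "ok s'" "frame (insert 50 (writes ?body)) s s'" "x < q ^ m" "s' 50 0 = x" "?I x s'"
    have fr': "frame ?W s s'" using s'(2) unfolding wb .
    have env': "env s'" by (rule env_frame[OF env fr']) auto
    have s1: "s' 1 = s 1" using fr' by (auto simp: frame_def)
    have xR: "x \<le> R" using ok_le[OF s'(1), of 50 0] s'(4) by simp
    obtain t1 where t1: "run (Point (Var 1) (Var 50)) s' t1" "env t1"
      "\<And>i. i < n \<Longrightarrow> t1 20 i = affine_pt u0 (outs s') m (qdig x) i" "\<And>i. i < n \<Longrightarrow> t1 20 i < q"
      by (rule Point[OF s'(1) env', of "Var 50" x "Var 1" m]) (use s'(4) xR s1 m Y in auto)
    obtain t2 where t2: "run Gradient t1 t2" "env t2" "\<And>i. i < n \<Longrightarrow> t2 40 i = gradient n f (t1 20) i"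
      by (rule Gradient[OF run_ok[OF t1(1)] t1(2) t1(4)]) auto
    have g: "t2 40 i = gradient n f (affine_pt u0 (outs s) m (qdig x)) i" if "i < n" for i
      unfolding t2(3)[OF that] by (rule gradient_cong) (use t1(3) s1 in simp)
    have f2: "t2 41 = s' 41" "t2 42 = s' 42"
      using run_frame[OF t1(1)] run_frame[OF t2(1)] by (auto simp: frame_def)
    have pt: "scalars n (affine_pt u0 (outs s) m (qdig x))"
      unfolding scalars_def[of n "affine_pt u0 (outs s) m (qdig x)"]
      by (intro allI impI affine_pt_qdig_closed) (use Y in auto)
    have gs: "scalars n (t2 40)"
      using gradient_closed[OF pt wf_f] g by (auto simp: scalars_def)
    obtain \<G>' where \<G>': "\<G> \<subseteq> \<G>'" "kernel_basis n \<G>' (vecs s') (s' 42 0)" "known s m piv \<G>'"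
      "\<forall>x'<x. \<exists>g\<in>\<G>'. \<forall>i<n. g i = gradient n f (affine_pt u0 (outs s) m (qdig x')) i" "s' 42 0 \<le> n"
      using s'(5) by blast
    obtain t3 where t3: "run Reduce t2 t3" "env t3" "kernel_basis n (insert (t2 40) \<G>') (vecs t3) (t3 42 0)"
      "t3 42 0 \<le> t2 42 0"
      by (rule Reduce[OF run_ok[OF t2(1)] t2(2) _ _ gs, of \<G>']) (use \<G>' f2 in auto)
    have "known s m piv (insert (t2 40) \<G>')"
      using \<G>'(3) g qdig_scalars[of m x] unfolding known_def by blast
    moreover have "\<forall>x'<Suc x. \<exists>g\<in>insert (t2 40) \<G>'. \<forall>i<n. g i = gradient n f (affine_pt u0 (outs s) m (qdig x')) i"
    proof (intro allI impI)
      fix x' assume x': "x' < Suc x"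
      show "\<exists>g\<in>insert (t2 40) \<G>'. \<forall>i<n. g i = gradient n f (affine_pt u0 (outs s) m (qdig x')) i"
      proof (cases "x' = x")
        case True
        show ?thesis by (rule bexI[of _ "t2 40"]) (use g True in auto)
      next
        case False
        with x' have "x' < x" by simp
        then obtain h where "h \<in> \<G>'" "\<forall>i<n. h i = gradient n f (affine_pt u0 (outs s) m (qdig x')) i"
          using \<G>'(4) by blast
        then show ?thesis by (intro bexI[of _ h]) simp_all
      qed
    qed
    moreover have "t3 42 0 \<le> n" using t3(4) f2 \<G>'(5) by simp
    ultimately have I: "?I (Suc x) t3" using t3(3) \<G>'(1) by (intro conjI exI[of _ "insert (t2 40) \<G>'"]) auto
    have r: "run ?body s' t3" by (intro run_seq[OF t1(1)] run_seq[OF t2(1)] t3(1))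
    show "\<exists>s2. run ?body s' s2 \<and> ?I (Suc x) s2"
      by (rule exI[of _ t3], rule conjI[OF r I])
  qed auto
  then obtain s' where s': "run Gradient_phase s s'" "?I (q ^ m) s'" unfolding Gradient_phase_def by blast
  obtain \<G>' where \<G>': "\<G> \<subseteq> \<G>'" "kernel_basis n \<G>' (vecs s') (s' 42 0)" "known s m piv \<G>'"
      "\<forall>x'<q ^ m. \<exists>g\<in>\<G>'. \<forall>i<n. g i = gradient n f (affine_pt u0 (outs s) m (qdig x')) i" "s' 42 0 \<le> n"
    using s'(2) by blast
  show ?thesis
  proof (rule that[OF s'(1) _ \<G>'(5,1,2,3)])
    show "env s'" by (rule env_frame[OF env run_frame[OF s'(1)]]) auto
    fix c assume c: "scalars m c"
    \<comment> \<open>The counter exhausts all points: every coefficient vector of length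
      \<open>m\<close> consists of the digits of some number below \<open>q ^ m\<close>.\<close>
    obtain x where x: "x < q ^ m" "\<forall>j<m. qdig x j = c j"
      using exists_digits[of m c] c by (auto simp: scalars_def carr_iff)
    have "affine_pt u0 (outs s) m (qdig x) = affine_pt u0 (outs s) m c"
      by (rule affine_pt_cong) (use x(2) in simp)
    then show "\<exists>g\<in>\<G>'. \<forall>i<n. g i = gradient n f (affine_pt u0 (outs s) m c) i"
      using \<G>'(4)[rule_format, OF x(1)] by simp
  qed
qed

lemma Candidate:
  assumes ok: "ok s" and env: "env s" and m: "s 1 0 = m" "m < n" and N: "s 42 0 = N" "N \<le> n"
    and V: "\<And>j. j < N \<Longrightarrow> scalars n (vecs s j)"
  obtains s' where "run Candidate s s'" "env s'" "s' 1 0 = m"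
    "\<And>i. i < n \<Longrightarrow> outs s' m i = comb_vec N (qdig (s 52 0)) (vecs s) i"
    "\<And>j i. j < m \<Longrightarrow> i < n \<Longrightarrow> outs s' j i = outs s j i"
proof -
  let ?lc = "Lc (Const 0) (Var 42) 41 (Const 0) (Var 52)"
  have zR: "s 52 0 \<le> R" by (rule ok_le[OF ok])
  obtain t1 where t1: "run ?lc s t1" "env t1"
    "\<And>i. i < n \<Longrightarrow> t1 20 i = 0 \<oplus> fsum N (\<lambda>j. qdig (s 52 0) j \<otimes> s 41 (0 + (j * n + i)))"
  proof (rule Lc[OF ok env _ zR])
    show "aval (Var 52) s = s 52 0" by simp
    show "aval (Var 42) s = N" using N by simp
    show "N \<le> R" using N n_le_R by simp
    show "s 41 (0 + (j * n + i)) < q" if "j < N" "i < n" for j i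
      using V[OF that(1)] that(2) by (simp add: scalars_less)
    show "(0::nat) < q" using q_gt_1 by simp
  qed auto
  let ?y = "comb_vec N (qdig (s 52 0)) (vecs s)"
  have ylt: "?y i < q" if "i < n" for i
  proof -
    have "scalars n ?y" by (rule comb_vec_qdig_closed) (use V in auto)
    then show ?thesis using that by (simp add: scalars_less)
  qed
  have y: "t1 20 i = ?y i" if "i < n" for i
    using t1(3)[OF that] zero_add[OF ylt[OF that]] by (simp add: comb_vec_def)
  have f1: "t1 1 = s 1" using run_frame[OF t1(1)] by (auto simp: frame_def)
  let ?as = "Assign 1 (Add (Const 1) (eVec (Var 1) (Var 31))) (Cell 20 (Var 31))"
  let ?I = "\<lambda>k s'. s' 1 0 = m \<and> (\<forall>i<k. outs s' m i = ?y i) \<and> (\<forall>j<m. \<forall>i<n. outs s' j i = outs s j i)"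
  have "\<exists>s'. run (For 31 eN ?as) t1 s' \<and> ?I n s'"
  proof (rule run_for[where I = ?I and B = n])
    show "ok t1" by (rule run_ok[OF t1(1)])
    show "aval eN t1 = n" using env_simps[OF t1(2)] by simp
    show "n \<le> R" by (rule n_le_R)
    show "?I 0 t1" using f1 m by simp
  next
    fix k s' assume s': "ok s'" "frame (insert 31 (writes ?as)) t1 s'" "k < n" "s' 31 0 = k" "?I k s'"
    have env': "env s'" by (rule env_frame[OF t1(2) s'(2)]) auto
    have same: "s' 20 = t1 20" using s'(2) by (auto simp: frame_def)
    have ix: "Suc (m * n + k) < IX" using vec_index[OF m(2) s'(3)] IX_square by linarith
    define t2 where "t2 = s'(1 := (s' 1)(Suc (m * n + k) := ?y k))"
    have "run ?as s' t2"
      unfolding t2_def using run_assign[OF s'(1), of 1 "Add (Const 1) (eVec (Var 1) (Var 31))" "Cell 20 (Var 31)"]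
        s'(3,4,5) same y[OF s'(3)] ix env_simps(3)[OF env'] less_R[OF ylt[OF s'(3)]] by simp
    moreover have "?I (Suc k) t2"
    proof (intro conjI allI impI)
      show "t2 1 0 = m" using s'(5) by (simp add: t2_def)
      show "outs t2 m i = ?y i" if "i < Suc k" for i
        using s'(5) that by (cases "i = k") (auto simp: t2_def)
      show "outs t2 j i = outs s j i" if "j < m" "i < n" for j i
        using s'(5) that vec_index_inj[OF that(2) s'(3), of j m] by (simp add: t2_def)
    qed
    ultimately show "\<exists>s2. run ?as s' s2 \<and> ?I (Suc k) s2" by blast
  qed auto
  then obtain s' where s': "run (For 31 eN ?as) t1 s'" "?I n s'" by blast
  have r: "run Candidate s s'" unfolding Candidate_def by (rule run_seq[OF t1(1) s'(1)])
  have "env s'" by (rule env_frame[OF env run_frame[OF r]]) auto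
  with r s'(2) show ?thesis by (intro that[of s']) auto
qed

lemma Test:
  assumes ok: "ok s" and env: "env s" and m: "s 1 0 = m" "m < K" and qm: "s 48 0 = q ^ m"
    and v0: "s 49 0 = val u0" and Y: "\<And>j. j \<le> m \<Longrightarrow> scalars n (outs s j)"
  obtains s' where "run Test s s'" "env s'"
    "s' 51 0 = (if \<forall>c. scalars (Suc m) c \<longrightarrow> val (affine_pt u0 (outs s) (Suc m) c) = val u0 then 1 else 0)"
proof -
  have mn: "Suc m \<le> n" using m K_less by simp
  have qR: "q ^ Suc m \<le> R"
  proof -
    have "q ^ Suc m \<le> q ^ K" using m q_gt_1 by (intro power_increasing) auto
    then show ?thesis using R_K by simp
  qed
  define t where "t = (\<lambda>x. val (affine_pt u0 (outs s) (Suc m) (qdig x)))"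
  let ?cond = "Cond (Add (Sub (Var 21) (Var 49)) (Sub (Var 49) (Var 21))) (Set 51 (Const 0)) Skip"
  let ?pt = "Point (Add (Var 1) (Const 1)) (Var 50)"
  let ?body = "Seq ?pt (Seq Eval ?cond)"
  have wb: "insert 50 (writes ?body) = writes Test" by (auto simp: Test_def)
  define s1 where "s1 = s(51 := (s 51)(0 := 1))"
  have r1: "run (Set 51 (Const 1)) s s1" unfolding s1_def by (rule run_set[OF ok]) (use R_pos in auto)
  have fr1: "frame (writes Test) s s1" by (auto simp: frame_def s1_def)
  have env1: "env s1" by (rule env_frame[OF env fr1]) auto
  let ?I = "\<lambda>x s'. s' 51 0 = (if \<forall>x'<x. t x' = val u0 then 1 else 0)"
  have "\<exists>s'. run (For 50 (Mul (Var 48) eQ) ?body) s1 s' \<and> ?I (q ^ Suc m) s'"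
  proof (rule run_for[where I = ?I and B = "q ^ Suc m"])
    show "ok s1" by (rule run_ok[OF r1])
    show "aval (Mul (Var 48) eQ) s1 = q ^ Suc m" using qm env_simps[OF env1] by (simp add: s1_def)
    show "q ^ Suc m \<le> R" by (rule qR)
    show "?I 0 s1" by (simp add: s1_def)
  next
    fix x s' assume s': "ok s'" "frame (insert 50 (writes ?body)) s1 s'" "x < q ^ Suc m" "s' 50 0 = x" "?I x s'"
    have fr': "frame (writes Test) s s'" using s'(2) fr1 unfolding wb by (auto simp: frame_def)
    have env': "env s'" by (rule env_frame[OF env fr']) auto
    have same: "s' 1 = s 1" "s' 49 = s 49" using fr' by (auto simp: frame_def)
    have xR: "x \<le> R" using ok_le[OF s'(1), of 50 0] s'(4) by simp
    obtain t1 where t1: "run ?pt s' t1" "env t1"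
      "\<And>i. i < n \<Longrightarrow> t1 20 i = affine_pt u0 (outs s') (Suc m) (qdig x) i" "\<And>i. i < n \<Longrightarrow> t1 20 i < q"
      by (rule Point[OF s'(1) env', of "Var 50" x "Add (Var 1) (Const 1)" "Suc m"])
        (use s'(4) xR same m mn Y in \<open>auto simp: less_Suc_eq_le\<close>)
    obtain t2 where t2: "run Eval t1 t2" "env t2"
      "(t2 21 0, t2 22 0) = dual_poly (t1 20) (unit_vec (t1 33 0)) n f (length f)"
      by (rule Eval[OF run_ok[OF t1(1)] t1(2) t1(4)]) auto
    have "t2 21 0 = fst (dual_poly (t1 20) (unit_vec (t1 33 0)) n f (length f))"
      unfolding t2(3)[symmetric] by simp
    also have "\<dots> = val (t1 20)" unfolding poly_value_def by (rule fst_dual_poly)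
    also have "\<dots> = t x" unfolding t_def by (rule poly_value_cong) (use t1(3) same in simp)
    finally have tx: "t2 21 0 = t x" .
    have f2: "t2 49 0 = val u0" "t2 51 0 = s' 51 0"
      using run_frame[OF t1(1)] run_frame[OF t2(1)] same v0 by (auto simp: frame_def)
    show "\<exists>s2. run ?body s' s2 \<and> ?I (Suc x) s2"
    proof (cases "t x = val u0")
      case True
      have "run ?cond t2 t2"
        by (rule run_cond_false[OF run_ok[OF t2(1)]]) (use tx f2 True run_skip[OF run_ok[OF t2(1)]] in auto)
      then have "run ?body s' t2" by (intro run_seq[OF t1(1)] run_seq[OF t2(1)])
      moreover have "?I (Suc x) t2" using s'(5) f2 True by (auto simp: less_Suc_eq)
      ultimately show ?thesis by blast
    next
      case False
      define t3 where "t3 = t2(51 := (t2 51)(0 := 0))"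
      have "run (Set 51 (Const 0)) t2 t3" unfolding t3_def by (rule run_set[OF run_ok[OF t2(1)]]) auto
      then have "run ?cond t2 t3"
        by (intro run_cond_true[OF run_ok[OF t2(1)]]) (use tx f2 False in auto)
      then have "run ?body s' t3" by (intro run_seq[OF t1(1)] run_seq[OF t2(1)])
      moreover have "?I (Suc x) t3" using False by (auto simp: t3_def)
      ultimately show ?thesis by blast
    qed
  qed auto
  then obtain s' where s': "run (For 50 (Mul (Var 48) eQ) ?body) s1 s'" "?I (q ^ Suc m) s'" by blast
  have r: "run Test s s'" unfolding Test_def by (rule run_seq[OF r1 s'(1)])
  have "env s'" by (rule env_frame[OF env run_frame[OF r]]) auto
  moreover have "(\<forall>x<q ^ Suc m. t x = val u0) \<longleftrightarrow>
      (\<forall>c. scalars (Suc m) c \<longrightarrow> val (affine_pt u0 (outs s) (Suc m) c) = val u0)"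
  proof (intro iffI allI impI)
    fix c assume all: "\<forall>x<q ^ Suc m. t x = val u0" and c: "scalars (Suc m) c"
    obtain x where x: "x < q ^ Suc m" "\<forall>j<Suc m. qdig x j = c j"
      using exists_digits[of "Suc m" c] c by (auto simp: scalars_def carr_iff)
    have "affine_pt u0 (outs s) (Suc m) (qdig x) = affine_pt u0 (outs s) (Suc m) c"
      by (rule affine_pt_cong) (use x(2) in blast)
    then show "val (affine_pt u0 (outs s) (Suc m) c) = val u0" using all x(1) unfolding t_def by metis
  next
    fix x assume "\<forall>c. scalars (Suc m) c \<longrightarrow> val (affine_pt u0 (outs s) (Suc m) c) = val u0"
    then show "t x = val u0" unfolding t_def using qdig_scalars by blast
  qed
  ultimately show ?thesis using s'(2) r by (intro that[of s']) simp_all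
qed

text \<open>The code \<open>zmax\<close> is there to guarantee termination. The search may stop at a
  smaller one, which has passed the same test on the whole enlarged subspace.\<close>

lemma Search_phase:
  assumes ok: "ok s" and env: "env s" and m: "s 1 0 = m" "m < K" and qm: "s 48 0 = q ^ m"
    and v0: "s 49 0 = val u0" and Y: "\<And>j. j < m \<Longrightarrow> scalars n (outs s j)" and N: "s 42 0 = N" "N \<le> n"
    and V: "\<And>j. j < N \<Longrightarrow> scalars n (vecs s j)"
    and zmax: "0 < zmax" "zmax \<le> R"
      "\<And>c. scalars (Suc m) c \<Longrightarrow>
        val (affine_pt u0 ((outs s)(m := comb_vec N (qdig zmax) (vecs s))) (Suc m) c) = val u0"
  obtains s' z where "run Search_phase s s'" "env s'" "s' 1 0 = m" "0 < z" "z \<le> zmax"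
    "\<And>i. i < n \<Longrightarrow> outs s' m i = comb_vec N (qdig z) (vecs s) i"
    "\<And>j i. j < m \<Longrightarrow> i < n \<Longrightarrow> outs s' j i = outs s j i"
    "\<And>c. scalars (Suc m) c \<Longrightarrow> val (affine_pt u0 (outs s') (Suc m) c) = val u0"
proof -
  have mn: "m < n" using m K_less by simp
  let ?Y = "\<lambda>z. (outs s)(m := comb_vec N (qdig z) (vecs s))"
  define good where "good = (\<lambda>z. \<forall>c. scalars (Suc m) c \<longrightarrow> val (affine_pt u0 (?Y z) (Suc m) c) = val u0)"
  have outs_eq: "affine_pt u0 (outs t) (Suc m) c i = affine_pt u0 (?Y y) (Suc m) c i"
    if "\<And>i. i < n \<Longrightarrow> outs t m i = comb_vec N (qdig y) (vecs s) i"
      "\<And>j i. j < m \<Longrightarrow> i < n \<Longrightarrow> outs t j i = outs s j i" "i < n" for t y c i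
    by (rule affine_pt_cong') (use that in \<open>auto simp: less_Suc_eq\<close>)
  define s1 where "s1 = s(51 := (s 51)(0 := 0))"
  have r1: "run (Set 51 (Const 0)) s s1" unfolding s1_def by (rule run_set[OF ok]) auto
  define s2 where "s2 = s1(52 := (s1 52)(0 := 0))"
  have r2: "run (Set 52 (Const 0)) s1 s2" unfolding s2_def by (rule run_set[OF run_ok[OF r1]]) auto
  have fr2: "frame (writes Search_phase) s s2" by (auto simp: frame_def s2_def s1_def)
  let ?body = "Seq (Set 52 (Add (Var 52) (Const 1))) (Seq Candidate Test)"
  let ?e = "Sub (Const 1) (Var 51)"
  let ?I = "\<lambda>k s'. s' 52 0 = k \<and> s' 1 0 = m \<and> k \<le> zmax \<and> (\<forall>j<m. \<forall>i<n. outs s' j i = outs s j i) \<and>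
    (0 < k \<longrightarrow> (\<forall>i<n. outs s' m i = comb_vec N (qdig k) (vecs s) i)) \<and>
    s' 51 0 = (if 0 < k \<and> good k then 1 else 0) \<and> (\<forall>z. 0 < z \<longrightarrow> z < k \<longrightarrow> \<not> good z)"
  have "\<exists>s' k. run (While ?e ?body) s2 s' \<and> ?I k s' \<and> aval ?e s' = 0"
  proof (rule run_while[where I = ?I])
    show "ok s2" by (rule run_ok[OF r2])
    show "?I 0 s2" using m by (simp add: s2_def s1_def)
  next
    fix k s' assume s': "ok s'" "frame (writes ?body) s2 s'" "?I k s'" "aval ?e s' \<noteq> 0"
    have fr': "frame (writes Search_phase) s s'" using s'(2) fr2 by (auto simp: frame_def)
    have env': "env s'" by (rule env_frame[OF env fr']) auto
    have same: "s' 42 = s 42" "s' 41 = s 41" "s' 48 = s 48" "s' 49 = s 49" using fr' by (auto simp: frame_def)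
    have "\<not> (0 < k \<and> good k)" using s'(3,4) by auto
    then have bad: "\<not> good z" if "0 < z" "z < Suc k" for z using s'(3) that by (auto simp: less_Suc_eq)
    have "good zmax" using zmax(3) by (simp add: good_def)
    then have kz: "k < zmax" using bad[of zmax] zmax(1) by (cases "zmax < Suc k") auto
    then have kR: "k < R" using zmax(2) by simp
    define t1 where "t1 = s'(52 := (s' 52)(0 := Suc k))"
    have q1: "run (Set 52 (Add (Var 52) (Const 1))) s' t1"
      unfolding t1_def by (rule run_set[OF s'(1)]) (use s'(3) kR in auto)
    have envt1: "env t1" using env' by (simp add: t1_def env_upd)
    have t1s: "t1 1 = s' 1" "t1 42 = s 42" "t1 41 = s 41" "t1 52 0 = Suc k" "t1 48 = s 48" "t1 49 = s 49"
      using same by (auto simp: t1_def)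
    obtain t2 where t2: "run Candidate t1 t2" "env t2" "t2 1 0 = m"
      "\<And>i. i < n \<Longrightarrow> outs t2 m i = comb_vec N (qdig (t1 52 0)) (vecs t1) i"
      "\<And>j i. j < m \<Longrightarrow> i < n \<Longrightarrow> outs t2 j i = outs t1 j i"
      by (rule Candidate[OF run_ok[OF q1] envt1, of m N]) (use s'(3) mn N V t1s in auto)
    have o1: "outs t2 m i = comb_vec N (qdig (Suc k)) (vecs s) i" if "i < n" for i
      using t2(4)[OF that] t1s by simp
    have o2: "outs t2 j i = outs s j i" if "j < m" "i < n" for j i
      using t2(5)[OF that] t1s s'(3) that by simp
    have t2s: "t2 48 = s 48" "t2 49 = s 49" "t2 52 0 = Suc k"
      using run_frame[OF t2(1)] t1s by (auto simp: frame_def)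
    have Y2: "scalars n (outs t2 j)" if "j \<le> m" for j
    proof (cases "j = m")
      case True
      have "scalars n (comb_vec N (qdig (Suc k)) (vecs s))" by (rule comb_vec_qdig_closed) (use V in auto)
      then show ?thesis using o1 True by (simp add: scalars_def)
    next
      case False
      then have "j < m" using that by simp
      then show ?thesis using Y[of j] o2[of j] by (simp add: scalars_def)
    qed
    obtain t3 where t3: "run Test t2 t3" "env t3"
      "t3 51 0 = (if \<forall>c. scalars (Suc m) c \<longrightarrow> val (affine_pt u0 (outs t2) (Suc m) c) = val u0 then 1 else 0)"
      by (rule Test[OF run_ok[OF t2(1)] t2(2,3) m(2) _ _ Y2]) (use t2s qm v0 in auto)
    have "val (affine_pt u0 (outs t2) (Suc m) c) = val (affine_pt u0 (?Y (Suc k)) (Suc m) c)" for c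
      by (rule poly_value_cong, rule outs_eq) (use o1 o2 in auto)
    then have g3: "t3 51 0 = (if good (Suc k) then 1 else 0)" using t3(3) by (simp add: good_def)
    have t3s: "t3 1 = t2 1" "t3 52 0 = Suc k" using run_frame[OF t3(1)] t2s by (auto simp: frame_def)
    have I: "?I (Suc k) t3"
      unfolding t3s(1)
    proof (intro conjI allI impI)
      show "t3 52 0 = Suc k" "t2 1 0 = m" "Suc k \<le> zmax" using t3s(2) t2(3) kz by simp_all
      show "outs t2 j i = outs s j i" if "j < m" "i < n" for j i by (rule o2[OF that])
      show "outs t2 m i = comb_vec N (qdig (Suc k)) (vecs s) i" if "i < n" for i by (rule o1[OF that])
      show "t3 51 0 = (if 0 < Suc k \<and> good (Suc k) then 1 else 0)" by (simp only: g3 zero_less_Suc simp_thms)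
      show "\<not> good z" if "0 < z" "z < Suc k" for z by (rule bad[OF that])
    qed
    have r: "run ?body s' t3" by (intro run_seq[OF q1] run_seq[OF t2(1)] t3(1))
    show "k < R \<and> (\<exists>s2. run ?body s' s2 \<and> ?I (Suc k) s2)"
      by (rule conjI[OF kR], rule exI[of _ t3], rule conjI[OF r I])
  qed
  then obtain s' k where s': "run (While ?e ?body) s2 s'" "?I k s'" "aval ?e s' = 0" by (rule ex_conj3E)
  have r: "run Search_phase s s'" unfolding Search_phase_def by (intro run_seq[OF r1] run_seq[OF r2] s'(1))
  have k: "0 < k" "good k" using s'(2,3) by (auto split: if_splits)
  show ?thesis
  proof (rule that[OF r])
    show "env s'" by (rule env_frame[OF env run_frame[OF r]]) auto
    show "0 < k" by (rule k)
    show "val (affine_pt u0 (outs s') (Suc m) c) = val u0" if c: "scalars (Suc m) c" for c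
    proof -
      have "val (affine_pt u0 (outs s') (Suc m) c) = val (affine_pt u0 (?Y k) (Suc m) c)"
        by (rule poly_value_cong, rule outs_eq) (use s'(2) k in auto)
      then show ?thesis using k(2) c by (simp add: good_def)
    qed
  qed (use s'(2) k in auto)
qed

lemma Pivot_phase:
  assumes ok: "ok s" and env: "env s" and m: "s 1 0 = m" "m < n" and N: "s 42 0 \<le> n"
    and kb: "kernel_basis n \<G> (vecs s) (s 42 0)" and nz: "\<exists>i<n. outs s m i \<noteq> 0"
  obtains s' c g where "run Pivot_phase s s'" "env s'" "c < n" "outs s m c \<noteq> 0" "s' 42 0 \<le> n"
    "kernel_basis n (insert g \<G>) (vecs s') (s' 42 0)" "\<And>i. i < n \<Longrightarrow> g i = unit_vec c i"
proof -
  define s1 where "s1 = s(33 := (s 33)(0 := 0))"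
  have r1: "run (Set 33 (Const 0)) s s1" unfolding s1_def by (rule run_set[OF ok]) auto
  let ?e = "Sub (Const 1) (Cell 1 (Add (Const 1) (eVec (Var 1) (Var 33))))"
  let ?b = "Set 33 (Add (Var 33) (Const 1))"
  let ?I = "\<lambda>c s'. s' 33 0 = c \<and> c < n \<and> (\<forall>i<c. outs s m i = 0)"
  have n0: "0 < n" using m by simp
  have "\<exists>s' c. run (While ?e ?b) s1 s' \<and> ?I c s' \<and> aval ?e s' = 0"
  proof (rule run_while[where I = ?I])
    show "ok s1" by (rule run_ok[OF r1])
    show "?I 0 s1" using n0 by (simp add: s1_def)
  next
    fix c s' assume s': "ok s'" "frame (writes ?b) s1 s'" "?I c s'" "aval ?e s' \<noteq> 0"
    have same: "s' 1 = s 1" "s' 0 = s 0" using s'(2) by (auto simp: frame_def s1_def)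
    have "outs s m c = 0" using s'(3,4) same m env_simps(3)[OF env] by simp
    then have z: "\<forall>i<Suc c. outs s m i = 0" using s'(3) by (auto simp: less_Suc_eq)
    then have "Suc c < n" using nz s'(3) by (metis Suc_lessI)
    then have cR: "c < R" "Suc c < n" using n_le_R by auto
    have "run ?b s' (s'(33 := (s' 33)(0 := Suc c)))" by (rule run_set[OF s'(1)]) (use s'(3) cR in auto)
    moreover have "?I (Suc c) (s'(33 := (s' 33)(0 := Suc c)))" using z cR by simp
    ultimately show "c < R \<and> (\<exists>s2. run ?b s' s2 \<and> ?I (Suc c) s2)" using cR by blast
  qed
  then obtain s2 c where r2: "run (While ?e ?b) s1 s2" and c: "?I c s2" and test: "aval ?e s2 = 0" by blast
  have f2: "s2 1 = s 1" "s2 0 = s 0" "s2 2 = s 2" "s2 41 = s 41" "s2 42 = s 42"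
    using run_frame[OF r2] by (auto simp: frame_def s1_def)
  have env2: "env s2" using env f2 by (simp add: env_def)
  have "outs s m c \<noteq> 0" using test c f2 m env_simps(3)[OF env] by auto
  let ?as = "Assign 40 (Var 31) eUnit"
  let ?J = "\<lambda>k s'. \<forall>i<k. s' 40 i = unit_vec c i"
  have "\<exists>s'. run (For 31 eN ?as) s2 s' \<and> ?J n s'"
  proof (rule run_for[where I = ?J and B = n])
    show "ok s2" by (rule run_ok[OF r2])
    show "aval eN s2 = n" using env_simps[OF env2] by simp
    show "n \<le> R" by (rule n_le_R)
  next
    fix k s' assume s': "ok s'" "frame (insert 31 (writes ?as)) s2 s'" "k < n" "s' 31 0 = k" "?J k s'"
    have same: "s' 33 0 = c" using s'(2) c by (auto simp: frame_def)
    have uc: "aval eUnit s' = unit_vec c k" using same s'(4) by (simp add: zero_code one_code)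
    have ul: "unit_vec c k \<le> R" using R_pos by (simp add: zero_code one_code)
    have "run ?as s' (s'(40 := (s' 40)(k := unit_vec c k)))"
      using run_assign[OF s'(1), of 40 "Var 31" eUnit] uc ul s'(3,4) n_less_IX by simp
    moreover have "?J (Suc k) (s'(40 := (s' 40)(k := unit_vec c k)))" using s'(5) by (auto simp: less_Suc_eq)
    ultimately show "\<exists>s2. run ?as s' s2 \<and> ?J (Suc k) s2" by blast
  qed auto
  then obtain s3 where r3: "run (For 31 eN ?as) s2 s3" and p3: "?J n s3" by blast
  have f3: "s3 41 = s 41" "s3 42 = s 42" "s3 0 = s 0" "s3 2 = s 2"
    using run_frame[OF r3] f2 by (auto simp: frame_def)
  have env3: "env s3" using env f3 by (simp add: env_def)
  have gs: "scalars n (s3 40)" using p3 by (simp add: scalars_def)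
  obtain s4 where s4: "run Reduce s3 s4" "env s4" "kernel_basis n (insert (s3 40) \<G>) (vecs s4) (s4 42 0)"
    "s4 42 0 \<le> s3 42 0"
    by (rule Reduce[OF run_ok[OF r3] env3 _ _ gs, of \<G>]) (use kb N f3 in auto)
  have "run Pivot_phase s s4"
    unfolding Pivot_phase_def by (intro run_seq[OF r1] run_seq[OF r2] run_seq[OF r3] s4(1))
  then show ?thesis
    using s4 c p3 f3 N \<open>outs s m c \<noteq> 0\<close> by (intro that[of s4 c "s3 40"]) auto
qed

text \<open>The functionals and pivots are ghost data. The coordinate functionals of the pivots
  belong to the functionals, so later directions vanish there, which keeps the output
  triangular.\<close>

definition invar :: "nat \<Rightarrow> store \<Rightarrow> bool" where
  "invar m s \<longleftrightarrow> env s \<and> s 1 0 = m \<and> m \<le> K \<and> s 9 0 = K \<and> s 48 0 = q ^ m \<and> s 49 0 = val u0 \<and>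
     (\<forall>j<m. scalars n (outs s j)) \<and>
     (\<forall>c. scalars m c \<longrightarrow> val (affine_pt u0 (outs s) m c) = val u0) \<and> s 42 0 \<le> n \<and>
     (\<exists>\<G> piv. kernel_basis n \<G> (vecs s) (s 42 0) \<and> known s m piv \<G> \<and>
        (\<forall>j<m. piv j < n \<and> outs s j (piv j) \<noteq> 0 \<and> (\<exists>g\<in>\<G>. \<forall>i<n. g i = unit_vec (piv j) i)) \<and>
        (\<forall>i j. i < j \<longrightarrow> j < m \<longrightarrow> outs s j (piv i) = 0))"

text \<open>A point of the old subspace is the point of the new one whose last coefficient is zero,
  so its gradient remains admissible.\<close>

lemma known_extend:
  assumes kn: "known s m piv \<G>" and Y: "\<And>j. j < m \<Longrightarrow> scalars n (outs s j)"
    and Y': "\<And>j i. j < m \<Longrightarrow> i < n \<Longrightarrow> outs s' j i = outs s j i" "scalars n (outs s' m)"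
  shows "known s' (Suc m) (piv(m := c)) \<G>"
  unfolding known_def
proof
  fix g assume "g \<in> \<G>"
  with kn consider (a) b where "scalars m b" "\<forall>i<n. g i = gradient n f (affine_pt u0 (outs s) m b) i"
    | (b) j where "j < m" "\<forall>i<n. g i = unit_vec (piv j) i"
    unfolding known_def by blast
  then show "(\<exists>b. scalars (Suc m) b \<and> (\<forall>i<n. g i = gradient n f (affine_pt u0 (outs s') (Suc m) b) i)) \<or>
     (\<exists>j<Suc m. \<forall>i<n. g i = unit_vec ((piv(m := c)) j) i)"
  proof cases
    case a
    let ?b = "b(m := \<zero>)"
    have b: "scalars (Suc m) ?b" using a(1) by (auto simp: scalars_def less_Suc_eq)
    have bc: "b j \<in> carrier F" if "j < m" for j using a(1) that by (simp add: scalars_def)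
    have "affine_pt u0 (outs s') (Suc m) ?b i = affine_pt u0 (outs s) m b i" if i: "i < n" for i
    proof -
      have Yc: "outs s j i \<in> carrier F" if "j < m" for j using Y[OF that] i by (simp add: scalars_def)
      have "fsum m (\<lambda>j. ?b j \<otimes> outs s' j i) = fsum m (\<lambda>j. b j \<otimes> outs s j i)"
        by (rule fsum_cong) (use Y'(1) i in simp)
      moreover have "fsum m (\<lambda>j. b j \<otimes> outs s j i) \<in> carrier F" using bc Yc by (intro fsum_closed) auto
      moreover have "outs s' m i \<in> carrier F" using Y'(2) i by (simp add: scalars_def)
      ultimately show ?thesis by (simp add: affine_pt_def)
    qed
    then have "gradient n f (affine_pt u0 (outs s') (Suc m) ?b) i = gradient n f (affine_pt u0 (outs s) m b) i" for i
      by (rule gradient_cong)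
    with a(2) b show ?thesis by auto
  next
    case b
    then show ?thesis by (intro disjI2 exI[of _ j]) auto
  qed
qed

lemma Step:
  assumes ok: "ok s" and inv: "invar m s" and mK: "m < K"
  shows "\<exists>s'. run Step s s' \<and> invar (Suc m) s'"
proof -
  have mn: "m < n" using mK K_less by simp
  note I = inv[unfolded invar_def]
  have env: "env s" and m: "s 1 0 = m" and qm: "s 48 0 = q ^ m" and v0: "s 49 0 = val u0" and N: "s 42 0 \<le> n"
    and s9: "s 9 0 = K" using I by auto
  have Y: "scalars n (outs s j)" if "j < m" for j using I that by blast
  have const: "val (affine_pt u0 (outs s) m c) = val u0" if "scalars m c" for c using I that by blast
  obtain \<G> piv where kb: "kernel_basis n \<G> (vecs s) (s 42 0)" and kn: "known s m piv \<G>"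
    and pv: "\<And>j. j < m \<Longrightarrow> piv j < n \<and> outs s j (piv j) \<noteq> 0 \<and> (\<exists>g\<in>\<G>. \<forall>i<n. g i = unit_vec (piv j) i)"
    and tri: "\<And>i j. i < j \<Longrightarrow> j < m \<Longrightarrow> outs s j (piv i) = 0"
    using I by blast
  obtain s1 \<G>1 where r1: "run Gradient_phase s s1" and env1: "env s1" and N1: "s1 42 0 \<le> n" and sub: "\<G> \<subseteq> \<G>1"
    and kb1: "kernel_basis n \<G>1 (vecs s1) (s1 42 0)" and kn1: "known s m piv \<G>1"
    and cov: "\<And>c. scalars m c \<Longrightarrow> \<exists>g\<in>\<G>1. \<forall>i<n. g i = gradient n f (affine_pt u0 (outs s) m c) i"
    using Gradient_phase[OF ok env m mn qm Y N kb kn] by blast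
  have f1: "s1 1 = s 1" "s1 48 = s 48" "s1 49 = s 49" "s1 9 = s 9" using run_frame[OF r1] by (auto simp: frame_def)
  define N' where "N' = s1 42 0"
  define V where "V = vecs s1"
  \<comment> \<open>One more than the degree sum, as Chevalley's theorem needs a strict
    inequality.\<close>
  define B where "B = Suc (\<Sum>j=2..d. j * ((m + (d - j)) choose (d - j)))"
  have Vs: "scalars n (V j)" if "j < N'" for j using kb1 that by (simp add: kernel_basis_def V_def N'_def)
  have "n \<le> N' + (((m + (d - 1)) choose (d - 1)) + m)"
  proof (rule kernel_dim_bound[OF finite_carr u0_scalars _ wf_f kb1[folded N'_def]])
    show "scalars n (outs s j)" if "j < m" for j by (rule Y[OF that])
    show "piv j < n" if "j < m" for j using pv[OF that] by blast
    show "(\<exists>c. scalars m c \<and> (\<forall>i<n. g i = gradient n f (affine_pt u0 (outs s) m c) i)) \<or>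
      (\<exists>j<m. \<forall>i<n. g i = unit_vec (piv j) i)" if "g \<in> \<G>1" for g
      using kn1 that unfolding known_def by blast
  qed
  then have BN: "B \<le> N'" using room[OF mK] unfolding B_def by linarith
  \<comment> \<open>Only the first \<open>B\<close> kernel vectors enter Chevalley's theorem, so
    that the code of the direction stays below \<open>q ^ B\<close>.\<close>
  have "\<exists>z. scalars B z \<and> (\<exists>j<B. z j \<noteq> \<zero>) \<and> (\<forall>c t. scalars m c \<longrightarrow> t \<in> carrier F \<longrightarrow>
    val (\<lambda>i. affine_pt u0 (outs s) m c i \<oplus> t \<otimes> comb_vec B z V i) = val (affine_pt u0 (outs s) m c))"
  proof (rule next_direction[OF finite_carr u0_scalars _ _ wf_f])
    show "scalars n (outs s j)" if "j < m" for j by (rule Y[OF that])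
    show "scalars n (V j)" if "j < B" for j using Vs that BN by simp
    show "dot n (gradient n f (affine_pt u0 (outs s) m c)) (V j) = \<zero>" if c: "scalars m c" and j: "j < B" for c j
    proof -
      obtain g where g: "g \<in> \<G>1" "\<forall>i<n. g i = gradient n f (affine_pt u0 (outs s) m c) i" using cov[OF c] by blast
      have "dot n g (V j) = \<zero>" using kb1 g(1) j BN by (simp add: kernel_basis_def V_def N'_def)
      moreover have "dot n (gradient n f (affine_pt u0 (outs s) m c)) (V j) = dot n g (V j)"
        unfolding dot_def by (rule fsum_cong) (use g(2) in simp)
      ultimately show ?thesis by simp
    qed
    show "(\<Sum>j=2..d. j * ((m + (d - j)) choose (d - j))) < B" by (simp add: B_def)
  qed
  then obtain z where z: "scalars B z" "\<exists>j<B. z j \<noteq> \<zero>"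
    "\<And>c t. scalars m c \<Longrightarrow> t \<in> carrier F \<Longrightarrow>
      val (\<lambda>i. affine_pt u0 (outs s) m c i \<oplus> t \<otimes> comb_vec B z V i) = val (affine_pt u0 (outs s) m c)" by blast
  obtain zm where zm: "zm < q ^ B" "\<forall>j<B. qdig zm j = z j"
    using exists_digits[of B z] z(1) by (auto simp: scalars_def carr_iff)
  have zm0: "0 < zm"
  proof (rule ccontr)
    assume "\<not> 0 < zm"
    then have "z j = 0" if "j < B" for j using zm(2) that by auto
    then show False using z(2) by (auto simp: zero_code)
  qed
  have zmR: "zm \<le> R" using zm(1) R_B[OF mK] unfolding B_def by simp
  \<comment> \<open>The digits of \<open>zm\<close> from \<open>B\<close> on vanish, so the
    combination of all kernel vectors formed by the machine is the same.\<close>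
  have cvB: "comb_vec N' (qdig zm) V i = comb_vec B z V i" if i: "i < n" for i
  proof -
    have zz: "qdig zm j = 0" if "B \<le> j" for j
    proof -
      have "q ^ B \<le> q ^ j" using that q_gt_1 by (intro power_increasing) auto
      then show ?thesis using zm(1) by simp
    qed
    have Vc: "V j i \<in> carrier F" if "j < N'" for j using Vs[OF that] i by (simp add: scalars_def)
    have "fsum k (\<lambda>j. qdig zm j \<otimes> V j i) = fsum B (\<lambda>j. z j \<otimes> V j i)" if "B \<le> k" "k \<le> N'" for k
      using that
    proof (induction k rule: dec_induct)
      case base
      show ?case by (rule fsum_cong) (use zm(2) in simp)
    next
      case (step k)
      have "qdig zm k \<otimes> V k i = \<zero>" using zz[OF step(1)] Vc[of k] step by (simp add: zero_code[symmetric])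
      moreover have "fsum B (\<lambda>j. z j \<otimes> V j i) \<in> carrier F"
        using z(1) Vc BN by (intro fsum_closed) (auto simp: scalars_def)
      ultimately show ?case using step by simp
    qed
    from this[OF BN order.refl] show ?thesis by (simp add: comb_vec_def)
  qed
  have good: "val (affine_pt u0 ((outs s1)(m := comb_vec N' (qdig zm) (vecs s1))) (Suc m) c) = val u0"
    if c: "scalars (Suc m) c" for c
  proof -
    have c': "scalars m c" "c m \<in> carrier F" using c by (auto simp: scalars_def)
    have "val (affine_pt u0 ((outs s1)(m := comb_vec N' (qdig zm) (vecs s1))) (Suc m) c)
        = val (\<lambda>i. affine_pt u0 (outs s) m c i \<oplus> c m \<otimes> comb_vec B z V i)"
    proof (rule poly_value_cong)
      fix i assume i: "i < n"
      have Yc: "outs s j i \<in> carrier F" if "j < m" for j using Y[OF that] i by (simp add: scalars_def)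
      have yc: "comb_vec B z V i \<in> carrier F"
        by (rule comb_vec_closed[OF z(1) _ i]) (use Vs BN in auto)
      have e: "fsum m (\<lambda>j. c j \<otimes> ((outs s1)(m := comb_vec N' (qdig zm) (vecs s1))) j i) = fsum m (\<lambda>j. c j \<otimes> outs s j i)"
        by (rule fsum_cong) (use f1 in simp)
      have "fsum m (\<lambda>j. c j \<otimes> outs s j i) \<in> carrier F" using c' Yc by (intro fsum_closed) (auto simp: scalars_def)
      then show "affine_pt u0 ((outs s1)(m := comb_vec N' (qdig zm) (vecs s1))) (Suc m) c i
          = affine_pt u0 (outs s) m c i \<oplus> c m \<otimes> comb_vec B z V i"
        unfolding affine_pt_def fsum.simps e
        using cvB[OF i] u0_closed[OF i] c'(2) yc by (simp add: V_def a_assoc)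
    qed
    also have "\<dots> = val u0" using z(3)[OF c'] const[OF c'(1)] by simp
    finally show ?thesis .
  qed
  obtain s2 z2 where r2: "run Search_phase s1 s2" and env2: "env s2" and m2: "s2 1 0 = m"
    and z2: "0 < z2" "z2 \<le> zm"
    and y2: "\<And>i. i < n \<Longrightarrow> outs s2 m i = comb_vec N' (qdig z2) (vecs s1) i"
    and o2: "\<And>j i. j < m \<Longrightarrow> i < n \<Longrightarrow> outs s2 j i = outs s1 j i"
    and c2: "\<And>c. scalars (Suc m) c \<Longrightarrow> val (affine_pt u0 (outs s2) (Suc m) c) = val u0"
  proof (rule Search_phase[OF run_ok[OF r1] env1 _ mK _ _ _ N'_def[symmetric] _ _ zm0 zmR good])
    show "s1 1 0 = m" "s1 48 0 = q ^ m" "s1 49 0 = val u0" using f1 m qm v0 by auto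
    show "scalars n (outs s1 j)" if "j < m" for j using Y[OF that] f1 by simp
    show "N' \<le> n" using N1 by (simp add: N'_def)
    show "scalars n (vecs s1 j)" if "j < N'" for j using Vs[OF that] by (simp add: V_def)
  next
    fix s2 z2 assume "run Search_phase s1 s2" "env s2" "s2 1 0 = m" "0 < z2" "z2 \<le> zm"
      "\<And>i. i < n \<Longrightarrow> outs s2 m i = comb_vec N' (qdig z2) (vecs s1) i"
      "\<And>j i. j < m \<Longrightarrow> i < n \<Longrightarrow> outs s2 j i = outs s1 j i"
      "\<And>c. scalars (Suc m) c \<Longrightarrow> val (affine_pt u0 (outs s2) (Suc m) c) = val u0"
    then show thesis by (rule that)
  qed
  have f2: "s2 41 = s1 41" "s2 42 = s1 42" "s2 48 = s 48" "s2 49 = s 49" "s2 9 = s 9"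
    using run_frame[OF r2] f1 by (auto simp: frame_def)
  have o2': "outs s2 j i = outs s j i" if "j < m" "i < n" for j i using o2[OF that] f1 by simp
  have ysc: "scalars n (outs s2 m)"
  proof -
    have "scalars n (comb_vec N' (qdig z2) (vecs s1))"
      by (rule comb_vec_qdig_closed) (use Vs in \<open>auto simp: V_def\<close>)
    then show ?thesis using y2 by (simp add: scalars_def)
  qed
  \<comment> \<open>A zero direction would, by independence of the kernel vectors, have only zero
    digits, whereas \<open>0 < z2 < q ^ N'\<close>.\<close>
  have nz: "\<exists>i<n. outs s2 m i \<noteq> 0"
  proof (rule ccontr)
    assume "\<not> ?thesis"
    then have "\<forall>k<n. comb_vec N' (qdig z2) (vecs s1) k = \<zero>" using y2 by (auto simp: zero_code)
    moreover have "indep n (vecs s1) N'" using kb1 by (simp add: kernel_basis_def N'_def)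
    ultimately have "\<forall>j<N'. qdig z2 j = \<zero>" using qdig_scalars unfolding indep_def by blast
    then have dz: "qdig z2 j = qdig 0 j" if "j < N'" for j using that by (simp add: zero_code)
    have "q ^ B \<le> q ^ N'" using BN q_gt_1 by (intro power_increasing) auto
    then have "z2 < q ^ N'" using z2(2) zm(1) by simp
    then have "z2 = 0" using digit_ext[of q z2 N' 0] dz q_gt_1 by simp
    then show False using z2(1) by simp
  qed
  have kb2: "kernel_basis n \<G>1 (vecs s2) (s2 42 0)" using kb1 f2 by simp
  obtain s3 c g where r3: "run Pivot_phase s2 s3" and env3: "env s3" and c: "c < n" "outs s2 m c \<noteq> 0"
    and N3: "s3 42 0 \<le> n" and kb3: "kernel_basis n (insert g \<G>1) (vecs s3) (s3 42 0)"
    and g: "\<And>i. i < n \<Longrightarrow> g i = unit_vec c i"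
    by (rule Pivot_phase[OF run_ok[OF r2] env2 m2 mn _ kb2 nz]) (use f2 N1 in auto)
  have f3: "s3 1 = s2 1" "s3 48 = s 48" "s3 49 = s 49" "s3 9 = s 9"
    using run_frame[OF r3] f2 by (auto simp: frame_def)
  have qR: "q ^ Suc m \<le> R"
  proof -
    have "q ^ Suc m \<le> q ^ K" using mK q_gt_1 by (intro power_increasing) auto
    then show ?thesis using R_K by simp
  qed
  define s4 where "s4 = s3(48 := (s3 48)(0 := q ^ Suc m))"
  have r4: "run (Set 48 (Mul (Var 48) eQ)) s3 s4"
    unfolding s4_def by (rule run_set[OF run_ok[OF r3]]) (use f3 qm env_simps(1)[OF env3] qR in auto)
  define s5 where "s5 = s4(1 := (s4 1)(0 := Suc m))"
  have r5: "run (Set 1 (Add (Var 1) (Const 1))) s4 s5"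
    unfolding s5_def
    by (rule run_set[OF run_ok[OF r4]]) (use f3 m2 mn n_le_R in \<open>auto simp: s4_def\<close>)
  have run: "run Step s s5"
    unfolding Step_def by (intro run_seq[OF r1] run_seq[OF r2] run_seq[OF r3] run_seq[OF r4] r5)
  have o5: "s5 1 (Suc x) = s2 1 (Suc x)" for x using f3 by (simp add: s5_def s4_def)
  have v5: "s5 41 = s3 41" "s5 42 = s3 42" by (simp_all add: s5_def s4_def)
  have "invar (Suc m) s5"
    unfolding invar_def o5 v5
  proof (intro conjI)
    show "env s5" using env3 by (simp add: s5_def s4_def env_upd)
    show "s5 1 0 = Suc m" by (simp add: s5_def)
    show "Suc m \<le> K" using mK by simp
    show "s5 9 0 = K" "s5 49 0 = val u0" using f3 s9 v0 by (simp_all add: s5_def s4_def)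
    show "s5 48 0 = q ^ Suc m" by (simp add: s5_def s4_def)
    show "s3 42 0 \<le> n" by (rule N3)
    show "\<forall>j<Suc m. scalars n (outs s2 j)"
    proof (intro allI impI)
      fix j assume "j < Suc m"
      then show "scalars n (outs s2 j)"
        using ysc Y[of j] o2'[of j] by (cases "j = m") (simp_all add: scalars_def)
    qed
    show "\<forall>c. scalars (Suc m) c \<longrightarrow> val (affine_pt u0 (outs s2) (Suc m) c) = val u0" using c2 by blast
    show "\<exists>\<G> piv. kernel_basis n \<G> (vecs s3) (s3 42 0) \<and> known s5 (Suc m) piv \<G> \<and>
        (\<forall>j<Suc m. piv j < n \<and> outs s2 j (piv j) \<noteq> 0 \<and> (\<exists>g\<in>\<G>. \<forall>i<n. g i = unit_vec (piv j) i)) \<and>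
        (\<forall>i j. i < j \<longrightarrow> j < Suc m \<longrightarrow> outs s2 j (piv i) = 0)"
    proof (intro exI conjI)
      show "kernel_basis n (insert g \<G>1) (vecs s3) (s3 42 0)" by (rule kb3)
      have "known s5 (Suc m) (piv(m := c)) \<G>1"
        by (rule known_extend[OF kn1 Y]) (simp_all only: o5 o2' ysc)
      moreover have "\<exists>j<Suc m. \<forall>i<n. g i = unit_vec ((piv(m := c)) j) i"
        using g by (intro exI[of _ m]) auto
      ultimately show "known s5 (Suc m) (piv(m := c)) (insert g \<G>1)"
        unfolding known_def by blast
      show "\<forall>j<Suc m. (piv(m := c)) j < n \<and> outs s2 j ((piv(m := c)) j) \<noteq> 0 \<and>
          (\<exists>g\<in>insert g \<G>1. \<forall>i<n. g i = unit_vec ((piv(m := c)) j) i)"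
      proof (intro allI impI)
        fix j assume j: "j < Suc m"
        show "(piv(m := c)) j < n \<and> outs s2 j ((piv(m := c)) j) \<noteq> 0 \<and>
          (\<exists>g\<in>insert g \<G>1. \<forall>i<n. g i = unit_vec ((piv(m := c)) j) i)"
        proof (cases "j = m")
          case True
          then show ?thesis using c g by auto
        next
          case False
          then have jm: "j < m" using j by simp
          from pv[OF jm] obtain h where h: "h \<in> \<G>" "\<forall>i<n. h i = unit_vec (piv j) i" by blast
          have "outs s2 j (piv j) \<noteq> 0" using pv[OF jm] o2'[OF jm] by simp
          moreover have "\<exists>g\<in>insert g \<G>1. \<forall>i<n. g i = unit_vec (piv j) i" using h sub by blast
          ultimately show ?thesis using pv[OF jm] False by simp
        qed
      qed
      show "\<forall>i j. i < j \<longrightarrow> j < Suc m \<longrightarrow> outs s2 j ((piv(m := c)) i) = 0"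
      proof (intro allI impI)
        fix i j assume ij: "i < j" "j < Suc m"
        then have im: "i < m" by simp
        from pv[OF im] obtain h where h: "h \<in> \<G>1" "\<forall>k<n. h k = unit_vec (piv i) k" and pi: "piv i < n"
          using sub by blast
        show "outs s2 j ((piv(m := c)) i) = 0"
        proof (cases "j = m")
          case False
          then have "j < m" using ij by simp
          then show ?thesis using tri[OF ij(1)] o2'[of j "piv i"] pi im by simp
        next
          case True
          \<comment> \<open>The new direction lies in the kernel, and the coordinate functional of
            every earlier pivot is among the functionals.\<close>
          let ?y = "comb_vec N' (qdig z2) (vecs s1)"
          have "dot n h ?y = \<zero>"
            by (rule kernel_basis_comb_vec[OF kb1[folded N'_def] qdig_scalars h(1)])
          moreover have "dot n h ?y = ?y (piv i)"
          proof -
            have yc: "?y k \<in> carrier F" if "k < n" for k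
            proof -
              have "scalars n ?y" by (rule comb_vec_qdig_closed) (use Vs in \<open>auto simp: V_def\<close>)
              then show ?thesis using that by (simp add: scalars_def)
            qed
            have "dot n h ?y = h (piv i) \<otimes> ?y (piv i)"
              unfolding dot_def by (rule fsum_single[OF pi]) (use h(2) pi yc in auto)
            then show ?thesis using h(2) pi yc[OF pi] by simp
          qed
          ultimately show ?thesis using y2[OF pi] True im by (simp add: zero_code)
        qed
      qed
    qed
  qed
  with run show ?thesis by blast
qed

lemma Main_loop:
  assumes ok: "ok s" and inv: "invar 0 s"
  shows "\<exists>s'. run Main_loop s s' \<and> invar K s'"
proof -
  have KR: "K \<le> R" using K_less n_le_R by simp
  have "\<exists>s' j. run (While (Sub (Var 9) (Var 1)) Step) s s' \<and> invar j s' \<and> aval (Sub (Var 9) (Var 1)) s' = 0"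
  proof (rule run_while[where I = invar, OF ok inv])
    fix j s' assume s': "ok s'" "invar j s'" "aval (Sub (Var 9) (Var 1)) s' \<noteq> 0"
    then have "j < K" by (simp add: invar_def)
    with Step[OF s'(1,2)] KR show "j < R \<and> (\<exists>s2. run Step s' s2 \<and> invar (Suc j) s2)" by simp
  qed
  then obtain s' j where s': "run Main_loop s s'" "invar j s'" "aval (Sub (Var 9) (Var 1)) s' = 0"
    unfolding Main_loop_def by blast
  then have "j = K" by (simp add: invar_def)
  with s' show ?thesis by blast
qed

end

section \<open>The complete algorithm\<close>

text \<open>Arrays: \<open>7\<close> the degree, \<open>8\<close> one more than the root \<open>a\<close>, \<open>37\<close> and \<open>38\<close> scratch.\<close>

definition Find_char :: prog where
  "Find_char = Seq (Set 2 (Const 2)) (While (Modulo eQ eP) (Set 2 (Add eP (Const 1))))"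

definition Degree :: prog where
  "Degree = Seq (Set 7 (Const 0)) (For 30 eLen (Seq (Set 37 (Const 0))
     (Seq (For 31 eN (Set 37 (Add (Var 37) eExp))) (Cond (Sub (Var 37) (Var 7)) (Set 7 (Var 37)) Skip))))"

text \<open>It stops at the least number whose \<open>(d - 1)\<close>-st power exceeds
  \<open>n\<close>, which is \<open>a + 1\<close>; the next routine subtracts the one.\<close>

definition Root :: prog where
  "Root = Seq (Set 8 (Const 1)) (Seq (Set 38 (Const 1)) (While (Sub (Add eN (Const 1)) (Var 38))
     (Seq (Set 8 (Add (Var 8) (Const 1))) (Seq (Set 38 (Const 1))
        (For 31 (Sub (Var 7) (Const 1)) (Set 38 (Mul (Var 38) (Var 8))))))))"

text \<open>The initial kernel is the whole space with its unit vectors; only the diagonal is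
  written, as array 41 is still zero. A \<open>Point\<close> without directions is \<open>u0\<close>
  itself, and its value becomes the target.\<close>

definition Initialize :: prog where
  "Initialize = Seq (Set 9 (Divide (Mul (Var 7) (Sub (Var 8) (Const 1))) (Const 128)))
     (Seq (Set 42 eN) (Seq (For 35 eN (Assign 41 (eVec (Var 35) (Var 35)) (Const 1)))
     (Seq (Set 48 (Const 1)) (Seq (Point (Const 0) (Const 0)) (Seq Eval (Set 49 (Var 21)))))))"

definition Find_subspace :: prog where
  "Find_subspace = Seq Find_char (Seq Degree (Seq Root (Seq Initialize Main_loop)))"

lemma writes_Find_char [simp]: "writes Find_char = {2}"
  by (auto simp: Find_char_def)

lemma writes_Degree [simp]: "writes Degree = {7, 30, 31, 37}"
  by (auto simp: Degree_def)

lemma writes_Root [simp]: "writes Root = {8, 31, 38}"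
  by (auto simp: Root_def)

section \<open>Correctness of the preprocessing and of the whole program\<close>

locale subspace_search = search F q r p e \<alpha> IX R n f u0 d K
  for F :: "nat ring" (structure) and q r p e \<alpha> IX R n :: nat and f u0 d K +
  fixes a :: nat
  assumes degree_eq: "total_degree f = d" and a_le: "a ^ (d - 1) \<le> n" and a_gt: "n < (a + 1) ^ (d - 1)"
    and root_R: "(a + 1) ^ (d - 1) \<le> R" and a_R: "a < R" and d_R: "d \<le> R" and K_eq: "K = d * a div 128"
begin

lemma ok_init: "ok (init_store (encode q r n f u0))"
proof -
  let ?xs = "encode q r n f u0"
  have len: "length ?xs < IX"
  proof -
    have "map (\<lambda>x. length (case x of (c, es) \<Rightarrow> c # es)) f = map (\<lambda>_. n + 1) f"
      using f_poly by (auto simp: polynomial_in_def)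
    note eq = this
    have "length ?xs = 4 + n + sum_list (map (\<lambda>x. length (case x of (c, es) \<Rightarrow> c # es)) f)"
      by (simp add: encode_def length_concat comp_def)
    also have "\<dots> = 4 + n + length f * (n + 1)" unfolding eq by (simp add: sum_list_triv)
    finally show ?thesis using IX_input by simp
  qed
  have ents: "x \<le> R" if "x \<in> set ?xs" for x
  proof -
    have c: "x \<le> R" if "(c, es) \<in> set f" "x = c \<or> x \<in> set es" for c es
    proof -
      have "c \<in> carrier F" "sum_list es \<le> d" using wf_f that(1) by (auto simp: wf_terms_def)
      then show ?thesis using that(2) member_le_sum_list[of x es] d_R less_R by (auto simp: carr_iff)
    qed
    have u: "u0 i \<le> R" if "i < n" for i using u0_closed[OF that] less_R by (simp add: carr_iff)
    have "length f \<le> length f * (n + 1)" by simp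
    then have "length f \<le> R" using IX_input IX_le_R by linarith
    then show ?thesis using that q_le_R less_R[OF r_less] n_le_R u c by (auto simp: encode_def)
  qed
  show ?thesis unfolding ok_def
  proof (intro allI impI)
    fix b i assume "init_store ?xs b i \<noteq> 0"
    then have "b = 0" "i < length ?xs" by (auto simp: init_store_def split: if_splits)
    then show "b < 60 \<and> i < IX \<and> init_store ?xs b i \<le> R" using len ents by (simp add: init_store_def)
  qed
qed

lemma Find_char:
  assumes ok: "ok s" and s0: "s 0 = input"
  obtains s' where "run Find_char s s'" "env s'"
proof -
  define s1 where "s1 = s(2 := (s 2)(0 := 2))"
  have "2 \<le> R" using q_gt_1 q_le_R by linarith
  then have r1: "run (Set 2 (Const 2)) s s1" unfolding s1_def by (intro run_set[OF ok]) auto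
  let ?e = "Modulo eQ eP"
  let ?b = "Set 2 (Add eP (Const 1))"
  let ?I = "\<lambda>j s'. s' 2 0 = j + 2 \<and> j + 2 \<le> p"
  have "\<exists>s' j. run (While ?e ?b) s1 s' \<and> ?I j s' \<and> aval ?e s' = 0"
  proof (rule run_while[where I = ?I])
    show "ok s1" by (rule run_ok[OF r1])
    show "?I 0 s1" using p_gt_1 by (simp add: s1_def)
  next
    fix j s' assume s': "ok s'" "frame (writes ?b) s1 s'" "?I j s'" "aval ?e s' \<noteq> 0"
    have "s' 0 = input" using s'(2) s0 by (auto simp: frame_def s1_def)
    then have nd: "\<not> j + 2 dvd q" using s'(3,4) by (simp add: input_simps mod_eq_0_iff_dvd)
    have "p dvd q" unfolding q_eq using e_pos by simp
    then have j: "j + 3 \<le> p" using nd s'(3) by (cases "j + 2 = p") auto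
    then have jR: "j + 3 \<le> R" using p_le_q q_le_R by linarith
    have "run ?b s' (s'(2 := (s' 2)(0 := j + 3)))"
      by (rule run_set[OF s'(1)]) (use s'(3) jR in auto)
    moreover have "?I (Suc j) (s'(2 := (s' 2)(0 := j + 3)))" using j by simp
    ultimately show "j < R \<and> (\<exists>s2. run ?b s' s2 \<and> ?I (Suc j) s2)" using jR by auto
  qed
  then obtain s' j where s': "run (While ?e ?b) s1 s'" "?I j s'" "aval ?e s' = 0" by (rule ex_conj3E)
  have r: "run Find_char s s'" unfolding Find_char_def by (rule run_seq[OF r1 s'(1)])
  have in': "s' 0 = input" using run_frame[OF r] s0 by (auto simp: frame_def)
  have "j + 2 dvd q" using s'(2,3) in' by (simp add: input_simps mod_eq_0_iff_dvd)
  then have "j + 2 dvd p ^ e" by (simp only: q_eq)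
  \<comment> \<open>A divisor of \<open>p ^ e\<close> is a power of \<open>p\<close>; being at least
    2 and at most \<open>p\<close>, it is \<open>p\<close>.\<close>
  then obtain i where i: "j + 2 = p ^ i" using divides_primepow_nat[OF prime_p] by blast
  then have "i \<noteq> 0" by (cases i) auto
  then have "p ^ 1 \<le> p ^ i" using p_gt_1 by (intro power_increasing) auto
  then have "s' 2 0 = p" using s'(2) i by simp
  then show ?thesis using r in' by (intro that[of s']) (simp_all add: env_def)
qed

lemma Degree:
  assumes ok: "ok s" and env: "env s"
  obtains s' where "run Degree s s'" "s' 7 0 = d"
proof -
  define w where "w = (\<lambda>t. sum_list (snd (f ! t)))"
  define D where "D = (\<lambda>t. Max (insert 0 (w ` {..<t})))"
  have D0: "D 0 = 0" by (simp add: D_def)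
  have DS: "D (Suc t) = max (w t) (D t)" for t
  proof -
    have "insert 0 (w ` {..<Suc t}) = insert (w t) (insert 0 (w ` {..<t}))" by (auto simp: lessThan_Suc)
    then show ?thesis unfolding D_def by (simp only: Max_insert finite_insert finite_imageI finite_lessThan insert_not_empty not_False_eq_True)
  qed
  have "(\<lambda>(c, es). sum_list es) ` set f = w ` {..<length f}"
    by (force simp: w_def set_conv_nth image_iff case_prod_unfold)
  then have DL: "D (length f) = d" using degree_eq by (simp add: total_degree_def D_def)
  have wR: "w t \<le> R" if "t < length f" for t
  proof -
    have "w t \<le> d" using wf_f nth_mem[OF that] by (auto simp: wf_terms_def w_def case_prod_unfold)
    then show ?thesis using d_R by simp
  qed
  have wn: "w t = (\<Sum>i<n. snd (f ! t) ! i)" if "t < length f" for t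
  proof -
    have "length (snd (f ! t)) = n" using wf_f nth_mem[OF that] by (auto simp: wf_terms_def case_prod_unfold)
    then show ?thesis by (simp add: w_def sum_list_sum_nth atLeast0LessThan)
  qed
  define s1 where "s1 = s(7 := (s 7)(0 := 0))"
  have r1: "run (Set 7 (Const 0)) s s1" unfolding s1_def by (rule run_set[OF ok]) auto
  have env1: "env s1" using env by (simp add: s1_def env_upd)
  let ?add = "Set 37 (Add (Var 37) eExp)"
  let ?cond = "Cond (Sub (Var 37) (Var 7)) (Set 7 (Var 37)) Skip"
  let ?body = "Seq (Set 37 (Const 0)) (Seq (For 31 eN ?add) ?cond)"
  let ?I = "\<lambda>t s'. s' 7 0 = D t"
  have "length f \<le> length f * (n + 1)" by simp
  then have lR: "length f \<le> R" using IX_input IX_le_R by linarith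
  have "\<exists>s'. run (For 30 eLen ?body) s1 s' \<and> ?I (length f) s'"
  proof (rule run_for[where I = ?I and B = "length f"])
    show "ok s1" by (rule run_ok[OF r1])
    show "aval eLen s1 = length f" using env_simps[OF env1] by simp
    show "length f \<le> R" by (rule lR)
    show "?I 0 s1" by (simp add: s1_def D0)
  next
    fix t s' assume s': "ok s'" "frame (insert 30 (writes ?body)) s1 s'" "t < length f" "s' 30 0 = t" "?I t s'"
    have env': "env s'" by (rule env_frame[OF env1 s'(2)]) auto
    define t1 where "t1 = s'(37 := (s' 37)(0 := 0))"
    have q1: "run (Set 37 (Const 0)) s' t1" unfolding t1_def by (rule run_set[OF s'(1)]) auto
    have envt1: "env t1" using env' by (simp add: t1_def env_upd)
    let ?J = "\<lambda>k s''. s'' 37 0 = (\<Sum>i<k. snd (f ! t) ! i)"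
    have "\<exists>s''. run (For 31 eN ?add) t1 s'' \<and> ?J n s''"
    proof (rule run_for[where I = ?J and B = n])
      show "ok t1" by (rule run_ok[OF q1])
      show "aval eN t1 = n" using env_simps[OF envt1] by simp
      show "n \<le> R" by (rule n_le_R)
      show "?J 0 t1" by (simp add: t1_def)
    next
      fix k s'' assume s'': "ok s''" "frame (insert 31 (writes ?add)) t1 s''" "k < n" "s'' 31 0 = k" "?J k s''"
      have env'': "env s''" by (rule env_frame[OF envt1 s''(2)]) auto
      have "s'' 30 0 = t" using s''(2) s'(4) by (auto simp: frame_def t1_def)
      then have "aval eExp s'' = s'' 0 (5 + n + t * (n + 1) + k)" using env_simps[OF env''] s''(4) by simp
      then have ex: "aval eExp s'' = snd (f ! t) ! k"
        using env'' input_monomials(2)[OF s'(3) s''(3)] by (simp add: env_def)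
      have "(\<Sum>i<Suc k. snd (f ! t) ! i) \<le> (\<Sum>i<n. snd (f ! t) ! i)"
        using s''(3) by (intro sum_mono2) auto
      then have le: "(\<Sum>i<Suc k. snd (f ! t) ! i) \<le> R" using wR[OF s'(3)] wn[OF s'(3)] by linarith
      have "run ?add s'' (s''(37 := (s'' 37)(0 := \<Sum>i<Suc k. snd (f ! t) ! i)))"
      proof (rule run_set[OF s''(1) _ _ le])
        show "aval (Add (Var 37) eExp) s'' = (\<Sum>i<Suc k. snd (f ! t) ! i)"
          unfolding aval.simps(3) ex using s''(5) by simp
      qed simp
      moreover have "?J (Suc k) (s''(37 := (s'' 37)(0 := \<Sum>i<Suc k. snd (f ! t) ! i)))" by simp
      ultimately show "\<exists>s2. run ?add s'' s2 \<and> ?J (Suc k) s2" by blast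
    qed auto
    then obtain t2 where t2: "run (For 31 eN ?add) t1 t2" "t2 37 0 = w t" unfolding wn[OF s'(3)] by blast
    have t7: "t2 7 0 = D t" using run_frame[OF t2(1)] s'(5) by (auto simp: frame_def t1_def)
    show "\<exists>s2. run ?body s' s2 \<and> ?I (Suc t) s2"
    proof (cases "w t \<le> D t")
      case True
      have "run ?cond t2 t2"
        by (rule run_cond_false[OF run_ok[OF t2(1)]]) (use t2 t7 True run_skip[OF run_ok[OF t2(1)]] in auto)
      then have "run ?body s' t2" by (intro run_seq[OF q1] run_seq[OF t2(1)])
      moreover have "?I (Suc t) t2" using t7 True by (simp add: DS)
      ultimately show ?thesis by blast
    next
      case False
      let ?t3 = "t2(7 := (t2 7)(0 := w t))"
      have "run (Set 7 (Var 37)) t2 ?t3" by (rule run_set[OF run_ok[OF t2(1)]]) (use t2(2) wR[OF s'(3)] in auto)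
      then have "run ?cond t2 ?t3"
        by (intro run_cond_true[OF run_ok[OF t2(1)]]) (use t2 t7 False in auto)
      then have "run ?body s' ?t3" by (intro run_seq[OF q1] run_seq[OF t2(1)])
      moreover have "?I (Suc t) ?t3" using False by (simp add: DS)
      ultimately show ?thesis by blast
    qed
  qed auto
  then obtain s' where "run (For 30 eLen ?body) s1 s'" "s' 7 0 = d" unfolding DL by blast
  note s' = this
  have "run Degree s s'" unfolding Degree_def by (rule run_seq[OF r1 s'(1)])
  then show ?thesis using s'(2) by (rule that)
qed

lemma Root:
  assumes ok: "ok s" and env: "env s" and s7: "s 7 0 = d"
  obtains s' where "run Root s s'" "s' 8 0 = a + 1"
proof -
  define s1 where "s1 = s(8 := (s 8)(0 := 1))"
  have r1: "run (Set 8 (Const 1)) s s1" unfolding s1_def by (rule run_set[OF ok]) (use R_pos in auto)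
  define s2 where "s2 = s1(38 := (s1 38)(0 := 1))"
  have r2: "run (Set 38 (Const 1)) s1 s2"
    unfolding s2_def by (rule run_set[OF run_ok[OF r1]]) (use R_pos in auto)
  have fr2: "frame (writes Root) s s2" by (auto simp: frame_def s1_def s2_def)
  let ?mul = "Set 38 (Mul (Var 38) (Var 8))"
  let ?pow = "For 31 (Sub (Var 7) (Const 1)) ?mul"
  let ?body = "Seq (Set 8 (Add (Var 8) (Const 1))) (Seq (Set 38 (Const 1)) ?pow)"
  let ?e = "Sub (Add eN (Const 1)) (Var 38)"
  let ?I = "\<lambda>j s'. s' 8 0 = j + 1 \<and> s' 38 0 = (j + 1) ^ (d - 1) \<and> j \<le> a"
  have "\<exists>s' j. run (While ?e ?body) s2 s' \<and> ?I j s' \<and> aval ?e s' = 0"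
  proof (rule run_while[where I = ?I])
    show "ok s2" by (rule run_ok[OF r2])
    show "?I 0 s2" by (simp add: s2_def s1_def)
  next
    fix j s' assume s': "ok s'" "frame (writes ?body) s2 s'" "?I j s'" "aval ?e s' \<noteq> 0"
    have fr': "frame (writes Root) s s'" using s'(2) fr2 by (auto simp: frame_def)
    have env': "env s'" by (rule env_frame[OF env fr']) auto
    have s7': "s' 7 0 = d" using fr' s7 by (auto simp: frame_def)
    have "(j + 1) ^ (d - 1) \<le> n" using s'(3,4) env_simps(3)[OF env'] by simp
    then have ja: "j < a" using s'(3) a_gt by (cases "j = a") auto
    define t1 where "t1 = s'(8 := (s' 8)(0 := j + 2))"
    have q1: "run (Set 8 (Add (Var 8) (Const 1))) s' t1"
      unfolding t1_def by (rule run_set[OF s'(1)]) (use s'(3) ja a_R in auto)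
    define t2 where "t2 = t1(38 := (t1 38)(0 := 1))"
    have q2: "run (Set 38 (Const 1)) t1 t2"
      unfolding t2_def by (rule run_set[OF run_ok[OF q1]]) (use R_pos in auto)
    let ?J = "\<lambda>i s''. s'' 38 0 = (j + 2) ^ i"
    have "\<exists>s''. run ?pow t2 s'' \<and> ?J (d - 1) s''"
    proof (rule run_for[where I = ?J and B = "d - 1"])
      show "ok t2" by (rule run_ok[OF q2])
      show "aval (Sub (Var 7) (Const 1)) t2 = d - 1" using s7' by (simp add: t2_def t1_def)
      show "d - 1 \<le> R" using d_R by simp
      show "?J 0 t2" by (simp add: t2_def)
    next
      fix i s'' assume s'': "ok s''" "frame (insert 31 (writes ?mul)) t2 s''" "i < d - 1" "s'' 31 0 = i" "?J i s''"
      have e8: "s'' 8 0 = j + 2" using s''(2) by (auto simp: frame_def t2_def t1_def)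
      have "(j + 2) ^ Suc i \<le> (j + 2) ^ (d - 1)" using s''(3) by (intro power_increasing) auto
      also have "\<dots> \<le> (a + 1) ^ (d - 1)" using ja by (intro power_mono) auto
      finally have le: "(j + 2) ^ Suc i \<le> R" using root_R by linarith
      have "run ?mul s'' (s''(38 := (s'' 38)(0 := (j + 2) ^ Suc i)))"
        by (rule run_set[OF s''(1) _ _ le]) (use s''(5) e8 in \<open>simp_all add: mult.commute\<close>)
      moreover have "?J (Suc i) (s''(38 := (s'' 38)(0 := (j + 2) ^ Suc i)))" by simp
      ultimately show "\<exists>s2. run ?mul s'' s2 \<and> ?J (Suc i) s2" by blast
    qed auto
    then obtain t3 where t3: "run ?pow t2 t3" "?J (d - 1) t3" by blast
    have "t3 8 0 = j + 2" using run_frame[OF t3(1)] by (auto simp: frame_def t2_def t1_def)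
    then have I: "?I (Suc j) t3" using t3(2) ja by simp
    have r: "run ?body s' t3" by (intro run_seq[OF q1] run_seq[OF q2] t3(1))
    show "j < R \<and> (\<exists>s2. run ?body s' s2 \<and> ?I (Suc j) s2)"
      by (rule conjI, use ja a_R in simp, rule exI[of _ t3], rule conjI[OF r I])
  qed
  then obtain s' j where s': "run (While ?e ?body) s2 s'" "?I j s'" "aval ?e s' = 0" by (rule ex_conj3E)
  have r: "run Root s s'" unfolding Root_def by (intro run_seq[OF r1] run_seq[OF r2] s'(1))
  have env': "env s'" by (rule env_frame[OF env run_frame[OF r]]) auto
  have big: "n < (j + 1) ^ (d - 1)" using s'(2,3) env_simps(3)[OF env'] by simp
  have "\<not> j < a"
  proof
    assume "j < a"
    then have "(j + 1) ^ (d - 1) \<le> a ^ (d - 1)" by (intro power_mono) auto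
    then show False using big a_le by simp
  qed
  then have "s' 8 0 = a + 1" using s'(2) by simp
  then show ?thesis by (rule that[OF r])
qed

lemma affine_pt_0: "i < n \<Longrightarrow> affine_pt u0 Y 0 c i = u0 i"
  by (simp add: affine_pt_def u0_closed)

lemma Initialize:
  assumes ok: "ok s" and env: "env s" and s7: "s 7 0 = d" and s8: "s 8 0 = a + 1"
    and s1: "s 1 0 = 0" and s41: "\<And>i. s 41 i = 0"
  obtains s' where "run Initialize s s'" "invar 0 s'"
proof -
  have nR: "n \<le> R" by (rule n_le_R)
  define t1 where "t1 = s(9 := (s 9)(0 := K))"
  have q1: "run (Set 9 (Divide (Mul (Var 7) (Sub (Var 8) (Const 1))) (Const 128))) s t1"
    unfolding t1_def by (rule run_set[OF ok]) (use s7 s8 K_eq K_less nR in auto)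
  have e1: "env t1" using env by (simp add: t1_def env_upd)
  define t2 where "t2 = t1(42 := (t1 42)(0 := n))"
  have q2: "run (Set 42 eN) t1 t2"
    unfolding t2_def by (rule run_set[OF run_ok[OF q1]]) (use env_simps(3)[OF e1] nR in auto)
  have e2: "env t2" using e1 by (simp add: t2_def env_upd)
  let ?as = "Assign 41 (eVec (Var 35) (Var 35)) (Const 1)"
  let ?I = "\<lambda>c s'. \<forall>x. s' 41 x = (if \<exists>j<c. x = j * n + j then 1 else 0)"
  have "\<exists>s'. run (For 35 eN ?as) t2 s' \<and> ?I n s'"
  proof (rule run_for[where I = ?I and B = n])
    show "ok t2" by (rule run_ok[OF q2])
    show "aval eN t2 = n" using env_simps[OF e2] by simp
    show "n \<le> R" by (rule nR)
    show "?I 0 t2" using s41 by (simp add: t2_def t1_def)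
  next
    fix c s' assume s': "ok s'" "frame (insert 35 (writes ?as)) t2 s'" "c < n" "s' 35 0 = c" "?I c s'"
    have env': "env s'" by (rule env_frame[OF e2 s'(2)]) auto
    have ix: "c * n + c < IX" using vec_index[OF s'(3,3)] IX_square by linarith
    let ?t = "s'(41 := (s' 41)(c * n + c := 1))"
    have "run ?as s' ?t"
      using run_assign[OF s'(1), of 41 "eVec (Var 35) (Var 35)" "Const 1"] s'(4) env_simps(3)[OF env'] ix R_pos by simp
    moreover have "?I (Suc c) ?t" using s'(5) by (auto simp: less_Suc_eq)
    ultimately show "\<exists>s2. run ?as s' s2 \<and> ?I (Suc c) s2" by blast
  qed auto
  then obtain t3 where t3: "run (For 35 eN ?as) t2 t3" "?I n t3" by blast
  have e3: "env t3" by (rule env_frame[OF e2 run_frame[OF t3(1)]]) auto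
  define t4 where "t4 = t3(48 := (t3 48)(0 := 1))"
  have q4: "run (Set 48 (Const 1)) t3 t4"
    unfolding t4_def by (rule run_set[OF run_ok[OF t3(1)]]) (use R_pos in auto)
  have e4: "env t4" using e3 by (simp add: t4_def env_upd)
  obtain t5 where t5: "run (Point (Const 0) (Const 0)) t4 t5" "env t5"
    "\<And>i. i < n \<Longrightarrow> t5 20 i = affine_pt u0 (outs t4) 0 (qdig 0) i" "\<And>i. i < n \<Longrightarrow> t5 20 i < q"
    by (rule Point[OF run_ok[OF q4] e4, of "Const 0" 0 "Const 0" 0]) auto
  obtain t6 where t6: "run Eval t5 t6" "env t6"
    "(t6 21 0, t6 22 0) = dual_poly (t5 20) (unit_vec (t5 33 0)) n f (length f)"
    by (rule Eval[OF run_ok[OF t5(1)] t5(2) t5(4)]) auto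
  have "t6 21 0 = fst (dual_poly (t5 20) (unit_vec (t5 33 0)) n f (length f))"
    unfolding t6(3)[symmetric] by simp
  also have "\<dots> = val (t5 20)" unfolding poly_value_def by (rule fst_dual_poly)
  also have "\<dots> = val u0" by (rule poly_value_cong) (use t5(3) affine_pt_0 in simp)
  finally have v: "t6 21 0 = val u0" .
  define t7 where "t7 = t6(49 := (t6 49)(0 := val u0))"
  have q7: "run (Set 49 (Var 21)) t6 t7"
    unfolding t7_def by (rule run_set[OF run_ok[OF t6(1)]]) (use v ok_le[OF run_ok[OF t6(1)], of 21 0] in auto)
  have r: "run Initialize s t7"
    unfolding Initialize_def
    by (intro run_seq[OF q1] run_seq[OF q2] run_seq[OF t3(1)] run_seq[OF q4] run_seq[OF t5(1)] run_seq[OF t6(1)] q7)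
  have fr: "t7 1 = s 1" "t7 9 0 = K" "t7 42 0 = n" "t7 41 = t3 41" "t7 48 0 = 1" "t7 49 0 = val u0"
    using run_frame[OF t3(1)] run_frame[OF t5(1)] run_frame[OF t6(1)]
    by (auto simp: frame_def t7_def t4_def t2_def t1_def)
  have "invar 0 t7"
    unfolding invar_def
  proof (intro conjI)
    show "env t7" using t6(2) by (simp add: t7_def env_upd)
    show "t7 1 0 = 0" using fr(1) s1 by simp
    show "t7 9 0 = K" "t7 48 0 = q ^ 0" "t7 49 0 = val u0" "t7 42 0 \<le> n" using fr by simp_all
    show "\<forall>c. scalars 0 c \<longrightarrow> val (affine_pt u0 (outs t7) 0 c) = val u0"
    proof (intro allI impI)
      fix c show "val (affine_pt u0 (outs t7) 0 c) = val u0" by (rule poly_value_cong) (rule affine_pt_0)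
    qed
    have "t3 41 (j * n + k) = (if j = k then \<one> else \<zero>)" if "j < n" "k < n" for j k
    proof -
      have "(\<exists>j'<n. j * n + k = j' * n + j') \<longleftrightarrow> j = k"
      proof
        assume "\<exists>j'<n. j * n + k = j' * n + j'"
        then obtain j' where "j' < n" "j * n + k = j' * n + j'" by blast
        then show "j = k" using vec_index_inj[OF that(2) \<open>j' < n\<close>, of j j'] by simp
      qed (use that in auto)
      then show ?thesis using t3(2) by (simp add: zero_code one_code)
    qed
    then have kb: "kernel_basis n {} (vecs t7) (t7 42 0)"
      unfolding fr(3,4) by (rule kernel_basis_unit)
    show "\<exists>\<G> piv. kernel_basis n \<G> (vecs t7) (t7 42 0) \<and> known t7 0 piv \<G> \<and>
        (\<forall>j<0. piv j < n \<and> outs t7 j (piv j) \<noteq> 0 \<and> (\<exists>g\<in>\<G>. \<forall>i<n. g i = unit_vec (piv j) i)) \<and>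
        (\<forall>i j. i < j \<longrightarrow> j < 0 \<longrightarrow> outs t7 j (piv i) = 0)"
      by (rule exI[of _ "{}"], rule exI[of _ id]) (use kb in \<open>simp add: known_def\<close>)
  qed simp_all
  with r show ?thesis by (rule that)
qed

lemma Find_subspace:
  obtains s where "run Find_subspace (init_store (encode q r n f u0)) s" "invar K s"
proof -
  let ?s = "init_store (encode q r n f u0)"
  obtain t1 where t1: "run Find_char ?s t1" "env t1"
    by (rule Find_char[OF ok_init]) (auto simp: input_def)
  obtain t2 where t2: "run Degree t1 t2" "t2 7 0 = d" by (rule Degree[OF run_ok[OF t1(1)] t1(2)])
  have e2: "env t2" by (rule env_frame[OF t1(2) run_frame[OF t2(1)]]) auto
  obtain t3 where t3: "run Root t2 t3" "t3 8 0 = a + 1" by (rule Root[OF run_ok[OF t2(1)] e2 t2(2)])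
  have e3: "env t3" by (rule env_frame[OF e2 run_frame[OF t3(1)]]) auto
  have f3: "t3 7 0 = d" "t3 1 = ?s 1" "t3 41 = ?s 41"
    using run_frame[OF t1(1)] run_frame[OF t2(1)] run_frame[OF t3(1)] t2(2) by (auto simp: frame_def)
  obtain t4 where t4: "run Initialize t3 t4" "invar 0 t4"
    by (rule Initialize[OF run_ok[OF t3(1)] e3 f3(1) t3(2)]) (use f3 in \<open>auto simp: init_store_def\<close>)
  obtain t5 where t5: "run Main_loop t4 t5" "invar K t5" using Main_loop[OF run_ok[OF t4(1)] t4(2)] by blast
  have "run Find_subspace ?s t5"
    unfolding Find_subspace_def
    by (intro run_seq[OF t1(1)] run_seq[OF t2(1)] run_seq[OF t3(1)] run_seq[OF t4(1)] t5(1))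
  then show ?thesis using t5(2) by (rule that)
qed

text \<open>The final invariant translated: triangularity makes the output a basis of its span, and
  every point of the coset is an \<open>affine_pt\<close>, where the value equals that at
  \<open>u0\<close>.\<close>

lemma Find_subspace_correct:
  "\<exists>s t m U. exec Find_subspace (init_store (encode q r n f u0)) s t m \<and> outputs_subspace F n s U \<and>
     const_on (poly_fun F n f) (u0 <+\<^bsub>affine_space F n\<^esub> U) \<and> dim_of F n U = K \<and>
     t \<le> time_bound Find_subspace \<and> m \<le> max_size"
proof -
  obtain s where r: "run Find_subspace (init_store (encode q r n f u0)) s" and inv: "invar K s"
    by (rule Find_subspace)
  obtain t m where ex: "exec Find_subspace (init_store (encode q r n f u0)) s t m"
    "t \<le> time_bound Find_subspace" "m \<le> max_size" using r unfolding run_def by blast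
  note I = inv[unfolded invar_def]
  have s1: "s 1 0 = K" using I by blast
  have Y: "scalars n (outs s j)" if "j < K" for j using I that by blast
  have const: "val (affine_pt u0 (outs s) K c) = val u0" if "scalars K c" for c using I that by blast
  obtain piv where pv: "\<And>j. j < K \<Longrightarrow> piv j < n \<and> outs s j (piv j) \<noteq> 0"
    and tri: "\<And>i j. i < j \<Longrightarrow> j < K \<Longrightarrow> outs s j (piv i) = 0"
    using I by blast
  have ind: "indep n (outs s) K"
  proof (rule triangular_indep)
    show "scalars n (outs s j)" if "j < K" for j by (rule Y[OF that])
    show "piv j < n" "outs s j (piv j) \<noteq> \<zero>" if "j < K" for j using pv[OF that] by (simp_all add: zero_code)
    show "outs s j (piv i) = \<zero>" if "i < j" "j < K" for i j using tri[OF that] by (simp add: zero_code)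
  qed
  define B where "B = (\<lambda>j. \<lambda>i\<in>{..<n}. outs s j i) ` {..<K}"
  have ov: "out_vector n s = (\<lambda>j. \<lambda>i\<in>{..<n}. outs s j i)" by (simp add: out_vector_def fun_eq_iff)
  have inj: "inj_on (\<lambda>j. \<lambda>i\<in>{..<n}. outs s j i) {..<K}"
    by (rule basis_of_indep(1)[where Y = "outs s", OF _ ind]) (rule Y)
  have B: "B \<subseteq> carrier (affine_space F n)" "\<not> module.lin_dep F (affine_space F n) B"
    unfolding B_def
    by (rule basis_of_indep(2)[where Y = "outs s", OF _ ind], erule Y,
        rule basis_of_indep(3)[where Y = "outs s", OF _ ind], erule Y)
  define U where "U = module.span F (affine_space F n) B"
  have fB: "finite B" by (simp add: B_def)
  note sp = span_of_indep[OF fB B, folded U_def]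
  have repr: "\<exists>c. scalars K c \<and> (\<forall>i<n. v i = comb_vec K c (outs s) i)" if "v \<in> U" for v
    by (rule basis_of_indep(4)[where Y = "outs s", OF _ ind])
      (use Y that in \<open>auto simp: U_def B_def\<close>)
  have "outputs_subspace F n s U"
    unfolding outputs_subspace_def s1 ov using sp(1,2) inj by (simp add: B_def)
  moreover have "dim_of F n U = K"
    unfolding sp(3) using inj by (simp add: B_def card_image)
  moreover have "const_on (poly_fun F n f) (u0 <+\<^bsub>affine_space F n\<^esub> U)"
    unfolding const_on_def
  proof (intro exI ballI)
    fix x assume "x \<in> u0 <+\<^bsub>affine_space F n\<^esub> U"
    then obtain v where v: "v \<in> U" "x = (\<lambda>i\<in>{..<n}. u0 i \<oplus> v i)" unfolding coset_affine by blast
    obtain c where c: "scalars K c" "\<And>i. i < n \<Longrightarrow> v i = comb_vec K c (outs s) i" using repr[OF v(1)] by blast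
    have x: "x i = affine_pt u0 (outs s) K c i" if "i < n" for i
      using v(2) c(2)[OF that] that by (simp add: affine_pt_def comb_vec_def)
    have xc: "x i \<in> carrier F" if "i < n" for i
      unfolding x[OF that] by (rule affine_pt_closed[where n = n]) (use that u0_closed c(1) Y in auto)
    have "poly_fun F n f x = val x" by (rule poly_fun_eq_value[OF f_poly xc])
    also have "\<dots> = val (affine_pt u0 (outs s) K c)" by (rule poly_value_cong[OF x])
    also have "\<dots> = val u0" by (rule const[OF c(1)])
    finally show "poly_fun F n f x = val u0" .
  qed
  ultimately show ?thesis using ex by blast
qed

end

text \<open>The factor \<open>1 / 2048\<close> comes from \<open>dim_le_K\<close>, the other
  constants from \<open>time_estimate\<close> and \<open>space_estimate\<close>. They depend only on
  the size and the nesting depth of the fixed program.\<close>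

theorem theorem4p3:
  shows "\<exists>\<beta>>0. \<exists>(alg :: prog) (c :: real) (C :: real) (b :: nat). c > 0 \<and>
    (\<forall>(q :: nat) (r :: nat) (F :: nat ring) (n :: nat) (d :: nat) (f :: monomials) (u0 :: nat \<Rightarrow> nat).
       primepow q \<and> coded_field q r F \<and>
       polynomial_in F n f \<and> total_degree f = d \<and>
       3 \<le> d \<and> real d \<le> log 2 (real n) / 10 \<and>
       u0 \<in> carrier (affine_space F n) \<longrightarrow>
       (\<exists>s t m U.
          exec alg (init_store (encode q r n f u0)) s t m \<and>
          outputs_subspace F n s U \<and>
          const_on (poly_fun F n f) (u0 <+\<^bsub>affine_space F n\<^esub> U) \<and>
          real (dim_of F n U) \<ge> c * real (kq F n d) \<and>
          real t \<le> real q powr (\<beta> * real n powr ((real d - 2) / (real d - 1)))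
                     * (C * real (n ^ d) ^ b) \<and>
          real m \<le> C * (real (n ^ d) * log 2 (real q)) ^ b))"
proof (rule exI[of _ "12 * real (loop_depth Find_subspace) + 1"], rule conjI, simp,
    rule exI[of _ Find_subspace], rule exI[of _ "1 / 2048"],
    rule exI[of _ "real (prog_size Find_subspace + 840)"],
    rule exI[of _ "24 * loop_depth Find_subspace + 5"], rule conjI, simp, intro allI impI)
  fix q r :: nat and F :: "nat ring" and n d :: nat and f :: monomials and u0 :: "nat \<Rightarrow> nat"
  assume asm: "primepow q \<and> coded_field q r F \<and> polynomial_in F n f \<and> total_degree f = d \<and>
       3 \<le> d \<and> real d \<le> log 2 (real n) / 10 \<and> u0 \<in> carrier (affine_space F n)"
  then have F: "coded_field q r F" and f: "polynomial_in F n f" and deg: "total_degree f = d"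
    and d: "3 \<le> d" and dn: "real d \<le> log 2 (real n) / 10" and u0: "u0 \<in> carrier (affine_space F n)"
    by blast+
  obtain p e \<alpha> where "coded F q r p e \<alpha>" by (rule coded_fieldE[OF F])
  then interpret coded F q r p e \<alpha> .
  have n_pow: "2 ^ (10 * d) \<le> n"
  proof -
    \<comment> \<open>The logarithm of 0 has the value 0 here, which would contradict
      \<open>3 \<le> d\<close>.\<close>
    have "n \<noteq> 0" using d dn by (intro notI) (simp add: log_def)
    moreover have "real (10 * d) \<le> log 2 (real n)" using dn by simp
    ultimately have "2 powr real (10 * d) \<le> real n" by (subst (asm) le_log_iff) auto
    then have "real (2 ^ (10 * d)) \<le> real n" by (simp add: powr_realpow del: of_nat_mult)
    then show ?thesis by (simp only: of_nat_le_iff)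
  qed
  obtain a where a: "a ^ (d - 1) \<le> n" "n < (a + 1) ^ (d - 1)"
  proof -
    define a where "a = (LEAST x. n < (x + 1) ^ (d - 1))"
    have "n < (n + 1) ^ 1" by simp
    also have "\<dots> \<le> (n + 1) ^ (d - 1)" using d by (intro power_increasing) auto
    finally have gt: "n < (a + 1) ^ (d - 1)"
      unfolding a_def by (rule LeastI[of "\<lambda>x. n < (x + 1) ^ (d - 1)"])
    have "a ^ (d - 1) \<le> n"
    proof (cases a)
      case 0
      then show ?thesis using d by (simp add: zero_power)
    next
      case (Suc b)
      then have "\<not> n < (b + 1) ^ (d - 1)"
        using not_less_Least[of b "\<lambda>x. n < (x + 1) ^ (d - 1)"] unfolding a_def by simp
      then show ?thesis using Suc by simp
    qed
    then show ?thesis using gt by (rule that)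
  qed
  define K where "K = d * a div 128"
  interpret parameters n d a K
    by unfold_locales (fact d n_pow a K_def)+
  define IX where "IX = n ^ (4 * d)"
  \<comment> \<open>The power of \<open>q\<close> covers both \<open>q ^ K\<close> and
    \<open>q\<close> to the degree sum plus 1, since \<open>K\<close> and the degree sum are at most
    \<open>a ^ (d - 2)\<close>, which is at least 1. The factor \<open>n ^ (4 * d)\<close> covers
    the indices.\<close>
  define R where "R = q ^ (2 * a ^ (d - 2)) * n ^ (4 * d)"
  have q2: "2 \<le> q" using q_gt_1 by simp
  have es: "length es = n" "sum_list es \<le> d" "c \<in> carrier F" if "(c, es) \<in> set f" for c es
  proof -
    show "length es = n" "c \<in> carrier F" using f that by (auto simp: polynomial_in_def)
    have "sum_list es \<le> total_degree f"
      unfolding total_degree_def by (rule Max_ge) (use that in force)+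
    then show "sum_list es \<le> d" by (simp add: deg)
  qed
  have len: "length f \<le> (n + d) choose d"
  proof -
    have "length f = card (set (map snd f))" using f distinct_card[of "map snd f"] by (simp add: polynomial_in_def)
    also have "\<dots> \<le> card (exponents n d)"
      by (intro card_mono finite_exponents) (use es in \<open>auto simp: exponents_def\<close>)
    finally show ?thesis by (simp add: card_exponents)
  qed
  note ix = index_bounds[OF len, folded IX_def]
  have n0: "0 < n" using n_ge by simp
  have a1: "1 \<le> a ^ (d - 2)" using a_ge by simp
  have qpow: "q ^ k \<le> R" if "k \<le> 2 * a ^ (d - 2)" for k
  proof -
    have "q ^ k * 1 \<le> q ^ (2 * a ^ (d - 2)) * n ^ (4 * d)"
      using q2 that n0 by (intro mult_le_mono power_increasing) auto
    then show ?thesis by (simp add: R_def)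
  qed
  have IXR: "IX \<le> R" using q2 by (simp add: R_def IX_def)
  have dan: "d \<le> n" "a < IX"
  proof -
    have "d * 1 \<le> d * a" using a_ge by (intro mult_le_mono2) simp
    then show "d \<le> n" using d_a_le by linarith
    have "1 * a \<le> d * a" using d by (intro mult_right_mono) auto
    then show "a < IX" using d_a_le ix(2) by linarith
  qed
  interpret subspace_search F q r p e \<alpha> IX R n f u0 d K a
  proof unfold_locales
    show "0 < IX" "0 < R" using n0 q2 by (simp_all add: IX_def R_def)
    show "polynomial_in F n f" by (rule f)
    show "u0 i \<in> carrier F" if "i < n" for i using u0 that by (auto simp: carrier_affine)
    show "5 + n + length f * (n + 1) \<le> IX" "n * n + n + 1 < IX" "IX \<le> R" by (fact ix IXR)+
    show "q \<le> R" using qpow[of 1] a1 by simp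
    show "wf_terms n d f" using es by (auto simp: wf_terms_def)
    show "K < n" by (rule K_less)
    show "Suc (\<Sum>j=2..d. j * ((m + (d - j)) choose (d - j))) + (((m + (d - 1)) choose (d - 1)) + m) \<le> n"
      if "m < K" for m by (rule room(2)[OF that])
    show "q ^ K \<le> R" by (rule qpow) (use K_le_pow in simp)
    show "q ^ Suc (\<Sum>j=2..d. j * ((m + (d - j)) choose (d - j))) \<le> R" if "m < K" for m
      by (rule qpow) (use room(1)[OF that] a1 in linarith)
    show "total_degree f = d" "a ^ (d - 1) \<le> n" "n < (a + 1) ^ (d - 1)" "K = d * a div 128"
      by (fact deg a K_def)+
    show "(a + 1) ^ (d - 1) \<le> R" "a < R" "d \<le> R" using ix IXR dan by linarith+
  qed
  obtain s t m U where run: "exec Find_subspace (init_store (encode q r n f u0)) s t m"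
    "outputs_subspace F n s U" "const_on (poly_fun F n f) (u0 <+\<^bsub>affine_space F n\<^esub> U)"
    "dim_of F n U = K" "t \<le> time_bound Find_subspace" "m \<le> max_size"
    using Find_subspace_correct by (elim exE conjE) (rule that)
  have "kq F n d \<le> 2048 * K" using d by (intro dim_le_K kq_choose) simp
  then have dim: "real (dim_of F n U) \<ge> 1 / 2048 * real (kq F n d)" using run(4) by simp
  note time = time_estimate[OF q2 R_def order.trans[OF run(5) time_bound_le]]
  have "m \<le> 60 * n ^ (4 * d) * (bits (n ^ (4 * d)) + bits R)"
    using run(6) unfolding max_size_def unfolding IX_def .
  note space = space_estimate[OF q2 R_def this]
  show "\<exists>s t m U.
      exec Find_subspace (init_store (encode q r n f u0)) s t m \<and>
      outputs_subspace F n s U \<and>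
      const_on (poly_fun F n f) (u0 <+\<^bsub>affine_space F n\<^esub> U) \<and>
      real (dim_of F n U) \<ge> 1 / 2048 * real (kq F n d) \<and>
      real t \<le> real q powr ((12 * real (loop_depth Find_subspace) + 1) * real n powr ((real d - 2) / (real d - 1)))
        * (real (prog_size Find_subspace + 840) * real (n ^ d) ^ (24 * loop_depth Find_subspace + 5)) \<and>
      real m \<le> real (prog_size Find_subspace + 840) * (real (n ^ d) * log 2 (real q)) ^ (24 * loop_depth Find_subspace + 5)"
    by (rule exI[of _ s], rule exI[of _ t], rule exI[of _ m], rule exI[of _ U], intro conjI)
      (fact run(1-3) dim time space)+
qed

end
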